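(* Let $\Phi$ be an indecomposable root system of rank $\ell>1$, let $R$ be an arbitrary commutative ring with $1$, and let $G$ be a large subgroup of a Chevalley group $G_\pi(\Phi,R)$. Then the ring $R$ is e-interpretable in the group $G$, using constants from the set $C_\Phi=\{x_\alpha(1)\mid\alpha\in\Phi\}$.
   Context: Root systems are reduced. Let $\mathcal L$ be the complex semisimple Lie algebra with root system $\Phi$, with Chevalley basis $\{h_i;x_\alpha\}$, and let $\pi$ be a faithful finite-dimensional representation of $\mathcal L$ with weight lattice $\Lambda_\pi$ (a lattice between the root lattice and the lattice of all weights). $G_\pi(\Phi,R)$ denotes the Chevalley group of type $(\Phi,\Lambda_\pi)$ over $R$, i.e. the group of $R$-points of the Chevalley--Demazure group scheme, realized as the subgroup of $\mathrm{SL}_n(R)$, $n=\dim\pi$, given by polynomial equations with integer coefficients in the matrix entries. For $\alpha\in\Phi$, $t\in R$, $x_\alpha(t)=\exp(t\pi(x_\alpha))$ is the elementary root unipotent. The elementary subgroup $E_\pi(\Phi,R)$ is generated by all $x_\alpha(t)$, $\alpha\in\Phi$, $t\in R$. A subgroup of $G_\pi(\Phi,R)$ is called large if it contains $E_\pi(\Phi,R)$. A subset $D\subseteq M^m$ of a structure $\mathcal M$ is Diophantine (e-definable) in $\mathcal M$ if there is a finite system of equations $\Sigma_D(x_1,\dots,x_m,y_1,\dots,y_k)$ in the language of $\mathcal M$, possibly with constants from $\mathcal M$, such that $\mathbf a\in D$ if and only if $\Sigma_D(\mathbf a,\mathbf y)$ has a solution $\mathbf y$ in $\mathcal M$. A structure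 $\mathcal A$ is e-interpretable in $\mathcal M$ if there are $n\in\mathbb N$, a subset $D\subseteq M^n$ and an onto map $\varphi:D\to\mathcal A$ such that $D$ is e-definable in $\mathcal M$, and the preimages under $\varphi$ of the graph of every function of the language of $\mathcal A$, of every relation of the language of $\mathcal A$, and of the equality relation of $\mathcal A$, are e-definable in $\mathcal M$. "Using constants from a set $C$" means that all constants occurring in the defining systems of equations belong to $C$. *)

theory Defs
  imports
    "HOL-Analysis.Cartesian_Euclidean_Space"
    "HOL-Library.Poly_Mapping"
    "HOL-Algebra.Ring"
    "HOL-Algebra.Generated_Groups"
begin

definition coroot :: "'e::euclidean_space \<Rightarrow> 'e" where
  "coroot \<alpha> = (2 / (\<alpha> \<bullet> \<alpha>)) *\<^sub>R \<alpha>"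

definition root_system :: "'e::euclidean_space set \<Rightarrow> bool" where
  "root_system \<Phi> \<longleftrightarrow>
     finite \<Phi> \<and> span \<Phi> = UNIV \<and> 0 \<notin> \<Phi> \<and>
     (\<forall>\<alpha>\<in>\<Phi>. \<forall>\<beta>\<in>\<Phi>. \<beta> - (\<beta> \<bullet> coroot \<alpha>) *\<^sub>R \<alpha> \<in> \<Phi>) \<and>
     (\<forall>\<alpha>\<in>\<Phi>. \<forall>\<beta>\<in>\<Phi>. \<beta> \<bullet> coroot \<alpha> \<in> \<int>)"

definition reduced :: "'e::euclidean_space set \<Rightarrow> bool" where
  "reduced \<Phi> \<longleftrightarrow> (\<forall>\<alpha>\<in>\<Phi>. \<forall>c::real. c *\<^sub>R \<alpha> \<in> \<Phi> \<longrightarrow> c = 1 \<or> c = -1)"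

definition indecomposable :: "'e::euclidean_space set \<Rightarrow> bool" where
  "indecomposable \<Phi> \<longleftrightarrow> \<Phi> \<noteq> {} \<and>
     \<not> (\<exists>A B. A \<noteq> {} \<and> B \<noteq> {} \<and> A \<inter> B = {} \<and> A \<union> B = \<Phi> \<and>
             (\<forall>a\<in>A. \<forall>b\<in>B. a \<bullet> b = 0))"

definition root_rank :: "'e::euclidean_space set \<Rightarrow> nat" where
  "root_rank \<Phi> = dim (span \<Phi>)"

definition root_base :: "'e::euclidean_space set \<Rightarrow> 'e set \<Rightarrow> bool" where
  "root_base \<Phi> \<Delta> \<longleftrightarrow>
     \<Delta> \<subseteq> \<Phi> \<and> independent \<Delta> \<and>
     (\<forall>\<alpha>\<in>\<Phi>. \<exists>c::'e \<Rightarrow> int. \<alpha> = (\<Sum>\<delta>\<in>\<Delta>. of_int (c \<delta>) *\<^sub>R \<delta>) \<and>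
        ((\<forall>\<delta>\<in>\<Delta>. c \<delta> \<ge> 0) \<or> (\<forall>\<delta>\<in>\<Delta>. c \<delta> \<le> 0)))"

locale complex_lie_algebra = vector_space scale
  for scale :: "complex \<Rightarrow> 'l::ab_group_add \<Rightarrow> 'l" +
  fixes brk :: "'l \<Rightarrow> 'l \<Rightarrow> 'l"
  assumes brk_linear_left: "Vector_Spaces.linear scale scale (\<lambda>x. brk x y)"
    and brk_linear_right: "Vector_Spaces.linear scale scale (\<lambda>y. brk x y)"
    and brk_self: "brk x x = 0"
    and jacobi: "brk x (brk y z) + brk y (brk z x) + brk z (brk x y) = 0"
begin

definition lie_ideal :: "'l set \<Rightarrow> bool" where
  "lie_ideal I \<longleftrightarrow> module.subspace scale I \<and> (\<forall>x. \<forall>y\<in>I. brk x y \<in> I)"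

definition derived :: "'l set \<Rightarrow> 'l set" where
  "derived I = module.span scale {brk x y | x y. x \<in> I \<and> y \<in> I}"

definition solvable :: "'l set \<Rightarrow> bool" where
  "solvable I \<longleftrightarrow> (\<exists>n. (derived ^^ n) I = {0})"

definition semisimple :: bool where
  "semisimple \<longleftrightarrow>
     (\<exists>B. finite B \<and> module.span scale B = UNIV) \<and>
     (\<forall>I. lie_ideal I \<and> solvable I \<longrightarrow> I = {0})"

text \<open>The elements \<open>h \<delta>\<close>, for \<open>\<delta>\<close> in a base \<open>\<Delta>\<close> of \<open>\<Phi>\<close>, span a Cartan subalgebra; a root
  \<open>\<alpha> \<in> \<Phi>\<close> is identified with the functional on it that sends \<open>h \<delta>\<close> to the Cartan integer
  \<open>\<alpha> \<bullet> coroot \<delta>\<close>, and \<open>x \<alpha>\<close> spans the corresponding root space.  In particular, the existence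
  of such a basis says that the root system of the algebra is \<open>\<Phi>\<close>.  The value of
  \<open>brk (x \<alpha>) (x (- \<alpha>))\<close> is \<open>h\<^sub>\<alpha>\<close>, the element of the Cartan subalgebra corresponding to the coroot of
  \<open>\<alpha>\<close>.\<close>

definition chevalley_basis ::
  "'e::euclidean_space set \<Rightarrow> 'e set \<Rightarrow> ('e \<Rightarrow> 'l) \<Rightarrow> ('e \<Rightarrow> 'l) \<Rightarrow> bool" where
  "chevalley_basis \<Phi> \<Delta> h x \<longleftrightarrow>
     root_base \<Phi> \<Delta> \<and>
     inj_on h \<Delta> \<and> inj_on x \<Phi> \<and> h ` \<Delta> \<inter> x ` \<Phi> = {} \<and>
     \<not> module.dependent scale (h ` \<Delta> \<union> x ` \<Phi>) \<and>
     module.span scale (h ` \<Delta> \<union> x ` \<Phi>) = UNIV \<and>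
     (\<forall>\<delta>\<in>\<Delta>. \<forall>\<epsilon>\<in>\<Delta>. brk (h \<delta>) (h \<epsilon>) = 0) \<and>
     (\<forall>\<delta>\<in>\<Delta>. \<forall>\<alpha>\<in>\<Phi>. brk (h \<delta>) (x \<alpha>) = scale (of_real (\<alpha> \<bullet> coroot \<delta>)) (x \<alpha>)) \<and>
     (\<forall>\<alpha>\<in>\<Phi>. \<exists>c::'e \<Rightarrow> int.
        coroot \<alpha> = (\<Sum>\<delta>\<in>\<Delta>. of_int (c \<delta>) *\<^sub>R coroot \<delta>) \<and>
        brk (x \<alpha>) (x (- \<alpha>)) = (\<Sum>\<delta>\<in>\<Delta>. scale (of_int (c \<delta>)) (h \<delta>))) \<and>
     (\<forall>\<alpha>\<in>\<Phi>. \<forall>\<beta>\<in>\<Phi>. \<alpha> + \<beta> \<notin> \<Phi> \<and> \<alpha> + \<beta> \<noteq> 0 \<longrightarrow> brk (x \<alpha>) (x \<beta>) = 0) \<and>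
     (\<forall>\<alpha>\<in>\<Phi>. \<forall>\<beta>\<in>\<Phi>. \<alpha> + \<beta> \<in> \<Phi> \<longrightarrow>
        (let p = Max {p::nat. \<beta> - real p *\<^sub>R \<alpha> \<in> \<Phi>} in
          brk (x \<alpha>) (x \<beta>) = scale (of_nat (p + 1)) (x (\<alpha> + \<beta>)) \<or>
          brk (x \<alpha>) (x \<beta>) = scale (- of_nat (p + 1)) (x (\<alpha> + \<beta>))))"

definition faithful_representation :: "('l \<Rightarrow> complex^'n^'n) \<Rightarrow> bool" where
  "faithful_representation \<rho> \<longleftrightarrow>
     Vector_Spaces.linear scale (\<lambda>c A. \<chi> i j. c * A $ i $ j) \<rho> \<and>
     (\<forall>x y. \<rho> (brk x y) = \<rho> x ** \<rho> y - \<rho> y ** \<rho> x) \<and>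
     inj \<rho>"

end

definition div_power :: "complex^'n^'n \<Rightarrow> nat \<Rightarrow> complex^'n^'n" where
  "div_power A k = (\<chi> i j. (((\<lambda>B. A ** B) ^^ k) (mat 1)) $ i $ j / fact k)"

text \<open>The coordinates of the representation space are taken with respect to a basis of an
  admissible lattice, i.e. one that is stable under all \<open>X \<alpha> ^ k / k!\<close>, where \<open>X \<alpha>\<close> is the matrix of
  \<open>x\<^sub>\<alpha>\<close>.  It is in such coordinates that the Chevalley group is a group scheme over the integers.\<close>

definition admissible :: "'e set \<Rightarrow> ('e \<Rightarrow> complex^'n^'n) \<Rightarrow> bool" where
  "admissible \<Phi> X \<longleftrightarrow> (\<forall>\<alpha>\<in>\<Phi>. \<forall>k i j. div_power (X \<alpha>) k $ i $ j \<in> \<int>)"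

definition matrix_monoid :: "('r, 'm) ring_scheme \<Rightarrow> ('r^'n^'n) monoid" where
  "matrix_monoid R =
     \<lparr>carrier = {A. \<forall>i j. A $ i $ j \<in> carrier R},
      monoid.mult = (\<lambda>A B. \<chi> i j. (\<Oplus>\<^bsub>R\<^esub>k\<in>UNIV. A $ i $ k \<otimes>\<^bsub>R\<^esub> B $ k $ j)),
      one = (\<chi> i j. if i = j then \<one>\<^bsub>R\<^esub> else \<zero>\<^bsub>R\<^esub>)\<rparr>"

definition general_linear_group :: "('r, 'm) ring_scheme \<Rightarrow> ('r^'n^'n) monoid" where
  "general_linear_group R = units_of (matrix_monoid R)"

text \<open>The matrix \<open>exp (t X)\<close>: the entries of \<open>X ^ k / k!\<close> are integers and are mapped to \<open>R\<close>, and
  the terms with \<open>k \<ge> CARD('n)\<close> vanish because \<open>X\<close> is nilpotent.\<close>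

definition exp_elem :: "('r, 'm) ring_scheme \<Rightarrow> complex^'n^'n \<Rightarrow> 'r \<Rightarrow> 'r^'n^'n" where
  "exp_elem R X t =
     (\<chi> i j. (\<Oplus>\<^bsub>R\<^esub>k\<in>{..<CARD('n)}.
        add_pow R (THE z::int. of_int z = div_power X k $ i $ j) (t [^]\<^bsub>R\<^esub> k)))"

definition elementary_subgroup ::
  "('r, 'm) ring_scheme \<Rightarrow> 'e set \<Rightarrow> ('e \<Rightarrow> complex^'n^'n) \<Rightarrow> ('r^'n^'n) set" where
  "elementary_subgroup R \<Phi> X =
     generate (general_linear_group R) {exp_elem R (X \<alpha>) t | \<alpha> t. \<alpha> \<in> \<Phi> \<and> t \<in> carrier R}"

type_synonym 'n entry_poly = "(('n \<times> 'n) \<Rightarrow>\<^sub>0 nat) \<Rightarrow>\<^sub>0 int"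

definition eval_poly :: "('r, 'm) ring_scheme \<Rightarrow> 'n entry_poly \<Rightarrow> 'r^'n^'n \<Rightarrow> 'r" where
  "eval_poly R p A =
     (\<Oplus>\<^bsub>R\<^esub>m\<in>Poly_Mapping.keys p. add_pow R (Poly_Mapping.lookup p m)
        (\<Otimes>\<^bsub>R\<^esub>v\<in>Poly_Mapping.keys m. (A $ fst v $ snd v) [^]\<^bsub>R\<^esub> Poly_Mapping.lookup m v))"

definition complex_ring :: "complex ring" where
  "complex_ring =
     \<lparr>carrier = UNIV, monoid.mult = (*), one = 1, ring.zero = 0, add = (+)\<rparr>"

text \<open>Over the complex numbers the Chevalley group is generated by the root unipotents.  The
  polynomials with integer coefficients that vanish on it (among them \<open>det - 1\<close>) define the
  Chevalley--Demazure group scheme, whose points over \<open>R\<close> are the matrices over \<open>R\<close> at which all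
  these polynomials vanish.\<close>

definition chevalley_equations ::
  "'e set \<Rightarrow> ('e \<Rightarrow> complex^'n^'n) \<Rightarrow> 'n entry_poly set" where
  "chevalley_equations \<Phi> X =
     {p. \<forall>A\<in>elementary_subgroup complex_ring \<Phi> X. eval_poly complex_ring p A = 0}"

definition chevalley_group ::
  "('r, 'm) ring_scheme \<Rightarrow> 'e set \<Rightarrow> ('e \<Rightarrow> complex^'n^'n) \<Rightarrow> ('r^'n^'n) monoid" where
  "chevalley_group R \<Phi> X =
     (general_linear_group R)
       \<lparr>carrier := {A \<in> carrier (general_linear_group R).
          \<forall>p\<in>chevalley_equations \<Phi> X. eval_poly R p A = \<zero>\<^bsub>R\<^esub>}\<rparr>"

definition large_subgroup ::
  "('r, 'm) ring_scheme \<Rightarrow> 'e set \<Rightarrow> ('e \<Rightarrow> complex^'n^'n) \<Rightarrow> ('r^'n^'n) set \<Rightarrow> bool" where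
  "large_subgroup R \<Phi> X G \<longleftrightarrow>
     subgroup G (chevalley_group R \<Phi> X) \<and> elementary_subgroup R \<Phi> X \<subseteq> G"

record ('a, 'f, 'p) fo_structure =
  univ :: "'a set"
  fun_syms :: "'f set"
  fun_arity :: "'f \<Rightarrow> nat"
  fun_interp :: "'f \<Rightarrow> 'a list \<Rightarrow> 'a"
  rel_syms :: "'p set"
  rel_arity :: "'p \<Rightarrow> nat"
  rel_interp :: "'p \<Rightarrow> 'a list \<Rightarrow> bool"

datatype ('f, 'a) trm = Var nat | Const 'a | App 'f "('f, 'a) trm list"

definition tuples :: "'a set \<Rightarrow> nat \<Rightarrow> 'a list set" where
  "tuples S m = {xs. length xs = m \<and> set xs \<subseteq> S}"

fun wf_trm :: "('a, 'f, 'p) fo_structure \<Rightarrow> 'a set \<Rightarrow> nat \<Rightarrow> ('f, 'a) trm \<Rightarrow> bool" where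
  "wf_trm M C m (Var i) \<longleftrightarrow> i < m"
| "wf_trm M C m (Const c) \<longleftrightarrow> c \<in> C \<and> c \<in> univ M"
| "wf_trm M C m (App f ts) \<longleftrightarrow>
     f \<in> fun_syms M \<and> length ts = fun_arity M f \<and> (\<forall>t\<in>set ts. wf_trm M C m t)"

fun eval_trm :: "('a, 'f, 'p) fo_structure \<Rightarrow> 'a list \<Rightarrow> ('f, 'a) trm \<Rightarrow> 'a" where
  "eval_trm M xs (Var i) = xs ! i"
| "eval_trm M xs (Const c) = c"
| "eval_trm M xs (App f ts) = fun_interp M f (map (eval_trm M xs) ts)"

definition e_definable ::
  "('a, 'f, 'p) fo_structure \<Rightarrow> 'a set \<Rightarrow> nat \<Rightarrow> 'a list set \<Rightarrow> bool" where
  "e_definable M C m D \<longleftrightarrow>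
     D \<subseteq> tuples (univ M) m \<and>
     (\<exists>k (Eqs :: (('f, 'a) trm \<times> ('f, 'a) trm) set).
        finite Eqs \<and>
        (\<forall>(s, t)\<in>Eqs. wf_trm M C (m + k) s \<and> wf_trm M C (m + k) t) \<and>
        (\<forall>a\<in>tuples (univ M) m.
           a \<in> D \<longleftrightarrow>
           (\<exists>y\<in>tuples (univ M) k. \<forall>(s, t)\<in>Eqs. eval_trm M (a @ y) s = eval_trm M (a @ y) t)))"

definition e_interpretable ::
  "('b, 'g, 'q) fo_structure \<Rightarrow> ('a, 'f, 'p) fo_structure \<Rightarrow> 'a set \<Rightarrow> bool" where
  "e_interpretable A M C \<longleftrightarrow>
     (\<exists>n D (\<phi> :: 'a list \<Rightarrow> 'b).
        e_definable M C n D \<and>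
        \<phi> ` D = univ A \<and>
        (\<forall>f\<in>fun_syms A. e_definable M C (n * (fun_arity A f + 1))
           {concat us @ v | us v. us \<in> tuples D (fun_arity A f) \<and> v \<in> D \<and>
              fun_interp A f (map \<phi> us) = \<phi> v}) \<and>
        (\<forall>r\<in>rel_syms A. e_definable M C (n * rel_arity A r)
           {concat us | us. us \<in> tuples D (rel_arity A r) \<and> rel_interp A r (map \<phi> us)}) \<and>
        e_definable M C (n * 2) {u @ v | u v. u \<in> D \<and> v \<in> D \<and> \<phi> u = \<phi> v})"

datatype group_op = Group_Mult | Group_Inv | Group_One

definition group_structure :: "('a, 'm) monoid_scheme \<Rightarrow> ('a, group_op, unit) fo_structure" where
  "group_structure G =
     \<lparr>univ = carrier G,
      fun_syms = UNIV,
      fun_arity = (\<lambda>f. case f of Group_Mult \<Rightarrow> 2 | Group_Inv \<Rightarrow> 1 | Group_One \<Rightarrow> 0),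
      fun_interp = (\<lambda>f xs. case f of
          Group_Mult \<Rightarrow> xs ! 0 \<otimes>\<^bsub>G\<^esub> xs ! 1
        | Group_Inv \<Rightarrow> inv\<^bsub>G\<^esub> (xs ! 0)
        | Group_One \<Rightarrow> \<one>\<^bsub>G\<^esub>),
      rel_syms = {},
      rel_arity = (\<lambda>_. 0),
      rel_interp = (\<lambda>_ _. False)\<rparr>"

datatype ring_op = Ring_Add | Ring_Neg | Ring_Mult | Ring_Zero | Ring_One

definition ring_structure :: "('r, 'm) ring_scheme \<Rightarrow> ('r, ring_op, unit) fo_structure" where
  "ring_structure R =
     \<lparr>univ = carrier R,
      fun_syms = UNIV,
      fun_arity = (\<lambda>f. case f of
          Ring_Add \<Rightarrow> 2 | Ring_Neg \<Rightarrow> 1 | Ring_Mult \<Rightarrow> 2 | Ring_Zero \<Rightarrow> 0 | Ring_One \<Rightarrow> 0),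
      fun_interp = (\<lambda>f xs. case f of
          Ring_Add \<Rightarrow> xs ! 0 \<oplus>\<^bsub>R\<^esub> xs ! 1
        | Ring_Neg \<Rightarrow> \<ominus>\<^bsub>R\<^esub> (xs ! 0)
        | Ring_Mult \<Rightarrow> xs ! 0 \<otimes>\<^bsub>R\<^esub> xs ! 1
        | Ring_Zero \<Rightarrow> \<zero>\<^bsub>R\<^esub>
        | Ring_One \<Rightarrow> \<one>\<^bsub>R\<^esub>),
      rel_syms = {},
      rel_arity = (\<lambda>_. 0),
      rel_interp = (\<lambda>_ _. False)\<rparr>"

end

theory Submission
  imports Defs "HOL-Analysis.Determinants" "HOL-Computational_Algebra.Fundamental_Theorem_Algebra"
begin

text \<open>Fix a long root \<open>\<theta>\<close> and grade the roots by their Cartan integer with \<open>\<theta>\<close>, which lies between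
  \<open>-2\<close> and \<open>2\<close>.  Let \<open>g\<close> commute with \<open>x\<^sub>\<delta>(1)\<close> for all roots \<open>\<delta>\<close> of degree \<open>\<ge> 0\<close>.  Then there is \<open>c\<close> in the ring such
  that \<open>x\<^sub>\<theta>(-c) g\<close> commutes with all \<open>x\<^bsub>-\<theta>\<^esub>(s)\<close>; this \<open>c\<close> is unique, and \<open>g\<close> represents it.  Addition of ring
  elements becomes multiplication of their representatives.  Weyl elements, which are words in the
  \<open>x\<^sub>\<alpha>(1)\<close>, turn \<open>x\<^sub>\<theta>(t)\<close> into other long root elements.  If there is a long root \<open>\<beta>\<close> of degree 1, multiplication is
  recovered from the commutator of \<open>x\<^sub>\<beta>(t)\<close> and \<open>x\<^bsub>\<theta>-\<beta>\<^esub>(s)\<close>, which is \<open>x\<^sub>\<theta>(\<plusminus>ts)\<close>; otherwise from the commutator of \<open>x\<^sub>\<beta>(s)\<close> and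
  \<open>x\<^bsub>\<theta>-2\<beta>\<^esub>(t)\<close>, whose \<open>x\<^bsub>\<theta>-\<beta>\<^esub>\<close>-part is \<open>\<plusminus>ts\<close>.

  For the existence of \<open>c\<close> over an arbitrary ring, a point \<open>g\<close> of the group scheme is regarded as a
  specialization of the integral polynomial functions on the complex group.  The centralizing
  conditions become congruences, modulo the functions that vanish at \<open>g\<close>, for the image \<open>Y\<close> of \<open>X\<^bsub>-\<theta>\<^esub>\<close> under
  \<open>Ad g\<close>.  They force its coordinate at \<open>-\<theta>\<close> to be congruent to 1 and those of degree \<open>-1\<close> to be congruent
  to 0.  Where the former does not vanish, \<open>Y\<close> is conjugate to a multiple of \<open>X\<^bsub>-\<theta>\<^esub>\<close> by an explicit unipotent
  element, which specializes to \<open>x\<^sub>\<theta>(c)\<close>.\<close>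

section \<open>The ring of complex square matrices\<close>

text \<open>The root subgroup of \<theta> itself is not cut out by equations. The elements used
  instead are \<theta>-root elements times a kernel factor, and this factor must drop out of every
  word into which representatives are substituted. It therefore has to commute with \<theta>-root
  elements of arbitrary, not only constant, parameter; this is why conjugation is controlled on the
  root elements of \<open>- \<theta>\<close> with every parameter s and not just with s = 1. In R
  the numbers 2 and 3 may be zero or zero divisors, while structure constants up to 3 occur.
  Whenever a congruence carries the factor \<open>mlt \<beta>\<close>, a second one with the factor
  \<open>mlt \<beta> - 1\<close>, obtained from the root
  \<open>\<theta> - 2 *\<^sub>R \<beta>\<close>, removes it. For the same reason a coordinate is
  used over R only after it has been extended to a functional with integer values on all integral
  matrices; admissibility says nothing directly about such coordinates. The only division is by the
  coordinate at \<open>- \<theta>\<close>, which specializes to 1.\<close>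

typedef 'n sqmat = "UNIV :: (complex^('n::finite)^'n) set" morphisms mx Mx
  by simp

setup_lifting type_definition_sqmat

lift_definition entry :: "'n::finite sqmat \<Rightarrow> 'n \<Rightarrow> 'n \<Rightarrow> complex" is "\<lambda>A i j. A $ i $ j" .

lift_definition smul :: "complex \<Rightarrow> 'n::finite sqmat \<Rightarrow> 'n sqmat" is "\<lambda>c A. \<chi> i j. c * A $ i $ j" .

text \<open>On \<open>complex^'n^'n\<close> the sign \<open>*\<close> is the componentwise product.
  The separate type makes the matrix product a ring multiplication, so that powers, sums and the
  algebraic simplification rules apply to it.\<close>

instantiation sqmat :: (finite) ring_1
begin
lift_definition zero_sqmat :: "'a sqmat" is 0 .
lift_definition one_sqmat :: "'a sqmat" is "mat 1" .
lift_definition plus_sqmat :: "'a sqmat \<Rightarrow> 'a sqmat \<Rightarrow> 'a sqmat" is "(+)" .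
lift_definition minus_sqmat :: "'a sqmat \<Rightarrow> 'a sqmat \<Rightarrow> 'a sqmat" is "(-)" .
lift_definition uminus_sqmat :: "'a sqmat \<Rightarrow> 'a sqmat" is "uminus" .
lift_definition times_sqmat :: "'a sqmat \<Rightarrow> 'a sqmat \<Rightarrow> 'a sqmat" is "(**)" .
instance
proof
  have "(0 :: complex^'a^'a) \<noteq> mat 1"
    by (auto simp: vec_eq_iff mat_def)
  then show "(0::'a sqmat) \<noteq> 1" unfolding zero_sqmat_def one_sqmat_def
    by (simp add: Mx_inject)
  fix a b c :: "'a sqmat"
  show "a * b * c = a * (b * c)" by transfer (simp add: matrix_mul_assoc)
  show "(a + b) * c = a * c + b * c" by transfer (vector matrix_matrix_mult_def sum.distrib[symmetric] field_simps)
  show "a * (b + c) = a * b + a * c" by transfer (simp add: matrix_add_ldistrib)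
  show "1 * a = a" "a * 1 = a" by (transfer, simp)+
  show "a + b + c = a + (b + c)" "a + b = b + a" "0 + a = a" "- a + a = 0" "a - b = a + - b"
    by (transfer, simp)+
qed
end

lemma sqmat_eqI: "(\<And>i j. entry A i j = entry B i j) \<Longrightarrow> A = B"
  by transfer (simp add: vec_eq_iff)

lemma entry_simps [simp]:
  "entry 0 i j = 0" "entry 1 i j = (if i = j then 1 else 0)"
  "entry (A + B) i j = entry A i j + entry B i j"
  "entry (A - B) i j = entry A i j - entry B i j"
  "entry (- A) i j = - entry A i j"
  "entry (smul c A) i j = c * entry A i j"
  by (transfer, simp add: mat_def)+

lemma entry_mult: "entry (A * B) i j = (\<Sum>k\<in>UNIV. entry A i k * entry B k j)"
  by transfer (simp add: matrix_matrix_mult_def)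

lemma entry_sum: "entry (\<Sum>x\<in>S. F x) i j = (\<Sum>x\<in>S. entry (F x) i j)"
  by (induction S rule: infinite_finite_induct) auto

interpretation sqm: vector_space smul
  by unfold_locales (rule sqmat_eqI; simp add: algebra_simps)+

lemma smul_mult_left [simp]: "smul c A * B = smul c (A * B)"
  by (rule sqmat_eqI) (simp add: entry_mult sum_distrib_left mult.assoc)

lemma smul_mult_right [simp]: "A * smul c B = smul c (A * B)"
  by (rule sqmat_eqI) (simp add: entry_mult sum_distrib_left mult.left_commute)

lemma smul_power: "smul c A ^ k = smul (c ^ k) (A ^ k)"
  by (induction k) auto

definition comm :: "'n::finite sqmat \<Rightarrow> 'n sqmat \<Rightarrow> 'n sqmat" where
  "comm A B = A * B - B * A"

lemma comm_simps:
  "comm (A + B) C = comm A C + comm B C" "comm A (B + C) = comm A B + comm A C"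
  "comm (A - B) C = comm A C - comm B C" "comm A (B - C) = comm A B - comm A C"
  "comm (- A) C = - comm A C" "comm A (- C) = - comm A C"
  "comm (smul c A) C = smul c (comm A C)" "comm A (smul c C) = smul c (comm A C)"
  "comm 0 C = 0" "comm A 0 = 0" "comm A A = 0"
  by (simp_all add: comm_def algebra_simps sqm.scale_right_diff_distrib)

lemma comm_sum_right: "comm A (\<Sum>x\<in>S. F x) = (\<Sum>x\<in>S. comm A (F x))"
  by (induction S rule: infinite_finite_induct) (auto simp: comm_simps)

lemma comm_sum_left: "comm (\<Sum>x\<in>S. F x) A = (\<Sum>x\<in>S. comm (F x) A)"
  by (induction S rule: infinite_finite_induct) (auto simp: comm_simps)

lemma comm_jacobi: "comm A (comm B C) = comm (comm A B) C + comm B (comm A C)"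
  by (simp add: comm_def algebra_simps)

lemma comm_swap: "comm A B = - comm B A"
  by (simp add: comm_def)

lemma comm_conj: "P * Q = 1 \<Longrightarrow> Q * P = 1 \<Longrightarrow> comm (P * A * Q) (P * B * Q) = P * comm A B * Q"
proof -
  assume 1: "P * Q = 1" "Q * P = 1"
  have *: "P * A * Q * (P * B * Q) = P * (A * B) * Q" for A B
  proof -
    have "P * A * Q * (P * B * Q) = P * A * (Q * P) * (B * Q)"
      by (simp only: mult.assoc)
    then show ?thesis using 1 by (simp add: mult.assoc)
  qed
  show ?thesis by (simp only: comm_def * right_diff_distrib left_diff_distrib)
qed

section \<open>Exponentials of nilpotent matrices\<close>

text \<open>The exponent is fixed because \<open>exp_elem\<close> truncates its series at
  \<open>CARD('n)\<close>. That every nilpotent matrix qualifies is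
  \<open>nilpotent_imp_nil\<close>.\<close>

definition nil :: "'n::finite sqmat \<Rightarrow> bool" where
  "nil A \<longleftrightarrow> A ^ CARD('n) = 0"

definition dpow :: "'n::finite sqmat \<Rightarrow> nat \<Rightarrow> 'n sqmat" where
  "dpow A k = smul (1 / fact k) (A ^ k)"

definition mexp :: "'n::finite sqmat \<Rightarrow> 'n sqmat" where
  "mexp A = (\<Sum>k<CARD('n). dpow A k)"

lemma dpow_smul: "dpow (smul t A) k = smul (t ^ k) (dpow A k)"
  by (simp add: dpow_def smul_power mult.commute)

lemma dpow_nil: "nil A \<Longrightarrow> k \<ge> CARD('n) \<Longrightarrow> dpow (A :: 'n::finite sqmat) k = 0"
  unfolding nil_def dpow_def by (metis le_add_diff_inverse mult_zero_left power_add sqm.scale_zero_right)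

lemma mexp_eq: "nil A \<Longrightarrow> N \<ge> CARD('n) \<Longrightarrow> mexp (A :: 'n::finite sqmat) = (\<Sum>k<N. dpow A k)"
  unfolding mexp_def by (rule sum.mono_neutral_left) (auto simp: dpow_nil)

lemma mexp_0 [simp]: "mexp 0 = 1"
proof -
  have "mexp (0 :: 'n::finite sqmat) = (\<Sum>k<CARD('n). if k = 0 then 1 else 0)"
    unfolding mexp_def by (rule sum.cong) (auto simp: dpow_def power_0_left)
  also have "\<dots> = 1" by (subst sum.delta) auto
  finally show ?thesis .
qed

lemma nil_smul: "nil A \<Longrightarrow> nil (smul t A)"
  by (simp add: nil_def smul_power)

lemma nil_uminus: "nil A \<Longrightarrow> nil (- A)"
  using nil_smul[of A "-1"] by simp

text \<open>Operators instead of matrices make it serve twice: for left multiplication by A and by B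
  in \<open>dpow_add_commute\<close>, and in \<open>dpow_ad\<close> for left multiplication by A
  together with right multiplication by \<open>- A\<close>, which always commute and add up to
  \<open>comm A\<close>.\<close>

lemma binomial_operators:
  fixes P Q :: "'n::finite sqmat \<Rightarrow> 'n sqmat"
  assumes add: "\<And>a b. P (a + b) = P a + P b" "\<And>a b. Q (a + b) = Q a + Q b"
    and scal: "\<And>c a. P (smul c a) = smul c (P a)" "\<And>c a. Q (smul c a) = smul c (Q a)"
    and comm: "\<And>a. P (Q a) = Q (P a)"
  shows "((\<lambda>a. P a + Q a) ^^ k) a
           = (\<Sum>i\<le>k. smul (of_nat (k choose i)) ((P ^^ i) ((Q ^^ (k - i)) a)))"
proof (induction k)
  case 0 show ?case by simp
next
  case (Suc k)
  have P0: "P 0 = 0" "Q 0 = 0" using scal[of 0 0] by auto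
  have Psum: "P (\<Sum>x\<in>S. F x) = (\<Sum>x\<in>S. P (F x))" for F and S :: "nat set"
    by (induction S rule: infinite_finite_induct) (auto simp: add P0)
  have Qsum: "Q (\<Sum>x\<in>S. F x) = (\<Sum>x\<in>S. Q (F x))" for F and S :: "nat set"
    by (induction S rule: infinite_finite_induct) (auto simp: add P0)
  have QP: "Q ((P ^^ i) b) = (P ^^ i) (Q b)" for i b
    by (induction i) (auto simp: comm[symmetric])
  define u where "u i = (P ^^ i) ((Q ^^ (Suc k - i)) a)" for i
  have 1: "P (\<Sum>i\<le>k. smul (of_nat (k choose i)) ((P ^^ i) ((Q ^^ (k - i)) a)))
        = (\<Sum>i\<le>k. smul (of_nat (k choose i)) (u (Suc i)))"
    by (simp add: Psum scal u_def)
  have 2: "Q (\<Sum>i\<le>k. smul (of_nat (k choose i)) ((P ^^ i) ((Q ^^ (k - i)) a)))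
        = (\<Sum>i\<le>Suc k. smul (of_nat (k choose i)) (u i))"
    by (simp add: Qsum scal u_def QP Suc_diff_le)
  have "(\<Sum>i\<le>Suc k. smul (of_nat (Suc k choose i)) (u i))
      = u 0 + (\<Sum>i\<le>k. smul (of_nat (k choose i) + of_nat (k choose Suc i)) (u (Suc i)))"
    by (subst sum.atMost_Suc_shift) simp
  also have "\<dots> = (\<Sum>i\<le>k. smul (of_nat (k choose i)) (u (Suc i)))
      + (u 0 + (\<Sum>i\<le>k. smul (of_nat (k choose Suc i)) (u (Suc i))))"
    by (simp add: sqm.scale_left_distrib sum.distrib)
  also have "u 0 + (\<Sum>i\<le>k. smul (of_nat (k choose Suc i)) (u (Suc i)))
      = (\<Sum>i\<le>Suc k. smul (of_nat (k choose i)) (u i))"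
    using sum.atMost_Suc_shift[of "\<lambda>i. smul (of_nat (k choose i)) (u i)" k] by simp
  finally show ?case
    using Suc 1 2 by (simp add: u_def)
qed

text \<open>A Cauchy product without convergence: pairs in the square of side N have index sum below
  2N, so the triangle of pairs with sum below M exceeds the square only by zero terms.\<close>

lemma sum_square_diag:
  fixes h :: "nat \<Rightarrow> nat \<Rightarrow> 'a::comm_monoid_add"
  assumes "\<And>i j. i \<ge> N \<Longrightarrow> h i j = 0" "\<And>i j. j \<ge> N \<Longrightarrow> h i j = 0" "M \<ge> 2 * N"
  shows "(\<Sum>k<M. \<Sum>i\<le>k. h i (k - i)) = (\<Sum>i<N. \<Sum>j<N. h i j)"
proof -
  have "(\<Sum>k<M. \<Sum>i\<le>k. h i (k - i)) = (\<Sum>(i,j)\<in>{(i,j). i + j < M}. h i j)"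
    by (simp add: sum.triangle_reindex)
  also have "\<dots> = (\<Sum>(i,j)\<in>{..<N} \<times> {..<N}. h i j)"
  proof (rule sum.mono_neutral_right)
    show "finite {(i,j). i + j < M}"
      by (rule finite_subset[of _ "{..<M} \<times> {..<M}"]) auto
    show "{..<N} \<times> {..<N} \<subseteq> {(i, j). i + j < M}" using assms(3) by auto
    show "\<forall>i\<in>{(i, j). i + j < M} - {..<N} \<times> {..<N}. (case i of (i, j) \<Rightarrow> h i j) = 0"
      using assms(1,2) by (auto, (meson not_le)+)
  qed
  finally show ?thesis by (simp add: sum.cartesian_product)
qed

lemma choose_over_fact: "i \<le> k \<Longrightarrow> of_nat (k choose i) / fact k = 1 / (fact i * fact (k - i) :: complex)"
  by (simp add: binomial_fact)

lemma funpow_mult_left: "((\<lambda>a. A * a) ^^ k) b = A ^ k * (b :: 'a::monoid_mult)"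
  by (induction k) (auto simp: mult.assoc)

lemma funpow_mult_right: "((\<lambda>a. a * A) ^^ k) b = b * A ^ k" for b :: "'a::monoid_mult"
  by (induction k) (auto simp: mult.assoc power_commutes)

lemma dpow_add_commute:
  assumes "A * B = B * A"
  shows "dpow (A + B) k = (\<Sum>i\<le>k. dpow A i * dpow B (k - i))"
proof -
  have AB: "A * (B * c) = B * (A * c)" for c
    by (metis assms mult.assoc)
  have "(A + B) ^ k = ((\<lambda>a. A * a + B * a) ^^ k) 1"
    using funpow_mult_left[where A = "A + B" and k = k and b = 1] by (simp add: distrib_right)
  also have "\<dots> = (\<Sum>i\<le>k. smul (of_nat (k choose i)) (A ^ i * B ^ (k - i)))"
    by (subst binomial_operators) (auto simp: distrib_left AB funpow_mult_left)
  finally have "dpow (A + B) k = (\<Sum>i\<le>k. smul (of_nat (k choose i) / fact k) (A ^ i * B ^ (k - i)))"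
    by (simp add: dpow_def sqm.scale_sum_right)
  also have "\<dots> = (\<Sum>i\<le>k. dpow A i * dpow B (k - i))"
    by (rule sum.cong) (auto simp: dpow_def choose_over_fact)
  finally show ?thesis .
qed

lemma dpow_ad:
  "smul (1 / fact k) ((comm A ^^ k) C) = (\<Sum>i\<le>k. dpow A i * C * dpow (- A) (k - i))"
proof -
  have "comm A = (\<lambda>a. A * a + a * (- A))"
    by (auto simp: comm_def)
  moreover have "((\<lambda>a. A * a + a * (- A)) ^^ k) C
      = (\<Sum>i\<le>k. smul (of_nat (k choose i)) (((\<lambda>a. A * a) ^^ i) (((\<lambda>a. a * (- A)) ^^ (k - i)) C)))"
    by (rule binomial_operators) (auto simp: algebra_simps)
  ultimately have "(comm A ^^ k) C = (\<Sum>i\<le>k. smul (of_nat (k choose i)) (A ^ i * C * (- A) ^ (k - i)))"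
    by (simp only: funpow_mult_left funpow_mult_right mult.assoc)
  then have "smul (1 / fact k) ((comm A ^^ k) C)
      = (\<Sum>i\<le>k. smul (of_nat (k choose i) / fact k) (A ^ i * C * (- A) ^ (k - i)))"
    by (simp add: sqm.scale_sum_right)
  also have "\<dots> = (\<Sum>i\<le>k. dpow A i * C * dpow (- A) (k - i))"
    by (rule sum.cong) (auto simp: dpow_def choose_over_fact)
  finally show ?thesis .
qed


text \<open>The images of the powers form a decreasing chain that stays constant once it repeats.
  Since it reaches 0, its dimension drops at every step before that, so at most
  \<open>CARD('n)\<close> steps are possible.\<close>

lemma nilpotent_imp_nil:
  fixes A :: "'n::finite sqmat"
  assumes "A ^ k = 0" shows "nil A"
proof -
  define S where "S j = range ((*v) (mx (A ^ j)))" for j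
  have mult: "mx (P * Q) *v v = mx P *v (mx Q *v v)" for P Q :: "'n sqmat" and v
    by (transfer fixing: v) (simp add: matrix_vector_mul_assoc)
  have sub: "vec.subspace (S j)" for j
    unfolding S_def
    by (intro vec.linear_subspace_image matrix_vector_mul_linear_gen) simp
  have anti: "S (Suc j) \<subseteq> S j" for j
    by (auto simp: S_def power_Suc2 mult simp del: power_Suc)
  have im: "S (Suc j) = (*v) (mx A) ` S j" for j
    by (auto simp: S_def mult image_def)
  have stable: "S (j + i) = S j" if "S (Suc j) = S j" for i j
  proof (induction i)
    case (Suc i) then show ?case using that im[of j] im[of "j + i"] by simp
  qed simp
  have zero: "A ^ j = 0 \<longleftrightarrow> S j = {0}" for j
  proof
    assume "S j = {0}"
    then have "mx (A ^ j) *v v = 0" for v unfolding S_def by auto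
    then have "mx (A ^ j) = 0" by (metis matrix_eq matrix_vector_mult_0)
    then show "A ^ j = 0" by (metis mx_inverse zero_sqmat.abs_eq)
  next
    assume "A ^ j = 0"
    then show "S j = {0}" by (auto simp: S_def zero_sqmat.rep_eq)
  qed
  have Sk: "S k = {0}" using assms zero by simp
  have "S j = {0} \<or> vec.dim (S j) + j \<le> CARD('n)" for j
  proof (induction j)
    case 0
    show ?case using vec.dim_subset_UNIV[of "S 0"] by (simp add: vec.dimension_def card_cart_basis)
  next
    case (Suc j)
    show ?case
    proof (cases "S j = {0}")
      case True then show ?thesis by (simp add: im)
    next
      case False
      have "S (Suc j) \<noteq> S j"
      proof
        assume eq: "S (Suc j) = S j"
        show False
        proof (cases "k \<le> j")
          case True
          then have "A ^ j = 0" using assms by (metis le_add_diff_inverse mult_zero_left power_add)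
          with False zero show False by blast
        next
          case f: False
          then have "S k = S j" using stable[OF eq, of "k - j"] by simp
          with Sk False show False by simp
        qed
      qed
      with anti have "S (Suc j) \<subset> S j" by blast
      then have "vec.dim (S (Suc j)) < vec.dim (S j)"
        by (intro vec.dim_psubset) (simp add: sub vec.span_eq_iff[THEN iffD2])
      with Suc False show ?thesis by auto
    qed
  qed
  from this[of "CARD('n)"] have "S (CARD('n)) = {0} \<or> vec.dim (S (CARD('n))) = 0" by auto
  then have "S (CARD('n)) = {0}"
  proof
    assume "vec.dim (S (CARD('n))) = 0"
    then have "S (CARD('n)) \<subseteq> {0}" using vec.dim_eq_0 by blast
    moreover have "0 \<in> S (CARD('n))" using sub vec.subspace_0 by blast
    ultimately show ?thesis by blast
  qed
  then show ?thesis by (simp add: nil_def zero)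
qed

lemma mexp_add:
  assumes "A * B = B * A" "nil (A::'n::finite sqmat)" "nil B"
  shows "nil (A + B)" "mexp (A + B) = mexp A * mexp B"
proof -
  have z: "dpow (A + B) k = 0" if "k \<ge> 2 * CARD('n)" for k
    unfolding dpow_add_commute[OF assms(1)]
  proof (rule sum.neutral, rule ballI)
    fix i assume "i \<in> {..k}"
    then have "i \<ge> CARD('n) \<or> k - i \<ge> CARD('n)" using that by auto
    then show "dpow A i * dpow B (k - i) = 0"
      using assms(2,3) by (auto simp: dpow_nil)
  qed
  from z[of "2 * CARD('n)"] show n: "nil (A + B)"
    by (intro nilpotent_imp_nil[of _ "2 * CARD('n)"]) (simp add: dpow_def)
  have "mexp (A + B) = (\<Sum>k<2 * CARD('n). \<Sum>i\<le>k. dpow A i * dpow B (k - i))"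
    using n by (subst mexp_eq[of _ "2 * CARD('n)"]) (auto simp: dpow_add_commute[OF assms(1)])
  also have "\<dots> = (\<Sum>i<CARD('n). \<Sum>j<CARD('n). dpow A i * dpow B j)"
    by (rule sum_square_diag) (use assms in \<open>auto simp: dpow_nil\<close>)
  also have "\<dots> = mexp A * mexp B"
    unfolding mexp_def by (simp add: sum_product)
  finally show "mexp (A + B) = mexp A * mexp B" .
qed

lemma dpow_conj:
  assumes "P * Q = 1" "Q * P = 1"
  shows "dpow (P * A * Q) k = P * dpow A k * Q"
proof -
  have "(P * A * Q) ^ k = P * A ^ k * Q"
  proof (induction k)
    case (Suc k)
    have "P * A * Q * (P * A ^ k * Q) = P * A * (Q * P) * (A ^ k * Q)"
      by (simp only: mult.assoc)
    with Suc assms show ?case by (simp add: mult.assoc)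
  qed (simp add: assms)
  then show ?thesis by (simp add: dpow_def)
qed

lemma mexp_conj:
  assumes "P * Q = 1" "Q * P = 1"
  shows "mexp (P * A * Q) = P * mexp A * Q"
  by (simp add: mexp_def dpow_conj[OF assms] sum_distrib_left sum_distrib_right)

text \<open>The divided power of ad A. By \<open>adp_dpow\<close> it is integral whenever the
  divided powers of A are, although its definition divides by a factorial.\<close>

definition adp :: "'n::finite sqmat \<Rightarrow> nat \<Rightarrow> 'n sqmat \<Rightarrow> 'n sqmat" where
  "adp A k C = smul (1 / fact k) ((comm A ^^ k) C)"

lemma adp_0 [simp]: "adp A 0 C = C" by (simp add: adp_def)

lemma adp_1 [simp]: "adp A (Suc 0) C = comm A C" by (simp add: adp_def)

lemma adp_Suc: "adp A (Suc k) C = smul (1 / of_nat (Suc k)) (comm A (adp A k C))"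
  by (simp add: adp_def comm_simps mult.commute)

lemma adp_smul: "adp (smul t A) k C = smul (t ^ k) (adp A k C)"
proof (induction k)
  case (Suc k) then show ?case by (simp add: adp_Suc comm_simps mult.commute mult.left_commute)
qed simp

lemma adp_dpow: "adp A k C = (\<Sum>i\<le>k. dpow A i * C * dpow (- A) (k - i))"
  unfolding adp_def by (rule dpow_ad)

text \<open>By \<open>adp_dpow\<close> the k-th divided power of ad A is the k-th diagonal of the
  double series for exp A and exp (- A); \<open>2 * CARD('n)\<close> diagonals exhaust all pairs of
  nonzero factors.\<close>

lemma mexp_ad:
  assumes "nil (A::'n::finite sqmat)" "M \<ge> 2 * CARD('n)"
  shows "mexp A * C * mexp (- A) = (\<Sum>k<M. adp A k C)"
proof -
  have "(\<Sum>k<M. adp A k C) = (\<Sum>k<M. \<Sum>i\<le>k. dpow A i * C * dpow (- A) (k - i))"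
    by (simp add: adp_dpow)
  also have "\<dots> = (\<Sum>i<CARD('n). \<Sum>j<CARD('n). dpow A i * C * dpow (- A) j)"
    by (rule sum_square_diag) (use assms in \<open>auto simp: dpow_nil nil_uminus\<close>)
  also have "\<dots> = mexp A * C * mexp (- A)"
    unfolding mexp_def sum_distrib_left sum_distrib_right by (rule sum.swap)
  finally show ?thesis by simp
qed

lemma geometric_sum_ring: "(1 - a) * (\<Sum>k<n. a ^ k) = 1 - (a::'a::ring_1) ^ n"
proof (induction n)
  case (Suc n)
  then show ?case by (simp add: distrib_left left_diff_distrib)
qed simp

text \<open>M = exp A - 1 is nilpotent, so \<open>1 + smul s M\<close> is invertible for every s and
  its determinant is a complex polynomial in s without zeros. It is therefore constant, with value 1
  at s = 0. Determinant 1 later makes the inverse polynomial in the entries, see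
  \<open>minv\<close>.\<close>

lemma det_mexp:
  fixes A :: "'n::finite sqmat"
  assumes "nil A" shows "det (mx (mexp A)) = 1"
proof -
  define M where "M = mexp A - 1"
  define Q where "Q = (\<Sum>k<CARD('n) - 1. smul (1 / fact (Suc k)) (A ^ k))"
  obtain m where m: "CARD('n) = Suc m" by (metis not0_implies_Suc zero_less_card_finite less_not_refl)
  have M: "M = A * Q"
    by (simp add: M_def Q_def mexp_def m sum.lessThan_Suc_shift dpow_def sum_distrib_left del: sum.lessThan_Suc)
  have comm: "A * Q = Q * A"
    by (simp add: Q_def sum_distrib_left sum_distrib_right power_commutes)
  have "M ^ j = A ^ j * Q ^ j" for j
  proof (induction j)
    case (Suc j)
    have "Q * A ^ j = A ^ j * Q"
      by (induction j) (auto simp: mult.assoc[symmetric] comm[symmetric], simp add: mult.assoc)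
    with Suc show ?case unfolding M by (simp add: mult.assoc) (metis (no_types, lifting) M mult.assoc)
  qed simp
  then have M0: "M ^ CARD('n) = 0" using assms by (simp add: nil_def)
  define P :: "complex poly^'n^'n" where "P = (\<chi> i j. [:mx 1 $ i $ j, entry M i j:])"
  have poly_det: "poly (det P) s = det (mx (1 + smul s M))" for s
    by (simp add: det_def poly_sum poly_prod P_def plus_sqmat.rep_eq smul.rep_eq
        entry.rep_eq)
  have det_mult: "det (mx (B * C)) = det (mx B) * det (mx C)" for B C :: "'n sqmat"
    by (simp add: times_sqmat.rep_eq det_mul)
  have "poly (det P) s \<noteq> 0" for s
  proof -
    define T where "T = (\<Sum>k<CARD('n). (smul (- s) M) ^ k)"
    have "(1 - smul (- s) M) * T = 1 - smul (- s) M ^ CARD('n)"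
      unfolding T_def by (rule geometric_sum_ring)
    also have "\<dots> = 1" by (simp only: smul_power M0) simp
    finally have "(1 + smul s M) * T = 1" by simp
    then have "det (mx (1 + smul s M)) * det (mx T) = 1"
      by (metis det_mult det_I one_sqmat.rep_eq)
    then show ?thesis by (auto simp: poly_det)
  qed
  then have "constant (poly (det P))" using fundamental_theorem_of_algebra by blast
  then have "poly (det P) 1 = poly (det P) 0" by (simp add: constant_def)
  then show ?thesis by (simp add: poly_det M_def one_sqmat.rep_eq)
qed

lemma scaleR_3: "3 *\<^sub>R x = x + 2 *\<^sub>R (x :: 'a::real_vector)"
proof -
  have "3 = 1 + (2::real)" by simp
  then show ?thesis by (simp only: scaleR_left_distrib scaleR_one)
qed

section \<open>Root systems graded by a long root\<close>

locale root_sys =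
  fixes \<Phi> :: "'e::euclidean_space set"
  assumes root_system: "root_system \<Phi>" and reduced: "reduced \<Phi>"
begin

section \<open>Cartan integers of a reduced root system\<close>

lemma finite_roots: "finite \<Phi>"
  using root_system by (simp add: root_system_def)

lemma root_nonzero: "\<alpha> \<in> \<Phi> \<Longrightarrow> \<alpha> \<noteq> 0"
  using root_system by (auto simp: root_system_def)

lemma root_inner_pos: "\<alpha> \<in> \<Phi> \<Longrightarrow> \<alpha> \<bullet> \<alpha> > 0"
  using root_nonzero by simp

lemma reflection: "\<alpha> \<in> \<Phi> \<Longrightarrow> \<beta> \<in> \<Phi> \<Longrightarrow> \<beta> - (\<beta> \<bullet> coroot \<alpha>) *\<^sub>R \<alpha> \<in> \<Phi>"
  using root_system by (simp add: root_system_def)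

lemma cartan_int: "\<alpha> \<in> \<Phi> \<Longrightarrow> \<beta> \<in> \<Phi> \<Longrightarrow> \<beta> \<bullet> coroot \<alpha> \<in> \<int>"
  using root_system by (simp add: root_system_def)

lemma cartan_cases:
  assumes "\<alpha> \<in> \<Phi>" "\<beta> \<in> \<Phi>" obtains k :: int where "\<beta> \<bullet> coroot \<alpha> = of_int k"
  using cartan_int[OF assms] by (auto elim: Ints_cases)

lemma coroot_self: "\<alpha> \<in> \<Phi> \<Longrightarrow> \<alpha> \<bullet> coroot \<alpha> = 2"
  using root_inner_pos[of \<alpha>] by (simp add: coroot_def)

lemma cartan_inner: "\<alpha> \<in> \<Phi> \<Longrightarrow> (\<beta> \<bullet> coroot \<alpha>) * (\<alpha> \<bullet> \<alpha>) = 2 * (\<alpha> \<bullet> \<beta>)"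
  using root_inner_pos[of \<alpha>] by (simp add: coroot_def inner_commute)

lemma neg_root: "\<alpha> \<in> \<Phi> \<Longrightarrow> - \<alpha> \<in> \<Phi>"
proof -
  assume a: "\<alpha> \<in> \<Phi>"
  have "\<alpha> - (\<alpha> \<bullet> coroot \<alpha>) *\<^sub>R \<alpha> = - \<alpha>"
    by (simp add: coroot_self[OF a] scaleR_2)
  then show ?thesis using reflection[OF a a] by simp
qed

lemma neg_root_iff [simp]: "- \<alpha> \<in> \<Phi> \<longleftrightarrow> \<alpha> \<in> \<Phi>"
  using neg_root[of \<alpha>] neg_root[of "- \<alpha>"] by auto

lemma multiple_root: "\<alpha> \<in> \<Phi> \<Longrightarrow> c *\<^sub>R \<alpha> \<in> \<Phi> \<Longrightarrow> c = 1 \<or> c = -1"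
  using reduced by (simp add: reduced_def)

text \<open>Equality in the Cauchy-Schwarz inequality would make \<beta> a multiple of \<alpha>, and
  a reduced system contains no multiples except \<alpha> and \<open>- \<alpha>\<close>.\<close>

lemma cartan_product:
  assumes "\<alpha> \<in> \<Phi>" "\<beta> \<in> \<Phi>" "\<beta> \<noteq> \<alpha>" "\<beta> \<noteq> - \<alpha>"
  shows "(\<beta> \<bullet> coroot \<alpha>) * (\<alpha> \<bullet> coroot \<beta>) < 4"
proof -
  have pos: "\<alpha> \<bullet> \<alpha> > 0" "\<beta> \<bullet> \<beta> > 0" using assms root_inner_pos by auto
  have le: "(\<alpha> \<bullet> \<beta>)\<^sup>2 \<le> (\<alpha> \<bullet> \<alpha>) * (\<beta> \<bullet> \<beta>)"
    by (rule Cauchy_Schwarz_ineq)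
  have "(\<alpha> \<bullet> \<beta>)\<^sup>2 \<noteq> (\<alpha> \<bullet> \<alpha>) * (\<beta> \<bullet> \<beta>)"
  proof
    assume eq: "(\<alpha> \<bullet> \<beta>)\<^sup>2 = (\<alpha> \<bullet> \<alpha>) * (\<beta> \<bullet> \<beta>)"
    define c where "c = (\<alpha> \<bullet> \<beta>) / (\<alpha> \<bullet> \<alpha>)"
    have "(\<beta> - c *\<^sub>R \<alpha>) \<bullet> (\<beta> - c *\<^sub>R \<alpha>) = \<beta> \<bullet> \<beta> - 2 * c * (\<alpha> \<bullet> \<beta>) + c * c * (\<alpha> \<bullet> \<alpha>)"
      by (simp add: inner_diff_left inner_diff_right inner_commute algebra_simps)
    also have "\<dots> = 0"
      using pos eq unfolding c_def by (simp add: field_simps power2_eq_square)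
    finally have "\<beta> = c *\<^sub>R \<alpha>" by simp
    then show False using multiple_root[OF assms(1), of c] assms by auto
  qed
  with le have lt: "(\<alpha> \<bullet> \<beta>)\<^sup>2 < (\<alpha> \<bullet> \<alpha>) * (\<beta> \<bullet> \<beta>)" by simp
  have "(\<beta> \<bullet> coroot \<alpha>) * (\<alpha> \<bullet> coroot \<beta>) * ((\<alpha> \<bullet> \<alpha>) * (\<beta> \<bullet> \<beta>))
      = ((\<beta> \<bullet> coroot \<alpha>) * (\<alpha> \<bullet> \<alpha>)) * ((\<alpha> \<bullet> coroot \<beta>) * (\<beta> \<bullet> \<beta>))"
    by (simp only: mult_ac)
  also have "\<dots> = (2 * (\<alpha> \<bullet> \<beta>)) * (2 * (\<beta> \<bullet> \<alpha>))"
    by (simp only: cartan_inner[OF assms(1)] cartan_inner[OF assms(2)])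
  also have "\<dots> = 4 * (\<alpha> \<bullet> \<beta>)\<^sup>2"
    by (simp add: inner_commute[of \<beta> \<alpha>] power2_eq_square)
  also have "\<dots> < 4 * ((\<alpha> \<bullet> \<alpha>) * (\<beta> \<bullet> \<beta>))" using lt by simp
  finally show ?thesis using pos by simp
qed

section \<open>Long roots\<close>

definition long :: "'e \<Rightarrow> bool" where
  "long \<delta> \<longleftrightarrow> \<delta> \<in> \<Phi> \<and> (\<forall>\<gamma>\<in>\<Phi>. \<gamma> \<bullet> \<gamma> \<le> \<delta> \<bullet> \<delta>)"

lemma long_root: "long \<delta> \<Longrightarrow> \<delta> \<in> \<Phi>" by (simp add: long_def)

lemma long_neg: "long (- \<delta>) \<longleftrightarrow> long \<delta>" by (simp add: long_def)

lemma long_norm_eq: "long \<delta> \<Longrightarrow> \<epsilon> \<in> \<Phi> \<Longrightarrow> \<epsilon> \<bullet> \<epsilon> = \<delta> \<bullet> \<delta> \<Longrightarrow> long \<epsilon>"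
  by (simp add: long_def)

lemma long_exists: "\<Phi> \<noteq> {} \<Longrightarrow> \<exists>\<delta>. long \<delta>"
proof -
  assume "\<Phi> \<noteq> {}"
  then have "Max ((\<lambda>\<gamma>. \<gamma> \<bullet> \<gamma>) ` \<Phi>) \<in> (\<lambda>\<gamma>. \<gamma> \<bullet> \<gamma>) ` \<Phi>"
    using finite_roots by (intro Max_in) auto
  then obtain \<delta> where "\<delta> \<in> \<Phi>" "Max ((\<lambda>\<gamma>. \<gamma> \<bullet> \<gamma>) ` \<Phi>) = \<delta> \<bullet> \<delta>" by auto
  then have "long \<delta>" using finite_roots unfolding long_def
    by (metis Max_ge finite_imageI imageI)
  then show ?thesis by blast
qed

text \<open>The two Cartan integers k and l of the pair satisfy k |\<delta>|^2 = l |\<gamma>|^2. As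
  \<delta> is long, they have equal sign and |k| \<le> |l|; together with k l < 4 this leaves |k|
  \<le> 1.\<close>

lemma long_cartan:
  assumes "long \<delta>" "\<gamma> \<in> \<Phi>" "\<gamma> \<noteq> \<delta>" "\<gamma> \<noteq> - \<delta>"
  shows "\<gamma> \<bullet> coroot \<delta> \<in> {-1, 0, 1}"
proof -
  have d: "\<delta> \<in> \<Phi>" using assms long_root by blast
  obtain k :: int where k: "\<gamma> \<bullet> coroot \<delta> = of_int k" using cartan_cases d assms(2) by blast
  obtain l :: int where l: "\<delta> \<bullet> coroot \<gamma> = of_int l" using cartan_cases d assms(2) by blast
  have pos: "\<gamma> \<bullet> \<gamma> > 0" "\<delta> \<bullet> \<delta> > 0" using root_inner_pos d assms(2) by auto
  have le: "\<gamma> \<bullet> \<gamma> \<le> \<delta> \<bullet> \<delta>" using assms by (simp add: long_def)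
  have e: "of_int k * (\<delta> \<bullet> \<delta>) = of_int l * (\<gamma> \<bullet> \<gamma>)"
    using cartan_inner[OF d, of \<gamma>] cartan_inner[OF assms(2), of \<delta>] k l by (simp add: inner_commute)
  have kl: "k * l < 4"
    using cartan_product[OF d assms(2-4)] k l by (metis of_int_less_iff of_int_mult of_int_numeral)
  have abs: "\<bar>k\<bar> \<le> \<bar>l\<bar>"
  proof -
    have "\<bar>real_of_int k\<bar> * (\<delta> \<bullet> \<delta>) = \<bar>real_of_int l\<bar> * (\<gamma> \<bullet> \<gamma>)"
      using e pos by (metis abs_mult abs_of_pos)
    also have "\<dots> \<le> \<bar>real_of_int l\<bar> * (\<delta> \<bullet> \<delta>)" using le by (simp add: mult_left_mono)
    finally show ?thesis using pos by simp
  qed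
  have sgn: "k * l \<ge> 0"
  proof (rule ccontr)
    assume "\<not> k * l \<ge> 0"
    then have "of_int k * of_int l < (0::real)"
      by (metis not_le of_int_less_0_iff of_int_mult)
    moreover have "(of_int k * of_int l) * (\<gamma> \<bullet> \<gamma>) = of_int k * of_int k * (\<delta> \<bullet> \<delta>)"
      using e by (simp add: mult.assoc mult.left_commute)
    moreover have "of_int k * of_int k * (\<delta> \<bullet> \<delta>) \<ge> 0" using pos by simp
    ultimately show False using pos by (smt (verit) mult_neg_pos)
  qed
  have "\<bar>k\<bar> \<le> 1"
  proof (rule ccontr)
    assume "\<not> \<bar>k\<bar> \<le> 1"
    then have "\<bar>k\<bar> \<ge> 2" "\<bar>l\<bar> \<ge> 2" using abs by auto
    then have "\<bar>k\<bar> * \<bar>l\<bar> \<ge> 2 * 2" by (intro mult_mono) auto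
    then show False using kl sgn by (simp add: abs_mult[symmetric])
  qed
  then have "k = -1 \<or> k = 0 \<or> k = 1" by auto
  then show ?thesis using k by auto
qed

text \<open>Otherwise all roots except \<theta> and \<open>- \<theta>\<close> are orthogonal to
  \<theta>. There are such roots because the rank exceeds 1, so the pair would split off from the
  system.\<close>

lemma long_adjacent:
  assumes "indecomposable \<Phi>" "root_rank \<Phi> > 1" "long \<theta>"
  shows "\<exists>\<beta>\<in>\<Phi>. \<beta> \<bullet> coroot \<theta> = 1"
proof (rule ccontr)
  assume no: "\<not> ?thesis"
  have t: "\<theta> \<in> \<Phi>" using assms long_root by blast
  have z: "\<theta> \<bullet> \<beta> = 0" if "\<beta> \<in> \<Phi>" "\<beta> \<noteq> \<theta>" "\<beta> \<noteq> - \<theta>" for \<beta>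
  proof -
    have "\<beta> \<bullet> coroot \<theta> \<noteq> 1" "- \<beta> \<bullet> coroot \<theta> \<noteq> 1" using no that by (metis neg_root)+
    then have "\<beta> \<bullet> coroot \<theta> = 0" using long_cartan[OF assms(3) that] by auto
    then show ?thesis using cartan_inner[OF t, of \<beta>] by simp
  qed
  have "\<Phi> - {\<theta>, -\<theta>} \<noteq> {}"
  proof
    assume "\<Phi> - {\<theta>, -\<theta>} = {}"
    then have "span \<Phi> \<subseteq> span {\<theta>}"
      by (intro span_minimal) (auto simp: span_neg span_base)
    then have "dim (span \<Phi>) \<le> dim (span {\<theta>})" by (rule dim_subset)
    also have "\<dots> \<le> card {\<theta>}" by (simp only: dim_span, rule dim_le_card') simp
    finally show False using assms(2) by (simp add: root_rank_def)
  qed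
  moreover have "{\<theta>, -\<theta>} \<union> (\<Phi> - {\<theta>, -\<theta>}) = \<Phi>" using t neg_root by auto
  moreover have "\<forall>a\<in>{\<theta>, -\<theta>}. \<forall>b\<in>\<Phi> - {\<theta>, -\<theta>}. a \<bullet> b = 0" using z by auto
  ultimately show False using assms(1) unfolding indecomposable_def
    by (metis Diff_disjoint insert_not_empty)
qed

text \<open>In a Chevalley basis the structure constant of the pair is this number plus 1, up to
  sign.\<close>

definition string_len :: "'e \<Rightarrow> 'e \<Rightarrow> nat" where
  "string_len \<alpha> \<beta> = Max {p::nat. \<beta> - real p *\<^sub>R \<alpha> \<in> \<Phi>}"

lemma string_lenI:
  assumes "\<beta> - real k *\<^sub>R \<alpha> \<in> \<Phi>" "\<And>p. \<beta> - real p *\<^sub>R \<alpha> \<in> \<Phi> \<Longrightarrow> p \<le> k"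
  shows "string_len \<alpha> \<beta> = k"
  unfolding string_len_def
  by (rule Max_eqI) (use assms in \<open>auto intro: finite_subset[of _ "{..k}"]\<close>)

end

locale graded_root_sys = root_sys \<Phi> for \<Phi> :: "'e::euclidean_space set" +
  fixes \<theta> :: 'e
  assumes long_theta: "long \<theta>"
begin

lemma theta_root: "\<theta> \<in> \<Phi>" using long_theta by (rule long_root)

definition deg :: "'e \<Rightarrow> real" where "deg \<gamma> = \<gamma> \<bullet> coroot \<theta>"

lemma deg_simps [simp]:
  "deg (a + b) = deg a + deg b" "deg (a - b) = deg a - deg b" "deg (- a) = - deg a"
  "deg (c *\<^sub>R a) = c * deg a" "deg 0 = 0" "deg \<theta> = 2"
  by (simp_all add: deg_def inner_add_left inner_diff_left coroot_self theta_root)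

lemma deg_cases: "\<gamma> \<in> \<Phi> \<Longrightarrow> \<gamma> = \<theta> \<or> \<gamma> = - \<theta> \<or> deg \<gamma> \<in> {-1, 0, 1}"
  using long_cartan[OF long_theta] by (auto simp: deg_def)

lemma deg_bounds: "\<gamma> \<in> \<Phi> \<Longrightarrow> - 2 \<le> deg \<gamma> \<and> deg \<gamma> \<le> 2"
  using deg_cases[of \<gamma>] by auto

lemma deg_2: "\<gamma> \<in> \<Phi> \<Longrightarrow> deg \<gamma> > 1 \<Longrightarrow> \<gamma> = \<theta>"
  using deg_cases[of \<gamma>] by auto

lemma deg_m2: "\<gamma> \<in> \<Phi> \<Longrightarrow> deg \<gamma> < -1 \<Longrightarrow> \<gamma> = - \<theta>"
  using deg_cases[of \<gamma>] by auto

section \<open>Roots of degree one and their lengths\<close>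

definition L1 :: "'e set" where "L1 = {\<beta> \<in> \<Phi>. deg \<beta> = 1}"

lemma L1_root: "\<beta> \<in> L1 \<Longrightarrow> \<beta> \<in> \<Phi>" and L1_deg: "\<beta> \<in> L1 \<Longrightarrow> deg \<beta> = 1"
  by (auto simp: L1_def)

lemma finite_L1: "finite L1"
  using finite_roots by (simp add: L1_def)

lemma L1_minus_theta: "\<beta> \<in> L1 \<Longrightarrow> \<beta> - \<theta> \<in> \<Phi>"
  using reflection[OF theta_root, of \<beta>] by (auto simp: L1_def deg_def)

lemma deg_m1_plus_theta: "\<gamma> \<in> \<Phi> \<Longrightarrow> deg \<gamma> = -1 \<Longrightarrow> \<gamma> + \<theta> \<in> L1"
  using reflection[OF theta_root, of \<gamma>] by (auto simp: L1_def deg_def inner_add_left coroot_self theta_root)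

lemma L1_compl: "\<beta> \<in> L1 \<Longrightarrow> \<theta> - \<beta> \<in> L1"
  using neg_root[OF L1_minus_theta[of \<beta>]] by (auto simp: L1_def)

text \<open>For \<beta> of degree 1 this is the ratio of the squared lengths of \<theta> and
  \<beta>, see \<open>mult_norm\<close>: it is 1 if \<beta> is long, and 2 or 3 if \<beta> is short
  and spans a system of type B2 or G2 with \<theta>.\<close>

definition mlt :: "'e \<Rightarrow> nat" where "mlt \<beta> = nat \<lfloor>\<theta> \<bullet> coroot \<beta>\<rfloor>"

lemma theta_multiple: assumes "\<beta> \<in> \<Phi>" "c *\<^sub>R \<beta> = d *\<^sub>R \<theta>" "d \<noteq> 0" shows "c = d \<or> c = - d"
proof -
  have "\<theta> = (c / d) *\<^sub>R \<beta>" using assms(2,3)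
    by (metis divideR_right divide_inverse_commute scaleR_scaleR)
  then have "c / d = 1 \<or> c / d = -1" using multiple_root[OF assms(1), of "c / d"] theta_root by metis
  then show ?thesis using assms(3) by (auto simp: field_simps)
qed

lemma mult_cartan: assumes "\<beta> \<in> L1" shows "\<theta> \<bullet> coroot \<beta> = real (mlt \<beta>)" "mlt \<beta> \<in> {1, 2, 3}"
proof -
  have b: "\<beta> \<in> \<Phi>" "\<beta> \<noteq> \<theta>" "\<beta> \<noteq> - \<theta>" using assms by (auto simp: L1_def)
  obtain k :: int where k: "\<theta> \<bullet> coroot \<beta> = of_int k" using cartan_cases b theta_root by blast
  have "(\<beta> \<bullet> coroot \<theta>) * (\<theta> \<bullet> coroot \<beta>) < 4" using cartan_product[OF theta_root b] .
  then have "k < 4" using k assms by (simp add: L1_def deg_def)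
  have "of_int k * (\<beta> \<bullet> \<beta>) = \<theta> \<bullet> \<theta>"
    using cartan_inner[OF b(1), of \<theta>] cartan_inner[OF theta_root, of \<beta>] assms k
    by (simp add: L1_def deg_def inner_commute)
  then have "k > 0" using root_inner_pos[OF b(1)] root_inner_pos[OF theta_root]
    by (metis less_eq_real_def mult_le_0_iff not_less of_int_0_less_iff of_int_le_0_iff)
  show "\<theta> \<bullet> coroot \<beta> = real (mlt \<beta>)" "mlt \<beta> \<in> {1, 2, 3}"
    using k \<open>k > 0\<close> \<open>k < 4\<close> by (auto simp: mlt_def)
qed

lemma mult_norm: "\<beta> \<in> L1 \<Longrightarrow> real (mlt \<beta>) * (\<beta> \<bullet> \<beta>) = \<theta> \<bullet> \<theta>"
  using cartan_inner[OF L1_root, of \<beta> \<theta>] cartan_inner[OF theta_root, of \<beta>] mult_cartan[of \<beta>]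
  by (simp add: L1_def deg_def inner_commute)

lemma inner_theta: "\<beta> \<in> L1 \<Longrightarrow> 2 * (\<theta> \<bullet> \<beta>) = \<theta> \<bullet> \<theta>"
  using cartan_inner[OF theta_root, of \<beta>] by (simp add: L1_def deg_def)

lemma mult_compl: assumes "\<beta> \<in> L1" shows "mlt (\<theta> - \<beta>) = mlt \<beta>"
proof -
  have "(\<theta> - \<beta>) \<bullet> (\<theta> - \<beta>) = \<beta> \<bullet> \<beta>"
    using inner_theta[OF assms] by (simp add: inner_diff_left inner_diff_right inner_commute)
  then have "real (mlt (\<theta> - \<beta>)) * (\<beta> \<bullet> \<beta>) = real (mlt \<beta>) * (\<beta> \<bullet> \<beta>)"
    using mult_norm[OF assms] mult_norm[OF L1_compl[OF assms]] by simp
  then show ?thesis using root_inner_pos[OF L1_root[OF assms]] by simp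
qed

lemma mult_1_long: "\<beta> \<in> L1 \<Longrightarrow> mlt \<beta> = 1 \<Longrightarrow> long \<beta>"
  using mult_norm[of \<beta>] long_norm_eq[OF long_theta L1_root, of \<beta>] by simp

text \<open>The reflection in \<beta>, written in the plane of \<theta> and \<beta>. Applied to a
  hypothetical root it changes the degree, so that \<open>deg_bounds\<close> excludes combinations
  whose own degree looks harmless.\<close>

lemma reflect_lin:
  assumes "\<beta> \<in> L1" "a *\<^sub>R \<theta> + b *\<^sub>R \<beta> \<in> \<Phi>"
  shows "a *\<^sub>R \<theta> + (- b - a * real (mlt \<beta>)) *\<^sub>R \<beta> \<in> \<Phi>"
proof -
  have "(a *\<^sub>R \<theta> + b *\<^sub>R \<beta>) \<bullet> coroot \<beta> = a * real (mlt \<beta>) + 2 * b"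
    using mult_cartan(1)[OF assms(1)] coroot_self[OF L1_root[OF assms(1)]] by (simp add: inner_add_left)
  then have "a *\<^sub>R \<theta> + b *\<^sub>R \<beta> - (a * real (mlt \<beta>) + 2 * b) *\<^sub>R \<beta> \<in> \<Phi>"
    using reflection[OF L1_root[OF assms(1)] assms(2)] by simp
  moreover have "a *\<^sub>R \<theta> + b *\<^sub>R \<beta> - (a * real (mlt \<beta>) + 2 * b) *\<^sub>R \<beta>
      = a *\<^sub>R \<theta> + (- b - a * real (mlt \<beta>)) *\<^sub>R \<beta>"
    unfolding add_diff_eq[symmetric] scaleR_left_diff_distrib[symmetric] by (simp add: algebra_simps)
  ultimately show ?thesis by simp
qed

lemma theta_minus_mult: assumes "\<beta> \<in> L1" shows "\<theta> - real (mlt \<beta>) *\<^sub>R \<beta> \<in> \<Phi>"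
  using reflect_lin[OF assms, of 1 0] theta_root by simp

text \<open>This root of degree 0 supplies the relations with the factor
  \<open>mlt \<beta> - 1\<close>. For \<open>mlt \<beta> = 2\<close> it is the reflection of
  \<theta> in \<beta>, for \<open>mlt \<beta> = 3\<close> that of
  \<open>\<theta> - \<beta>\<close>.\<close>

lemma theta_minus_2: assumes "\<beta> \<in> L1" "mlt \<beta> \<ge> 2" shows "\<theta> - 2 *\<^sub>R \<beta> \<in> \<Phi>"
proof -
  consider "mlt \<beta> = 2" | "mlt \<beta> = 3" using mult_cartan[OF assms(1)] assms(2) by auto
  then show ?thesis
  proof cases
    case 1 then show ?thesis using theta_minus_mult[OF assms(1)] by simp
  next
    case 2 then show ?thesis
      using reflect_lin[OF assms(1), of 1 "-1"] L1_root[OF L1_compl[OF assms(1)]] by simp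
  qed
qed

text \<open>In type G2 there is also a long root of degree 1. It reduces multiplication to the long
  case, and it lets \<open>rr_zero\<close> treat an extra G2 term as settled.\<close>

lemma mult_3: assumes "\<beta> \<in> L1" "mlt \<beta> = 3"
  shows "3 *\<^sub>R \<beta> - \<theta> \<in> L1" "mlt (3 *\<^sub>R \<beta> - \<theta>) = 1" "3 *\<^sub>R \<beta> - 2 *\<^sub>R \<theta> \<in> \<Phi>"
proof -
  have "- (\<theta> - 3 *\<^sub>R \<beta>) \<in> \<Phi>" using theta_minus_mult[OF assms(1)] assms(2) neg_root by fastforce
  then show 1: "3 *\<^sub>R \<beta> - \<theta> \<in> L1" using L1_deg[OF assms(1)] by (simp add: L1_def)
  have "\<theta> \<bullet> \<theta> = 3 * (\<beta> \<bullet> \<beta>)" using mult_norm[OF assms(1)] assms(2) by simp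
  then have "(3 *\<^sub>R \<beta> - \<theta>) \<bullet> (3 *\<^sub>R \<beta> - \<theta>) = \<theta> \<bullet> \<theta>"
    using inner_theta[OF assms(1)] by (simp add: inner_diff_left inner_diff_right inner_commute)
  then have "real (mlt (3 *\<^sub>R \<beta> - \<theta>)) * (\<theta> \<bullet> \<theta>) = \<theta> \<bullet> \<theta>" using mult_norm[OF 1] by simp
  then show "mlt (3 *\<^sub>R \<beta> - \<theta>) = 1" using root_inner_pos[OF theta_root] by simp
  show "3 *\<^sub>R \<beta> - 2 *\<^sub>R \<theta> \<in> \<Phi>" using L1_minus_theta[OF 1] by (simp add: scaleR_2 algebra_simps)
qed

lemma not_2_4: assumes "\<beta> \<in> L1" shows "4 *\<^sub>R \<beta> \<noteq> 2 *\<^sub>R \<theta>"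
  using theta_multiple[OF L1_root[OF assms], of 4 2] by auto

lemma string_theta: assumes "\<gamma> \<in> \<Phi>" "deg \<gamma> = -1" shows "string_len \<theta> \<gamma> = 0"
proof (rule string_lenI)
  fix p assume "\<gamma> - real p *\<^sub>R \<theta> \<in> \<Phi>"
  from deg_bounds[OF this] assms show "p \<le> 0" by simp
qed (use assms in simp)

lemma string_L1_mtheta: assumes "\<beta> \<in> L1" shows "string_len \<beta> (- \<theta>) = 0"
proof (rule string_lenI)
  fix p assume "- \<theta> - real p *\<^sub>R \<beta> \<in> \<Phi>"
  from deg_bounds[OF this] L1_deg[OF assms] show "p \<le> 0" by simp
qed (use theta_root neg_root in simp)

lemma string_compl: assumes "\<beta> \<in> L1" shows "string_len \<beta> (\<theta> - \<beta>) = mlt \<beta> - 1"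
proof (rule string_lenI)
  have m: "mlt \<beta> \<ge> 1" using mult_cartan[OF assms] by auto
  have "\<theta> - \<beta> - real (mlt \<beta> - 1) *\<^sub>R \<beta> = \<theta> - real (mlt \<beta>) *\<^sub>R \<beta>"
    using m by (simp add: of_nat_diff scaleR_left_diff_distrib)
  then show "\<theta> - \<beta> - real (mlt \<beta> - 1) *\<^sub>R \<beta> \<in> \<Phi>"
    using theta_minus_mult[OF assms] by (simp only:)
  fix p assume "\<theta> - \<beta> - real p *\<^sub>R \<beta> \<in> \<Phi>"
  then have "1 *\<^sub>R \<theta> + (- 1 - real p) *\<^sub>R \<beta> \<in> \<Phi>" by (simp add: algebra_simps)
  from deg_bounds[OF reflect_lin[OF assms this]] L1_deg[OF assms]
  have "real (Suc p) \<le> real (mlt \<beta>)" by simp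
  then show "p \<le> mlt \<beta> - 1" by linarith
qed

text \<open>It yields a structure constant of absolute value \<open>mlt \<beta> - 1\<close>, coprime
  to the \<open>mlt \<beta>\<close> that comes from \<open>string_compl\<close>.\<close>

lemma string_delta_L1: assumes "\<beta> \<in> L1" "mlt \<beta> \<ge> 2"
  shows "string_len (\<theta> - 2 *\<^sub>R \<beta>) \<beta> = mlt \<beta> - 2"
proof (rule string_lenI)
  have m: "mlt \<beta> = 2 \<or> mlt \<beta> = 3" using mult_cartan[OF assms(1)] assms(2) by auto
  show "\<beta> - real (mlt \<beta> - 2) *\<^sub>R (\<theta> - 2 *\<^sub>R \<beta>) \<in> \<Phi>"
    using m
  proof
    assume "mlt \<beta> = 2" then show ?thesis using L1_root[OF assms(1)] by simp
  next
    assume 3: "mlt \<beta> = 3"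
    have "\<beta> - real (mlt \<beta> - 2) *\<^sub>R (\<theta> - 2 *\<^sub>R \<beta>) = 3 *\<^sub>R \<beta> - \<theta>"
      unfolding 3 scaleR_3 by (simp add: diff_diff_eq2)
    then show ?thesis using L1_root[OF mult_3(1)[OF assms(1) 3]] by (simp only:)
  qed
  fix p assume "\<beta> - real p *\<^sub>R (\<theta> - 2 *\<^sub>R \<beta>) \<in> \<Phi>"
  then have "(- real p) *\<^sub>R \<theta> + (1 + 2 * real p) *\<^sub>R \<beta> \<in> \<Phi>" by (simp add: algebra_simps)
  from deg_bounds[OF reflect_lin[OF assms(1) this]] L1_deg[OF assms(1)]
  have "real p * (4 - real (mlt \<beta>)) \<le> 1" by (simp add: algebra_simps)
  with m show "p \<le> mlt \<beta> - 2" by auto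
qed

lemma string_delta_Lm1: assumes "\<beta> \<in> L1" "mlt \<beta> \<ge> 2"
  shows "string_len (\<theta> - 2 *\<^sub>R \<beta>) (\<beta> - \<theta>) = mlt \<beta> - 2"
proof (rule string_lenI)
  have m: "mlt \<beta> = 2 \<or> mlt \<beta> = 3" using mult_cartan[OF assms(1)] assms(2) by auto
  show "\<beta> - \<theta> - real (mlt \<beta> - 2) *\<^sub>R (\<theta> - 2 *\<^sub>R \<beta>) \<in> \<Phi>"
    using m
  proof
    assume "mlt \<beta> = 2" then show ?thesis using L1_minus_theta[OF assms(1)] by simp
  next
    assume 3: "mlt \<beta> = 3"
    have "b - t - (t - c) = b + c - (t + t)" for b c t :: 'e by simp
    then have "\<beta> - \<theta> - real (mlt \<beta> - 2) *\<^sub>R (\<theta> - 2 *\<^sub>R \<beta>) = 3 *\<^sub>R \<beta> - 2 *\<^sub>R \<theta>"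
      unfolding 3 scaleR_3 scaleR_2[of \<theta>] by simp
    then show ?thesis using mult_3(3)[OF assms(1) 3] by (simp only:)
  qed
  fix p assume "\<beta> - \<theta> - real p *\<^sub>R (\<theta> - 2 *\<^sub>R \<beta>) \<in> \<Phi>"
  then have *: "(- 1 - real p) *\<^sub>R \<theta> + (1 + 2 * real p) *\<^sub>R \<beta> \<in> \<Phi>" by (simp add: algebra_simps)
  note r = reflect_lin[OF assms(1) this]
  from deg_bounds[OF r] L1_deg[OF assms(1)]
  have le: "real p * (4 - real (mlt \<beta>)) \<le> real (mlt \<beta>) - 1" by (simp add: algebra_simps)
  show "p \<le> mlt \<beta> - 2"
  proof (rule ccontr)
    assume "\<not> p \<le> mlt \<beta> - 2"
    \<comment> \<open>The degree bound leaves p = 2 in type G2. There the reflected root has degree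
      -2 and must be \<open>- \<theta>\<close>, which would make \<theta> equal to
      \<open>2 *\<^sub>R \<beta>\<close>.\<close>
    with m le have 3: "mlt \<beta> = 3" "p = 2" by auto
    have eq: "- 3 *\<^sub>R \<theta> + 4 *\<^sub>R \<beta> \<in> \<Phi>" using r 3 by simp
    from deg_m2[OF eq] L1_deg[OF assms(1)] have "- 3 *\<^sub>R \<theta> + 4 *\<^sub>R \<beta> = - \<theta>" by simp
    then have "4 *\<^sub>R \<beta> = 3 *\<^sub>R \<theta> - \<theta>"
      by (metis add_uminus_conv_diff minus_add_cancel scaleR_minus_left)
    also have "\<dots> = 2 *\<^sub>R \<theta>" unfolding scaleR_3 by simp
    finally have "4 *\<^sub>R \<beta> = 2 *\<^sub>R \<theta>" .
    then show False using not_2_4[OF assms(1)] by simp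
  qed
qed

text \<open>No root is longer than \<theta>, and the Cartan integers then leave a single case: both
  multiplicities are 3 and the Cartan integer of \<epsilon> and \<beta> is 1, where the difference
  has three times the squared length of \<beta>. It shows that the second divided power of ad
  \<open>X (- \<beta>)\<close> sends the other short root vectors of degree 1 into long root spaces
  or to 0.\<close>

lemma short_difference_long:
  assumes "\<epsilon> \<in> L1" "\<beta> \<in> L1" "mlt \<epsilon> \<ge> 2" "mlt \<beta> \<ge> 2" "\<epsilon> \<noteq> \<beta>" "\<epsilon> - 2 *\<^sub>R \<beta> \<in> \<Phi>"
  shows "long (\<epsilon> - 2 *\<^sub>R \<beta>)"
proof -
  have b: "\<beta> \<in> \<Phi>" and e: "\<epsilon> \<in> \<Phi>" using assms L1_root by auto
  have en: "\<epsilon> \<noteq> - \<beta>" using L1_deg[OF assms(1)] L1_deg[OF assms(2)] by auto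
  have me: "mlt \<epsilon> \<in> {2,3}" "mlt \<beta> \<in> {2,3}" using assms mult_cartan by fastforce+
  have ne: "real (mlt \<epsilon>) * (\<epsilon> \<bullet> \<epsilon>) = \<theta> \<bullet> \<theta>" "real (mlt \<beta>) * (\<beta> \<bullet> \<beta>) = \<theta> \<bullet> \<theta>"
    using mult_norm assms by auto
  have pos: "\<theta> \<bullet> \<theta> > 0" using root_inner_pos theta_root by auto
  obtain k :: int where k: "\<epsilon> \<bullet> coroot \<beta> = of_int k" using cartan_cases b e by blast
  obtain l :: int where l: "\<beta> \<bullet> coroot \<epsilon> = of_int l" using cartan_cases b e by blast
  have kk: "of_int k * (\<beta> \<bullet> \<beta>) = 2 * (\<beta> \<bullet> \<epsilon>)" using cartan_inner[OF b, of \<epsilon>] k by simp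
  have ll: "of_int l * (\<epsilon> \<bullet> \<epsilon>) = 2 * (\<beta> \<bullet> \<epsilon>)" using cartan_inner[OF e, of \<beta>] l by (simp add: inner_commute)
  have kl: "k * l < 4" using cartan_product[OF b e assms(5) en] k l
    by (metis of_int_less_iff of_int_mult of_int_numeral)
  have n: "(\<epsilon> - 2 *\<^sub>R \<beta>) \<bullet> (\<epsilon> - 2 *\<^sub>R \<beta>) = \<epsilon> \<bullet> \<epsilon> + 4 * (\<beta> \<bullet> \<beta>) - 4 * (\<beta> \<bullet> \<epsilon>)"
    by (simp add: inner_diff_left inner_diff_right inner_commute)
  have le: "\<epsilon> \<bullet> \<epsilon> + 4 * (\<beta> \<bullet> \<beta>) - 4 * (\<beta> \<bullet> \<epsilon>) \<le> \<theta> \<bullet> \<theta>"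
    using long_theta assms(6) n by (metis long_def)
  define T where "T = \<theta> \<bullet> \<theta>"
  have T: "T > 0" using pos T_def by simp
  have bT: "\<beta> \<bullet> \<beta> = T / real (mlt \<beta>)" "\<epsilon> \<bullet> \<epsilon> = T / real (mlt \<epsilon>)"
    using ne me unfolding T_def by (auto simp: field_simps)
  have "of_int k * (T / real (mlt \<beta>)) = of_int l * (T / real (mlt \<epsilon>))" using kk ll bT by simp
  then have klm: "real_of_int k * real (mlt \<epsilon>) = real_of_int l * real (mlt \<beta>)"
    using T me by (auto simp: field_simps)
  then have klm': "k * int (mlt \<epsilon>) = l * int (mlt \<beta>)"
    by (metis (mono_tags, lifting) of_int_eq_iff of_int_mult of_int_of_nat_eq)
  have "2 * (\<beta> \<bullet> \<epsilon>) = of_int k * (T / real (mlt \<beta>))" using kk bT by simp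
  then have le2: "T / real (mlt \<epsilon>) + 4 * (T / real (mlt \<beta>)) - 2 * of_int k * (T / real (mlt \<beta>)) \<le> T"
    using le bT unfolding T_def[symmetric] by simp
  have "T * (1 / real (mlt \<epsilon>) + 4 / real (mlt \<beta>) - 2 * of_int k / real (mlt \<beta>)) \<le> T * 1"
    using le2 by (simp add: algebra_simps)
  then have le3: "1 / real (mlt \<epsilon>) + 4 / real (mlt \<beta>) - 2 * of_int k / real (mlt \<beta>) \<le> 1"
    using T by (simp only: mult_le_cancel_left_pos)
  have fin: "mlt \<epsilon> = 3 \<and> mlt \<beta> = 3 \<and> k = 1"
  proof -
    have k0: "k \<ge> 1"
    proof (rule ccontr)
      assume "\<not> k \<ge> 1"
      then have "real_of_int k \<le> 0" by simp
      with le3 me show False by (auto simp: field_simps)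
    qed
    have "k \<le> 3"
    proof (rule ccontr)
      assume "\<not> k \<le> 3"
      then have "l \<ge> 1" using klm' me k0 by auto
      then have "k * l \<ge> 4 * 1" using \<open>\<not> k \<le> 3\<close> by (intro mult_mono) auto
      then show False using kl by simp
    qed
    then consider "k = 1" | "k = 2" | "k = 3" using k0 by linarith
    then show ?thesis using klm' kl me le3 by cases auto
  qed
  then have "(\<epsilon> - 2 *\<^sub>R \<beta>) \<bullet> (\<epsilon> - 2 *\<^sub>R \<beta>) = \<theta> \<bullet> \<theta>"
    using n bT kk T_def by simp
  then show ?thesis using long_norm_eq[OF long_theta assms(6)] by simp
qed

end

section \<open>Matrix Lie algebras with a Chevalley basis\<close>

text \<open>T stands for the Cartan subalgebra. Only its independence of the root vectors and its
  action on them are recorded; coordinates inside T never occur.\<close>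

locale chevalley = root_sys \<Phi> for \<Phi> :: "'e::euclidean_space set" +
  fixes X :: "'e \<Rightarrow> 'n::finite sqmat" and T :: "'n sqmat set"
  assumes T_subspace: "sqm.subspace T"
    and indep: "H \<in> T \<Longrightarrow> (\<Sum>\<delta>\<in>\<Phi>. smul (c \<delta>) (X \<delta>)) + H = 0 \<Longrightarrow> \<delta> \<in> \<Phi> \<Longrightarrow> c \<delta> = 0"
    and T_comm: "H \<in> T \<Longrightarrow> H' \<in> T \<Longrightarrow> comm H H' = 0"
    and T_X: "H \<in> T \<Longrightarrow> \<delta> \<in> \<Phi> \<Longrightarrow> \<exists>c. comm H (X \<delta>) = smul c (X \<delta>)"
    and coroot_T: "\<alpha> \<in> \<Phi> \<Longrightarrow> comm (X \<alpha>) (X (- \<alpha>)) \<in> T"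
    and coroot_X: "\<alpha> \<in> \<Phi> \<Longrightarrow> \<beta> \<in> \<Phi> \<Longrightarrow>
      comm (comm (X \<alpha>) (X (- \<alpha>))) (X \<beta>) = smul (of_real (\<beta> \<bullet> coroot \<alpha>)) (X \<beta>)"
    and X_zero: "\<alpha> \<in> \<Phi> \<Longrightarrow> \<beta> \<in> \<Phi> \<Longrightarrow> \<alpha> + \<beta> \<notin> \<Phi> \<Longrightarrow> \<alpha> + \<beta> \<noteq> 0 \<Longrightarrow> comm (X \<alpha>) (X \<beta>) = 0"
    and X_sum: "\<alpha> \<in> \<Phi> \<Longrightarrow> \<beta> \<in> \<Phi> \<Longrightarrow> \<alpha> + \<beta> \<in> \<Phi> \<Longrightarrow>
      \<exists>c::int. \<bar>c\<bar> = int (string_len \<alpha> \<beta>) + 1 \<and> comm (X \<alpha>) (X \<beta>) = smul (of_int c) (X (\<alpha> + \<beta>))"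
    and X_int: "\<alpha> \<in> \<Phi> \<Longrightarrow> entry (dpow (X \<alpha>) k) i j \<in> \<int>"
begin

text \<open>The entries of the divided powers are integers, while their absolute values are at most
  K^k / k!, which tends to 0. So some power vanishes: nilpotency follows from admissibility.\<close>

lemma X_nil: assumes a: "\<alpha> \<in> \<Phi>" shows "nil (X \<alpha>)"
proof -
  define M where "M = 1 + (\<Sum>i\<in>UNIV. \<Sum>j\<in>UNIV. cmod (entry (X \<alpha>) i j))"
  have M: "cmod (entry (X \<alpha>) i j) \<le> M" for i j
  proof -
    have "cmod (entry (X \<alpha>) i j) \<le> (\<Sum>j\<in>UNIV. cmod (entry (X \<alpha>) i j))"
      by (rule member_le_sum) auto
    also have "\<dots> \<le> (\<Sum>i\<in>UNIV. \<Sum>j\<in>UNIV. cmod (entry (X \<alpha>) i j))"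
      by (rule member_le_sum[where f = "\<lambda>i. \<Sum>j\<in>UNIV. cmod (entry (X \<alpha>) i j)"]) (auto intro: sum_nonneg)
    finally show ?thesis by (simp add: M_def)
  qed
  have M1: "M \<ge> 1" by (simp add: M_def sum_nonneg)
  define K where "K = real CARD('n) * M"
  have bound: "cmod (entry (X \<alpha> ^ k) i j) \<le> K ^ k" for k i j
  proof (induction k arbitrary: i j)
    case (Suc k)
    have "cmod (entry (X \<alpha> ^ Suc k) i j) \<le> (\<Sum>l\<in>UNIV. cmod (entry (X \<alpha>) i l * entry (X \<alpha> ^ k) l j))"
      by (simp add: entry_mult norm_sum)
    also have "\<dots> \<le> (\<Sum>l\<in>(UNIV::'n set). M * K ^ k)"
      by (rule sum_mono) (auto simp: norm_mult intro!: mult_mono M Suc order_trans[OF zero_le_one M1])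
    finally show ?case by (simp add: K_def mult.assoc)
  qed simp
  have "(\<lambda>k. K ^ k / fact k) \<longlonglongrightarrow> 0"
    using summable_LIMSEQ_zero[OF summable_exp[of K]] by (simp add: field_simps)
  then have "\<forall>\<^sub>F k in sequentially. K ^ k / fact k < 1"
    by (rule order_tendstoD) simp
  then obtain k where k: "K ^ k / fact k < 1"
    using eventually_happens'[OF sequentially_bot] by blast
  have "entry (X \<alpha> ^ k) i j = 0" for i j
  proof -
    obtain z :: int where z: "entry (dpow (X \<alpha>) k) i j = of_int z"
      using X_int[OF a] by (metis Ints_cases)
    then have e: "entry (X \<alpha> ^ k) i j = fact k * of_int z" by (simp add: dpow_def field_simps)
    then have "fact k * \<bar>real_of_int z\<bar> \<le> K ^ k" using bound[of k i j] by (simp add: norm_mult)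
    also have "\<dots> < fact k * 1" using k by (simp add: field_simps)
    finally have "\<bar>real_of_int z\<bar> < 1" by (simp only: mult_less_cancel_left_pos fact_gt_zero)
    then have "z = 0" by simp
    then show ?thesis using e by simp
  qed
  then have "X \<alpha> ^ k = 0" by (intro sqmat_eqI) simp
  then show ?thesis by (rule nilpotent_imp_nil)
qed

section \<open>Structure constants and coordinates in the Lie algebra\<close>

definition N :: "'e \<Rightarrow> 'e \<Rightarrow> int" where
  "N \<alpha> \<beta> = (SOME c. \<bar>c\<bar> = int (string_len \<alpha> \<beta>) + 1 \<and> comm (X \<alpha>) (X \<beta>) = smul (of_int c) (X (\<alpha> + \<beta>)))"

lemma N:
  assumes "\<alpha> \<in> \<Phi>" "\<beta> \<in> \<Phi>" "\<alpha> + \<beta> \<in> \<Phi>"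
  shows "\<bar>N \<alpha> \<beta>\<bar> = int (string_len \<alpha> \<beta>) + 1" "comm (X \<alpha>) (X \<beta>) = smul (of_int (N \<alpha> \<beta>)) (X (\<alpha> + \<beta>))"
  using someI_ex[OF X_sum[OF assms]] by (auto simp: N_def)

definition LL :: "'n sqmat set" where
  "LL = {a. \<exists>c. \<exists>H\<in>T. a = (\<Sum>\<delta>\<in>\<Phi>. smul (c \<delta>) (X \<delta>)) + H}"

definition coef :: "'e \<Rightarrow> 'n sqmat \<Rightarrow> complex" where
  "coef \<delta> a = (SOME c. \<exists>H\<in>T. a = (\<Sum>\<delta>\<in>\<Phi>. smul (c \<delta>) (X \<delta>)) + H) \<delta>"

definition cpart :: "'n sqmat \<Rightarrow> 'n sqmat" where
  "cpart a = a - (\<Sum>\<delta>\<in>\<Phi>. smul (coef \<delta> a) (X \<delta>))"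

lemma T_closed: "0 \<in> T" "H \<in> T \<Longrightarrow> H' \<in> T \<Longrightarrow> H + H' \<in> T" "H \<in> T \<Longrightarrow> H' \<in> T \<Longrightarrow> H - H' \<in> T"
  "H \<in> T \<Longrightarrow> smul c H \<in> T"
  using T_subspace by (auto simp: sqm.subspace_0 sqm.subspace_add sqm.subspace_scale sqm.subspace_diff)

lemma coef_eq:
  assumes "H \<in> T" "a = (\<Sum>\<delta>\<in>\<Phi>. smul (c \<delta>) (X \<delta>)) + H" "\<delta> \<in> \<Phi>"
  shows "coef \<delta> a = c \<delta>"
proof -
  define d where "d = (SOME c. \<exists>H\<in>T. a = (\<Sum>\<delta>\<in>\<Phi>. smul (c \<delta>) (X \<delta>)) + H)"
  have "\<exists>H\<in>T. a = (\<Sum>\<delta>\<in>\<Phi>. smul (d \<delta>) (X \<delta>)) + H"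
    unfolding d_def
    by (rule someI_ex[where P = "\<lambda>c. \<exists>H\<in>T. a = (\<Sum>\<delta>\<in>\<Phi>. smul (c \<delta>) (X \<delta>)) + H"]) (use assms in blast)
  then obtain H' where H': "H' \<in> T" "a = (\<Sum>\<delta>\<in>\<Phi>. smul (d \<delta>) (X \<delta>)) + H'" by blast
  have "(\<Sum>\<delta>\<in>\<Phi>. smul (d \<delta> - c \<delta>) (X \<delta>)) + (H' - H) = 0"
    using H'(2) assms(2) by (simp add: sqm.scale_left_diff_distrib sum_subtractf algebra_simps)
  from indep[OF T_closed(3)[OF H'(1) assms(1)] this assms(3)] have "d \<delta> - c \<delta> = 0" .
  then show ?thesis by (simp add: coef_def d_def)
qed

lemma cpart_T: assumes "a \<in> LL" shows "cpart a \<in> T"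
proof -
  obtain c H where H: "H \<in> T" "a = (\<Sum>\<delta>\<in>\<Phi>. smul (c \<delta>) (X \<delta>)) + H"
    using assms by (auto simp: LL_def)
  have "(\<Sum>\<delta>\<in>\<Phi>. smul (coef \<delta> a) (X \<delta>)) = (\<Sum>\<delta>\<in>\<Phi>. smul (c \<delta>) (X \<delta>))"
    by (rule sum.cong) (simp_all add: coef_eq[OF H])
  then show ?thesis using H by (simp add: cpart_def)
qed

lemma decomp: "a = (\<Sum>\<delta>\<in>\<Phi>. smul (coef \<delta> a) (X \<delta>)) + cpart a"
  by (simp add: cpart_def)

lemma LL_I: "H \<in> T \<Longrightarrow> a = (\<Sum>\<delta>\<in>\<Phi>. smul (c \<delta>) (X \<delta>)) + H \<Longrightarrow> a \<in> LL"
  by (auto simp: LL_def)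

lemma X_decomp: "\<epsilon> \<in> \<Phi> \<Longrightarrow> X \<epsilon> = (\<Sum>\<delta>\<in>\<Phi>. smul (if \<delta> = \<epsilon> then 1 else 0) (X \<delta>)) + 0"
  using finite_roots by (subst sum.remove[of _ \<epsilon>]) auto

lemma add_decomp:
  assumes "a \<in> LL" "b \<in> LL"
  shows "a + b = (\<Sum>\<delta>\<in>\<Phi>. smul (coef \<delta> a + coef \<delta> b) (X \<delta>)) + (cpart a + cpart b)"
  by (simp add: sqm.scale_left_distrib sum.distrib cpart_def)

lemma smul_decomp: "smul c a = (\<Sum>\<delta>\<in>\<Phi>. smul (c * coef \<delta> a) (X \<delta>)) + smul c (cpart a)"
  by (simp add: cpart_def sqm.scale_right_diff_distrib sqm.scale_sum_right)

lemma LL_X [simp]: "\<epsilon> \<in> \<Phi> \<Longrightarrow> X \<epsilon> \<in> LL"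
  using LL_I[OF T_closed(1) X_decomp] .

lemma LL_T [simp]: "H \<in> T \<Longrightarrow> H \<in> LL"
  by (rule LL_I[of H _ "\<lambda>_. 0"]) auto

lemma LL_add [simp]: "a \<in> LL \<Longrightarrow> b \<in> LL \<Longrightarrow> a + b \<in> LL"
  by (rule LL_I[OF _ add_decomp]) (auto intro: T_closed cpart_T)

lemma LL_smul [simp]: "a \<in> LL \<Longrightarrow> smul c a \<in> LL"
  by (rule LL_I[OF _ smul_decomp]) (auto intro: T_closed cpart_T)

lemma LL_0 [simp]: "0 \<in> LL"
  by (simp add: T_closed)

lemma LL_uminus [simp]: "a \<in> LL \<Longrightarrow> - a \<in> LL"
  using LL_smul[of a "-1"] by simp

lemma LL_diff [simp]: "a \<in> LL \<Longrightarrow> b \<in> LL \<Longrightarrow> a - b \<in> LL"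
  using LL_add[of a "- b"] by simp

lemma LL_sum [simp]: "(\<And>i. i \<in> S \<Longrightarrow> f i \<in> LL) \<Longrightarrow> sum f S \<in> LL"
  by (induction S rule: infinite_finite_induct) auto

lemma coef_X [simp]: "\<epsilon> \<in> \<Phi> \<Longrightarrow> \<delta> \<in> \<Phi> \<Longrightarrow> coef \<delta> (X \<epsilon>) = (if \<delta> = \<epsilon> then 1 else 0)"
  by (rule coef_eq[OF T_closed(1) X_decomp])

lemma coef_T [simp]: "H \<in> T \<Longrightarrow> \<delta> \<in> \<Phi> \<Longrightarrow> coef \<delta> H = 0"
  by (rule coef_eq[of H _ "\<lambda>_. 0"]) auto

lemma coef_add [simp]: "a \<in> LL \<Longrightarrow> b \<in> LL \<Longrightarrow> \<delta> \<in> \<Phi> \<Longrightarrow> coef \<delta> (a + b) = coef \<delta> a + coef \<delta> b"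
  by (rule coef_eq[OF _ add_decomp]) (auto intro: T_closed cpart_T)

lemma coef_smul [simp]: "a \<in> LL \<Longrightarrow> \<delta> \<in> \<Phi> \<Longrightarrow> coef \<delta> (smul c a) = c * coef \<delta> a"
  by (rule coef_eq[OF _ smul_decomp]) (auto intro: T_closed cpart_T)

lemma coef_0 [simp]: "\<delta> \<in> \<Phi> \<Longrightarrow> coef \<delta> 0 = 0"
  by (simp add: T_closed)

lemma coef_uminus [simp]: "a \<in> LL \<Longrightarrow> \<delta> \<in> \<Phi> \<Longrightarrow> coef \<delta> (- a) = - coef \<delta> a"
  using coef_smul[of a \<delta> "-1"] by simp

lemma coef_diff [simp]: "a \<in> LL \<Longrightarrow> b \<in> LL \<Longrightarrow> \<delta> \<in> \<Phi> \<Longrightarrow> coef \<delta> (a - b) = coef \<delta> a - coef \<delta> b"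
  using coef_add[of a "- b"] by simp

lemma coef_sum: "(\<And>i. i \<in> S \<Longrightarrow> f i \<in> LL) \<Longrightarrow> \<delta> \<in> \<Phi> \<Longrightarrow> coef \<delta> (sum f S) = (\<Sum>i\<in>S. coef \<delta> (f i))"
  by (induction S rule: infinite_finite_induct) (auto intro: LL_sum)

lemma X_nonzero: "\<epsilon> \<in> \<Phi> \<Longrightarrow> X \<epsilon> \<noteq> 0"
  using coef_X[of \<epsilon> \<epsilon>] coef_0[of \<epsilon>] by (metis zero_neq_one)

lemma linear_ext:
  fixes f :: "'n sqmat \<Rightarrow> complex"
  assumes "\<And>a b. a \<in> LL \<Longrightarrow> b \<in> LL \<Longrightarrow> f (a + b) = f a + f b"
    and "\<And>c a. a \<in> LL \<Longrightarrow> f (smul c a) = c * f a"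
    and "a \<in> LL"
  shows "f a = (\<Sum>\<delta>\<in>\<Phi>. coef \<delta> a * f (X \<delta>)) + f (cpart a)"
proof -
  have f0: "f 0 = 0" using assms(2)[of 0 0] by simp
  have "f (\<Sum>\<delta>\<in>S. smul (coef \<delta> a) (X \<delta>)) = (\<Sum>\<delta>\<in>S. coef \<delta> a * f (X \<delta>))" if "S \<subseteq> \<Phi>" for S
    using finite_subset[OF that finite_roots] that
    by (induction S rule: finite_induct) (auto simp: assms(1,2) f0 subset_iff)
  from this[of \<Phi>] show ?thesis
    by (subst decomp[of a], subst assms(1)) (auto intro!: LL_sum simp: cpart_T assms(3))
qed

text \<open>G is required to be linear on \<open>LL\<close> only, because it will be built from
  \<open>coef\<close>, which is an arbitrary choice outside \<open>LL\<close>.\<close>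

lemma linear_ext_eq:
  fixes F G :: "'n sqmat \<Rightarrow> 'n sqmat"
  assumes F: "\<And>a b. F (a + b) = F a + F b" "\<And>c a. F (smul c a) = smul c (F a)"
    and G: "\<And>a b. a \<in> LL \<Longrightarrow> b \<in> LL \<Longrightarrow> G (a + b) = G a + G b"
      "\<And>c a. a \<in> LL \<Longrightarrow> G (smul c a) = smul c (G a)"
    and eq: "\<And>\<epsilon>. \<epsilon> \<in> \<Phi> \<Longrightarrow> F (X \<epsilon>) = G (X \<epsilon>)" "\<And>H. H \<in> T \<Longrightarrow> F H = G H"
    and a: "a \<in> LL"
  shows "F a = G a"
proof -
  have f0: "F 0 = 0" "G 0 = 0" using F(2)[of 0 0] G(2)[of 0 0] by auto
  have "F (\<Sum>\<delta>\<in>S. smul (coef \<delta> a) (X \<delta>)) = G (\<Sum>\<delta>\<in>S. smul (coef \<delta> a) (X \<delta>))" if "S \<subseteq> \<Phi>" for S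
    using finite_subset[OF that finite_roots] that
    by (induction S rule: finite_induct) (auto simp: F G eq f0 LL_sum subset_iff)
  from this[of \<Phi>] show ?thesis
    by (subst (1 2) decomp[of a]) (auto simp: F G LL_sum cpart_T a eq)
qed

section \<open>Weight spaces and root automorphisms\<close>

text \<open>For a \<mu> that is neither a root nor 0 the space is \<open>{0}\<close>. Thus
  \<open>comm_W\<close> and \<open>adp_W\<close> add weights without side conditions, and vanishing
  is read off from the weight.\<close>

definition W :: "'e \<Rightarrow> 'n sqmat set" where
  "W \<mu> = (if \<mu> \<in> \<Phi> then range (\<lambda>c. smul c (X \<mu>)) else if \<mu> = 0 then T else {0})"

lemma X_W: "\<epsilon> \<in> \<Phi> \<Longrightarrow> X \<epsilon> \<in> W \<epsilon>"
  by (auto simp: W_def intro!: range_eqI[of _ _ 1])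

lemma T_W: "H \<in> T \<Longrightarrow> H \<in> W 0"
  using root_nonzero by (auto simp: W_def)

lemma W_LL: "a \<in> W \<mu> \<Longrightarrow> a \<in> LL"
  by (auto simp: W_def split: if_splits)

lemma W_smul: "a \<in> W \<mu> \<Longrightarrow> smul c a \<in> W \<mu>"
  by (auto simp: W_def T_closed split: if_splits)

lemma W_trivial: "a \<in> W \<mu> \<Longrightarrow> \<mu> \<notin> \<Phi> \<Longrightarrow> \<mu> \<noteq> 0 \<Longrightarrow> a = 0"
  by (auto simp: W_def)

lemma coef_W: "a \<in> W \<mu> \<Longrightarrow> \<eta> \<in> \<Phi> \<Longrightarrow> \<eta> \<noteq> \<mu> \<Longrightarrow> coef \<eta> a = 0"
  by (auto simp: W_def split: if_splits)

lemma W_coef: "a \<in> W \<mu> \<Longrightarrow> \<mu> \<in> \<Phi> \<Longrightarrow> a = smul (coef \<mu> a) (X \<mu>)"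
  by (auto simp: W_def)

lemma comm_W: assumes "\<delta> \<in> \<Phi>" "a \<in> W \<mu>" shows "comm (X \<delta>) a \<in> W (\<mu> + \<delta>)"
proof -
  consider "\<mu> \<in> \<Phi>" | "\<mu> = 0" | "\<mu> \<notin> \<Phi>" "\<mu> \<noteq> 0" by blast
  then show ?thesis
  proof cases
    case 1
    then obtain c where a: "a = smul c (X \<mu>)" using assms(2) by (auto simp: W_def)
    consider "\<mu> + \<delta> \<in> \<Phi>" | "\<mu> + \<delta> = 0" | "\<mu> + \<delta> \<notin> \<Phi>" "\<mu> + \<delta> \<noteq> 0" by blast
    then show ?thesis
    proof cases
      case 1
      then have "comm (X \<delta>) (X \<mu>) = smul (of_int (N \<delta> \<mu>)) (X (\<mu> + \<delta>))"
        using N(2)[OF assms(1) \<open>\<mu> \<in> \<Phi>\<close>] by (simp add: add.commute)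
      then show ?thesis using 1 by (simp add: a comm_simps W_smul X_W)
    next
      case 2
      then have "\<mu> = - \<delta>" by (simp add: add_eq_0_iff2)
      then show ?thesis using coroot_T[OF assms(1)] 2
        by (simp add: a comm_simps W_smul T_W)
    next
      case 3
      then have "comm (X \<delta>) (X \<mu>) = 0" using X_zero[OF assms(1) \<open>\<mu> \<in> \<Phi>\<close>] by (simp add: add.commute)
      then show ?thesis by (simp add: a comm_simps 3 W_def)
    qed
  next
    case 2
    then have "a \<in> T" using assms(2) root_nonzero by (auto simp: W_def split: if_splits)
    then obtain c where "comm a (X \<delta>) = smul c (X \<delta>)" using T_X assms(1) by blast
    then have "comm (X \<delta>) a = smul (- c) (X \<delta>)" by (subst comm_swap) (simp only: sqm.scale_minus_left)
    then show ?thesis using 2 W_smul[OF X_W[OF assms(1)], of "- c"] by simp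
  next
    case 3
    then have "a = 0" using assms(2) W_trivial by blast
    then show ?thesis by (auto simp: comm_simps W_def T_closed intro!: range_eqI[of _ _ 0])
  qed
qed

lemma adp_W: "\<delta> \<in> \<Phi> \<Longrightarrow> a \<in> W \<mu> \<Longrightarrow> adp (X \<delta>) k a \<in> W (\<mu> + real k *\<^sub>R \<delta>)"
proof (induction k)
  case (Suc k)
  have "comm (X \<delta>) (adp (X \<delta>) k a) \<in> W (\<mu> + real k *\<^sub>R \<delta> + \<delta>)"
    using Suc by (intro comm_W) auto
  moreover have "\<mu> + real k *\<^sub>R \<delta> + \<delta> = \<mu> + real (Suc k) *\<^sub>R \<delta>"
    by (simp add: scaleR_left_distrib)
  ultimately show ?case by (simp add: adp_Suc W_smul)
qed simp

section \<open>Root elements and the automorphisms they induce\<close>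

definition ex :: "'e \<Rightarrow> complex \<Rightarrow> 'n sqmat" where
  "ex \<delta> t = mexp (smul t (X \<delta>))"

definition E :: "'e \<Rightarrow> complex \<Rightarrow> 'n sqmat \<Rightarrow> 'n sqmat" where
  "E \<delta> t a = ex \<delta> t * a * ex \<delta> (- t)"

lemma ex_add: "\<delta> \<in> \<Phi> \<Longrightarrow> ex \<delta> (s + t) = ex \<delta> s * ex \<delta> t"
  unfolding ex_def sqm.scale_left_distrib
  by (rule mexp_add(2)) (auto intro: nil_smul X_nil simp: mult.commute)

lemma ex_0 [simp]: "ex \<delta> 0 = 1"
  by (simp add: ex_def)

lemma ex_inverse [simp]: "\<delta> \<in> \<Phi> \<Longrightarrow> ex \<delta> t * ex \<delta> (- t) = 1" "\<delta> \<in> \<Phi> \<Longrightarrow> ex \<delta> (- t) * ex \<delta> t = 1"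
  by (simp_all flip: ex_add)

lemma E_add: "E \<delta> t (a + b) = E \<delta> t a + E \<delta> t b" and E_smul: "E \<delta> t (smul c a) = smul c (E \<delta> t a)"
  and E_diff: "E \<delta> t (a - b) = E \<delta> t a - E \<delta> t b"
  by (simp_all add: E_def algebra_simps)

lemma E_expand:
  assumes "\<delta> \<in> \<Phi>" "M \<ge> 2 * CARD('n)"
  shows "E \<delta> t a = (\<Sum>k<M. smul (t ^ k) (adp (X \<delta>) k a))"
  using mexp_ad[OF nil_smul[OF X_nil[OF assms(1)]] assms(2), of t a]
  by (simp add: E_def ex_def adp_smul)

lemma E_W:
  assumes "\<delta> \<in> \<Phi>" "a \<in> W \<mu>" "\<And>k. k \<ge> K \<Longrightarrow> \<mu> + real k *\<^sub>R \<delta> \<notin> \<Phi> \<and> \<mu> + real k *\<^sub>R \<delta> \<noteq> 0"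
  shows "E \<delta> t a = (\<Sum>k<K. smul (t ^ k) (adp (X \<delta>) k a))"
proof -
  have "E \<delta> t a = (\<Sum>k<2 * CARD('n) + K. smul (t ^ k) (adp (X \<delta>) k a))"
    by (rule E_expand[OF assms(1)]) simp
  also have "\<dots> = (\<Sum>k<K. smul (t ^ k) (adp (X \<delta>) k a))"
  proof (rule sum.mono_neutral_right)
    show "\<forall>k\<in>{..<2 * CARD('n) + K} - {..<K}. smul (t ^ k) (adp (X \<delta>) k a) = 0"
      using W_trivial[OF adp_W[OF assms(1,2)]] assms(3) by auto
  qed auto
  finally show ?thesis .
qed

lemma comm_LL: assumes "\<delta> \<in> \<Phi>" "a \<in> LL" shows "comm (X \<delta>) a \<in> LL"
proof -
  have "comm (X \<delta>) (X \<epsilon>) \<in> LL" if "\<epsilon> \<in> \<Phi>" for \<epsilon>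
    using W_LL[OF comm_W[OF assms(1) X_W[OF that]]] .
  moreover have "comm (X \<delta>) (cpart a) \<in> LL"
    using W_LL[OF comm_W[OF assms(1) T_W[OF cpart_T[OF assms(2)]]]] .
  ultimately show ?thesis
    by (subst decomp[of a]) (auto simp: comm_simps comm_sum_right intro!: LL_sum)
qed

lemma comm_LL': assumes "a \<in> LL" "b \<in> LL" shows "comm a b \<in> LL"
proof -
  have "comm H b \<in> LL" if H: "H \<in> T" for H
  proof -
    have "comm H (X \<epsilon>) \<in> LL" if "\<epsilon> \<in> \<Phi>" for \<epsilon>
      using T_X[OF H that] that by auto
    moreover have "comm H (cpart b) \<in> LL"
      using T_comm[OF H cpart_T[OF assms(2)]] by simp
    ultimately show ?thesis
      by (subst decomp[of b]) (auto simp: comm_simps comm_sum_right intro!: LL_sum)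
  qed
  from this[OF cpart_T[OF assms(1)]] show ?thesis
    by (subst decomp[of a]) (auto simp: comm_simps comm_sum_left assms comm_LL intro!: LL_sum)
qed

lemma adp_LL: "\<delta> \<in> \<Phi> \<Longrightarrow> a \<in> LL \<Longrightarrow> adp (X \<delta>) k a \<in> LL"
  by (induction k) (auto simp: adp_Suc comm_LL)

lemma E_LL: "\<delta> \<in> \<Phi> \<Longrightarrow> a \<in> LL \<Longrightarrow> E \<delta> t a \<in> LL"
  by (subst E_expand[OF _ order_refl]) (auto intro!: LL_sum simp: adp_LL)

lemma coef_E:
  assumes "\<delta> \<in> \<Phi>" "a \<in> W \<mu>" "\<mu> + real k *\<^sub>R \<delta> \<in> \<Phi>"
  shows "coef (\<mu> + real k *\<^sub>R \<delta>) (E \<delta> t a) = t ^ k * coef (\<mu> + real k *\<^sub>R \<delta>) (adp (X \<delta>) k a)"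
proof -
  let ?\<eta> = "\<mu> + real k *\<^sub>R \<delta>"
  have "coef ?\<eta> (E \<delta> t a) = (\<Sum>j<2 * CARD('n) + Suc k. coef ?\<eta> (smul (t ^ j) (adp (X \<delta>) j a)))"
    by (subst E_expand[OF assms(1), of "2 * CARD('n) + Suc k"])
      (auto simp: coef_sum adp_LL assms W_LL[OF assms(2)])
  also have "\<dots> = (\<Sum>j\<in>{k}. coef ?\<eta> (smul (t ^ j) (adp (X \<delta>) j a)))"
  proof (rule sum.mono_neutral_right)
    have "coef ?\<eta> (adp (X \<delta>) j a) = 0" if "j \<noteq> k" for j
      by (rule coef_W[OF adp_W[OF assms(1,2)] assms(3)]) (use that root_nonzero[OF assms(1)] in auto)
    then show "\<forall>j\<in>{..<2 * CARD('n) + Suc k} - {k}. coef ?\<eta> (smul (t ^ j) (adp (X \<delta>) j a)) = 0"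
      using assms adp_LL[OF assms(1) W_LL[OF assms(2)]] by auto
  qed auto
  finally show ?thesis using assms adp_LL[OF assms(1) W_LL[OF assms(2)]] by simp
qed

lemma coef_E_0:
  assumes "\<delta> \<in> \<Phi>" "a \<in> W \<mu>" "\<eta> \<in> \<Phi>" "\<And>k::nat. \<eta> \<noteq> \<mu> + real k *\<^sub>R \<delta>"
  shows "coef \<eta> (E \<delta> t a) = 0"
  by (subst E_expand[OF assms(1) order_refl], subst coef_sum)
    (use assms adp_LL[OF assms(1) W_LL[OF assms(2)]] coef_W[OF adp_W[OF assms(1,2)]] in auto)

text \<open>Only the weights \<open>\<eta> - real k *\<^sub>R \<delta>\<close> can reach \<eta>. The
  hypotheses confine k to 0, 1, 2 and keep the weight 0, that is the Cartan part, out of this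
  string.\<close>

lemma coef_E_two_steps:
  assumes "\<delta> \<in> \<Phi>" "\<eta> \<in> \<Phi>" "\<eta> - \<delta> \<in> \<Phi>" "\<eta> \<noteq> 2 *\<^sub>R \<delta>" "a \<in> LL"
    and "\<And>k::nat. k \<ge> 3 \<Longrightarrow> \<eta> - real k *\<^sub>R \<delta> \<notin> \<Phi> \<and> \<eta> - real k *\<^sub>R \<delta> \<noteq> 0"
  shows "coef \<eta> (E \<delta> t a) = coef \<eta> a + t * of_int (N \<delta> (\<eta> - \<delta>)) * coef (\<eta> - \<delta>) a
    + (if \<eta> - 2 *\<^sub>R \<delta> \<in> \<Phi> then t ^ 2 * coef \<eta> (adp (X \<delta>) 2 (X (\<eta> - 2 *\<^sub>R \<delta>))) * coef (\<eta> - 2 *\<^sub>R \<delta>) a else 0)"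
proof -
  define f where "f a = coef \<eta> (E \<delta> t a)" for a
  have d0: "\<delta> \<noteq> 0" using root_nonzero assms(1) by blast
  have *: "f a = (\<Sum>\<epsilon>\<in>\<Phi>. coef \<epsilon> a * f (X \<epsilon>)) + f (cpart a)"
    by (rule linear_ext) (use assms in \<open>auto simp: f_def E_add E_smul E_LL\<close>)
  have "\<eta> \<noteq> 0 + real k *\<^sub>R \<delta>" for k
  proof -
    consider "k = 0" | "k = 1" | "k = 2" | "k \<ge> 3" by linarith
    then show ?thesis
      by cases (use assms root_nonzero[OF assms(2)] root_nonzero[OF assms(3)] in auto)
  qed
  then have cp: "f (cpart a) = 0"
    unfolding f_def by (intro coef_E_0[OF assms(1) T_W[OF cpart_T[OF assms(5)]] assms(2)]) auto
  have f0: "f (X \<eta>) = 1"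
    using coef_E[OF assms(1) X_W[OF assms(2)], of 0 t] assms(2) by (simp add: f_def)
  have f1: "f (X (\<eta> - \<delta>)) = t * of_int (N \<delta> (\<eta> - \<delta>))"
    using coef_E[OF assms(1) X_W[OF assms(3)], of 1 t] assms(1-3) N(2)[OF assms(1,3)] by (simp add: f_def)
  have f2: "f (X (\<eta> - 2 *\<^sub>R \<delta>)) = t ^ 2 * coef \<eta> (adp (X \<delta>) 2 (X (\<eta> - 2 *\<^sub>R \<delta>)))" if "\<eta> - 2 *\<^sub>R \<delta> \<in> \<Phi>"
    using coef_E[OF assms(1) X_W[OF that], of 2 t] assms(2) by (simp add: f_def)
  have fo: "f (X \<epsilon>) = 0" if "\<epsilon> \<in> \<Phi>" "\<epsilon> \<notin> {\<eta>, \<eta> - \<delta>, \<eta> - 2 *\<^sub>R \<delta>}" for \<epsilon>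
    unfolding f_def
  proof (rule coef_E_0[OF assms(1) X_W[OF that(1)] assms(2)])
    fix k :: nat
    show "\<eta> \<noteq> \<epsilon> + real k *\<^sub>R \<delta>"
    proof
      assume e: "\<eta> = \<epsilon> + real k *\<^sub>R \<delta>"
      then have e': "\<epsilon> = \<eta> - real k *\<^sub>R \<delta>" by simp
      consider "k = 0" | "k = 1" | "k = 2" | "k \<ge> 3" by linarith
      then show False by cases (use that e' assms(6)[of k] in auto)
    qed
  qed
  have dist: "\<eta> \<noteq> \<eta> - \<delta>" "\<eta> \<noteq> \<eta> - 2 *\<^sub>R \<delta>" "\<eta> - \<delta> \<noteq> \<eta> - 2 *\<^sub>R \<delta>" 
    using d0 scaleR_cancel_right[of 2 \<delta> 1] by auto
  have "(\<Sum>\<epsilon>\<in>\<Phi>. coef \<epsilon> a * f (X \<epsilon>)) = (\<Sum>\<epsilon>\<in>{\<eta>, \<eta> - \<delta>, \<eta> - 2 *\<^sub>R \<delta>} \<inter> \<Phi>. coef \<epsilon> a * f (X \<epsilon>))"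
    by (rule sum.mono_neutral_right) (use finite_roots fo in auto)
  also have "\<dots> = coef \<eta> a + coef (\<eta> - \<delta>) a * f (X (\<eta> - \<delta>))
      + (if \<eta> - 2 *\<^sub>R \<delta> \<in> \<Phi> then coef (\<eta> - 2 *\<^sub>R \<delta>) a * f (X (\<eta> - 2 *\<^sub>R \<delta>)) else 0)"
    using dist assms(2,3) by (auto simp: f0 Int_insert_left)
  finally show ?thesis
    using * cp f1 f2 by (simp add: f_def mult.commute mult.left_commute)
qed

end

section \<open>Integral functionals\<close>

definition intmat :: "'n::finite sqmat \<Rightarrow> bool" where
  "intmat A \<longleftrightarrow> (\<forall>i j. entry A i j \<in> \<int>)"

lemma intmat_simps [simp]:
  "intmat 0" "intmat 1" "intmat A \<Longrightarrow> intmat B \<Longrightarrow> intmat (A + B)" "intmat A \<Longrightarrow> intmat B \<Longrightarrow> intmat (A - B)"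
  "intmat A \<Longrightarrow> intmat (- A)" "intmat A \<Longrightarrow> intmat B \<Longrightarrow> intmat (A * B)"
  "c \<in> \<int> \<Longrightarrow> intmat A \<Longrightarrow> intmat (smul c A)"
  by (auto simp: intmat_def entry_mult)

lemma intmat_sum [simp]: "(\<And>x. x \<in> S \<Longrightarrow> intmat (F x)) \<Longrightarrow> intmat (sum F S)"
  by (induction S rule: infinite_finite_induct) auto

text \<open>Linearity is demanded on all matrices, not only on \<open>LL\<close>: such a functional
  is a combination of the matrix entries with integer coefficients, and hence can be specialized to
  any commutative ring.\<close>

definition intfun :: "('n::finite sqmat \<Rightarrow> complex) \<Rightarrow> bool" where
  "intfun f \<longleftrightarrow> (\<forall>A B. f (A + B) = f A + f B) \<and> (\<forall>c A. f (smul c A) = c * f A) \<and>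
     (\<forall>A. intmat A \<longrightarrow> f A \<in> \<int>)"

definition intop :: "('n::finite sqmat \<Rightarrow> 'n sqmat) \<Rightarrow> bool" where
  "intop F \<longleftrightarrow> (\<forall>A B. F (A + B) = F A + F B) \<and> (\<forall>c A. F (smul c A) = smul c (F A)) \<and>
     (\<forall>A. intmat A \<longrightarrow> intmat (F A))"

lemma intfun_D:
  assumes "intfun f"
  shows "f (A + B) = f A + f B" "f (smul c A) = c * f A" "intmat A \<Longrightarrow> f A \<in> \<int>"
    "f 0 = 0" "f (- A) = - f A" "f (A - B) = f A - f B"
proof -
  show 1: "f (A + B) = f A + f B" "f (smul c A) = c * f A" "intmat A \<Longrightarrow> f A \<in> \<int>" for A B c
    using assms by (auto simp: intfun_def)
  show "f 0 = 0" using 1(2)[of 0 0] by simp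
  show 2: "f (- A) = - f A" for A using 1(2)[of "-1" A] by simp
  show "f (A - B) = f A - f B" using 1(1)[of A "- B"] 2 by simp
qed

lemma intfun_sum: "intfun f \<Longrightarrow> f (sum F S) = (\<Sum>x\<in>S. f (F x))"
  by (induction S rule: infinite_finite_induct) (auto simp: intfun_D)

lemma intfun_intop: "intfun f \<Longrightarrow> intop F \<Longrightarrow> intfun (\<lambda>A. f (F A))"
  by (auto simp: intfun_def intop_def)

lemma intfun_smul: "intfun f \<Longrightarrow> c \<in> \<int> \<Longrightarrow> intfun (\<lambda>A. c * f A)"
  by (auto simp: intfun_def algebra_simps)

lemma intfun_add: "intfun f \<Longrightarrow> intfun g \<Longrightarrow> intfun (\<lambda>A. f A + g A)"
  by (auto simp: intfun_def algebra_simps)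

lemma intfun_entry: "intfun (\<lambda>A. entry A i j)"
  by (auto simp: intfun_def intmat_def)

lemma intop_diff: "intop F \<Longrightarrow> intop G \<Longrightarrow> intop (\<lambda>A. F A - G A)"
  by (auto simp: intop_def algebra_simps sqm.scale_right_diff_distrib)

lemma intop_sum: "(\<And>x. x \<in> S \<Longrightarrow> intop (F x)) \<Longrightarrow> intop (\<lambda>A. \<Sum>x\<in>S. F x A)"
  by (induction S rule: infinite_finite_induct) (auto simp: intop_def sqm.scale_right_distrib)

lemma intop_rank1: "intfun f \<Longrightarrow> intmat B \<Longrightarrow> intop (\<lambda>A. smul (f A) B)"
  by (auto simp: intop_def intfun_def sqm.scale_left_distrib)

lemma intop_comp: "intop F \<Longrightarrow> intop G \<Longrightarrow> intop (\<lambda>A. F (G A))"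
  by (auto simp: intop_def)

lemma intop_mult: "intmat P \<Longrightarrow> intmat Q \<Longrightarrow> intop (\<lambda>A. P * A * Q)"
  by (auto simp: intop_def algebra_simps)

text \<open>The values at \<open>B\<close> of the integral functionals form an ideal of \<open>\<int>\<close>, and its generator divides
  every entry of \<open>B\<close>.\<close>

lemma content_functional:
  fixes B :: "'n::finite sqmat"
  assumes "intmat B" "B \<noteq> 0"
  obtains g :: nat and A f where "g > 0" "intmat A" "B = smul (of_nat g) A" "intfun f" "f A = 1"
proof -
  define I where "I = {z::int. \<exists>f. intfun f \<and> f B = of_int z}"
  have entryI: "\<exists>z\<in>I. entry B i j = of_int z" for i j
  proof -
    obtain z where "entry B i j = of_int z" using assms(1) unfolding intmat_def by (meson Ints_cases)
    then show ?thesis unfolding I_def using intfun_entry by blast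
  qed
  have Imult: "c * z \<in> I" if "z \<in> I" for c z
  proof -
    from that obtain f where "intfun f" "f B = of_int z" by (auto simp: I_def)
    then have "intfun (\<lambda>A. of_int c * f A)" "of_int c * f B = of_int (c * z)"
      by (auto intro: intfun_smul)
    then show ?thesis unfolding I_def by blast
  qed
  have Iadd: "y + z \<in> I" if "y \<in> I" "z \<in> I" for y z
  proof -
    from that obtain f f' where "intfun f" "f B = of_int y" "intfun f'" "f' B = of_int z"
      by (auto simp: I_def)
    then have "intfun (\<lambda>A. f A + f' A)" "f B + f' B = of_int (y + z)"
      by (auto intro: intfun_add)
    then show ?thesis unfolding I_def by blast
  qed
  obtain i j where ij: "entry B i j \<noteq> 0" using assms(2) by (metis entry_simps(1) sqmat_eqI)
  then obtain z where z: "z \<in> I" "z \<noteq> 0" using entryI[of i j] by auto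
  have "\<exists>n::nat. n > 0 \<and> int n \<in> I"
  proof (cases "z > 0")
    case True then show ?thesis using z by (intro exI[of _ "nat z"]) auto
  next
    case False then show ?thesis using z Imult[of z "-1"] by (intro exI[of _ "nat (- z)"]) auto
  qed
  define g where "g = (LEAST n::nat. n > 0 \<and> int n \<in> I)"
  have g: "g > 0" "int g \<in> I"
    using LeastI_ex[OF \<open>\<exists>n::nat. n > 0 \<and> int n \<in> I\<close>] by (auto simp: g_def)
  have dvd: "int g dvd y" if "y \<in> I" for y
  proof -
    have eq: "y mod int g = y + (- (y div int g)) * int g" using div_mult_mod_eq[of y "int g"] by (simp add: algebra_simps)
    have m: "y mod int g \<in> I" unfolding eq by (rule Iadd[OF that Imult[OF g(2)]])
    show ?thesis
    proof (rule ccontr)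
      assume "\<not> int g dvd y"
      then have "y mod int g \<noteq> 0" by (simp add: dvd_eq_mod_eq_0)
      moreover have "y mod int g \<ge> 0" using g(1) by simp
      ultimately have "y mod int g > 0" by linarith
      then have "0 < nat (y mod int g) \<and> int (nat (y mod int g)) \<in> I" using m by simp
      then have "g \<le> nat (y mod int g)" unfolding g_def by (rule Least_le)
      then show False using pos_mod_bound[of "int g" y] g(1) by linarith
    qed
  qed
  define A where "A = smul (1 / of_nat g) B"
  have BA: "B = smul (of_nat g) A" using g(1) by (simp add: A_def)
  have A: "intmat A"
    unfolding intmat_def
  proof (intro allI)
    fix i j
    obtain z where z: "z \<in> I" "entry B i j = of_int z" using entryI by blast
    from dvd[OF z(1)] obtain w where "z = int g * w" by (auto elim: dvdE)
    then show "entry A i j \<in> \<int>" using z(2) g(1) by (simp add: A_def)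
  qed
  obtain f where f: "intfun f" "f B = of_nat g" using g(2) by (auto simp: I_def)
  then have "f A = 1" using g(1) by (simp add: A_def intfun_D)
  with g(1) A BA f(1) that show ?thesis by blast
qed

context chevalley
begin

section \<open>Integrality of root vectors and of the operators built from them\<close>

lemma int_X [simp]: "\<alpha> \<in> \<Phi> \<Longrightarrow> intmat (X \<alpha>)"
  using X_int[of \<alpha> 1] by (simp add: intmat_def dpow_def)

lemma int_dpow [simp]: "\<alpha> \<in> \<Phi> \<Longrightarrow> intmat (dpow (X \<alpha>) k)"
  using X_int[of \<alpha> k] by (simp add: intmat_def)

lemma int_ex [simp]: "\<alpha> \<in> \<Phi> \<Longrightarrow> t \<in> \<int> \<Longrightarrow> intmat (ex \<alpha> t)"
  unfolding ex_def mexp_def dpow_smul by simp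

lemma int_comm [simp]: "intmat A \<Longrightarrow> intmat B \<Longrightarrow> intmat (comm A B)"
  by (simp add: comm_def)

lemma intop_comm: "intmat A \<Longrightarrow> intop (comm A)"
  by (auto simp: intop_def comm_simps)

lemma intop_adp: assumes "\<alpha> \<in> \<Phi>" shows "intop (adp (X \<alpha>) k)"
proof -
  have "intop (\<lambda>a. \<Sum>i\<le>k. dpow (X \<alpha>) i * a * smul ((-1) ^ (k - i)) (dpow (X \<alpha>) (k - i)))"
    by (intro intop_sum intop_mult) (auto simp: assms)
  moreover have "adp (X \<alpha>) k = (\<lambda>a. \<Sum>i\<le>k. dpow (X \<alpha>) i * a * smul ((-1) ^ (k - i)) (dpow (X \<alpha>) (k - i)))"
    using dpow_smul[of "-1" "X \<alpha>"] by (simp add: fun_eq_iff adp_dpow)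
  ultimately show ?thesis by simp
qed

lemma intop_E: assumes "\<alpha> \<in> \<Phi>" "t \<in> \<int>" shows "intop (E \<alpha> t)"
proof -
  have "intop (\<lambda>a. ex \<alpha> t * a * ex \<alpha> (- t))" by (rule intop_mult) (use assms in auto)
  then show ?thesis by (simp add: E_def[abs_def])
qed

definition Hc :: "'e \<Rightarrow> 'n sqmat" where "Hc \<delta> = comm (X \<delta>) (X (- \<delta>))"

lemma Hc_T [simp]: "\<delta> \<in> \<Phi> \<Longrightarrow> Hc \<delta> \<in> T"
  by (simp add: Hc_def coroot_T)

lemma Hc_X: "\<delta> \<in> \<Phi> \<Longrightarrow> \<beta> \<in> \<Phi> \<Longrightarrow> comm (Hc \<delta>) (X \<beta>) = smul (of_real (\<beta> \<bullet> coroot \<delta>)) (X \<beta>)"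
  by (simp add: Hc_def coroot_X)

lemma X_Hc: "\<delta> \<in> \<Phi> \<Longrightarrow> \<beta> \<in> \<Phi> \<Longrightarrow> comm (X \<beta>) (Hc \<delta>) = - smul (of_real (\<beta> \<bullet> coroot \<delta>)) (X \<beta>)"
  by (subst comm_swap) (simp add: Hc_X)

lemma int_Hc [simp]: "\<delta> \<in> \<Phi> \<Longrightarrow> intmat (Hc \<delta>)"
  by (simp add: Hc_def)

lemma adp_2: "adp A 2 B = smul (1/2) (comm A (comm A B))"
  using adp_Suc[of A 1 B] by (simp add: numeral_2_eq_2)

lemma adp_2_neg: "\<delta> \<in> \<Phi> \<Longrightarrow> adp (X \<delta>) 2 (X (- \<delta>)) = - X \<delta>"
  using X_Hc[of \<delta> \<delta>] by (simp add: adp_2 Hc_def[symmetric] coroot_self)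

lemma adp_2_neg': "\<delta> \<in> \<Phi> \<Longrightarrow> adp (X (- \<delta>)) 2 (X \<delta>) = - X (- \<delta>)"
  using adp_2_neg[of "- \<delta>"] by simp

lemma intop_smul: "intop F \<Longrightarrow> F (smul c A) = smul c (F A)"
  by (simp add: intop_def)

lemma intop_int: "intop F \<Longrightarrow> intmat A \<Longrightarrow> intmat (F A)"
  by (simp add: intop_def)

end

locale chevalley_graded = chevalley \<Phi> X T + graded_root_sys \<Phi> \<theta>
  for \<Phi> :: "'e::euclidean_space set" and X :: "'e \<Rightarrow> 'n::finite sqmat" and T \<theta> +
  assumes indecomposable: "indecomposable \<Phi>" and rank: "root_rank \<Phi> > 1"
begin

lemma adjacent: "long \<delta> \<Longrightarrow> \<exists>\<beta>\<in>\<Phi>. \<beta> \<bullet> coroot \<delta> = 1"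
  by (rule long_adjacent[OF indecomposable rank])

lemma L1_nonempty: "L1 \<noteq> {}"
  using adjacent[OF long_theta] by (auto simp: L1_def deg_def)

text \<open>If g divides \<open>X \<delta>\<close>, it divides \<open>X (- \<delta>)\<close> by
  \<open>adp_2_neg'\<close>, so \<open>Hc \<delta>\<close> is g^2 times an integral B. A root
  \<beta> with Cartan integer 1 satisfies [Hc \<delta>, X \<beta>] = X \<beta>; iterating this,
  \<open>X \<beta>\<close> is divisible by every power of g, and g must be 1.\<close>

lemma long_primitive:
  assumes "long \<delta>" shows "\<exists>f. intfun f \<and> f (X \<delta>) = 1"
proof -
  have d: "\<delta> \<in> \<Phi>" using assms by (rule long_root)
  obtain g A f where g: "g > 0" "intmat A" "X \<delta> = smul (of_nat g) A" "intfun f" "f A = 1"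
    using content_functional[OF int_X[OF d] X_nonzero[OF d]] .
  define A' where "A' = - adp (X (- \<delta>)) 2 A"
  have A': "intmat A'" unfolding A'_def using intop_int[OF intop_adp g(2)] d by simp
  have X': "X (- \<delta>) = smul (of_nat g) A'"
    using adp_2_neg'[OF d] unfolding g(3) A'_def intop_smul[OF intop_adp[OF neg_root[OF d]]]
    by simp
  obtain \<beta> where b: "\<beta> \<in> \<Phi>" "\<beta> \<bullet> coroot \<delta> = 1" using adjacent[OF assms] by blast
  define B where "B = comm A A'"
  have B: "intmat B" using g A' by (simp add: B_def)
  have Xb: "X \<beta> = smul ((of_nat g)\<^sup>2) (comm B (X \<beta>))"
    using Hc_X[OF d b(1)] unfolding Hc_def g(3) X' b(2) B_def by (simp add: comm_simps power2_eq_square)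
  have Xk: "X \<beta> = smul ((of_nat g) ^ (2 * k)) ((comm B ^^ k) (X \<beta>))" for k
  proof (induction k)
    case (Suc k)
    then have "comm B (X \<beta>) = smul ((of_nat g) ^ (2 * k)) (comm B ((comm B ^^ k) (X \<beta>)))"
      by (metis comm_simps(8))
    with Xb have "X \<beta> = smul ((of_nat g)\<^sup>2) (smul ((of_nat g) ^ (2 * k)) (comm B ((comm B ^^ k) (X \<beta>))))"
      by simp
    also have "\<dots> = smul ((of_nat g)\<^sup>2 * (of_nat g) ^ (2 * k)) (comm B ((comm B ^^ k) (X \<beta>)))"
      by simp
    also have "(of_nat g :: complex)\<^sup>2 * (of_nat g) ^ (2 * k) = (of_nat g) ^ (2 * Suc k)"
      by (simp add: power2_eq_square)
    finally show ?case by simp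
  qed simp
  have int: "intmat ((comm B ^^ k) (X \<beta>))" for k
    by (induction k) (auto simp: B b)
  have "g = 1"
  proof (rule ccontr)
    assume "g \<noteq> 1"
    with g(1) have g2: "g \<ge> 2" by linarith
    obtain i j where ij: "entry (X \<beta>) i j \<noteq> 0" using X_nonzero[OF b(1)] by (metis entry_simps(1) sqmat_eqI)
    obtain z :: int where z: "entry (X \<beta>) i j = of_int z" using int_X[OF b(1)] unfolding intmat_def by (meson Ints_cases)
    \<comment> \<open>Any k with g^(2k) > |z| gives the contradiction, and |z| is large enough
      because g \<ge> 2.\<close>
    define k where "k = nat \<bar>z\<bar>"
    obtain w :: int where w: "entry ((comm B ^^ k) (X \<beta>)) i j = of_int w"
      using int[of k] unfolding intmat_def by (meson Ints_cases)
    have "(of_int z :: complex) = of_int (int g ^ (2 * k) * w)"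
      using z w Xk[of k] by (metis entry_simps(6) of_int_mult of_int_of_nat_eq of_int_power)
    then have zw: "z = int g ^ (2 * k) * w" by (simp only: of_int_eq_iff)
    then have "w \<noteq> 0" using z ij by auto
    have "\<bar>z\<bar> = int g ^ (2 * k) * \<bar>w\<bar>" using zw by (simp add: abs_mult)
    also have "\<dots> \<ge> int g ^ (2 * k) * 1" using \<open>w \<noteq> 0\<close> by (intro mult_left_mono) auto
    finally have "\<bar>z\<bar> \<ge> int g ^ (2 * k)" by simp
    moreover have "int k < int g ^ (2 * k)"
    proof -
      have "k < 2 ^ k" by simp
      also have "\<dots> \<le> g ^ k" using g2 by (rule power_mono) simp
      also have "\<dots> \<le> g ^ (2 * k)" using g2 by (intro power_increasing) auto
      finally show ?thesis by (metis of_nat_less_iff of_nat_power)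
    qed
    ultimately show False by (simp add: k_def)
  qed
  then show ?thesis using g by auto
qed

text \<open>Cartan integers with the long root \<delta> are at most 1 except for \<delta> itself, so
  subtracting \<open>2 *\<^sub>R \<delta>\<close> leaves the weights except from \<delta>. The
  integral operator on the left therefore isolates one coordinate.\<close>

lemma adp_2_long:
  assumes "long \<delta>" "a \<in> LL"
  shows "adp (X (- \<delta>)) 2 a = smul (coef \<delta> a) (- X (- \<delta>))"
proof -
  have d: "\<delta> \<in> \<Phi>" "- \<delta> \<in> \<Phi>" using assms by (auto simp: long_root)
  show ?thesis
  proof (rule linear_ext_eq[OF _ _ _ _ _ _ assms(2), where F = "adp (X (- \<delta>)) 2"])
    show "adp (X (- \<delta>)) 2 (X \<epsilon>) = smul (coef \<delta> (X \<epsilon>)) (- X (- \<delta>))" if e: "\<epsilon> \<in> \<Phi>" for \<epsilon>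
    proof (cases "\<epsilon> = \<delta>")
      case True then show ?thesis using d adp_2_neg' by simp
    next
      case False
      have "\<epsilon> + real 2 *\<^sub>R (- \<delta>) \<notin> \<Phi> \<and> \<epsilon> + real 2 *\<^sub>R (- \<delta>) \<noteq> 0"
      proof (rule ccontr)
        define \<gamma> where "\<gamma> = \<epsilon> + real 2 *\<^sub>R (- \<delta>)"
        assume "\<not> ?thesis"
        then have g: "\<gamma> \<in> \<Phi> \<or> \<gamma> = 0" by (auto simp: \<gamma>_def)
        have "\<gamma> \<bullet> coroot \<delta> = \<epsilon> \<bullet> coroot \<delta> - 4"
          using coroot_self[OF d(1)] by (simp add: \<gamma>_def inner_diff_left)
        moreover have "\<epsilon> \<bullet> coroot \<delta> \<le> 1"
          using long_cartan[OF assms(1) e False] coroot_self[OF d(1)] by (cases "\<epsilon> = - \<delta>") auto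
        moreover have "\<gamma> \<bullet> coroot \<delta> \<ge> -2"
          using g long_cartan[OF assms(1), of \<gamma>] coroot_self[OF d(1)]
          by (cases "\<gamma> = \<delta>"; cases "\<gamma> = - \<delta>") auto
        ultimately show False by simp
      qed
      then have "adp (X (- \<delta>)) 2 (X \<epsilon>) = 0"
        using W_trivial[OF adp_W[OF d(2) X_W[OF e], of 2]] by blast
      then show ?thesis using False e d by simp
    qed
    show "adp (X (- \<delta>)) 2 H = smul (coef \<delta> H) (- X (- \<delta>))" if "H \<in> T" for H
    proof -
      have "adp (X (- \<delta>)) 2 H = 0"
      proof (rule W_trivial[OF adp_W[OF d(2) T_W[OF that], of 2]])
        show "0 + real 2 *\<^sub>R - \<delta> \<notin> \<Phi>" using multiple_root[OF d(2), of 2] by auto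
        show "0 + real 2 *\<^sub>R - \<delta> \<noteq> 0" using root_nonzero[OF d(1)] by simp
      qed
      then show ?thesis using that d by simp
    qed
  qed (use intop_adp[OF d(2)] d in \<open>auto simp: intop_def sqm.scale_left_distrib sqm.scale_left_diff_distrib\<close>)
qed

text \<open>Composition of the operator of \<open>adp_2_long\<close> with a functional that is 1 on
  \<open>X (- \<delta>)\<close>.\<close>

lemma long_functional:
  assumes "long \<delta>" shows "\<exists>f. intfun f \<and> (\<forall>a\<in>LL. f a = coef \<delta> a)"
proof -
  have d: "\<delta> \<in> \<Phi>" "- \<delta> \<in> \<Phi>" using assms by (auto simp: long_root)
  obtain f where f: "intfun f" "f (X (- \<delta>)) = 1" using long_primitive[of "- \<delta>"] assms long_neg by blast
  note adp_2_long[OF assms]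
  then have "- f (adp (X (- \<delta>)) 2 a) = coef \<delta> a" if "a \<in> LL" for a
    using that f by (simp add: intfun_D)
  moreover have "intfun (\<lambda>a. -1 * f (adp (X (- \<delta>)) 2 a))"
    by (intro intfun_smul intfun_intop[OF f(1)] intop_adp d) auto
  ultimately show ?thesis by (intro exI[of _ "\<lambda>a. -1 * f (adp (X (- \<delta>)) 2 a)"]) auto
qed

lemma coef_comm:
  assumes "\<delta> \<in> \<Phi>" "\<eta> \<in> \<Phi>" "\<eta> \<noteq> \<delta>" "a \<in> LL"
  shows "coef \<eta> (comm (X \<delta>) a) = (if \<eta> - \<delta> \<in> \<Phi> then of_int (N \<delta> (\<eta> - \<delta>)) * coef (\<eta> - \<delta>) a else 0)"
proof -
  define f where "f a = coef \<eta> (comm (X \<delta>) a)" for a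
  have *: "f a = (\<Sum>\<epsilon>\<in>\<Phi>. coef \<epsilon> a * f (X \<epsilon>)) + f (cpart a)"
    by (rule linear_ext) (use assms in \<open>auto simp: f_def comm_simps comm_LL\<close>)
  have "f (cpart a) = 0" unfolding f_def
    by (rule coef_W[OF comm_W[OF assms(1) T_W[OF cpart_T[OF assms(4)]]] assms(2)]) (use assms in simp)
  moreover have "f (X \<epsilon>) = 0" if "\<epsilon> \<in> \<Phi>" "\<epsilon> \<noteq> \<eta> - \<delta>" for \<epsilon>
    unfolding f_def by (rule coef_W[OF comm_W[OF assms(1) X_W[OF that(1)]] assms(2)]) (use that in auto)
  ultimately have "f a = (\<Sum>\<epsilon>\<in>\<Phi>. if \<epsilon> = \<eta> - \<delta> then coef (\<eta> - \<delta>) a * f (X (\<eta> - \<delta>)) else 0)"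
    using * by (auto intro!: sum.cong)
  also have "\<dots> = (if \<eta> - \<delta> \<in> \<Phi> then coef (\<eta> - \<delta>) a * f (X (\<eta> - \<delta>)) else 0)"
    using finite_roots by simp
  also have "\<dots> = (if \<eta> - \<delta> \<in> \<Phi> then of_int (N \<delta> (\<eta> - \<delta>)) * coef (\<eta> - \<delta>) a else 0)"
    using N(2)[OF assms(1), of "\<eta> - \<delta>"] assms(2) by (simp add: f_def)
  finally show ?thesis by (simp add: f_def)
qed

lemma abs_1: "\<bar>x\<bar> = 1 \<Longrightarrow> x = 1 \<or> x = (-1::int)" by auto

lemma N_theta: "\<gamma> \<in> \<Phi> \<Longrightarrow> deg \<gamma> = -1 \<Longrightarrow> \<bar>N \<theta> \<gamma>\<bar> = 1"
  using N(1)[of \<theta> \<gamma>] theta_root deg_m1_plus_theta[of \<gamma>] string_theta[of \<gamma>] by (simp add: L1_def add.commute)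

lemma N_mtheta: assumes "\<beta> \<in> L1" shows "\<bar>N (- \<theta>) \<beta>\<bar> = 1"
proof -
  have "string_len (- \<theta>) \<beta> = 0"
  proof (rule string_lenI)
    fix p assume "\<beta> - real p *\<^sub>R - \<theta> \<in> \<Phi>"
    from deg_bounds[OF this] L1_deg[OF assms] show "p \<le> 0" by simp
  qed (use L1_root[OF assms] in simp)
  then show ?thesis using N(1)[of "- \<theta>" \<beta>] theta_root L1_root[OF assms] L1_minus_theta[OF assms] by simp
qed

lemma N_L1_mtheta: "\<beta> \<in> L1 \<Longrightarrow> \<bar>N \<beta> (- \<theta>)\<bar> = 1"
  using N(1)[of \<beta> "- \<theta>"] theta_root L1_minus_theta[of \<beta>] L1_root[of \<beta>] string_L1_mtheta[of \<beta>] by simp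

lemma N_compl: "\<beta> \<in> L1 \<Longrightarrow> \<bar>N \<beta> (\<theta> - \<beta>)\<bar> = int (mlt \<beta>)"
  using N(1)[of \<beta> "\<theta> - \<beta>"] theta_root L1_root[of \<beta>] L1_root[OF L1_compl[of \<beta>]] string_compl[of \<beta>] mult_cartan[of \<beta>]
  by auto

lemma N_delta_L1: "\<beta> \<in> L1 \<Longrightarrow> mlt \<beta> \<ge> 2 \<Longrightarrow> \<bar>N (\<theta> - 2 *\<^sub>R \<beta>) \<beta>\<bar> = int (mlt \<beta>) - 1"
proof -
  assume b: "\<beta> \<in> L1" "mlt \<beta> \<ge> 2"
  have "\<theta> - 2 *\<^sub>R \<beta> + \<beta> = \<theta> - \<beta>" by (simp add: scaleR_2)
  then have "\<theta> - 2 *\<^sub>R \<beta> + \<beta> \<in> \<Phi>" using L1_root[OF L1_compl[OF b(1)]] by (simp only:)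
  from N(1)[OF theta_minus_2[OF b] L1_root[OF b(1)] this] show ?thesis
    using string_delta_L1[OF b] b by simp
qed

lemma N_delta_Lm1: "\<beta> \<in> L1 \<Longrightarrow> mlt \<beta> \<ge> 2 \<Longrightarrow> \<bar>N (\<theta> - 2 *\<^sub>R \<beta>) (\<beta> - \<theta>)\<bar> = int (mlt \<beta>) - 1"
proof -
  assume b: "\<beta> \<in> L1" "mlt \<beta> \<ge> 2"
  have "\<theta> - 2 *\<^sub>R \<beta> + (\<beta> - \<theta>) = - \<beta>" by (simp add: scaleR_2)
  then have "\<theta> - 2 *\<^sub>R \<beta> + (\<beta> - \<theta>) \<in> \<Phi>" using neg_root[OF L1_root[OF b(1)]] by (simp only:)
  from N(1)[OF theta_minus_2[OF b] L1_minus_theta[OF b(1)] this] show ?thesis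
    using string_delta_Lm1[OF b] b by simp
qed

text \<open>For short \<beta>, divisibility by g spreads from \<open>- \<beta>\<close> through
  \<beta> and \<open>\<beta> - \<theta>\<close> to \<open>\<theta> - \<beta>\<close>. Hence g^2
  divides the commutator of \<open>X \<beta>\<close> and \<open>X (\<theta> - \<beta>)\<close>,
  which up to sign is \<open>mlt \<beta>\<close> times the primitive \<open>X \<theta>\<close>. As
  \<open>mlt \<beta>\<close> is at most 3, g = 1.\<close>

lemma L1_primitive:
  assumes "\<beta> \<in> L1" shows "\<exists>f. intfun f \<and> f (X (- \<beta>)) = 1"
proof (cases "mlt \<beta> = 1")
  case True
  then show ?thesis using long_primitive[of "- \<beta>"] mult_1_long[OF assms] long_neg by blast
next
  case False
  have m: "mlt \<beta> = 2 \<or> mlt \<beta> = 3" using False mult_cartan[OF assms] by auto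
  have b: "\<beta> \<in> \<Phi>" "- \<beta> \<in> \<Phi>" using L1_root[OF assms] by auto
  have b': "\<theta> - \<beta> \<in> \<Phi>" "\<beta> - \<theta> \<in> \<Phi>" "- \<theta> \<in> \<Phi>"
    using L1_root[OF L1_compl[OF assms]] L1_minus_theta[OF assms] theta_root by auto
  obtain g A f where g: "g > 0" "intmat A" "X (- \<beta>) = smul (of_nat g) A" "intfun f" "f A = 1"
    using content_functional[OF int_X[OF b(2)] X_nonzero[OF b(2)]] .
  define D where "D B \<longleftrightarrow> (\<exists>C. intmat C \<and> B = smul (of_nat g) C)" for B :: "'n sqmat"
  have D_op: "D (F B)" if "intop F" "D B" for F B
    using that unfolding D_def by (metis intop_smul intop_int)
  have D_neg: "D B" if "D (- B)" for B
  proof -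
    from that obtain C where "intmat C" "- B = smul (of_nat g) C" by (auto simp: D_def)
    then have "intmat (- C)" "- (- B) = smul (of_nat g) (- C)" by simp_all
    then have "intmat (- C)" "B = smul (of_nat g) (- C)" unfolding minus_minus by auto
    then show ?thesis unfolding D_def by blast
  qed
  have D_sign: "D B" if "\<bar>c\<bar> = 1" "D (smul (of_int c) B)" for c :: int and B
    using abs_1[OF that(1)] that(2) D_neg by auto
  have 0: "D (X (- \<beta>))" using g by (auto simp: D_def)
  have 1: "D (X \<beta>)" using D_neg D_op[OF intop_adp[OF b(1), of 2] 0] adp_2_neg[OF b(1)] by simp
  have "comm (X (- \<theta>)) (X \<beta>) = smul (of_int (N (- \<theta>) \<beta>)) (X (\<beta> - \<theta>))"
    using N(2)[OF b'(3) b(1)] b' by simp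
  then have 2: "D (X (\<beta> - \<theta>))"
    using D_sign[OF N_mtheta[OF assms]] D_op[OF intop_comm[OF int_X[OF b'(3)]] 1] by simp
  have 3: "D (X (\<theta> - \<beta>))" using D_neg D_op[OF intop_adp[OF b'(1), of 2] 2] adp_2_neg[OF b'(1)] by simp
  obtain C C' where C: "intmat C" "intmat C'" "X \<beta> = smul (of_nat g) C" "X (\<theta> - \<beta>) = smul (of_nat g) C'"
    using 1 3 by (auto simp: D_def)
  have Nt: "smul (of_int (N \<beta> (\<theta> - \<beta>))) (X \<theta>) = smul (of_nat g * of_nat g) (comm C C')"
    using N(2)[OF b(1) b'(1)] theta_root C by (simp add: comm_simps)
  obtain h where h: "intfun h" "h (X \<theta>) = 1" using long_primitive[OF long_theta] by blast
  obtain z where z: "h (comm C C') = of_int z" using intfun_D(3)[OF h(1) int_comm[OF C(1,2)]] by (meson Ints_cases)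
  have "(of_int (N \<beta> (\<theta> - \<beta>)) :: complex) = of_int (int g * int g * z)"
    using arg_cong[OF Nt, of h] h z by (simp add: intfun_D)
  then have e: "N \<beta> (\<theta> - \<beta>) = int g * int g * z" by (simp only: of_int_eq_iff)
  have "int g * int g dvd int (mlt \<beta>)" using N_compl[OF assms] e by (metis dvd_abs_iff dvd_triv_left)
  then have dv: "g * g dvd mlt \<beta>" by (metis of_nat_dvd_iff of_nat_mult)
  have "mlt \<beta> > 0" using m by auto
  from dvd_imp_le[OF dv this] have le: "g * g \<le> 3" using m by auto
  have "g < 2"
  proof (rule ccontr)
    assume "\<not> g < 2"
    then have "2 * 2 \<le> g * g" by (intro mult_mono) auto
    with le show False by simp
  qed
  then have "g = 1" using g(1) by simp
  then show ?thesis using g by auto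
qed

text \<open>ad \<open>X \<theta>\<close> raises degrees by 2, so degree 0 is reached from
  \<open>- \<theta>\<close> alone, and there only along \<open>Hc \<theta>\<close>. This is the list
  of terms that \<open>Lm1_functional\<close> has to filter.\<close>

lemma comm_theta:
  assumes "a \<in> LL"
  shows "comm (X \<theta>) a = smul (coef (- \<theta>) a) (Hc \<theta>)
    + (\<Sum>\<epsilon>\<in>insert \<theta> L1. smul (coef \<epsilon> (comm (X \<theta>) a)) (X \<epsilon>))"
proof -
  have t: "\<theta> \<in> \<Phi>" "- \<theta> \<in> \<Phi>" using theta_root by auto
  have fin: "finite (insert \<theta> L1)" using finite_L1 by simp
  have sub: "insert \<theta> L1 \<subseteq> \<Phi>" using t L1_root by auto
  have single: "(\<Sum>\<epsilon>\<in>insert \<theta> L1. smul (coef \<epsilon> b) (X \<epsilon>)) = b" if "b \<in> W \<mu>" "\<mu> \<in> insert \<theta> L1" for b \<mu>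
  proof -
    have m: "\<mu> \<in> \<Phi>" using that sub by blast
    have "(\<Sum>\<epsilon>\<in>insert \<theta> L1. smul (coef \<epsilon> b) (X \<epsilon>)) = (\<Sum>\<epsilon>\<in>insert \<theta> L1. if \<epsilon> = \<mu> then smul (coef \<mu> b) (X \<mu>) else 0)"
      using coef_W[OF that(1)] sub by (intro sum.cong) auto
    also have "\<dots> = smul (coef \<mu> b) (X \<mu>)" by (subst sum.delta[OF fin]) (use that in simp)
    finally show ?thesis using W_coef[OF that(1) m] by simp
  qed
  show ?thesis
  proof (rule linear_ext_eq[OF _ _ _ _ _ _ assms])
    show "comm (X \<theta>) (X \<epsilon>) = smul (coef (- \<theta>) (X \<epsilon>)) (Hc \<theta>)
        + (\<Sum>\<gamma>\<in>insert \<theta> L1. smul (coef \<gamma> (comm (X \<theta>) (X \<epsilon>))) (X \<gamma>))" if e: "\<epsilon> \<in> \<Phi>" for \<epsilon>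
    proof (cases "\<epsilon> = - \<theta>")
      case True
      have "(\<Sum>\<gamma>\<in>insert \<theta> L1. smul (coef \<gamma> (Hc \<theta>)) (X \<gamma>)) = 0"
        using sub t by (intro sum.neutral) auto
      then show ?thesis using True t by (simp add: Hc_def)
    next
      case False
      have w: "comm (X \<theta>) (X \<epsilon>) \<in> W (\<epsilon> + \<theta>)" using comm_W[OF t(1) X_W[OF e]] .
      show ?thesis
      proof (cases "\<epsilon> + \<theta> \<in> \<Phi>")
        case True
        have "\<epsilon> + \<theta> \<in> insert \<theta> L1"
          using deg_cases[OF True] deg_cases[OF e] False root_nonzero[OF e] root_nonzero[OF t(1)]
          by (auto simp: L1_def True dest: arg_cong[where f = deg])
        then show ?thesis using single[OF w] False e t by simp
      next
        case no: False
        have "\<epsilon> + \<theta> \<noteq> 0" using False by (simp add: eq_neg_iff_add_eq_0)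
        then have "comm (X \<theta>) (X \<epsilon>) = 0" using W_trivial[OF w no] by simp
        moreover have "(\<Sum>\<gamma>\<in>insert \<theta> L1. smul (coef \<gamma> 0) (X \<gamma>)) = 0"
          using sub by (intro sum.neutral) auto
        ultimately show ?thesis using False e t by simp
      qed
    qed
    show "comm (X \<theta>) H = smul (coef (- \<theta>) H) (Hc \<theta>)
        + (\<Sum>\<gamma>\<in>insert \<theta> L1. smul (coef \<gamma> (comm (X \<theta>) H)) (X \<gamma>))" if "H \<in> T" for H
      using single[of "comm (X \<theta>) H" \<theta>] comm_W[OF t(1) T_W[OF that]] that t by simp
  next
    fix a b c assume "a \<in> LL" "b \<in> LL"
    show "smul (coef (- \<theta>) (a + b)) (Hc \<theta>) + (\<Sum>\<epsilon>\<in>insert \<theta> L1. smul (coef \<epsilon> (comm (X \<theta>) (a + b))) (X \<epsilon>)) =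
       smul (coef (- \<theta>) a) (Hc \<theta>) + (\<Sum>\<epsilon>\<in>insert \<theta> L1. smul (coef \<epsilon> (comm (X \<theta>) a)) (X \<epsilon>)) +
       (smul (coef (- \<theta>) b) (Hc \<theta>) + (\<Sum>\<epsilon>\<in>insert \<theta> L1. smul (coef \<epsilon> (comm (X \<theta>) b)) (X \<epsilon>)))"
    proof -
      have "(\<Sum>\<epsilon>\<in>insert \<theta> L1. smul (coef \<epsilon> (comm (X \<theta>) (a + b))) (X \<epsilon>))
         = (\<Sum>\<epsilon>\<in>insert \<theta> L1. smul (coef \<epsilon> (comm (X \<theta>) a)) (X \<epsilon>) + smul (coef \<epsilon> (comm (X \<theta>) b)) (X \<epsilon>))"
        by (rule sum.cong) (use sub t \<open>a \<in> LL\<close> \<open>b \<in> LL\<close> in \<open>auto simp: comm_simps comm_LL sqm.scale_left_distrib\<close>)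
      then show ?thesis using \<open>a \<in> LL\<close> \<open>b \<in> LL\<close> t by (simp add: sum.distrib sqm.scale_left_distrib del: sum.insert)
    qed
  next
    fix a c assume "a \<in> LL"
    have "(\<Sum>\<epsilon>\<in>insert \<theta> L1. smul (coef \<epsilon> (comm (X \<theta>) (smul c a))) (X \<epsilon>))
         = smul c (\<Sum>\<epsilon>\<in>insert \<theta> L1. smul (coef \<epsilon> (comm (X \<theta>) a)) (X \<epsilon>))"
      unfolding sqm.scale_sum_right by (rule sum.cong) (use sub t \<open>a \<in> LL\<close> in \<open>auto simp: comm_simps comm_LL\<close>)
    then show "smul (coef (- \<theta>) (smul c a)) (Hc \<theta>) + (\<Sum>\<epsilon>\<in>insert \<theta> L1. smul (coef \<epsilon> (comm (X \<theta>) (smul c a))) (X \<epsilon>))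
       = smul c (smul (coef (- \<theta>) a) (Hc \<theta>) + (\<Sum>\<epsilon>\<in>insert \<theta> L1. smul (coef \<epsilon> (comm (X \<theta>) a)) (X \<epsilon>)))"
      using \<open>a \<in> LL\<close> t by (simp add: sqm.scale_right_distrib del: sum.insert)
  qed (simp_all add: comm_simps)
qed

lemma Lm1_functional:
  assumes "\<beta> \<in> L1" shows "\<exists>f. intfun f \<and> (\<forall>a\<in>LL. f a = coef (\<beta> - \<theta>) a)"
proof (cases "mlt \<beta> = 1")
  case True
  have "long (\<beta> - \<theta>)"
    using mult_1_long[OF L1_compl[OF assms]] mult_compl[OF assms] True long_neg[of "\<theta> - \<beta>"] by simp
  then show ?thesis by (rule long_functional)
next
  case False
  then have m: "mlt \<beta> \<ge> 2" using mult_cartan[OF assms] by auto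
  have b: "\<beta> \<in> \<Phi>" "- \<beta> \<in> \<Phi>" "\<beta> - \<theta> \<in> \<Phi>" "\<theta> \<in> \<Phi>" "- \<theta> \<in> \<Phi>"
    using L1_root[OF assms] L1_minus_theta[OF assms] theta_root by auto
  define F where "F \<eta> = (SOME f. intfun f \<and> (\<forall>a\<in>LL. f a = coef \<eta> a))" for \<eta>
  have F: "intfun (F \<eta>)" "a \<in> LL \<Longrightarrow> F \<eta> a = coef \<eta> a" if "long \<eta>" for \<eta> a
    using someI_ex[OF long_functional[OF that]] by (auto simp: F_def)
  define Lg where "Lg = insert \<theta> {\<epsilon> \<in> L1. mlt \<epsilon> = 1}"
  define Sh where "Sh = {\<epsilon> \<in> L1. mlt \<epsilon> \<noteq> 1}"
  have Lg: "long \<eta>" if "\<eta> \<in> Lg" for \<eta> using that long_theta mult_1_long by (auto simp: Lg_def)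
  have fin: "finite Lg" "finite Sh" using finite_L1 by (auto simp: Lg_def Sh_def)
  have un: "insert \<theta> L1 = Lg \<union> Sh" "Lg \<inter> Sh = {}" using L1_deg by (fastforce simp: Lg_def Sh_def)+
  have Sh: "\<epsilon> \<in> L1" "mlt \<epsilon> \<ge> 2" "\<epsilon> \<in> \<Phi>" if "\<epsilon> \<in> Sh" for \<epsilon>
    using that mult_cartan[of \<epsilon>] L1_root[of \<epsilon>] by (auto simp: Sh_def)
  have bSh: "\<beta> \<in> Sh" using assms False by (simp add: Sh_def)
  have Lr: "\<eta> \<in> \<Phi>" if "long \<eta>" for \<eta> using that by (rule long_root)
  define R where "R a = comm (X \<theta>) a - smul (F (- \<theta>) a) (Hc \<theta>)
      - (\<Sum>\<epsilon>\<in>Lg. smul (F \<epsilon> (comm (X \<theta>) a)) (X \<epsilon>))" for a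
  have R: "intop R"
    unfolding R_def
    by (intro intop_diff intop_comm intop_sum intop_rank1 F intfun_intop[OF F(1) intop_comm])
       (use b Lg Lr long_theta long_neg in auto)
  have R_eq: "R a = (\<Sum>\<epsilon>\<in>Sh. smul (coef \<epsilon> (comm (X \<theta>) a)) (X \<epsilon>))" if a: "a \<in> LL" for a
  proof -
    have "comm (X \<theta>) a = smul (coef (- \<theta>) a) (Hc \<theta>)
      + ((\<Sum>\<epsilon>\<in>Lg. smul (coef \<epsilon> (comm (X \<theta>) a)) (X \<epsilon>)) + (\<Sum>\<epsilon>\<in>Sh. smul (coef \<epsilon> (comm (X \<theta>) a)) (X \<epsilon>)))"
      using comm_theta[OF a] unfolding un(1) sum.union_disjoint[OF fin un(2)] .
    moreover have "(\<Sum>\<epsilon>\<in>Lg. smul (F \<epsilon> (comm (X \<theta>) a)) (X \<epsilon>)) = (\<Sum>\<epsilon>\<in>Lg. smul (coef \<epsilon> (comm (X \<theta>) a)) (X \<epsilon>))"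
      by (rule sum.cong) (use F(2)[OF Lg comm_LL[OF b(4) a]] in auto)
    moreover have "F (- \<theta>) a = coef (- \<theta>) a" using F(2) long_theta long_neg a by blast
    ultimately show ?thesis unfolding R_def by (metis (no_types, lifting) add_diff_cancel_left')
  qed
  define LG where "LG = {\<eta> \<in> \<Phi>. long \<eta>}"
  have finLG: "finite LG" using finite_roots by (simp add: LG_def)
  \<comment> \<open>V describes the span of the long root vectors: on it, subtracting the long
    coordinates leaves 0.\<close>
  define V where "V a \<longleftrightarrow> a \<in> LL \<and> a = (\<Sum>\<eta>\<in>LG. smul (coef \<eta> a) (X \<eta>))" for a
  have coefLG: "coef \<eta> (a + c) = coef \<eta> a + coef \<eta> c" "coef \<eta> (smul d a) = d * coef \<eta> a"
    if "\<eta> \<in> LG" "a \<in> LL" "c \<in> LL" for \<eta> a c d using that by (auto simp: LG_def)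
  have V_add: "V (a + c)" if "V a" "V c" for a c
  proof -
    have "(\<Sum>\<eta>\<in>LG. smul (coef \<eta> (a + c)) (X \<eta>)) = (\<Sum>\<eta>\<in>LG. smul (coef \<eta> a) (X \<eta>)) + (\<Sum>\<eta>\<in>LG. smul (coef \<eta> c) (X \<eta>))"
      unfolding sum.distrib[symmetric]
      by (rule sum.cong) (use that coefLG in \<open>auto simp: V_def sqm.scale_left_distrib\<close>)
    then show ?thesis using that by (auto simp: V_def)
  qed
  have V_smul: "V (smul d a)" if "V a" for d a
  proof -
    have "(\<Sum>\<eta>\<in>LG. smul (coef \<eta> (smul d a)) (X \<eta>)) = smul d (\<Sum>\<eta>\<in>LG. smul (coef \<eta> a) (X \<eta>))"
      unfolding sqm.scale_sum_right
      by (rule sum.cong) (use that coefLG in \<open>auto simp: V_def\<close>)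
    then show ?thesis using that by (auto simp: V_def)
  qed
  have V_0: "V 0" by (auto simp: V_def LG_def intro!: sum.neutral[symmetric])
  have V_W: "V a" if "a \<in> W \<eta>" "long \<eta>" for a \<eta>
  proof -
    have "(\<Sum>\<epsilon>\<in>LG. smul (coef \<epsilon> a) (X \<epsilon>)) = (\<Sum>\<epsilon>\<in>LG. if \<epsilon> = \<eta> then smul (coef \<eta> a) (X \<eta>) else 0)"
      using coef_W[OF that(1)] by (intro sum.cong) (auto simp: LG_def)
    also have "\<dots> = smul (coef \<eta> a) (X \<eta>)" by (subst sum.delta[OF finLG]) (use that Lr in \<open>simp add: LG_def\<close>)
    finally show ?thesis using W_coef[OF that(1) Lr[OF that(2)]] W_LL[OF that(1)] by (simp add: V_def)
  qed
  have V_sum: "V (sum f S)" if "\<And>x. x \<in> S \<Longrightarrow> V (f x)" for f and S :: "'e set"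
    using that by (induction S rule: infinite_finite_induct) (auto simp: V_0 V_add)
  define B where "B a = adp (X (- \<beta>)) 2 (R a)" for a
  have B: "intop B" unfolding B_def by (intro intop_comp[OF _ R] intop_adp b)
  have Vadp: "V (adp (X (- \<beta>)) 2 (X \<epsilon>))" if "\<epsilon> \<in> Sh - {\<beta>}" for \<epsilon>
  proof -
    have e: "\<epsilon> \<in> Sh" "\<epsilon> \<noteq> \<beta>" using that by auto
    have eq: "\<epsilon> + real 2 *\<^sub>R - \<beta> = \<epsilon> - 2 *\<^sub>R \<beta>" by simp
    have w: "adp (X (- \<beta>)) 2 (X \<epsilon>) \<in> W (\<epsilon> - 2 *\<^sub>R \<beta>)"
      using adp_W[OF b(2) X_W[OF Sh(3)[OF e(1)]], of 2] unfolding eq .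
    show ?thesis
    proof (cases "\<epsilon> - 2 *\<^sub>R \<beta> \<in> \<Phi>")
      case True
      show ?thesis by (rule V_W[OF w short_difference_long[OF Sh(1)[OF e(1)] assms Sh(2)[OF e(1)] m e(2) True]])
    next
      case no: False
      have "\<epsilon> - 2 *\<^sub>R \<beta> \<noteq> 0" using L1_deg[OF Sh(1)[OF e(1)]] L1_deg[OF assms] by (auto dest: arg_cong[where f = deg])
      then show ?thesis using W_trivial[OF w no] V_0 by simp
    qed
  qed
  define Q where "Q a = (\<Sum>\<epsilon>\<in>Sh - {\<beta>}. smul (coef \<epsilon> (comm (X \<theta>) a)) (adp (X (- \<beta>)) 2 (X \<epsilon>)))" for a
  have VQ: "V (Q a)" for a unfolding Q_def by (rule V_sum) (rule V_smul[OF Vadp])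
  have B_eq: "B a = smul (- coef \<beta> (comm (X \<theta>) a)) (X (- \<beta>)) + Q a" if a: "a \<in> LL" for a
  proof -
    have add: "adp (X (- \<beta>)) 2 (sum f S) = (\<Sum>x\<in>S. adp (X (- \<beta>)) 2 (f x))" for f and S :: "'e set"
      using intop_adp[OF b(2), of 2] intop_smul[OF intop_adp[OF b(2)], of 2 0 0]
      by (induction S rule: infinite_finite_induct) (auto simp: intop_def)
    have "B a = (\<Sum>\<epsilon>\<in>Sh. smul (coef \<epsilon> (comm (X \<theta>) a)) (adp (X (- \<beta>)) 2 (X \<epsilon>)))"
      by (simp add: B_def R_eq[OF a] add intop_smul[OF intop_adp[OF b(2)]])
    also have "\<dots> = smul (coef \<beta> (comm (X \<theta>) a)) (adp (X (- \<beta>)) 2 (X \<beta>)) + Q a"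
      unfolding Q_def by (rule sum.remove[OF fin(2) bSh])
    finally show ?thesis by (simp add: adp_2_neg'[OF b(1)])
  qed
  define B' where "B' a = B a - (\<Sum>\<eta>\<in>LG. smul (F \<eta> (B a)) (X \<eta>))" for a
  have B': "intop B'"
    unfolding B'_def
    by (intro intop_diff B intop_sum intop_rank1 intfun_intop[OF F(1) B]) (auto simp: LG_def)
  have nl: "\<not> long (- \<beta>)"
  proof
    assume "long (- \<beta>)"
    then have "\<theta> \<bullet> \<theta> \<le> \<beta> \<bullet> \<beta>" using b(4) by (auto simp: long_def)
    moreover have "2 * (\<beta> \<bullet> \<beta>) \<le> \<theta> \<bullet> \<theta>"
      using mult_norm[OF assms] m root_inner_pos[OF b(1)] mult_right_mono[of 2 "real (mlt \<beta>)" "\<beta> \<bullet> \<beta>"] by simp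
    ultimately show False using root_inner_pos[OF b(1)] by simp
  qed
  have B'_eq: "B' a = smul (- coef \<beta> (comm (X \<theta>) a)) (X (- \<beta>))" if a: "a \<in> LL" for a
  proof -
    have QL: "Q a \<in> LL" using VQ[of a] by (simp add: V_def)
    have BL: "B a \<in> LL" using B_eq[OF a] QL b by simp
    have "(\<Sum>\<eta>\<in>LG. smul (F \<eta> (B a)) (X \<eta>)) = (\<Sum>\<eta>\<in>LG. smul (coef \<eta> (Q a)) (X \<eta>))"
    proof (rule sum.cong[OF refl])
      fix \<eta> assume h: "\<eta> \<in> LG"
      then have "F \<eta> (B a) = coef \<eta> (B a)" using F BL by (simp add: LG_def)
      also have "\<dots> = coef \<eta> (Q a)"
        using h nl QL b unfolding B_eq[OF a] by (auto simp: LG_def simp del: sqm.scale_minus_left)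
      finally show "smul (F \<eta> (B a)) (X \<eta>) = smul (coef \<eta> (Q a)) (X \<eta>)" by simp
    qed
    also have "\<dots> = Q a" using VQ[of a] by (simp add: V_def)
    finally show ?thesis by (simp add: B'_def B_eq[OF a])
  qed
  obtain f where f: "intfun f" "f (X (- \<beta>)) = 1" using L1_primitive[OF assms] by blast
  define n where "n = N \<theta> (\<beta> - \<theta>)"
  have n: "n * n = 1" using N_theta[OF b(3)] L1_deg[OF assms] abs_1[of n] by (auto simp: n_def)
  have "of_int (- n) * f (B' a) = coef (\<beta> - \<theta>) a" if a: "a \<in> LL" for a
  proof -
    have "coef \<beta> (comm (X \<theta>) a) = of_int n * coef (\<beta> - \<theta>) a"
    proof -
      have "\<beta> \<noteq> \<theta>" using L1_deg[OF assms] by auto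
      from coef_comm[OF b(4,1) this a] b show ?thesis by (simp add: n_def)
    qed
    then have "of_int (- n) * f (B' a) = of_int (n * n) * coef (\<beta> - \<theta>) a"
      unfolding B'_eq[OF a] by (simp add: intfun_D[OF f(1)] f(2) del: sqm.scale_minus_left)
    then show ?thesis by (simp add: n)
  qed
  moreover have "intfun (\<lambda>a. of_int (- n) * f (B' a))"
    by (intro intfun_smul intfun_intop[OF f(1) B']) auto
  ultimately show ?thesis by blast
qed

text \<open>ad \<open>X (- \<theta>)\<close> carries the coordinate at \<beta> to
  \<open>\<beta> - \<theta>\<close> with the factor 1 or -1.\<close>

lemma L1_functional:
  assumes "\<beta> \<in> L1" shows "\<exists>f. intfun f \<and> (\<forall>a\<in>LL. f a = coef \<beta> a)"
proof -
  obtain f where f: "intfun f" "\<And>a. a \<in> LL \<Longrightarrow> f a = coef (\<beta> - \<theta>) a" using Lm1_functional[OF assms] by blast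
  have b: "\<beta> \<in> \<Phi>" "\<beta> - \<theta> \<in> \<Phi>" "- \<theta> \<in> \<Phi>"
    using L1_root[OF assms] L1_minus_theta[OF assms] theta_root by auto
  define n where "n = N (- \<theta>) \<beta>"
  have n: "n * n = 1" using N_mtheta[OF assms] abs_1[of n] by (auto simp: n_def)
  have "of_int n * f (comm (X (- \<theta>)) a) = coef \<beta> a" if a: "a \<in> LL" for a
  proof -
    have "coef (\<beta> - \<theta>) (comm (X (- \<theta>)) a) = of_int n * coef \<beta> a"
    proof -
      have "\<beta> - \<theta> \<noteq> - \<theta>" using root_nonzero[OF b(1)] by simp
      from coef_comm[OF b(3,2) this a] b show ?thesis by (simp add: n_def)
    qed
    then have "of_int n * f (comm (X (- \<theta>)) a) = of_int (n * n) * coef \<beta> a"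
      using f(2)[OF comm_LL[OF b(3) a]] by simp
    then show ?thesis by (simp add: n)
  qed
  moreover have "intfun (\<lambda>a. of_int n * f (comm (X (- \<theta>)) a))"
    by (intro intfun_smul intfun_intop[OF f(1) intop_comm]) (use b in auto)
  ultimately show ?thesis by blast
qed

text \<open>A coordinate of an integral matrix need not be an integer; for \<open>deg \<eta> \<noteq> 0\<close> it extends to a functional
  that is integral on all integral matrices, and only then is the choice below meaningful.\<close>

definition cf :: "'e \<Rightarrow> 'n sqmat \<Rightarrow> complex" where
  "cf \<eta> = (SOME f. intfun f \<and> (\<forall>a\<in>LL. f a = coef \<eta> a))"

lemma cf:
  assumes "\<eta> \<in> \<Phi>" "deg \<eta> \<noteq> 0"
  shows "intfun (cf \<eta>)" "a \<in> LL \<Longrightarrow> cf \<eta> a = coef \<eta> a"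
proof -
  have "\<exists>f. intfun f \<and> (\<forall>a\<in>LL. f a = coef \<eta> a)"
  proof -
    consider "\<eta> = \<theta>" | "\<eta> = - \<theta>" | "deg \<eta> = 1" | "deg \<eta> = -1"
      using deg_cases[OF assms(1)] assms(2) by auto
    then show ?thesis
    proof cases
      case 1 then show ?thesis using long_functional[OF long_theta] by simp
    next
      case 2 then show ?thesis using long_functional[of "- \<theta>"] long_theta long_neg by simp
    next
      case 3 then show ?thesis using L1_functional assms by (simp add: L1_def)
    next
      case 4
      from Lm1_functional[OF deg_m1_plus_theta[OF assms(1) 4]] show ?thesis by simp
    qed
  qed
  from someI_ex[OF this] show "intfun (cf \<eta>)" "a \<in> LL \<Longrightarrow> cf \<eta> a = coef \<eta> a" by (auto simp: cf_def)
qed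

end

section \<open>Root automorphisms and the grading\<close>

context chevalley
begin

lemma coef_E_unchanged:
  assumes "\<delta> \<in> \<Phi>" "\<eta> \<in> \<Phi>" "a \<in> LL"
    and "\<And>k::nat. k \<ge> 1 \<Longrightarrow> \<eta> - real k *\<^sub>R \<delta> \<notin> \<Phi> \<and> \<eta> - real k *\<^sub>R \<delta> \<noteq> 0"
  shows "coef \<eta> (E \<delta> t a) = coef \<eta> a"
proof -
  define f where "f a = coef \<eta> (E \<delta> t a)" for a
  have *: "f a = (\<Sum>\<epsilon>\<in>\<Phi>. coef \<epsilon> a * f (X \<epsilon>)) + f (cpart a)"
    by (rule linear_ext) (use assms in \<open>auto simp: f_def E_add E_smul E_LL\<close>)
  have "\<eta> \<noteq> 0 + real k *\<^sub>R \<delta>" for k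
    using assms(4)[of k] root_nonzero[OF assms(2)] by (cases "k = 0") auto
  then have cp: "f (cpart a) = 0"
    unfolding f_def by (intro coef_E_0[OF assms(1) T_W[OF cpart_T[OF assms(3)]] assms(2)]) auto
  have f0: "f (X \<eta>) = 1"
    using coef_E[OF assms(1) X_W[OF assms(2)], of 0 t] assms(2) by (simp add: f_def)
  have fo: "f (X \<epsilon>) = 0" if "\<epsilon> \<in> \<Phi>" "\<epsilon> \<noteq> \<eta>" for \<epsilon>
    unfolding f_def
  proof (rule coef_E_0[OF assms(1) X_W[OF that(1)] assms(2)])
    fix k :: nat
    show "\<eta> \<noteq> \<epsilon> + real k *\<^sub>R \<delta>"
      using that assms(4)[of k] by (cases "k = 0") auto
  qed
  have "(\<Sum>\<epsilon>\<in>\<Phi>. coef \<epsilon> a * f (X \<epsilon>)) = (\<Sum>\<epsilon>\<in>\<Phi>. if \<epsilon> = \<eta> then coef \<eta> a else 0)"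
    by (rule sum.cong) (auto simp: f0 fo)
  then show ?thesis using * cp finite_roots assms(2) by (simp add: f_def)
qed

lemma E_fix:
  assumes "\<delta> \<in> \<Phi>" "a \<in> W \<mu>" "\<And>k. k \<ge> 1 \<Longrightarrow> \<mu> + real k *\<^sub>R \<delta> \<notin> \<Phi> \<and> \<mu> + real k *\<^sub>R \<delta> \<noteq> 0"
  shows "E \<delta> t a = a"
  using E_W[OF assms(1,2), of 1 t] assms(3) by simp

lemma E_linear:
  assumes "\<delta> \<in> \<Phi>" "a \<in> W \<mu>" "\<And>k. k \<ge> 2 \<Longrightarrow> \<mu> + real k *\<^sub>R \<delta> \<notin> \<Phi> \<and> \<mu> + real k *\<^sub>R \<delta> \<noteq> 0"
  shows "E \<delta> t a = a + smul t (comm (X \<delta>) a)"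
  using E_W[OF assms(1,2), of 2 t] assms(3) by (simp add: numeral_2_eq_2)

lemma E_quadratic:
  assumes "\<delta> \<in> \<Phi>" "a \<in> W \<mu>" "\<And>k. k \<ge> 3 \<Longrightarrow> \<mu> + real k *\<^sub>R \<delta> \<notin> \<Phi> \<and> \<mu> + real k *\<^sub>R \<delta> \<noteq> 0"
  shows "E \<delta> t a = a + smul t (comm (X \<delta>) a) + smul (t ^ 2) (adp (X \<delta>) 2 a)"
  using E_W[OF assms(1,2), of 3 t] assms(3) by (simp add: numeral_3_eq_3 numeral_2_eq_2)

end

context chevalley_graded
begin

lemma theta_roots [simp]: "\<theta> \<in> \<Phi>" "- \<theta> \<in> \<Phi>"
  using theta_root by auto

lemma L1_roots [simp]: "\<beta> \<in> L1 \<Longrightarrow> \<beta> \<in> \<Phi>" "\<beta> \<in> L1 \<Longrightarrow> \<theta> - \<beta> \<in> \<Phi>" "\<beta> \<in> L1 \<Longrightarrow> \<beta> - \<theta> \<in> \<Phi>"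
  using L1_root L1_compl L1_minus_theta by auto

lemma high_deg: assumes "deg \<mu> > 2" shows "\<mu> \<notin> \<Phi> \<and> \<mu> \<noteq> 0"
  using assms deg_bounds[of \<mu>] by auto

lemma low_deg: assumes "deg \<mu> < - 2" shows "\<mu> \<notin> \<Phi> \<and> \<mu> \<noteq> 0"
  using assms deg_bounds[of \<mu>] by auto

lemma deg2: assumes "deg \<mu> = 2" "\<mu> \<noteq> \<theta>" shows "\<mu> \<notin> \<Phi> \<and> \<mu> \<noteq> 0"
  using assms deg_2[of \<mu>] by auto

lemma degm2: assumes "deg \<mu> = - 2" "\<mu> \<noteq> - \<theta>" shows "\<mu> \<notin> \<Phi> \<and> \<mu> \<noteq> 0"
  using assms deg_m2[of \<mu>] by auto

lemma E_theta_mtheta: "E \<theta> t (X (- \<theta>)) = X (- \<theta>) + smul t (Hc \<theta>) - smul (t ^ 2) (X \<theta>)"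
proof -
  have "E \<theta> t (X (- \<theta>)) = X (- \<theta>) + smul t (comm (X \<theta>) (X (- \<theta>))) + smul (t ^ 2) (adp (X \<theta>) 2 (X (- \<theta>)))"
    by (rule E_quadratic[OF _ X_W]; (rule high_deg)?; simp)
  then show ?thesis by (simp add: adp_2_neg Hc_def)
qed

lemma E_theta_fix: assumes "a \<in> W \<mu>" "deg \<mu> \<ge> 0" "\<mu> \<noteq> 0" shows "E \<theta> t a = a"
proof (rule E_fix[OF _ assms(1)])
  fix k :: nat assume k: "k \<ge> 1"
  consider "deg (\<mu> + real k *\<^sub>R \<theta>) > 2" | "deg (\<mu> + real k *\<^sub>R \<theta>) = 2" "k = 1"
    using assms(2) k by (cases "k = 1"; cases "deg \<mu> = 0") auto
  then show "\<mu> + real k *\<^sub>R \<theta> \<notin> \<Phi> \<and> \<mu> + real k *\<^sub>R \<theta> \<noteq> 0"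
    by cases (use assms high_deg deg2 in auto)
qed simp

lemma E_theta_m1: "\<epsilon> \<in> \<Phi> \<Longrightarrow> deg \<epsilon> = -1 \<Longrightarrow> E \<theta> t (X \<epsilon>) = X \<epsilon> + smul (t * of_int (N \<theta> \<epsilon>)) (X (\<epsilon> + \<theta>))"
proof -
  assume e: "\<epsilon> \<in> \<Phi>" "deg \<epsilon> = -1"
  have "E \<theta> t (X \<epsilon>) = X \<epsilon> + smul t (comm (X \<theta>) (X \<epsilon>))"
    by (insert e, rule E_linear[OF _ X_W]; (rule high_deg)?; simp)
  then show ?thesis using N(2)[of \<theta> \<epsilon>] e deg_m1_plus_theta[OF e] by (simp add: add.commute)
qed

lemma E_theta_T: assumes "H \<in> T" shows "\<exists>c. E \<theta> t H = H + smul c (X \<theta>)"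
proof -
  have "E \<theta> t H = H + smul t (comm (X \<theta>) H)"
    by (rule E_linear[OF _ T_W[OF assms]]; (rule high_deg)?; simp)
  moreover obtain c where "comm H (X \<theta>) = smul c (X \<theta>)" using T_X[OF assms, of \<theta>] by auto
  ultimately have "E \<theta> t H = H + smul (t * - c) (X \<theta>)" by (subst (asm) comm_swap) simp
  then show ?thesis by blast
qed

lemma E_L1_theta: "\<beta> \<in> L1 \<Longrightarrow> E \<beta> t (X \<theta>) = X \<theta>"
  by (rule E_fix[OF _ X_W]; (rule high_deg)?; simp add: L1_deg)

lemma E_L1_L1:
  assumes "\<beta> \<in> L1" "\<gamma> \<in> L1"
  shows "E \<beta> t (X \<gamma>) = X \<gamma> + (if \<gamma> = \<theta> - \<beta> then smul (t * of_int (N \<beta> (\<theta> - \<beta>))) (X \<theta>) else 0)"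
proof -
  have "E \<beta> t (X \<gamma>) = X \<gamma> + smul t (comm (X \<beta>) (X \<gamma>))"
    by (insert assms, rule E_linear[OF _ X_W]; (rule high_deg)?; simp add: L1_deg)
  moreover have "comm (X \<beta>) (X \<gamma>) = (if \<gamma> = \<theta> - \<beta> then smul (of_int (N \<beta> (\<theta> - \<beta>))) (X \<theta>) else 0)"
  proof (cases "\<gamma> = \<theta> - \<beta>")
    case True then show ?thesis using N(2)[of \<beta> "\<theta> - \<beta>"] assms by simp
  next
    case False
    then have "\<beta> + \<gamma> \<noteq> \<theta>" by auto
    then show ?thesis using deg2[of "\<beta> + \<gamma>"] X_zero[of \<beta> \<gamma>] assms False by (simp add: L1_deg)
  qed
  ultimately show ?thesis by simp
qed

lemma E_L1_Hc: assumes "\<beta> \<in> L1" shows "E \<beta> t (Hc \<theta>) = Hc \<theta> - smul t (X \<beta>)"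
proof -
  have "E \<beta> t (Hc \<theta>) = Hc \<theta> + smul t (comm (X \<beta>) (Hc \<theta>))"
  proof (rule E_linear[OF _ T_W])
    fix k :: nat assume "k \<ge> 2"
    then show "0 + real k *\<^sub>R \<beta> \<notin> \<Phi> \<and> 0 + real k *\<^sub>R \<beta> \<noteq> 0"
      using multiple_root[of \<beta> "real k"] root_nonzero[of \<beta>] assms by auto
  qed (use assms in auto)
  then show ?thesis using X_Hc[of \<theta> \<beta>] assms L1_deg[OF assms] by (simp add: deg_def)
qed

text \<open>The factor that \<open>X (- \<beta>)\<close> acquires on its way to
  \<open>X \<theta>\<close> under ad \<open>X \<theta>\<close> followed by ad
  \<open>X \<beta>\<close>.\<close>

definition nu :: "'e \<Rightarrow> int" where "nu \<beta> = N \<theta> (- \<beta>) * N \<beta> (\<theta> - \<beta>)"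

lemma abs_nu: "\<beta> \<in> L1 \<Longrightarrow> \<bar>nu \<beta>\<bar> = int (mlt \<beta>)"
  using N_theta[of "- \<beta>"] N_compl[of \<beta>] by (simp add: nu_def abs_mult L1_deg)

text \<open>\<open>E \<theta> 1 a - a\<close> has terms only at \<open>Hc \<theta>\<close>, in
  degree 1 and at \<theta>. Of these, \<open>E \<beta> 1 - 1\<close> keeps two: it sends
  \<open>Hc \<theta>\<close> to \<open>- X \<beta>\<close> and \<open>X (\<theta> - \<beta>)\<close>
  to a multiple of \<open>X \<theta>\<close>. Since both parameters are 1, commuting with the
  constants suffices for Ad g to respect this expression.\<close>

lemma double_difference:
  assumes b: "\<beta> \<in> L1" and a: "a \<in> LL"
  shows "E \<beta> 1 (E \<theta> 1 a - a) - (E \<theta> 1 a - a)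
       = smul (- coef (- \<theta>) a) (X \<beta>) + smul (of_int (nu \<beta>) * coef (- \<beta>) a) (X \<theta>)"
proof (rule linear_ext_eq[OF _ _ _ _ _ _ a, where F = "\<lambda>a. E \<beta> 1 (E \<theta> 1 a - a) - (E \<theta> 1 a - a)"])
  have nb: "- \<beta> \<in> \<Phi>" "- \<beta> \<noteq> - \<theta>" using b L1_deg[OF b] by auto
  show "E \<beta> 1 (E \<theta> 1 (X \<epsilon>) - X \<epsilon>) - (E \<theta> 1 (X \<epsilon>) - X \<epsilon>)
       = smul (- coef (- \<theta>) (X \<epsilon>)) (X \<beta>) + smul (of_int (nu \<beta>) * coef (- \<beta>) (X \<epsilon>)) (X \<theta>)"
    if e: "\<epsilon> \<in> \<Phi>" for \<epsilon>
  proof -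
    consider "\<epsilon> = - \<theta>" | "deg \<epsilon> = -1" | "deg \<epsilon> \<ge> 0" using deg_cases[OF e] by auto
    then show ?thesis
    proof cases
      case 1
      then show ?thesis using b nb
        by (simp add: E_theta_mtheta E_diff E_L1_Hc E_L1_theta)
    next
      case 2
      have l: "\<epsilon> + \<theta> \<in> L1" by (rule deg_m1_plus_theta[OF e 2])
      have ne: "\<epsilon> \<noteq> - \<theta>" using 2 by auto
      have iff: "\<epsilon> + \<theta> = \<theta> - \<beta> \<longleftrightarrow> - \<beta> = \<epsilon>" by (auto simp: add_eq_0_iff)
      have "E \<theta> 1 (X \<epsilon>) - X \<epsilon> = smul (of_int (N \<theta> \<epsilon>)) (X (\<epsilon> + \<theta>))"
        using E_theta_m1[OF e 2, of 1] by simp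
      then show ?thesis using e nb ne 2 b unfolding iff[symmetric]
        by (auto simp: E_smul E_L1_L1[OF b l] nu_def iff sqm.scale_right_distrib)
    next
      case 3
      then have "\<epsilon> \<noteq> - \<theta>" "\<epsilon> \<noteq> - \<beta>" using L1_deg[OF b] by auto
      then show ?thesis using E_theta_fix[OF X_W[OF e] 3 root_nonzero[OF e]] e nb
        by (simp add: E_def)
    qed
  qed
  show "E \<beta> 1 (E \<theta> 1 H - H) - (E \<theta> 1 H - H)
       = smul (- coef (- \<theta>) H) (X \<beta>) + smul (of_int (nu \<beta>) * coef (- \<beta>) H) (X \<theta>)" if H: "H \<in> T" for H
  proof -
    obtain c where "E \<theta> 1 H = H + smul c (X \<theta>)" using E_theta_T[OF H] by blast
    then show ?thesis using H nb by (simp add: E_smul E_L1_theta[OF b])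
  qed
qed (use b in \<open>auto simp: E_add E_diff E_smul sqm.scale_left_distrib sqm.scale_left_diff_distrib
      sqm.scale_right_diff_distrib sqm.scale_right_distrib algebra_simps\<close>)

lemma coef_E_L1: assumes "\<beta> \<in> L1" "\<gamma> \<in> L1" "a \<in> LL"
  shows "coef (\<gamma> - \<theta>) (E \<beta> t a) = coef (\<gamma> - \<theta>) a + (if \<gamma> = \<beta> then t * of_int (N \<beta> (- \<theta>)) * coef (- \<theta>) a else 0)"
proof (cases "\<gamma> = \<beta>")
  case True
  have e: "\<beta> - \<theta> - \<beta> = - \<theta>" by simp
  have no: "\<beta> - \<theta> - 2 *\<^sub>R \<beta> \<notin> \<Phi>" using low_deg[of "\<beta> - \<theta> - 2 *\<^sub>R \<beta>"] L1_deg[OF assms(1)] by simp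
  have "coef (\<beta> - \<theta>) (E \<beta> t a) = coef (\<beta> - \<theta>) a + t * of_int (N \<beta> (\<beta> - \<theta> - \<beta>)) * coef (\<beta> - \<theta> - \<beta>) a
    + (if \<beta> - \<theta> - 2 *\<^sub>R \<beta> \<in> \<Phi> then t ^ 2 * coef (\<beta> - \<theta>) (adp (X \<beta>) 2 (X (\<beta> - \<theta> - 2 *\<^sub>R \<beta>))) * coef (\<beta> - \<theta> - 2 *\<^sub>R \<beta>) a else 0)"
  proof (rule coef_E_two_steps)
    fix k :: nat assume "k \<ge> 3"
    then show "\<beta> - \<theta> - real k *\<^sub>R \<beta> \<notin> \<Phi> \<and> \<beta> - \<theta> - real k *\<^sub>R \<beta> \<noteq> 0"
      using L1_deg[OF assms(1)] by (intro low_deg) simp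
  qed (use assms L1_deg[OF assms(1)] in \<open>auto dest: arg_cong[where f = deg]\<close>)
  then show ?thesis using no True by (simp add: e)
next
  case False
  have "coef (\<gamma> - \<theta>) (E \<beta> t a) = coef (\<gamma> - \<theta>) a"
  proof (rule coef_E_unchanged)
    fix k :: nat assume k: "k \<ge> 1"
    show "\<gamma> - \<theta> - real k *\<^sub>R \<beta> \<notin> \<Phi> \<and> \<gamma> - \<theta> - real k *\<^sub>R \<beta> \<noteq> 0"
    proof (cases "k = 1")
      case True
      have "deg (\<gamma> - \<theta> - \<beta>) = - 2" "\<gamma> - \<theta> - \<beta> \<noteq> - \<theta>" using L1_deg assms False by auto
      then show ?thesis using True degm2[of "\<gamma> - \<theta> - \<beta>"] by simp
    next
      case k1: False
      then show ?thesis using k L1_deg assms by (intro low_deg) auto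
    qed
  qed (use assms in auto)
  then show ?thesis using False by simp
qed

lemma coef_mtheta_E_L1: assumes "\<beta> \<in> L1" "a \<in> LL" shows "coef (- \<theta>) (E \<beta> t a) = coef (- \<theta>) a"
  by (insert assms, rule coef_E_unchanged; (rule low_deg)?; simp add: L1_deg)

lemma coef_comm_L1: assumes "\<beta> \<in> L1" "a \<in> LL"
  shows "coef (\<beta> - \<theta>) (comm (X \<beta>) a) = of_int (N \<beta> (- \<theta>)) * coef (- \<theta>) a"
proof -
  have "\<beta> - \<theta> \<noteq> \<beta>" using root_nonzero theta_roots by auto
  from coef_comm[of \<beta> "\<beta> - \<theta>", OF _ _ this assms(2)] assms show ?thesis by simp
qed

lemma coef_comm_theta_m1: assumes "\<beta> \<in> L1" "a \<in> LL" shows "coef (\<beta> - \<theta>) (comm (X \<theta>) a) = 0"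
proof -
  have "deg (\<beta> - \<theta> - \<theta>) < - 2" using L1_deg[OF assms(1)] by simp
  from low_deg[OF this] have "\<beta> - \<theta> - \<theta> \<notin> \<Phi>" by simp
  moreover have "\<beta> - \<theta> \<noteq> \<theta>" using L1_deg[OF assms(1)] by (auto dest: arg_cong[where f = deg])
  ultimately show ?thesis using coef_comm[of \<theta> "\<beta> - \<theta>" a] assms by simp
qed

lemma coef_E_theta: assumes "\<beta> \<in> L1" "a \<in> LL"
  shows "coef \<beta> (E \<theta> 1 a) = coef \<beta> a + of_int (N \<theta> (\<beta> - \<theta>)) * coef (\<beta> - \<theta>) a"
proof -
  have no: "\<beta> - 2 *\<^sub>R \<theta> \<notin> \<Phi>" using low_deg[of "\<beta> - 2 *\<^sub>R \<theta>"] L1_deg[OF assms(1)] by simp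
  have "coef \<beta> (E \<theta> 1 a) = coef \<beta> a + 1 * of_int (N \<theta> (\<beta> - \<theta>)) * coef (\<beta> - \<theta>) a
    + (if \<beta> - 2 *\<^sub>R \<theta> \<in> \<Phi> then 1 ^ 2 * coef \<beta> (adp (X \<theta>) 2 (X (\<beta> - 2 *\<^sub>R \<theta>))) * coef (\<beta> - 2 *\<^sub>R \<theta>) a else 0)"
  proof (rule coef_E_two_steps)
    fix k :: nat assume "k \<ge> 3"
    then show "\<beta> - real k *\<^sub>R \<theta> \<notin> \<Phi> \<and> \<beta> - real k *\<^sub>R \<theta> \<noteq> 0"
      using L1_deg[OF assms(1)] by (intro low_deg) simp
  qed (use assms L1_deg[OF assms(1)] in \<open>auto dest: arg_cong[where f = deg]\<close>)
  then show ?thesis using no by simp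
qed

text \<open>The terms of order two and three of \<open>E \<beta> 1 (X (- \<theta>))\<close>. Unlike
  the first-order term they have degree \<ge> 0, so \<open>E \<theta> 1\<close> fixes them.\<close>

definition qq :: "'e \<Rightarrow> 'n sqmat" where
  "qq \<beta> = E \<beta> 1 (X (- \<theta>)) - X (- \<theta>) - comm (X \<beta>) (X (- \<theta>))"

lemma qq_decomp:
  assumes b: "\<beta> \<in> L1"
  obtains a c where "qq \<beta> = a + c" "a \<in> W (2 *\<^sub>R \<beta> - \<theta>)" "c \<in> W (3 *\<^sub>R \<beta> - \<theta>)"
proof -
  have e: "- \<theta> + real k *\<^sub>R \<beta> = real k *\<^sub>R \<beta> - \<theta>" for k by simp
  have "E \<beta> 1 (X (- \<theta>)) = (\<Sum>k<4. smul (1 ^ k) (adp (X \<beta>) k (X (- \<theta>))))"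
  proof (rule E_W[OF _ X_W])
    fix k :: nat assume k: "k \<ge> 4"
    show "- \<theta> + real k *\<^sub>R \<beta> \<notin> \<Phi> \<and> - \<theta> + real k *\<^sub>R \<beta> \<noteq> 0"
    proof (cases "k = 4")
      case True
      \<comment> \<open>At k = 4 the weight has degree 2, which among roots only \<theta>
        attains.\<close>
      have "4 *\<^sub>R \<beta> - \<theta> \<noteq> \<theta>" using not_2_4[OF b] by (auto simp: scaleR_2 algebra_simps)
      then show ?thesis using deg2[of "4 *\<^sub>R \<beta> - \<theta>"] L1_deg[OF b] True by simp
    next
      case False then show ?thesis using k L1_deg[OF b] by (intro high_deg) simp
    qed
  qed (use b in auto)
  also have "\<dots> = X (- \<theta>) + comm (X \<beta>) (X (- \<theta>)) + adp (X \<beta>) 2 (X (- \<theta>)) + adp (X \<beta>) 3 (X (- \<theta>))"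
    by (simp add: eval_nat_numeral)
  finally have "qq \<beta> = adp (X \<beta>) 2 (X (- \<theta>)) + adp (X \<beta>) 3 (X (- \<theta>))"
    by (simp add: qq_def)
  moreover have "adp (X \<beta>) 2 (X (- \<theta>)) \<in> W (2 *\<^sub>R \<beta> - \<theta>)" "adp (X \<beta>) 3 (X (- \<theta>)) \<in> W (3 *\<^sub>R \<beta> - \<theta>)"
    using adp_W[of \<beta> "X (- \<theta>)" "- \<theta>" 2] adp_W[of \<beta> "X (- \<theta>)" "- \<theta>" 3] X_W b by auto
  ultimately show ?thesis using that by blast
qed

lemma qq_LL: "\<beta> \<in> L1 \<Longrightarrow> qq \<beta> \<in> LL"
  by (metis qq_decomp W_LL LL_add)

lemma int_qq: assumes "\<beta> \<in> L1" shows "intmat (qq \<beta>)"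
  unfolding qq_def using intop_int[OF intop_E[of \<beta> 1]] assms by simp

lemma two_L1_ne_theta: assumes "\<beta> \<in> L1" shows "2 *\<^sub>R \<beta> - \<theta> \<noteq> 0"
  using theta_multiple[OF L1_root[OF assms], of 2 1] by auto

lemma E_theta_qq: assumes "\<beta> \<in> L1" shows "E \<theta> 1 (qq \<beta>) = qq \<beta>"
proof -
  obtain a c where ac: "qq \<beta> = a + c" "a \<in> W (2 *\<^sub>R \<beta> - \<theta>)" "c \<in> W (3 *\<^sub>R \<beta> - \<theta>)"
    using qq_decomp[OF assms] .
  have "deg (3 *\<^sub>R \<beta> - \<theta>) = 1" using L1_deg[OF assms] by simp
  then have "3 *\<^sub>R \<beta> - \<theta> \<noteq> 0" by (metis deg_simps(5) zero_neq_one)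
  then have "E \<theta> 1 c = c" using L1_deg[OF assms] by (intro E_theta_fix[OF ac(3)]) auto
  moreover have "E \<theta> 1 a = a" using L1_deg[OF assms] two_L1_ne_theta[OF assms]
    by (intro E_theta_fix[OF ac(2)]) auto
  ultimately show ?thesis by (simp add: ac E_add)
qed

text \<open>The part of \<open>qq \<beta>\<close> of weight
  \<open>3 *\<^sub>R \<beta> - \<theta>\<close> commutes with \<open>X \<beta>\<close>, because the
  sum of the weights has degree 2 without being \<theta>. So \<open>ee_zero\<close> has to deal with
  one root space only.\<close>

lemma comm_qq_W: assumes "\<beta> \<in> L1" shows "comm (qq \<beta>) (X \<beta>) \<in> W (3 *\<^sub>R \<beta> - \<theta>)"
proof -
  obtain a c where ac: "qq \<beta> = a + c" "a \<in> W (2 *\<^sub>R \<beta> - \<theta>)" "c \<in> W (3 *\<^sub>R \<beta> - \<theta>)"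
    using qq_decomp[OF assms] .
  have "comm (X \<beta>) c \<in> W (3 *\<^sub>R \<beta> - \<theta> + \<beta>)" using comm_W[OF _ ac(3)] assms by simp
  moreover have "3 *\<^sub>R \<beta> - \<theta> + \<beta> \<notin> \<Phi> \<and> 3 *\<^sub>R \<beta> - \<theta> + \<beta> \<noteq> 0"
  proof (rule deg2)
    have "4 *\<^sub>R \<beta> = 3 *\<^sub>R \<beta> + \<beta>" using scaleR_left_distrib[of 3 1 \<beta>] by simp
    then show "3 *\<^sub>R \<beta> - \<theta> + \<beta> \<noteq> \<theta>" using not_2_4[OF assms] by (auto simp: scaleR_2 algebra_simps)
  qed (use L1_deg[OF assms] in simp)
  ultimately have c: "comm (X \<beta>) c = 0" using W_trivial by blast
  have e: "2 *\<^sub>R \<beta> - \<theta> + \<beta> = 3 *\<^sub>R \<beta> - \<theta>" unfolding scaleR_3 by simp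
  have "comm (X \<beta>) a \<in> W (2 *\<^sub>R \<beta> - \<theta> + \<beta>)" using comm_W[OF _ ac(2)] assms by simp
  then have "smul (-1) (comm (X \<beta>) a) \<in> W (3 *\<^sub>R \<beta> - \<theta>)" unfolding e by (rule W_smul)
  moreover have "comm (qq \<beta>) (X \<beta>) = smul (-1) (comm (X \<beta>) a)"
    using c unfolding ac(1) by (subst comm_swap) (simp add: comm_simps)
  ultimately show ?thesis by simp
qed

text \<open>A term of order k \<ge> 2 coming from weight \<mu>, commuted with
  \<open>X \<beta>\<close>, reaches weight \<beta> only for
  \<open>\<mu> = - real k *\<^sub>R \<beta>\<close>, which is neither a root nor 0.\<close>

lemma coef_comm_second_order:
  assumes b: "\<beta> \<in> L1" and a: "a \<in> LL"
  shows "coef \<beta> (comm (E \<beta> 1 a - a - comm (X \<beta>) a) (X \<beta>)) = 0"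
proof -
  define f where "f a = coef \<beta> (comm (E \<beta> 1 a - a - comm (X \<beta>) a) (X \<beta>))" for a
  have *: "f a = (\<Sum>\<epsilon>\<in>\<Phi>. coef \<epsilon> a * f (X \<epsilon>)) + f (cpart a)"
    by (rule linear_ext) (use a b in \<open>auto simp: f_def E_add E_smul E_LL comm_simps comm_LL comm_LL' algebra_simps\<close>)
  have w: "f c = 0" if c: "c \<in> W \<mu>" and mu: "\<And>k::nat. k \<ge> 2 \<Longrightarrow> \<mu> \<noteq> - real k *\<^sub>R \<beta>" for c \<mu>
  proof -
    have cL: "c \<in> LL" using c by (rule W_LL)
    define M where "M = 2 * CARD('n)"
    have "E \<beta> 1 c = (\<Sum>k<Suc (Suc M). smul (1 ^ k) (adp (X \<beta>) k c))"
      by (rule E_expand) (use b in \<open>auto simp: M_def\<close>)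
    also have "\<dots> = c + comm (X \<beta>) c + (\<Sum>k<M. adp (X \<beta>) (Suc (Suc k)) c)"
      by (simp add: sum.lessThan_Suc_shift add.assoc del: sum.lessThan_Suc)
    finally have "f c = coef \<beta> (\<Sum>k<M. comm (adp (X \<beta>) (Suc (Suc k)) c) (X \<beta>))"
      by (simp add: f_def comm_sum_left)
    also have "\<dots> = (\<Sum>k<M. coef \<beta> (comm (adp (X \<beta>) (Suc (Suc k)) c) (X \<beta>)))"
      by (rule coef_sum) (use b cL in \<open>auto intro!: comm_LL' adp_LL\<close>)
    also have "\<dots> = 0"
    proof (rule sum.neutral, rule ballI)
      fix k
      have "comm (X \<beta>) (adp (X \<beta>) (Suc (Suc k)) c) \<in> W (\<mu> + real (Suc (Suc k)) *\<^sub>R \<beta> + \<beta>)"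
        using b c by (intro comm_W adp_W) auto
      moreover have "\<beta> \<noteq> \<mu> + real (Suc (Suc k)) *\<^sub>R \<beta> + \<beta>"
      proof
        assume "\<beta> = \<mu> + real (Suc (Suc k)) *\<^sub>R \<beta> + \<beta>"
        then have "\<mu> + real (Suc (Suc k)) *\<^sub>R \<beta> = 0" by (simp del: of_nat_Suc)
        then have "\<mu> = - real (Suc (Suc k)) *\<^sub>R \<beta>"
          by (simp only: eq_neg_iff_add_eq_0 scaleR_minus_left)
        then show False using mu[of "Suc (Suc k)"] by simp
      qed
      ultimately have "coef \<beta> (comm (X \<beta>) (adp (X \<beta>) (Suc (Suc k)) c)) = 0"
        using coef_W b by (metis L1_root)
      then show "coef \<beta> (comm (adp (X \<beta>) (Suc (Suc k)) c) (X \<beta>)) = 0"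
        using b cL by (subst comm_swap) (simp add: comm_LL adp_LL)
    qed
    finally show ?thesis .
  qed
  have "f (X \<epsilon>) = 0" if "\<epsilon> \<in> \<Phi>" for \<epsilon>
  proof (rule w[OF X_W[OF that]])
    fix k :: nat assume "k \<ge> 2"
    then show "\<epsilon> \<noteq> - real k *\<^sub>R \<beta>" using multiple_root[of \<beta> "- real k"] b that by auto
  qed
  moreover have "f (cpart a) = 0"
    by (rule w[OF T_W[OF cpart_T[OF a]]]) (use root_nonzero[of \<beta>] b in auto)
  ultimately show ?thesis using * by (simp add: f_def)
qed

text \<open>By weights only the coordinate at \<open>- \<theta>\<close> contributes, and it does so
  through [Hc \<theta>, X \<beta>] = X \<beta>.\<close>

lemma coef_comm_comm_theta:
  assumes b: "\<beta> \<in> L1" and a: "a \<in> LL"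
  shows "coef \<beta> (comm (comm (X \<theta>) a) (X \<beta>)) = coef (- \<theta>) a"
proof -
  define f where "f a = coef \<beta> (comm (comm (X \<theta>) a) (X \<beta>))" for a
  have *: "f a = (\<Sum>\<epsilon>\<in>\<Phi>. coef \<epsilon> a * f (X \<epsilon>)) + f (cpart a)"
    by (rule linear_ext) (use a b in \<open>auto simp: f_def comm_simps comm_LL comm_LL'\<close>)
  have w: "f c = 0" if c: "c \<in> W \<mu>" and mu: "\<mu> \<noteq> - \<theta>" for c \<mu>
  proof -
    have "comm (X \<beta>) (comm (X \<theta>) c) \<in> W (\<mu> + \<theta> + \<beta>)" using b c by (intro comm_W) auto
    moreover have "\<beta> \<noteq> \<mu> + \<theta> + \<beta>" using mu by (simp add: eq_neg_iff_add_eq_0)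
    ultimately have "coef \<beta> (comm (X \<beta>) (comm (X \<theta>) c)) = 0" using coef_W b by (metis L1_root)
    then show ?thesis unfolding f_def using b W_LL[OF c] by (subst comm_swap) (simp add: comm_LL)
  qed
  have "f (X (- \<theta>)) = 1"
    using Hc_X[of \<theta> \<beta>] b L1_deg[OF b] by (simp add: f_def Hc_def deg_def)
  then have "(\<Sum>\<epsilon>\<in>\<Phi>. coef \<epsilon> a * f (X \<epsilon>)) = (\<Sum>\<epsilon>\<in>\<Phi>. if \<epsilon> = - \<theta> then coef (- \<theta>) a else 0)"
    using w[OF X_W] by (intro sum.cong) auto
  moreover have "f (cpart a) = 0" by (rule w[OF T_W[OF cpart_T[OF a]]]) (use root_nonzero theta_roots in auto)
  ultimately show ?thesis using * finite_roots by (simp add: f_def)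
qed

lemma E_delta_theta:
  assumes "\<delta> \<in> \<Phi>" "deg \<delta> = 0" shows "E \<delta> t (X \<theta>) = X \<theta>" "E \<delta> t (X (- \<theta>)) = X (- \<theta>)"
proof -
  show "E \<delta> t (X \<theta>) = X \<theta>"
    by (insert assms root_nonzero[OF assms(1)], rule E_fix[OF _ X_W]; (rule deg2)?; simp)
  show "E \<delta> t (X (- \<theta>)) = X (- \<theta>)"
    by (insert assms root_nonzero[OF assms(1)], rule E_fix[OF _ X_W]; (rule degm2)?; simp)
qed

lemma delta_deg: "\<beta> \<in> L1 \<Longrightarrow> deg (\<theta> - 2 *\<^sub>R \<beta>) = 0"
  using L1_deg[of \<beta>] by simp

lemma coef_E_delta_L1: assumes "\<beta> \<in> L1" "mlt \<beta> \<ge> 2"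
  shows "coef (\<theta> - \<beta>) (E (\<theta> - 2 *\<^sub>R \<beta>) 1 (X \<beta>)) = of_int (N (\<theta> - 2 *\<^sub>R \<beta>) \<beta>)"
proof -
  have d: "\<theta> - 2 *\<^sub>R \<beta> \<in> \<Phi>" by (rule theta_minus_2[OF assms])
  have e: "\<beta> + real 1 *\<^sub>R (\<theta> - 2 *\<^sub>R \<beta>) = \<theta> - \<beta>" "\<theta> - 2 *\<^sub>R \<beta> + \<beta> = \<theta> - \<beta>" by (simp_all add: scaleR_2)
  have r: "\<theta> - \<beta> \<in> \<Phi>" "\<beta> \<in> \<Phi>" using assms by auto
  have "comm (X (\<theta> - 2 *\<^sub>R \<beta>)) (X \<beta>) = smul (of_int (N (\<theta> - 2 *\<^sub>R \<beta>) \<beta>)) (X (\<theta> - \<beta>))"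
    using N(2)[OF d r(2)] r unfolding e by simp
  moreover have "coef (\<theta> - \<beta>) (E (\<theta> - 2 *\<^sub>R \<beta>) 1 (X \<beta>)) = 1 ^ 1 * coef (\<theta> - \<beta>) (adp (X (\<theta> - 2 *\<^sub>R \<beta>)) 1 (X \<beta>))"
    using coef_E[OF d X_W[OF r(2)], of 1 1] unfolding e using r by simp
  ultimately show ?thesis using r by simp
qed

text \<open>The coordinate can be reached from \<open>- \<beta>\<close>,
  \<open>\<beta> - \<theta>\<close> and \<open>3 *\<^sub>R \<beta> - 2 *\<^sub>R \<theta>\<close>.
  The last is a root in type G2 only; there it belongs to the long root of \<open>mult_3\<close>,
  which is why \<open>rr_zero\<close> settles long roots first.\<close>

lemma coef_E_delta:
  assumes b: "\<beta> \<in> L1" "mlt \<beta> \<ge> 2" and a: "a \<in> LL"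
  shows "coef (- \<beta>) (E (\<theta> - 2 *\<^sub>R \<beta>) 1 a) = coef (- \<beta>) a + of_int (N (\<theta> - 2 *\<^sub>R \<beta>) (\<beta> - \<theta>)) * coef (\<beta> - \<theta>) a
    + (if 3 *\<^sub>R \<beta> - 2 *\<^sub>R \<theta> \<in> \<Phi> then coef (- \<beta>) (adp (X (\<theta> - 2 *\<^sub>R \<beta>)) 2 (X (3 *\<^sub>R \<beta> - 2 *\<^sub>R \<theta>))) * coef (3 *\<^sub>R \<beta> - 2 *\<^sub>R \<theta>) a else 0)"
proof -
  let ?\<delta> = "\<theta> - 2 *\<^sub>R \<beta>"
  have d: "?\<delta> \<in> \<Phi>" by (rule theta_minus_2[OF b])
  have aux: "- b - (t - (b + b)) = b - t" for b t :: 'e by simp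
  have e1: "- \<beta> - ?\<delta> = \<beta> - \<theta>" unfolding scaleR_2 by (rule aux)
  have aux: "- b - ((t + t) - 2 *\<^sub>R (b + b)) = b + (b + b) - (t + t)" for b t :: 'e by (simp add: scaleR_2)
  have e2: "- \<beta> - 2 *\<^sub>R ?\<delta> = 3 *\<^sub>R \<beta> - 2 *\<^sub>R \<theta>"
    unfolding scaleR_3 scaleR_right_diff_distrib scaleR_2[of \<theta>] scaleR_2[of \<beta>] by (rule aux)
  have "coef (- \<beta>) (E ?\<delta> 1 a) = coef (- \<beta>) a + 1 * of_int (N ?\<delta> (- \<beta> - ?\<delta>)) * coef (- \<beta> - ?\<delta>) a
    + (if - \<beta> - 2 *\<^sub>R ?\<delta> \<in> \<Phi> then 1 ^ 2 * coef (- \<beta>) (adp (X ?\<delta>) 2 (X (- \<beta> - 2 *\<^sub>R ?\<delta>))) * coef (- \<beta> - 2 *\<^sub>R ?\<delta>) a else 0)"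
  proof (rule coef_E_two_steps[OF d _ _ _ a])
    show "- \<beta> \<in> \<Phi>" using b by simp
    show "- \<beta> - ?\<delta> \<in> \<Phi>" unfolding e1 using b by simp
    show "- \<beta> \<noteq> 2 *\<^sub>R ?\<delta>" using L1_deg[OF b(1)] delta_deg[OF b(1)] by (auto dest: arg_cong[where f = deg])
    fix k :: nat assume k: "k \<ge> 3"
    have eq: "- \<beta> - real k *\<^sub>R ?\<delta> = (- real k) *\<^sub>R \<theta> + (2 * real k - 1) *\<^sub>R \<beta>"
      by (simp add: scaleR_right_diff_distrib scaleR_left_diff_distrib mult.commute)
    show "- \<beta> - real k *\<^sub>R ?\<delta> \<notin> \<Phi> \<and> - \<beta> - real k *\<^sub>R ?\<delta> \<noteq> 0"
    proof
      show "- \<beta> - real k *\<^sub>R ?\<delta> \<noteq> 0"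
        using L1_deg[OF b(1)] delta_deg[OF b(1)] by (auto dest: arg_cong[where f = deg])
      show "- \<beta> - real k *\<^sub>R ?\<delta> \<notin> \<Phi>"
      proof
        assume "- \<beta> - real k *\<^sub>R ?\<delta> \<in> \<Phi>"
        then have "(- real k) *\<^sub>R \<theta> + (2 * real k - 1) *\<^sub>R \<beta> \<in> \<Phi>" by (simp only: eq)
        note r = reflect_lin[OF b(1) this]
        have m: "mlt \<beta> = 2 \<or> mlt \<beta> = 3" using mult_cartan(2)[OF b(1)] b(2) by auto
        have dg: "deg ((- real k) *\<^sub>R \<theta> + (- (2 * real k - 1) - - real k * real (mlt \<beta>)) *\<^sub>R \<beta>)
          = real k * (real (mlt \<beta>) - 4) + 1"
          using L1_deg[OF b(1)] by (simp add: algebra_simps)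
        have "real k * (real (mlt \<beta>) - 4) + 1 \<ge> - 2" using deg_bounds[OF r] unfolding dg by simp
        then have m3: "mlt \<beta> = 3" "k = 3" using m k by auto
        have r': "- 3 *\<^sub>R \<theta> + 4 *\<^sub>R \<beta> \<in> \<Phi>" using r m3 by simp
        then have "- 3 *\<^sub>R \<theta> + 4 *\<^sub>R \<beta> = - \<theta>" using deg_m2[OF r'] L1_deg[OF b(1)] by simp
        then have "4 *\<^sub>R \<beta> = 3 *\<^sub>R \<theta> - \<theta>"
          by (metis add_uminus_conv_diff minus_add_cancel scaleR_minus_left)
        also have "\<dots> = 2 *\<^sub>R \<theta>" unfolding scaleR_3 by simp
        finally show False using not_2_4[OF b(1)] by blast
      qed
    qed
  qed
  then show ?thesis unfolding e1 e2 by simp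
qed

end

section \<open>The big cell relative to the highest root\<close>

context chevalley_graded
begin

text \<open>The condition \<open>quad\<close> holds for all conjugates of multiples of
  \<open>X (- \<theta>)\<close>. Its coordinate at \<open>- \<theta>\<close> gives l = -2y, those of
  degree 1 give 3 y coef \<beta> a = 0, and the one at \<theta> gives 4 y z = - \<tau>^2. So a is
  determined by y and \<tau>, and it is the conjugate of \<open>smul y (X (- \<theta>))\<close> with
  parameter \<tau> / (2y). The division by 3 happens over the complex numbers only. Since \<tau> / 2
  is a coordinate of [a, X \<beta>] for any \<beta> of degree 1, the parameter needs no division by
  2.\<close>

lemma orbit_normal_form:
  assumes a: "a \<in> LL" and y: "y = coef (- \<theta>) a" "y \<noteq> 0"
    and m1: "\<And>\<beta>. \<beta> \<in> L1 \<Longrightarrow> coef (\<beta> - \<theta>) a = 0"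
    and quad: "comm a (comm a (X \<theta>)) = smul l a" and b0: "\<beta>\<^sub>0 \<in> L1"
  shows "a = E \<theta> (coef \<beta>\<^sub>0 (comm a (X \<beta>\<^sub>0)) / y) (smul y (X (- \<theta>)))"
proof -
  define L0 where "L0 = {\<epsilon> \<in> \<Phi>. deg \<epsilon> = 0}"
  define a0 where "a0 = (\<Sum>\<epsilon>\<in>L0. smul (coef \<epsilon> a) (X \<epsilon>)) + cpart a"
  define a1 where "a1 = (\<Sum>\<epsilon>\<in>L1. smul (coef \<epsilon> a) (X \<epsilon>))"
  define z where "z = coef \<theta> a"
  have L0: "\<epsilon> \<in> \<Phi>" "deg \<epsilon> = 0" if "\<epsilon> \<in> L0" for \<epsilon> using that by (auto simp: L0_def)
  have fin: "finite L0" "finite L1" using finite_roots finite_L1 by (auto simp: L0_def)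
  have Xm: "comm (X (- \<theta>)) (X \<theta>) = - Hc \<theta>" "comm (X (- \<theta>)) (Hc \<theta>) = smul 2 (X (- \<theta>))"
    "comm (X \<theta>) (Hc \<theta>) = - smul 2 (X \<theta>)"
  proof -
    show "comm (X (- \<theta>)) (X \<theta>) = - Hc \<theta>" unfolding Hc_def by (rule comm_swap)
    show "comm (X (- \<theta>)) (Hc \<theta>) = smul 2 (X (- \<theta>))" 
      unfolding X_Hc[OF theta_roots(1) theta_roots(2)] by (simp add: coroot_self)
    show "comm (X \<theta>) (Hc \<theta>) = - smul 2 (X \<theta>)" 
      unfolding X_Hc[OF theta_roots(1) theta_roots(1)] by (simp add: coroot_self)
  qed
  have "(\<Sum>\<epsilon>\<in>\<Phi>. smul (coef \<epsilon> a) (X \<epsilon>)) = (\<Sum>\<epsilon>\<in>insert (- \<theta>) (insert \<theta> (L0 \<union> L1)). smul (coef \<epsilon> a) (X \<epsilon>))"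
  proof (rule sum.mono_neutral_right)
    show "\<forall>\<epsilon>\<in>\<Phi> - insert (- \<theta>) (insert \<theta> (L0 \<union> L1)). smul (coef \<epsilon> a) (X \<epsilon>) = 0"
    proof
      fix \<epsilon> assume e: "\<epsilon> \<in> \<Phi> - insert (- \<theta>) (insert \<theta> (L0 \<union> L1))"
      then have r: "\<epsilon> \<in> \<Phi>" and "\<epsilon> \<noteq> \<theta>" "\<epsilon> \<noteq> - \<theta>" "deg \<epsilon> \<noteq> 0" "deg \<epsilon> \<noteq> 1" 
        unfolding L0_def L1_def by simp_all
      then have "deg \<epsilon> = -1" using deg_cases[of \<epsilon>] by simp
      then have "coef (\<epsilon> + \<theta> - \<theta>) a = 0" by (rule m1[OF deg_m1_plus_theta[OF r]])
      then show "smul (coef \<epsilon> a) (X \<epsilon>) = 0" by simp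
    qed
  qed (use finite_roots L0 in auto)
  also have "\<dots> = smul y (X (- \<theta>)) + (smul z (X \<theta>) + ((\<Sum>\<epsilon>\<in>L0. smul (coef \<epsilon> a) (X \<epsilon>)) + a1))"
  proof -
    have "- \<theta> \<notin> insert \<theta> (L0 \<union> L1)" "\<theta> \<notin> L0 \<union> L1" "L0 \<inter> L1 = {}"
      using L0 L1_deg by (force dest: arg_cong[where f = deg])+
    then show ?thesis using fin by (simp add: sum.union_disjoint y z_def a1_def)
  qed
  finally have deco: "a = smul y (X (- \<theta>)) + smul z (X \<theta>) + a0 + a1"
    using decomp[of a] unfolding a0_def by (metis (no_types, lifting) add.assoc add.commute)
  obtain \<tau> where tau: "comm (cpart a) (X \<theta>) = smul \<tau> (X \<theta>)" using T_X[OF cpart_T[OF a], of \<theta>] by auto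
  have "comm (X \<epsilon>) (X \<theta>) = 0" if "\<epsilon> \<in> L0" for \<epsilon>
    using L0[OF that] deg2[of "\<epsilon> + \<theta>"] root_nonzero[of \<epsilon>] by (intro X_zero) auto
  then have c1: "comm a0 (X \<theta>) = smul \<tau> (X \<theta>)"
    by (simp add: a0_def comm_simps comm_sum_left tau)
  have "comm (X \<epsilon>) (Hc \<theta>) = 0" if "\<epsilon> \<in> L0" for \<epsilon>
    using X_Hc[of \<theta> \<epsilon>] L0[OF that] by (simp add: deg_def)
  then have c2: "comm a0 (Hc \<theta>) = 0"
    using T_comm[OF cpart_T[OF a], of "Hc \<theta>"] by (simp add: a0_def comm_simps comm_sum_left)
  have "comm (X \<epsilon>) (X \<theta>) = 0" if "\<epsilon> \<in> L1" for \<epsilon>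
    using that L1_deg high_deg[of "\<epsilon> + \<theta>"] by (intro X_zero) auto
  then have c3: "comm a1 (X \<theta>) = 0"
    by (simp add: a1_def comm_simps comm_sum_left)
  have "comm (X \<epsilon>) (Hc \<theta>) = - X \<epsilon>" if "\<epsilon> \<in> L1" for \<epsilon>
    using X_Hc[of \<theta> \<epsilon>] that L1_deg[OF that] by (simp add: deg_def)
  then have c4: "comm a1 (Hc \<theta>) = - a1"
    by (simp add: a1_def comm_simps comm_sum_left sum_negf)
  have e1: "comm a (X \<theta>) = smul \<tau> (X \<theta>) - smul y (Hc \<theta>)"
    by (subst deco) (simp add: comm_simps Xm c1 c3)
  have e2: "comm a (Hc \<theta>) = smul (2 * y) (X (- \<theta>)) - smul (2 * z) (X \<theta>) - a1"
    by (subst deco) (simp add: comm_simps Xm c2 c4 mult.commute)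
  have main: "smul l a = smul (- 2 * y * y) (X (- \<theta>)) + smul (2 * y * z + \<tau> * \<tau>) (X \<theta>) + smul y a1 - smul (y * \<tau>) (Hc \<theta>)"
    unfolding quad[symmetric] e1
    by (simp add: comm_simps e1 e2 sqm.scale_right_diff_distrib sqm.scale_left_distrib algebra_simps)
  have a1L: "a1 \<in> LL" unfolding a1_def by (rule LL_sum) simp
  have coef_a1: "coef \<eta> a1 = (if \<eta> \<in> L1 then coef \<eta> a else 0)" if "\<eta> \<in> \<Phi>" for \<eta>
  proof -
    have "coef \<eta> a1 = (\<Sum>\<epsilon>\<in>L1. if \<epsilon> = \<eta> then coef \<eta> a else 0)"
      unfolding a1_def using that by (subst coef_sum) (auto intro!: sum.cong)
    then show ?thesis using fin by simp
  qed
  have nn: "\<theta> \<noteq> - \<theta>" "- \<theta> \<notin> L1" "\<theta> \<notin> L1" "\<And>\<beta>. \<beta> \<in> L1 \<Longrightarrow> \<beta> \<noteq> \<theta> \<and> \<beta> \<noteq> - \<theta>"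
    using L1_deg by (force dest: arg_cong[where f = deg])+
  have "l * y = - 2 * y * y"
    using arg_cong[OF main, of "coef (- \<theta>)"] a a1L nn coef_a1[of "- \<theta>"] by (simp add: y)
  then have l: "l = - 2 * y" using mult_right_cancel[OF y(2), of l "- 2 * y"] by simp
  have "coef \<beta> a = 0" if "\<beta> \<in> L1" for \<beta>
  proof -
    have "l * coef \<beta> a = y * coef \<beta> a"
      using arg_cong[OF main, of "coef \<beta>"] a a1L nn(4)[OF that] coef_a1[of \<beta>] that by simp
    then have "3 * y * coef \<beta> a = 0" unfolding l by (simp add: algebra_simps)
    then show ?thesis using y(2) by simp
  qed
  then have a1: "a1 = 0" unfolding a1_def by (intro sum.neutral) simp
  have "l * z = 2 * y * z + \<tau> * \<tau>"
    using arg_cong[OF main, of "coef \<theta>"] a nn by (simp add: z_def a1)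
  then have "4 * y * z = - (\<tau> * \<tau>)" unfolding l by (simp add: algebra_simps add_eq_0_iff)
  then have z: "z = - ((\<tau> / (2 * y)) ^ 2 * y)" using y(2) by (simp add: field_simps power2_eq_square)
  have "a = smul (1 / l) (smul l a)" using y(2) by (simp add: l)
  also have "\<dots> = smul (1 / l * (- 2 * y * y)) (X (- \<theta>)) + smul (1 / l * (2 * y * z + \<tau> * \<tau>)) (X \<theta>) - smul (1 / l * (y * \<tau>)) (Hc \<theta>)"
    unfolding main a1 by (simp add: sqm.scale_right_distrib sqm.scale_right_diff_distrib)
  also have "1 / l * (- 2 * y * y) = y" using y(2) by (simp add: l)
  also have "1 / l * (2 * y * z + \<tau> * \<tau>) = z"
    using \<open>l * z = 2 * y * z + \<tau> * \<tau>\<close> y(2) by (metis l mult_cancel_left1 mult_eq_0_iff neg_equal_0_iff_equal nonzero_mult_div_cancel_left times_divide_eq_left zero_neq_numeral mult_1)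
  also have "1 / l * (y * \<tau>) = - (\<tau> / 2)" using y(2) by (simp add: l)
  finally have fin_a: "a = smul y (X (- \<theta>)) + smul z (X \<theta>) + smul (\<tau> / 2) (Hc \<theta>)"
    by simp
  have k: "coef \<beta>\<^sub>0 (comm a (X \<beta>\<^sub>0)) = \<tau> / 2"
  proof -
    have 1: "comm (X (- \<theta>)) (X \<beta>\<^sub>0) = smul (of_int (N (- \<theta>) \<beta>\<^sub>0)) (X (\<beta>\<^sub>0 - \<theta>))"
      using N(2)[of "- \<theta>" \<beta>\<^sub>0] b0 by simp
    have 2: "comm (X \<theta>) (X \<beta>\<^sub>0) = 0" using b0 L1_deg high_deg[of "\<theta> + \<beta>\<^sub>0"] by (intro X_zero) auto
    have 3: "comm (Hc \<theta>) (X \<beta>\<^sub>0) = X \<beta>\<^sub>0" using Hc_X[of \<theta> \<beta>\<^sub>0] b0 L1_deg[OF b0] by (simp add: deg_def)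
    have "\<beta>\<^sub>0 \<noteq> \<beta>\<^sub>0 - \<theta>" using root_nonzero[of \<theta>] by simp
    then show ?thesis unfolding fin_a using b0 by (simp add: comm_simps 1 2 3)
  qed
  show ?thesis
    unfolding k E_smul E_theta_mtheta
    by (subst fin_a) (use y(2) in \<open>simp add: z sqm.scale_right_distrib sqm.scale_right_diff_distrib mult.commute\<close>)
qed

section \<open>Clearing the coordinates of degree -1\<close>

definition uprod :: "('e \<Rightarrow> complex) \<Rightarrow> 'e list \<Rightarrow> 'n sqmat" where
  "uprod c bs = foldr (\<lambda>\<beta> g. ex \<beta> (c \<beta>) * g) bs 1"

definition uprod_inv :: "('e \<Rightarrow> complex) \<Rightarrow> 'e list \<Rightarrow> 'n sqmat" where
  "uprod_inv c bs = foldr (\<lambda>\<beta> g. g * ex \<beta> (- c \<beta>)) bs 1"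

lemma uprod_inverse:
  assumes "set bs \<subseteq> \<Phi>" shows "uprod c bs * uprod_inv c bs = 1" "uprod_inv c bs * uprod c bs = 1"
proof -
  have *: "ex \<delta> t * (ex \<delta> (- t) * g) = g" "ex \<delta> (- t) * (ex \<delta> t * g) = g" if "\<delta> \<in> \<Phi>" for \<delta> t g
    using ex_inverse[OF that, of t] by (metis mult.assoc mult_1)+
  show "uprod c bs * uprod_inv c bs = 1"
    using assms
  proof (induction bs)
    case (Cons \<beta> bs)
    have "uprod c (\<beta> # bs) * uprod_inv c (\<beta> # bs) = ex \<beta> (c \<beta>) * (uprod c bs * uprod_inv c bs) * ex \<beta> (- c \<beta>)"
      by (simp add: uprod_def uprod_inv_def mult.assoc)
    with Cons show ?case by simp
  qed (simp add: uprod_def uprod_inv_def)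
  show "uprod_inv c bs * uprod c bs = 1"
    using assms by (induction bs) (auto simp: uprod_def uprod_inv_def mult.assoc *)
qed

lemma uprod_Cons_conj:
  "uprod c (\<beta> # bs) * a * uprod_inv c (\<beta> # bs) = E \<beta> (c \<beta>) (uprod c bs * a * uprod_inv c bs)"
  by (simp add: uprod_def uprod_inv_def E_def mult.assoc)

lemma uprod_conj_LL:
  assumes "set bs \<subseteq> \<Phi>" "a \<in> LL"
  shows "uprod c bs * a * uprod_inv c bs \<in> LL" "uprod_inv c bs * a * uprod c bs \<in> LL"
proof -
  show "uprod c bs * a * uprod_inv c bs \<in> LL"
    using assms(1)
  proof (induction bs)
    case (Cons \<beta> bs) then show ?case by (simp add: uprod_Cons_conj E_LL)
  qed (use assms in \<open>simp add: uprod_def uprod_inv_def\<close>)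
  show "uprod_inv c bs * a * uprod c bs \<in> LL"
    using assms
  proof (induction bs arbitrary: a)
    case (Cons \<beta> bs)
    have "uprod_inv c (\<beta> # bs) * a * uprod c (\<beta> # bs) = uprod_inv c bs * E \<beta> (- c \<beta>) a * uprod c bs"
      by (simp add: uprod_def uprod_inv_def E_def mult.assoc)
    then show ?case using Cons by (simp add: E_LL)
  qed (simp add: uprod_def uprod_inv_def)
qed

text \<open>The factor of \<gamma> leaves the coordinate at \<open>- \<theta>\<close> alone and adds
  a multiple of it to the coordinate at \<open>\<gamma> - \<theta>\<close> only. So the effects of
  the factors in the two lowest degrees are independent, whatever the order of the list.\<close>

lemma uprod_coefs:
  assumes "set bs \<subseteq> L1" "distinct bs" "a \<in> LL"
  shows "coef (- \<theta>) (uprod c bs * a * uprod_inv c bs) = coef (- \<theta>) a"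
    and "\<gamma> \<in> L1 \<Longrightarrow> coef (\<gamma> - \<theta>) (uprod c bs * a * uprod_inv c bs) = coef (\<gamma> - \<theta>) a
      + (if \<gamma> \<in> set bs then c \<gamma> * of_int (N \<gamma> (- \<theta>)) * coef (- \<theta>) a else 0)"
proof -
  have "coef (- \<theta>) (uprod c bs * a * uprod_inv c bs) = coef (- \<theta>) a \<and>
     (\<gamma> \<in> L1 \<longrightarrow> coef (\<gamma> - \<theta>) (uprod c bs * a * uprod_inv c bs) = coef (\<gamma> - \<theta>) a
      + (if \<gamma> \<in> set bs then c \<gamma> * of_int (N \<gamma> (- \<theta>)) * coef (- \<theta>) a else 0))"
    using assms(1,2)
  proof (induction bs)
    case (Cons \<beta> bs)
    have "uprod c bs * a * uprod_inv c bs \<in> LL"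
      by (rule uprod_conj_LL) (use Cons assms in auto)
    then show ?case using Cons by (auto simp: uprod_Cons_conj coef_mtheta_E_L1 coef_E_L1)
  qed (simp add: uprod_def uprod_inv_def)
  then show "coef (- \<theta>) (uprod c bs * a * uprod_inv c bs) = coef (- \<theta>) a"
    "\<gamma> \<in> L1 \<Longrightarrow> coef (\<gamma> - \<theta>) (uprod c bs * a * uprod_inv c bs) = coef (\<gamma> - \<theta>) a
      + (if \<gamma> \<in> set bs then c \<gamma> * of_int (N \<gamma> (- \<theta>)) * coef (- \<theta>) a else 0)" by auto
qed

lemma conj_conj: "P * (Q :: 'n sqmat) = 1 \<Longrightarrow> P * (Q * a * P) * Q = a" for a
  by (metis mult.assoc mult_1 mult_1_right)

text \<open>The c are chosen so that \<open>uprod\<close> clears the coordinates of degree -1 of Y;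
  the structure constants in them are 1 or -1 and thus their own inverses. Then
  \<open>orbit_normal_form\<close> applies. All parameters are expressions in A that divide by
  nothing but y, which is what allows the identity to be specialized.\<close>

lemma big_cell:
  assumes A: "A * A' = 1" "A' * A = 1" and AL: "\<And>a. a \<in> LL \<Longrightarrow> A * a * A' \<in> LL" "\<And>a. a \<in> LL \<Longrightarrow> A' * a * A \<in> LL"
    and Y: "Y = A * X (- \<theta>) * A'" and y: "y = coef (- \<theta>) Y" "y \<noteq> 0"
    and bs: "set bs = L1" "distinct bs" and b0: "\<beta>\<^sub>0 \<in> L1"
    and c: "\<And>\<beta>. \<beta> \<in> L1 \<Longrightarrow> c \<beta> = - of_int (N \<beta> (- \<theta>)) * coef (\<beta> - \<theta>) Y / y"
    and d: "d = coef \<beta>\<^sub>0 (comm (uprod c bs * Y * uprod_inv c bs) (X \<beta>\<^sub>0)) / y"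
  shows "A * ex (- \<theta>) s * A' = (uprod_inv c bs * ex \<theta> d) * ex (- \<theta>) (y * s) * (ex \<theta> (- d) * uprod c bs)"
proof -
  define P where "P = uprod c bs"
  define Q where "Q = uprod_inv c bs"
  have sub: "set bs \<subseteq> L1" "set bs \<subseteq> \<Phi>" using bs by auto
  have PQ: "P * Q = 1" "Q * P = 1" using uprod_inverse[OF sub(2)] by (auto simp: P_def Q_def)
  have YL: "Y \<in> LL" unfolding Y by (rule AL) simp
  define b where "b = P * Y * Q"
  have bL: "b \<in> LL" unfolding b_def P_def Q_def by (rule uprod_conj_LL[OF sub(2) YL])
  have yb: "coef (- \<theta>) b = y" unfolding b_def P_def Q_def y(1) by (rule uprod_coefs[OF sub(1) bs(2) YL])
  have m1: "coef (\<beta> - \<theta>) b = 0" if "\<beta> \<in> L1" for \<beta>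
  proof -
    have "of_int (N \<beta> (- \<theta>)) * of_int (N \<beta> (- \<theta>)) = (1::complex)"
      using abs_1[OF N_L1_mtheta[OF that]] by auto
    then show ?thesis
      unfolding b_def P_def Q_def uprod_coefs(2)[OF sub(1) bs(2) YL that]
      using that y bs c[OF that] by simp
  qed
  \<comment> \<open>Z is the preimage of \<open>X \<theta>\<close> under the conjugation that takes
    \<open>X (- \<theta>)\<close> to b. The quadratic relation between \<open>X (- \<theta>)\<close>
    and Z is thereby carried to b and \<open>X \<theta>\<close>.\<close>
  define Z where "Z = A' * (Q * X \<theta> * P) * A"
  have ZL: "Z \<in> LL" unfolding Z_def Q_def P_def by (intro AL uprod_conj_LL sub) simp
  have "comm (X (- \<theta>)) (comm (X (- \<theta>)) Z) = smul 2 (adp (X (- \<theta>)) 2 Z)"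
    by (simp add: adp_2)
  also have "\<dots> = smul (- 2 * coef \<theta> Z) (X (- \<theta>))" by (simp add: adp_2_long[OF long_theta ZL])
  finally have ZZ: "comm (X (- \<theta>)) (comm (X (- \<theta>)) Z) = smul (- 2 * coef \<theta> Z) (X (- \<theta>))" .
  define PA where "PA = P * A"
  define AQ where "AQ = A' * Q"
  have PA: "PA * AQ = 1" "AQ * PA = 1"
    unfolding PA_def AQ_def using PQ A by (metis mult.assoc mult_1)+
  have bP: "b = PA * X (- \<theta>) * AQ" by (simp add: b_def Y PA_def AQ_def mult.assoc)
  have XP: "X \<theta> = PA * Z * AQ"
    unfolding Z_def PA_def AQ_def using PQ A conj_conj[of A A'] conj_conj[of P Q]
    by (metis (no_types, lifting) mult.assoc)
  have "comm b (comm b (X \<theta>)) = PA * comm (X (- \<theta>)) (comm (X (- \<theta>)) Z) * AQ"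
    by (simp only: bP XP comm_conj[OF PA])
  also have "\<dots> = smul (- 2 * coef \<theta> Z) b" by (simp only: ZZ bP smul_mult_left smul_mult_right)
  finally have quad: "comm b (comm b (X \<theta>)) = smul (- 2 * coef \<theta> Z) b" .
  have "b = E \<theta> d (smul y (X (- \<theta>)))"
    using orbit_normal_form[OF bL yb[symmetric] y(2) m1 quad b0] d by (simp add: b_def P_def Q_def)
  then have "Y = Q * E \<theta> d (smul y (X (- \<theta>))) * P"
    using conj_conj[OF PQ(2), of Y] by (simp add: b_def)
  then have Yeq: "Y = (Q * ex \<theta> d) * smul y (X (- \<theta>)) * (ex \<theta> (- d) * P)"
    by (simp add: E_def mult.assoc)
  define V where "V = Q * ex \<theta> d"
  define V' where "V' = ex \<theta> (- d) * P"
  have V: "V * V' = 1" "V' * V = 1"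
  proof -
    have "V * V' = Q * (ex \<theta> d * ex \<theta> (- d)) * P" by (simp only: V_def V'_def mult.assoc)
    then show "V * V' = 1" using PQ by simp
    have "V' * V = ex \<theta> (- d) * (P * Q) * ex \<theta> d" by (simp only: V_def V'_def mult.assoc)
    then show "V' * V = 1" using PQ by simp
  qed
  have "A * ex (- \<theta>) s * A' = mexp (A * smul s (X (- \<theta>)) * A')"
    unfolding mexp_conj[OF A] ex_def ..
  also have "A * smul s (X (- \<theta>)) * A' = smul s Y" by (simp add: Y)
  also have "smul s Y = V * smul (y * s) (X (- \<theta>)) * V'"
    unfolding Yeq V_def[symmetric] V'_def[symmetric] by (simp add: mult.commute)
  also have "mexp \<dots> = V * ex (- \<theta>) (y * s) * V'" unfolding ex_def by (rule mexp_conj[OF V])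
  finally show ?thesis by (simp add: V_def V'_def P_def Q_def)
qed

end

section \<open>Evaluation of integer polynomials\<close>

context cring
begin

definition mono_val :: "'a^'n^'n \<Rightarrow> (('n \<times> 'n) \<Rightarrow>\<^sub>0 nat) \<Rightarrow> 'a" where
  "mono_val A m = (\<Otimes>v\<in>Poly_Mapping.keys m. (A $ fst v $ snd v) [^] Poly_Mapping.lookup m v)"

lemma eval_poly_eq: "eval_poly R p A =
    (\<Oplus>m\<in>Poly_Mapping.keys p. [(Poly_Mapping.lookup p m)] \<cdot> mono_val A m)"
  by (simp add: eval_poly_def mono_val_def)

context
  fixes A :: "'a^'n::finite^'n"
  assumes A: "\<And>i j. A $ i $ j \<in> carrier R"
begin

lemma mono_val_closed [simp]: "mono_val A m \<in> carrier R"
  unfolding mono_val_def by (rule finprod_closed) (auto simp: A)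

lemma mono_val_extend:
  assumes "finite K" "Poly_Mapping.keys m \<subseteq> K"
  shows "mono_val A m = (\<Otimes>v\<in>K. (A $ fst v $ snd v) [^] Poly_Mapping.lookup m v)"
  unfolding mono_val_def
  by (rule finprod_mono_neutral_cong_left) (use assms in \<open>auto simp: A in_keys_iff\<close>)

lemma mono_val_add: "mono_val A (m + m') = mono_val A m \<otimes> mono_val A m'"
proof -
  let ?K = "Poly_Mapping.keys m \<union> Poly_Mapping.keys m'"
  have K: "finite ?K" "Poly_Mapping.keys (m + m') \<subseteq> ?K" using keys_add[of m m'] by auto
  have "mono_val A (m + m') = (\<Otimes>v\<in>?K. (A $ fst v $ snd v) [^] Poly_Mapping.lookup m v
      \<otimes> (A $ fst v $ snd v) [^] Poly_Mapping.lookup m' v)"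
    by (simp add: mono_val_extend[OF K] lookup_add nat_pow_mult A)
  also have "\<dots> = mono_val A m \<otimes> mono_val A m'"
    by (subst finprod_multf) (auto simp: A mono_val_extend[of ?K])
  finally show ?thesis .
qed

lemma mono_val_0: "mono_val A 0 = \<one>"
  by (simp add: mono_val_def)

lemma eval_poly_closed: "eval_poly R p A \<in> carrier R"
  unfolding eval_poly_eq by (rule finsum_closed) auto

lemma int_add_pow_0: "[(0::int)] \<cdot> x = \<zero>"
  by (simp add: add_pow_int_ge)

lemma eval_poly_extend:
  assumes "finite K" "Poly_Mapping.keys p \<subseteq> K"
  shows "eval_poly R p A = (\<Oplus>m\<in>K. [(Poly_Mapping.lookup p m)] \<cdot> mono_val A m)"
  unfolding eval_poly_eq
  by (rule add.finprod_mono_neutral_cong_left) (use assms in \<open>auto simp: in_keys_iff int_add_pow_0\<close>)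

lemma eval_poly_add: "eval_poly R (p + q) A = eval_poly R p A \<oplus> eval_poly R q A"
proof -
  let ?K = "Poly_Mapping.keys p \<union> Poly_Mapping.keys q"
  have K: "finite ?K" "Poly_Mapping.keys (p + q) \<subseteq> ?K" using keys_add[of p q] by auto
  have "eval_poly R (p + q) A = (\<Oplus>m\<in>?K. [(Poly_Mapping.lookup p m)] \<cdot> mono_val A m
      \<oplus> [(Poly_Mapping.lookup q m)] \<cdot> mono_val A m)"
    by (simp add: eval_poly_extend[OF K] lookup_add add.int_pow_mult)
  also have "\<dots> = eval_poly R p A \<oplus> eval_poly R q A"
    by (subst finsum_addf) (auto simp: eval_poly_extend[of ?K])
  finally show ?thesis .
qed

lemma eval_poly_0: "eval_poly R 0 A = \<zero>"
  by (simp add: eval_poly_eq)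

lemma eval_poly_single: "eval_poly R (Poly_Mapping.single m c) A = [c] \<cdot> mono_val A m"
  by (subst eval_poly_extend[of "{m}"]) auto

lemma add_pow_mult: "x \<in> carrier R \<Longrightarrow> y \<in> carrier R \<Longrightarrow> [(c * d::int)] \<cdot> (x \<otimes> y) = ([c] \<cdot> x) \<otimes> ([d] \<cdot> y)"
  by (simp add: add_pow_ldistr_int add_pow_rdistr_int add.int_pow_pow mult.commute)

lemma eval_poly_mult: "eval_poly R (p * q) A = eval_poly R p A \<otimes> eval_poly R q A"
proof (induction p rule: update_induct)
  case const then show ?case by (simp add: eval_poly_0 eval_poly_closed)
next
  case (update f m c)
  have up: "Poly_Mapping.update m c f = f + Poly_Mapping.single m c"
    using update(1) by (intro poly_mapping_eqI) (auto simp: lookup_update lookup_add lookup_single in_keys_iff when_def)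
  have "eval_poly R (Poly_Mapping.single m c * q) A = eval_poly R (Poly_Mapping.single m c) A \<otimes> eval_poly R q A"
  proof (induction q rule: update_induct)
    case const then show ?case by (simp add: eval_poly_0 eval_poly_closed)
  next
    case (update g m' c')
    have up': "Poly_Mapping.update m' c' g = g + Poly_Mapping.single m' c'"
      using update(1) by (intro poly_mapping_eqI) (auto simp: lookup_update lookup_add lookup_single in_keys_iff when_def)
    have "eval_poly R (Poly_Mapping.single m c * Poly_Mapping.single m' c') A
        = eval_poly R (Poly_Mapping.single m c) A \<otimes> eval_poly R (Poly_Mapping.single m' c') A"
      by (simp add: mult_single eval_poly_single mono_val_add add_pow_mult)
    then show ?case using update
      by (simp add: up' distrib_left eval_poly_add eval_poly_closed r_distr)
  qed
  then show ?case using update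
    by (simp add: up distrib_right eval_poly_add eval_poly_closed l_distr)
qed

lemma eval_poly_1: "eval_poly R 1 A = \<one>"
proof -
  have "eval_poly R (Poly_Mapping.single 0 1) A = \<one>"
    unfolding eval_poly_single mono_val_0 by simp
  then show ?thesis by simp
qed

lemma eval_poly_entry: "eval_poly R (Poly_Mapping.single (Poly_Mapping.single (i, j) 1) 1) A = A $ i $ j"
  unfolding eval_poly_single by (subst mono_val_extend[of "{(i, j)}"]) (auto simp: A)

lemma eval_poly_uminus: "eval_poly R (- p) A = \<ominus> eval_poly R p A"
proof -
  have "eval_poly R (- p) A \<oplus> eval_poly R p A = \<zero>"
    using eval_poly_add[of "- p" p] eval_poly_0 by simp
  then show ?thesis using eval_poly_closed by (simp add: minus_equality)
qed

end

end

section \<open>Specialization of complex-valued functions to a commutative ring\<close>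

lemma div_power_eq: "div_power (mx X) k $ i $ j = entry (dpow X k) i j"
proof -
  have "((\<lambda>B. mx X ** B) ^^ k) (mat 1) = mx (X ^ k)"
    by (induction k) (simp_all add: one_sqmat.rep_eq times_sqmat.rep_eq)
  then show ?thesis by (simp add: div_power_def dpow_def entry.rep_eq smul.rep_eq)
qed

text \<open>The relation \<open>V\<close> is a ring homomorphism from a ring of functions on \<open>S\<close> to \<open>R\<close>, given by its
  graph: an identity between such functions, verified over the complex numbers, specializes to
  an identity in \<open>R\<close>.\<close>

locale spec = cring R for R :: "('r, 'm) ring_scheme" (structure) +
  fixes S :: "'x set" and V :: "('x \<Rightarrow> complex) \<Rightarrow> 'r \<Rightarrow> bool"
  assumes V_carrier: "V f r \<Longrightarrow> r \<in> carrier R"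
    and V_one: "V (\<lambda>_. 1) \<one>"
    and V_uminus: "V f r \<Longrightarrow> V (\<lambda>x. - f x) (\<ominus> r)"
    and V_add: "V f r \<Longrightarrow> V g s \<Longrightarrow> V (\<lambda>x. f x + g x) (r \<oplus> s)"
    and V_mult: "V f r \<Longrightarrow> V g s \<Longrightarrow> V (\<lambda>x. f x * g x) (r \<otimes> s)"
    and V_cong: "V f r \<Longrightarrow> (\<And>x. x \<in> S \<Longrightarrow> f x = g x) \<Longrightarrow> V g r"
    and V_zero: "V f r \<Longrightarrow> (\<And>x. x \<in> S \<Longrightarrow> f x = 0) \<Longrightarrow> r = \<zero>"
begin

lemma V_diff: "V f r \<Longrightarrow> V g s \<Longrightarrow> V (\<lambda>x. f x - g x) (r \<ominus> s)"
  using V_add[OF _ V_uminus[of g s]] by (simp add: a_minus_def)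

lemma V_0: "V (\<lambda>_. 0) \<zero>"
  using V_add[OF V_one V_uminus[OF V_one]] by (simp add: r_neg)

lemma V_unique:
  assumes "V f r" "V g s" "\<And>x. x \<in> S \<Longrightarrow> f x = g x" shows "r = s"
proof -
  have "r \<ominus> s = \<zero>" using V_zero[OF V_diff[OF assms(1,2)]] assms(3) by simp
  moreover have "(r \<ominus> s) \<oplus> s = r"
    using V_carrier[OF assms(1)] V_carrier[OF assms(2)] by (simp add: a_minus_def a_assoc l_neg)
  ultimately show ?thesis using V_carrier[OF assms(2)] by simp
qed

lemma V_add_pow_nat: "V f r \<Longrightarrow> V (\<lambda>x. of_nat k * f x) ([(k::nat)] \<cdot> r)"
proof (induction k)
  case 0 then show ?case using V_0 by simp
next
  case (Suc k)
  have "V (\<lambda>x. of_nat k * f x + f x) ([k] \<cdot> r \<oplus> r)" using Suc by (intro V_add) auto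
  then show ?case by (simp add: algebra_simps)
qed

lemma V_add_pow: "V f r \<Longrightarrow> V (\<lambda>x. of_int z * f x) ([(z::int)] \<cdot> r)"
proof (cases "z \<ge> 0")
  case True
  assume "V f r"
  from V_add_pow_nat[OF this, of "nat z"] show ?thesis using True by (simp add: add_pow_int_ge)
next
  case False
  assume "V f r"
  from V_uminus[OF V_add_pow_nat[OF this, of "nat (- z)"]] show ?thesis
    using False by (simp add: add_pow_int_lt)
qed

lemma V_int: "V (\<lambda>_. of_int z) ([z] \<cdot> \<one>)"
  using V_add_pow[OF V_one, of z] by simp

lemma V_power: "V f r \<Longrightarrow> V (\<lambda>x. f x ^ k) (r [^] k)"
proof (induction k)
  case 0 then show ?case using V_one by simp
next
  case (Suc k)
  then have "V (\<lambda>x. f x ^ k * f x) (r [^] k \<otimes> r)" by (intro V_mult) auto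
  then show ?case by (simp add: mult.commute)
qed

lemma V_sum: "finite I \<Longrightarrow> (\<And>i. i \<in> I \<Longrightarrow> V (f i) (r i)) \<Longrightarrow> V (\<lambda>x. \<Sum>i\<in>I. f i x) (\<Oplus>i\<in>I. r i)"
proof (induction I rule: finite_induct)
  case empty then show ?case using V_0 by simp
next
  case (insert i I)
  then show ?case using V_add[of "f i" "r i" "\<lambda>x. \<Sum>i\<in>I. f i x" "\<Oplus>i\<in>I. r i"] V_carrier
    by (subst finsum_insert) (auto simp: Pi_iff)
qed

lemma V_prod: "finite I \<Longrightarrow> (\<And>i. i \<in> I \<Longrightarrow> V (f i) (r i)) \<Longrightarrow> V (\<lambda>x. \<Prod>i\<in>I. f i x) (\<Otimes>i\<in>I. r i)"
proof (induction I rule: finite_induct)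
  case empty then show ?case using V_one by simp
next
  case (insert i I)
  then show ?case using V_mult[of "f i" "r i" "\<lambda>x. \<Prod>i\<in>I. f i x" "\<Otimes>i\<in>I. r i"] V_carrier
    by (subst finprod_insert) (auto simp: Pi_iff)
qed

section \<open>Matrices of functions and their specializations\<close>

definition mrel :: "('x \<Rightarrow> 'n::finite sqmat) \<Rightarrow> 'r^'n^'n \<Rightarrow> bool" where
  "mrel F B \<longleftrightarrow> (\<forall>i j. V (\<lambda>x. entry (F x) i j) (B $ i $ j))"

lemma mrel_mult: "mrel F B \<Longrightarrow> mrel G C \<Longrightarrow> mrel (\<lambda>x. F x * G x) (B \<otimes>\<^bsub>matrix_monoid R\<^esub> C)"
  unfolding mrel_def entry_mult by (auto simp: matrix_monoid_def intro!: V_sum V_mult)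

lemma mrel_one: "mrel (\<lambda>_. 1) \<one>\<^bsub>matrix_monoid R\<^esub>"
  by (auto simp: mrel_def matrix_monoid_def V_one V_0)

lemma mrel_unique: "mrel F B \<Longrightarrow> mrel G C \<Longrightarrow> (\<And>x. x \<in> S \<Longrightarrow> F x = G x) \<Longrightarrow> B = C"
  unfolding mrel_def vec_eq_iff by (metis (no_types, lifting) V_unique)

lemma mrel_carrier: "mrel F B \<Longrightarrow> B \<in> carrier (matrix_monoid R)"
  by (auto simp: mrel_def matrix_monoid_def intro: V_carrier)

lemma mrel_exp:
  fixes X :: "'n::finite sqmat"
  assumes int: "\<And>k. intmat (dpow X k)" and V: "V f r"
  shows "mrel (\<lambda>x. mexp (smul (f x) X)) (exp_elem R (mx X) r)"
  unfolding mrel_def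
proof (intro allI)
  fix i j :: 'n
  define z where "z k = (THE z::int. of_int z = div_power (mx X) k $ i $ j)" for k
  have z: "of_int (z k) = entry (dpow X k) i j" for k
  proof -
    obtain w :: int where "entry (dpow X k) i j = of_int w" using int[of k] unfolding intmat_def by (meson Ints_cases)
    then show ?thesis unfolding z_def div_power_eq by simp
  qed
  have "V (\<lambda>x. \<Sum>k<CARD('n). of_int (z k) * f x ^ k) (\<Oplus>k\<in>{..<CARD('n)}. [(z k)] \<cdot> (r [^] k))"
    by (intro V_sum V_add_pow V_power V) auto
  moreover have "entry (mexp (smul (f x) X)) i j = (\<Sum>k<CARD('n). of_int (z k) * f x ^ k)" for x
    by (simp add: mexp_def entry_sum dpow_smul z mult.commute)
  ultimately show "V (\<lambda>x. entry (mexp (smul (f x) X)) i j) (exp_elem R (mx X) r $ i $ j)"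
    by (simp add: exp_elem_def z_def)
qed

section \<open>The functions that specialize and the ideal of those that specialize to zero\<close>

definition ofn :: "('x \<Rightarrow> complex) \<Rightarrow> bool" where "ofn f \<longleftrightarrow> (\<exists>r. V f r)"

definition jfn :: "('x \<Rightarrow> complex) \<Rightarrow> bool" where "jfn f \<longleftrightarrow> V f \<zero>"

definition MO :: "('x \<Rightarrow> 'n::finite sqmat) \<Rightarrow> bool" where "MO F \<longleftrightarrow> (\<forall>i j. ofn (\<lambda>x. entry (F x) i j))"

definition MJ :: "('x \<Rightarrow> 'n::finite sqmat) \<Rightarrow> bool" where "MJ F \<longleftrightarrow> (\<forall>i j. jfn (\<lambda>x. entry (F x) i j))"

lemma mrel_MO: "mrel F B \<Longrightarrow> MO F"
  by (auto simp: mrel_def MO_def ofn_def)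

lemma MO_mrel: "MO F \<Longrightarrow> \<exists>B. mrel F B"
proof -
  assume "MO F"
  then have "V (\<lambda>x. entry (F x) i j) (SOME r. V (\<lambda>x. entry (F x) i j) r)" for i j
    by (auto simp: MO_def ofn_def intro: someI_ex)
  then have "mrel F (\<chi> i j. SOME r. V (\<lambda>x. entry (F x) i j) r)" by (simp add: mrel_def)
  then show ?thesis by blast
qed

lemma ofn_intros:
  "ofn (\<lambda>_. 1)" "ofn (\<lambda>_. 0)" "z \<in> \<int> \<Longrightarrow> ofn (\<lambda>_. z)"
  "ofn f \<Longrightarrow> ofn g \<Longrightarrow> ofn (\<lambda>x. f x + g x)" "ofn f \<Longrightarrow> ofn g \<Longrightarrow> ofn (\<lambda>x. f x - g x)"
  "ofn f \<Longrightarrow> ofn (\<lambda>x. - f x)" "ofn f \<Longrightarrow> ofn g \<Longrightarrow> ofn (\<lambda>x. f x * g x)"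
  unfolding ofn_def by (metis V_one, metis V_0, metis V_int Ints_cases, (use V_add V_diff V_uminus V_mult in fast)+)

lemma ofn_sum: "(\<And>i. i \<in> I \<Longrightarrow> ofn (f i)) \<Longrightarrow> ofn (\<lambda>x. \<Sum>i\<in>I. f i x)"
  by (induction I rule: infinite_finite_induct) (auto intro: ofn_intros)

lemma ofn_prod: "(\<And>i. i \<in> I \<Longrightarrow> ofn (f i)) \<Longrightarrow> ofn (\<lambda>x. \<Prod>i\<in>I. f i x)"
  by (induction I rule: infinite_finite_induct) (auto intro: ofn_intros)

lemma jfn_cong: "jfn f \<Longrightarrow> (\<And>x. x \<in> S \<Longrightarrow> f x = g x) \<Longrightarrow> jfn g"
  unfolding jfn_def by (rule V_cong)

lemma ofn_cong: "ofn f \<Longrightarrow> (\<And>x. x \<in> S \<Longrightarrow> f x = g x) \<Longrightarrow> ofn g"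
  unfolding ofn_def using V_cong by blast

lemma jfn_intros:
  "jfn (\<lambda>_. 0)" "jfn f \<Longrightarrow> jfn g \<Longrightarrow> jfn (\<lambda>x. f x + g x)" "jfn f \<Longrightarrow> jfn g \<Longrightarrow> jfn (\<lambda>x. f x - g x)"
  "jfn f \<Longrightarrow> jfn (\<lambda>x. - f x)" "ofn f \<Longrightarrow> jfn g \<Longrightarrow> jfn (\<lambda>x. f x * g x)" "jfn f \<Longrightarrow> ofn g \<Longrightarrow> jfn (\<lambda>x. f x * g x)"
  unfolding jfn_def ofn_def
  using V_0 V_add[of f \<zero> g \<zero>] V_diff[of f \<zero> g \<zero>] V_uminus[of f \<zero>] V_mult[of f _ g \<zero>] V_mult[of f \<zero> g]
  by (auto simp: a_minus_def dest: V_carrier) (metis V_carrier r_null V_mult l_null)+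

lemma jfn_sum: "(\<And>i. i \<in> I \<Longrightarrow> jfn (f i)) \<Longrightarrow> jfn (\<lambda>x. \<Sum>i\<in>I. f i x)"
  by (induction I rule: infinite_finite_induct) (auto intro: jfn_intros)

lemma MO_intros:
  "intmat M \<Longrightarrow> MO (\<lambda>_. M)" "MO F \<Longrightarrow> MO G \<Longrightarrow> MO (\<lambda>x. F x + G x)" "MO F \<Longrightarrow> MO G \<Longrightarrow> MO (\<lambda>x. F x - G x)"
  "MO F \<Longrightarrow> MO G \<Longrightarrow> MO (\<lambda>x. F x * G x)" "ofn f \<Longrightarrow> MO F \<Longrightarrow> MO (\<lambda>x. smul (f x) (F x))"
  "MO F \<Longrightarrow> MO (\<lambda>x. - F x)"
  by (auto simp: MO_def intmat_def entry_mult intro!: ofn_intros ofn_sum)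

lemma MJ_intros:
  "MJ (\<lambda>_. 0)" "MJ F \<Longrightarrow> MJ G \<Longrightarrow> MJ (\<lambda>x. F x + G x)" "MJ F \<Longrightarrow> MJ G \<Longrightarrow> MJ (\<lambda>x. F x - G x)"
  "MO F \<Longrightarrow> MJ G \<Longrightarrow> MJ (\<lambda>x. F x * G x)" "MJ F \<Longrightarrow> MO G \<Longrightarrow> MJ (\<lambda>x. F x * G x)"
  "ofn f \<Longrightarrow> MJ F \<Longrightarrow> MJ (\<lambda>x. smul (f x) (F x))" "jfn f \<Longrightarrow> MO F \<Longrightarrow> MJ (\<lambda>x. smul (f x) (F x))"
  "MJ F \<Longrightarrow> MJ (\<lambda>x. - F x)"
proof -
  show "MJ (\<lambda>_. 0)" "MJ F \<Longrightarrow> MJ G \<Longrightarrow> MJ (\<lambda>x. F x + G x)" "MJ F \<Longrightarrow> MJ G \<Longrightarrow> MJ (\<lambda>x. F x - G x)"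
    "MJ F \<Longrightarrow> MJ (\<lambda>x. - F x)"
    by (auto simp: MJ_def intro!: jfn_intros)
  show "MO F \<Longrightarrow> MJ G \<Longrightarrow> MJ (\<lambda>x. F x * G x)" "ofn f \<Longrightarrow> MJ F \<Longrightarrow> MJ (\<lambda>x. smul (f x) (F x))"
    by (auto simp: MJ_def MO_def entry_mult intro!: jfn_intros(5) jfn_sum)
  show "MJ F \<Longrightarrow> MO G \<Longrightarrow> MJ (\<lambda>x. F x * G x)" "jfn f \<Longrightarrow> MO F \<Longrightarrow> MJ (\<lambda>x. smul (f x) (F x))"
    by (auto simp: MJ_def MO_def entry_mult intro!: jfn_intros(6) jfn_sum)
qed

lemma MJ_cong: "MJ F \<Longrightarrow> (\<And>x. x \<in> S \<Longrightarrow> F x = G x) \<Longrightarrow> MJ G"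
  unfolding MJ_def by (metis (no_types, lifting) jfn_cong)

lemma intfun_expand:
  assumes "intfun f"
  shows "f A = (\<Sum>i\<in>UNIV. \<Sum>j\<in>UNIV. entry A i j * f (Mx (\<chi> k l. if k = i \<and> l = j then 1 else 0)))"
proof -
  have "A = (\<Sum>i\<in>UNIV. \<Sum>j\<in>UNIV. smul (entry A i j) (Mx (\<chi> k l. if k = i \<and> l = j then 1 else 0)))"
  proof (rule sqmat_eqI)
    fix k l
    have "entry (\<Sum>i\<in>UNIV. \<Sum>j\<in>UNIV. smul (entry A i j) (Mx (\<chi> k l. if k = i \<and> l = j then 1 else 0))) k l
      = (\<Sum>i\<in>UNIV. \<Sum>j\<in>UNIV. if k = i then if l = j then entry A i j else 0 else 0)"
      by (simp add: entry_sum entry.abs_eq) (intro sum.cong refl, auto)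
    also have "\<dots> = (\<Sum>i\<in>UNIV. if k = i then entry A i l else 0)"
      by (intro sum.cong refl) auto
    finally show "entry A k l = entry (\<Sum>i\<in>UNIV. \<Sum>j\<in>UNIV. smul (entry A i j) (Mx (\<chi> k l. if k = i \<and> l = j then 1 else 0))) k l"
      by simp
  qed
  then have "f A = f (\<Sum>i\<in>UNIV. \<Sum>j\<in>UNIV. smul (entry A i j) (Mx (\<chi> k l. if k = i \<and> l = j then 1 else 0)))"
    by simp
  then show ?thesis by (simp add: intfun_sum[OF assms] intfun_D(2)[OF assms])
qed

lemma intfun_unit:
  assumes "intfun f" shows "f (Mx (\<chi> k l. if k = i \<and> l = j then 1 else 0)) \<in> \<int>"
  by (rule intfun_D(3)[OF assms]) (auto simp: intmat_def entry.abs_eq)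

lemma ofn_intfun: assumes "intfun f" "MO F" shows "ofn (\<lambda>x. f (F x))"
  by (subst intfun_expand[OF assms(1)])
    (use assms(2) in \<open>auto simp: MO_def intro!: ofn_sum ofn_intros intfun_unit[OF assms(1)]\<close>)

lemma jfn_intfun: assumes "intfun f" "MJ F" shows "jfn (\<lambda>x. f (F x))"
  by (subst intfun_expand[OF assms(1)])
    (use assms(2) in \<open>auto simp: MJ_def intro!: jfn_sum jfn_intros ofn_intros intfun_unit[OF assms(1)]\<close>)

end

subsection \<open>Adjoining a variable\<close>

context spec
begin

text \<open>Polynomial functions of the second argument together with their value at a. The Horner
  form exposes the constant term, which \<open>horner_zero\<close> needs.\<close>

inductive horner :: "'r \<Rightarrow> ('x \<times> complex \<Rightarrow> complex) \<Rightarrow> 'r \<Rightarrow> bool" for a where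
  horner_0: "horner a (\<lambda>_. 0) \<zero>"
| horner_Suc: "V f r \<Longrightarrow> horner a g s \<Longrightarrow> horner a (\<lambda>p. f (fst p) + snd p * g p) (r \<oplus> a \<otimes> s)"

context
  fixes a assumes a: "a \<in> carrier R"
begin

lemma horner_carrier: "horner a g s \<Longrightarrow> s \<in> carrier R"
  by (induction rule: horner.induct) (auto simp: a V_carrier)

lemma horner_continuous: "horner a g s \<Longrightarrow> continuous_on UNIV (\<lambda>t. g (x, t))"
  by (induction rule: horner.induct) (auto intro!: continuous_intros)

text \<open>Excluding t = 0 from the hypothesis makes the induction work: the constant term vanishes
  by continuity as t tends to 0, and the factor t can then be cancelled for t other than 0.\<close>

lemma horner_zero:
  "horner a g s \<Longrightarrow> (\<And>x t. x \<in> S \<Longrightarrow> t \<noteq> 0 \<Longrightarrow> g (x, t) = 0) \<Longrightarrow> s = \<zero>"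
proof (induction rule: horner.induct)
  case (horner_Suc f r g s)
  have f0: "f x = 0" if x: "x \<in> S" for x
  proof -
    have c: "continuous_on UNIV (\<lambda>t. f x + t * g (x, t))"
      by (intro continuous_intros horner_continuous[OF horner_Suc(2)])
    have lim: "((\<lambda>t. f x + t * g (x, t)) \<longlongrightarrow> f x + 0 * g (x, 0)) (at 0)"
      using c unfolding continuous_on_def by blast
    have "((\<lambda>t. f x + t * g (x, t)) \<longlongrightarrow> 0) (at 0)"
    proof (rule Lim_transform_eventually[OF tendsto_const])
      show "\<forall>\<^sub>F t in at 0. 0 = f x + t * g (x, t)"
        using horner_Suc(4)[OF x] by (auto simp: eventually_at_filter)
    qed
    from tendsto_unique[OF _ lim this] show ?thesis by simp
  qed
  have "g (x, t) = 0" if "x \<in> S" "t \<noteq> 0" for x t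
    using horner_Suc(4)[OF that] f0[OF that(1)] that(2) by simp
  then have "s = \<zero>" by (rule horner_Suc(3))
  moreover have "r = \<zero>" by (rule V_zero[OF horner_Suc(1) f0])
  ultimately show ?case using a by simp
qed simp

lemma horner_add: "horner a g s \<Longrightarrow> horner a g' s' \<Longrightarrow> horner a (\<lambda>p. g p + g' p) (s \<oplus> s')"
proof (induction arbitrary: g' s' rule: horner.induct)
  case horner_0
  then show ?case using horner_carrier[OF horner_0] by simp
next
  case (horner_Suc f r g s)
  from horner_Suc(4) show ?case
  proof cases
    case horner_0
    then show ?thesis using horner.horner_Suc[OF horner_Suc(1,2)] horner_carrier[OF horner_Suc(2)] V_carrier[OF horner_Suc(1)] a
      by simp
  next
    case (horner_Suc f' r' h u)
    note h = this
    have "horner a (\<lambda>p. (f (fst p) + f' (fst p)) + snd p * (g p + h p)) ((r \<oplus> r') \<oplus> a \<otimes> (s \<oplus> u))"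
      using V_add[OF \<open>V f r\<close> h(3)] horner_Suc.IH by (intro horner.horner_Suc) (use h in auto)
    moreover have "(r \<oplus> r') \<oplus> a \<otimes> (s \<oplus> u) = (r \<oplus> a \<otimes> s) \<oplus> (r' \<oplus> a \<otimes> u)"
      using V_carrier[OF \<open>V f r\<close>] V_carrier[OF h(3)] horner_carrier[OF \<open>horner a g s\<close>] horner_carrier[OF h(4)] a
      by (simp add: r_distr a_ac)
    moreover have "(\<lambda>p. (f (fst p) + f' (fst p)) + snd p * (g p + h p)) = (\<lambda>p. f (fst p) + snd p * g p + g' p)"
      using h by (auto simp: algebra_simps)
    ultimately show ?thesis using h by simp
  qed
qed

lemma horner_scale: "horner a g s \<Longrightarrow> V f r \<Longrightarrow> horner a (\<lambda>p. f (fst p) * g p) (r \<otimes> s)"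
proof (induction rule: horner.induct)
  case horner_0
  then show ?case using horner.horner_0 V_carrier by simp
next
  case (horner_Suc f' r' g s)
  have "horner a (\<lambda>p. f (fst p) * f' (fst p) + snd p * (f (fst p) * g p)) (r \<otimes> r' \<oplus> a \<otimes> (r \<otimes> s))"
    using V_mult[OF horner_Suc(4,1)] horner_Suc by (intro horner.horner_Suc) auto
  moreover have "r \<otimes> r' \<oplus> a \<otimes> (r \<otimes> s) = r \<otimes> (r' \<oplus> a \<otimes> s)"
    using V_carrier[OF horner_Suc(1)] V_carrier[OF horner_Suc(4)] horner_carrier[OF horner_Suc(2)] a
    by (simp add: r_distr m_lcomm)
  moreover have "(\<lambda>p. f (fst p) * f' (fst p) + snd p * (f (fst p) * g p)) = (\<lambda>p. f (fst p) * (f' (fst p) + snd p * g p))"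
    by (auto simp: algebra_simps)
  ultimately show ?case by simp
qed

lemma horner_shift: "horner a g s \<Longrightarrow> horner a (\<lambda>p. snd p * g p) (a \<otimes> s)"
  using horner.horner_Suc[OF V_0] horner_carrier[of g s] a by fastforce

lemma horner_mult: "horner a g s \<Longrightarrow> horner a h u \<Longrightarrow> horner a (\<lambda>p. g p * h p) (s \<otimes> u)"
proof (induction rule: horner.induct)
  case horner_0
  then show ?case using horner.horner_0 horner_carrier by simp
next
  case (horner_Suc f r g s)
  have "horner a (\<lambda>p. f (fst p) * h p + snd p * (g p * h p)) (r \<otimes> u \<oplus> a \<otimes> (s \<otimes> u))"
    using horner_Suc by (intro horner_add horner_scale horner_shift)
  moreover have "r \<otimes> u \<oplus> a \<otimes> (s \<otimes> u) = (r \<oplus> a \<otimes> s) \<otimes> u"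
    using V_carrier[OF horner_Suc(1)] horner_carrier[OF horner_Suc(4)] horner_carrier[OF horner_Suc(2)] a
    by (simp add: l_distr m_assoc)
  moreover have "(\<lambda>p. f (fst p) * h p + snd p * (g p * h p)) = (\<lambda>p. (f (fst p) + snd p * g p) * h p)"
    by (auto simp: algebra_simps)
  ultimately show ?case by simp
qed

lemma horner_base: "V f r \<Longrightarrow> horner a (\<lambda>p. f (fst p)) r"
  using horner.horner_Suc[of f r a "\<lambda>_. 0" \<zero>] horner_0 V_carrier[of f r] a by simp

lemma horner_var: "horner a snd a"
  using horner_shift[OF horner_base[OF V_one]] a by simp

definition "adj f r \<longleftrightarrow> (\<exists>g. horner a g r \<and> (\<forall>x\<in>S. \<forall>t. f (x, t) = g (x, t)))"

text \<open>It allows an identity in a free complex parameter to be specialized at an arbitrary a in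
  R, such as the parameter of a root element.\<close>

lemma spec_adj: "spec R (S \<times> UNIV) adj"
proof
  show "adj f r \<Longrightarrow> r \<in> carrier R" for f r using horner_carrier by (auto simp: adj_def)
  show "adj (\<lambda>_. 1) \<one>" using horner_base[OF V_one] by (auto simp: adj_def)
  show "adj (\<lambda>x. - f x) (\<ominus> r)" if f: "adj f r" for f r
  proof -
    obtain g where g: "horner a g r" "\<forall>x\<in>S. \<forall>t. f (x, t) = g (x, t)" using f by (auto simp: adj_def)
    have "horner a (\<lambda>p. - 1 * g p) (\<ominus> \<one> \<otimes> r)" by (rule horner_scale[OF g(1) V_uminus[OF V_one]])
    then have "horner a (\<lambda>p. - g p) (\<ominus> r)" using horner_carrier[OF g(1)] by (simp add: l_minus)
    then show ?thesis using g by (auto simp: adj_def)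
  qed
  show "adj (\<lambda>x. f x + g x) (r \<oplus> s)" if "adj f r" "adj g s" for f r g s
    using that horner_add unfolding adj_def by (metis (no_types, lifting))
  show "adj (\<lambda>x. f x * g x) (r \<otimes> s)" if "adj f r" "adj g s" for f r g s
    using that horner_mult unfolding adj_def by (metis (no_types, lifting))
  show "adj g r" if "adj f r" "\<And>x. x \<in> S \<times> UNIV \<Longrightarrow> f x = g x" for f r g
    using that by (auto simp: adj_def)
  show "r = \<zero>" if "adj f r" "\<And>x. x \<in> S \<times> UNIV \<Longrightarrow> f x = 0" for f r
    using that horner_zero by (auto simp: adj_def)
qed

lemma adj_base: "V f r \<Longrightarrow> adj (\<lambda>p. f (fst p)) r"
  unfolding adj_def using horner_base[of f r] by blast

lemma adj_var: "adj snd a"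
  using horner_var by (auto simp: adj_def)

end

end

subsection \<open>Inverting a function that specializes to one\<close>

context spec
begin

text \<open>f is represented as a fraction F / d^k. Since d will specialize to 1, the value of F
  serves as the value of f whatever k is.\<close>

definition "loc d f r \<longleftrightarrow> (\<exists>F k. V F r \<and> (\<forall>x\<in>S. d x \<noteq> 0 \<longrightarrow> F x = f x * d x ^ k))" for d :: "'x \<Rightarrow> complex"

lemma spec_loc:
  assumes d: "V d \<one>"
  shows "spec R {x \<in> S. d x \<noteq> 0} (loc d)"
proof
  have pw: "V (\<lambda>x. F x * d x ^ k) r" if "V F r" for F k r
    using V_mult[OF that V_power[OF d, of k]] V_carrier[OF that] by simp
  show "loc d f r \<Longrightarrow> r \<in> carrier R" for f r using V_carrier by (auto simp: loc_def)
  show "loc d (\<lambda>_. 1) \<one>" using V_one by (auto simp: loc_def intro!: exI[of _ "\<lambda>_. 1"] exI[of _ 0])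
  show "loc d (\<lambda>x. - f x) (\<ominus> r)" if f: "loc d f r" for f r
  proof -
    obtain F k where F: "V F r" "\<forall>x\<in>S. d x \<noteq> 0 \<longrightarrow> F x = f x * d x ^ k" using f by (auto simp: loc_def)
    show ?thesis unfolding loc_def
      by (rule exI[of _ "\<lambda>x. - F x"], rule exI[of _ k]) (use F V_uminus in auto)
  qed
  show "loc d (\<lambda>x. f x + g x) (r \<oplus> s)" if fg: "loc d f r" "loc d g s" for f r g s
  proof -
    obtain F k where F: "V F r" "\<forall>x\<in>S. d x \<noteq> 0 \<longrightarrow> F x = f x * d x ^ k" using fg by (auto simp: loc_def)
    obtain G l where G: "V G s" "\<forall>x\<in>S. d x \<noteq> 0 \<longrightarrow> G x = g x * d x ^ l" using fg by (auto simp: loc_def)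
    show ?thesis unfolding loc_def
      by (rule exI[of _ "\<lambda>x. F x * d x ^ l + G x * d x ^ k"], rule exI[of _ "k + l"])
        (use F G in \<open>auto intro!: V_add pw simp: algebra_simps power_add\<close>)
  qed
  show "loc d (\<lambda>x. f x * g x) (r \<otimes> s)" if fg: "loc d f r" "loc d g s" for f r g s
  proof -
    obtain F k where F: "V F r" "\<forall>x\<in>S. d x \<noteq> 0 \<longrightarrow> F x = f x * d x ^ k" using fg by (auto simp: loc_def)
    obtain G l where G: "V G s" "\<forall>x\<in>S. d x \<noteq> 0 \<longrightarrow> G x = g x * d x ^ l" using fg by (auto simp: loc_def)
    show ?thesis unfolding loc_def
      by (rule exI[of _ "\<lambda>x. F x * G x"], rule exI[of _ "k + l"])
        (use F G in \<open>auto intro!: V_mult simp: algebra_simps power_add\<close>)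
  qed
  show "loc d g r" if "loc d f r" "\<And>x. x \<in> {x \<in> S. d x \<noteq> 0} \<Longrightarrow> f x = g x" for f r g
    using that unfolding loc_def by auto
  show "r = \<zero>" if f: "loc d f r" "\<And>x. x \<in> {x \<in> S. d x \<noteq> 0} \<Longrightarrow> f x = 0" for f r
  proof -
    obtain F k where F: "V F r" "\<forall>x\<in>S. d x \<noteq> 0 \<longrightarrow> F x = f x * d x ^ k" using f by (auto simp: loc_def)
    \<comment> \<open>Multiplication by d extends the vanishing to all of S and does not change the
      value, because d specializes to 1.\<close>
    have "F x * d x ^ 1 = 0" if "x \<in> S" for x
      using F(2) f(2)[of x] that by (cases "d x = 0") auto
    then show ?thesis using V_zero[OF pw[OF F(1), of 1]] by simp
  qed
qed

lemma loc_base: "V f r \<Longrightarrow> loc d f r"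
  unfolding loc_def by (rule exI[of _ f], rule exI[of _ 0]) auto

lemma loc_inverse: "loc d (\<lambda>x. 1 / d x) \<one>"
  unfolding loc_def by (rule exI[of _ "\<lambda>_. 1"], rule exI[of _ 1]) (auto simp: V_one)

end

section \<open>Matrices over a commutative ring\<close>

context cring
begin

lemma finsum_swap:
  assumes "finite A" "finite B" "\<And>i j. i \<in> A \<Longrightarrow> j \<in> B \<Longrightarrow> f i j \<in> carrier R"
  shows "(\<Oplus>i\<in>A. \<Oplus>j\<in>B. f i j) = (\<Oplus>j\<in>B. \<Oplus>i\<in>A. f i j)"
  using assms(1,3)
proof (induction A rule: finite_induct)
  case empty then show ?case by simp
next
  case (insert a A)
  have "(\<Oplus>i\<in>insert a A. \<Oplus>j\<in>B. f i j) = (\<Oplus>j\<in>B. f a j) \<oplus> (\<Oplus>j\<in>B. \<Oplus>i\<in>A. f i j)"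
    using insert assms(2) by (subst finsum_insert) (auto intro!: finsum_closed)
  also have "\<dots> = (\<Oplus>j\<in>B. f a j \<oplus> (\<Oplus>i\<in>A. f i j))"
    using insert by (subst finsum_addf) (auto intro!: finsum_closed)
  also have "\<dots> = (\<Oplus>j\<in>B. \<Oplus>i\<in>insert a A. f i j)"
    using insert assms(2) by (intro finsum_cong') (auto intro!: finsum_closed)
  finally show ?case .
qed

lemma monoid_matrix: "monoid (matrix_monoid R :: ('a^'n::finite^'n) monoid)"
proof
  fix A B C :: "'a^'n^'n"
  assume "A \<in> carrier (matrix_monoid R)" "B \<in> carrier (matrix_monoid R)" "C \<in> carrier (matrix_monoid R)"
  then have car: "A $ i $ j \<in> carrier R" "B $ i $ j \<in> carrier R" "C $ i $ j \<in> carrier R" for i j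
    by (auto simp: matrix_monoid_def)
  show "A \<otimes>\<^bsub>matrix_monoid R\<^esub> B \<in> carrier (matrix_monoid R)"
    using car by (auto simp: matrix_monoid_def intro!: finsum_closed)
  have "(\<Oplus>k\<in>UNIV. (\<Oplus>l\<in>UNIV. A $ i $ l \<otimes> B $ l $ k) \<otimes> C $ k $ j)
      = (\<Oplus>l\<in>UNIV. A $ i $ l \<otimes> (\<Oplus>k\<in>UNIV. B $ l $ k \<otimes> C $ k $ j))" for i j
  proof -
    have "(\<Oplus>k\<in>UNIV. (\<Oplus>l\<in>UNIV. A $ i $ l \<otimes> B $ l $ k) \<otimes> C $ k $ j)
        = (\<Oplus>k\<in>UNIV. \<Oplus>l\<in>UNIV. A $ i $ l \<otimes> B $ l $ k \<otimes> C $ k $ j)"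
      using car by (intro finsum_cong') (auto simp: finsum_ldistr)
    also have "\<dots> = (\<Oplus>l\<in>UNIV. \<Oplus>k\<in>UNIV. A $ i $ l \<otimes> B $ l $ k \<otimes> C $ k $ j)"
      using car by (intro finsum_swap) auto
    also have "\<dots> = (\<Oplus>l\<in>UNIV. A $ i $ l \<otimes> (\<Oplus>k\<in>UNIV. B $ l $ k \<otimes> C $ k $ j))"
      using car by (intro finsum_cong') (auto simp: finsum_rdistr m_assoc)
    finally show ?thesis .
  qed
  then show "A \<otimes>\<^bsub>matrix_monoid R\<^esub> B \<otimes>\<^bsub>matrix_monoid R\<^esub> C = A \<otimes>\<^bsub>matrix_monoid R\<^esub> (B \<otimes>\<^bsub>matrix_monoid R\<^esub> C)"
    by (simp add: matrix_monoid_def vec_eq_iff)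
  have delta: "(\<Oplus>k\<in>UNIV. (if i = k then \<one> else \<zero>) \<otimes> A $ k $ j) = A $ i $ j" for i j
  proof -
    have "(\<Oplus>k\<in>UNIV. (if i = k then \<one> else \<zero>) \<otimes> A $ k $ j) = (\<Oplus>k\<in>UNIV. if i = k then A $ k $ j else \<zero>)"
      using car by (intro finsum_cong') auto
    then show ?thesis using add.finprod_singleton[of i UNIV "\<lambda>k. A $ k $ j"] car by simp
  qed
  have delta': "(\<Oplus>k\<in>UNIV. A $ i $ k \<otimes> (if k = j then \<one> else \<zero>)) = A $ i $ j" for i j
  proof -
    have "(\<Oplus>k\<in>UNIV. A $ i $ k \<otimes> (if k = j then \<one> else \<zero>)) = (\<Oplus>k\<in>UNIV. if j = k then A $ i $ k else \<zero>)"
      using car by (intro finsum_cong') auto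
    then show ?thesis using add.finprod_singleton[of j UNIV "\<lambda>k. A $ i $ k"] car by simp
  qed
  show "\<one>\<^bsub>matrix_monoid R\<^esub> \<otimes>\<^bsub>matrix_monoid R\<^esub> A = A" "A \<otimes>\<^bsub>matrix_monoid R\<^esub> \<one>\<^bsub>matrix_monoid R\<^esub> = A"
    by (simp_all add: matrix_monoid_def vec_eq_iff delta delta')
qed (auto simp: matrix_monoid_def)

end

section \<open>The complex elementary group\<close>

lemma cring_complex: "cring complex_ring"
proof (rule cringI)
  show "abelian_group complex_ring"
    by (rule abelian_groupI) (auto simp: complex_ring_def algebra_simps intro: exI[of _ "- x" for x])
  show "comm_monoid complex_ring"
    by (rule comm_monoidI) (auto simp: complex_ring_def algebra_simps)
qed (auto simp: complex_ring_def algebra_simps)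

interpretation complex: cring complex_ring by (rule cring_complex)

lemma complex_ring_simps [simp]:
  "carrier complex_ring = UNIV" "x \<otimes>\<^bsub>complex_ring\<^esub> y = x * y" "x \<oplus>\<^bsub>complex_ring\<^esub> y = x + y"
  "\<one>\<^bsub>complex_ring\<^esub> = 1" "\<zero>\<^bsub>complex_ring\<^esub> = 0"
  by (simp_all add: complex_ring_def)

lemma complex_a_inv [simp]: "\<ominus>\<^bsub>complex_ring\<^esub> x = - x"
  using complex.minus_equality[of "- x" x] by simp

lemma complex_finsum: "finite A \<Longrightarrow> finsum complex_ring f A = sum f A"
  by (induction A rule: finite_induct) (auto simp: complex.finsum_insert)

lemma complex_finprod: "finite A \<Longrightarrow> finprod complex_ring f A = prod f A"
  by (induction A rule: finite_induct) (auto simp: complex.finprod_insert)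

lemma complex_pow: "x [^]\<^bsub>complex_ring\<^esub> (k::nat) = x ^ k"
  by (induction k) auto

lemma complex_add_pow_nat: "add_pow complex_ring (k::nat) x = of_nat k * x"
  by (induction k) (auto simp: algebra_simps)

lemma complex_add_pow: "add_pow complex_ring (k::int) x = of_int k * x"
  by (cases "k \<ge> 0") (auto simp: add_pow_int_ge add_pow_int_lt complex_add_pow_nat)

lemma complex_matrix_mult: "A \<otimes>\<^bsub>matrix_monoid complex_ring\<^esub> B = A ** B"
  by (simp add: matrix_monoid_def matrix_matrix_mult_def complex_finsum)

lemma complex_matrix_one: "\<one>\<^bsub>matrix_monoid complex_ring\<^esub> = mat 1"
  by (simp add: matrix_monoid_def mat_def vec_eq_iff)

interpretation cmat: monoid "matrix_monoid complex_ring :: (complex^'n::finite^'n) monoid"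
  by (rule complex.monoid_matrix)

text \<open>The inverse by Cramer's rule for determinant 1. It is an integer polynomial in the
  entries, so inversion can be specialized, see \<open>MO_minv\<close>.\<close>

definition minv :: "'n::finite sqmat \<Rightarrow> 'n sqmat" where
  "minv A = Mx (\<chi> k j. det (\<chi> i l. if l = k then if i = j then 1 else 0 else entry A i l))"

lemma minv_eq:
  assumes "det (mx A) = 1" "A * A' = 1" shows "minv A = A'"
proof (rule sqmat_eqI)
  fix k j
  define x where "x = (\<chi> i. entry A' i j)"
  have "mx A *v x = (\<chi> i. if i = j then 1 else 0)"
  proof -
    have "(\<Sum>l\<in>UNIV. entry A i l * entry A' l j) = (if i = j then 1 else 0)" for i
      using arg_cong[OF assms(2), of "\<lambda>M. entry M i j"] by (simp add: entry_mult)
    then show ?thesis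
      by (simp add: vec_eq_iff matrix_vector_mult_def x_def entry.rep_eq)
  qed
  then have "det (\<chi> i l. if l = k then if i = j then 1 else 0 else mx A $ i $ l) = x $ k"
    using cramer_lemma[of k "mx A" x] assms(1) by (simp cong: if_cong)
  then show "entry (minv A) k j = entry A' k j"
    unfolding minv_def entry.rep_eq by (simp add: x_def entry.rep_eq Mx_inverse)
qed

context chevalley
begin

definition EC :: "'n sqmat set" where
  "EC = {A. mx A \<in> elementary_subgroup complex_ring \<Phi> (\<lambda>\<alpha>. mx (X \<alpha>))}"

lemma exp_elem_complex: assumes "\<alpha> \<in> \<Phi>" shows "exp_elem complex_ring (mx (X \<alpha>)) t = mx (ex \<alpha> t)"
proof -
  have "exp_elem complex_ring (mx (X \<alpha>)) t $ i $ j = mx (ex \<alpha> t) $ i $ j" for i j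
  proof -
    have *: "of_int (THE z::int. of_int z = div_power (mx (X \<alpha>)) k $ i $ j) = entry (dpow (X \<alpha>) k) i j" for k
    proof -
      obtain w :: int where w: "entry (dpow (X \<alpha>) k) i j = of_int w"
        using X_int[OF assms, of k i j] by (auto elim: Ints_cases)
      show ?thesis unfolding div_power_eq w by simp
    qed
    have "exp_elem complex_ring (mx (X \<alpha>)) t $ i $ j
      = (\<Sum>k<CARD('n). of_int (THE z::int. of_int z = div_power (mx (X \<alpha>)) k $ i $ j) * t ^ k)"
      by (simp add: exp_elem_def complex_finsum complex_add_pow complex_pow)
    also have "\<dots> = entry (ex \<alpha> t) i j"
      unfolding * by (simp add: ex_def mexp_def entry_sum dpow_smul mult.commute)
    finally show ?thesis by (simp add: entry.rep_eq)
  qed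
  then show ?thesis by (simp add: vec_eq_iff)
qed

lemma ex_unit: "\<alpha> \<in> \<Phi> \<Longrightarrow> mx (ex \<alpha> t) \<in> Units (matrix_monoid complex_ring)"
proof -
  assume a: "\<alpha> \<in> \<Phi>"
  have "mx (ex \<alpha> t) ** mx (ex \<alpha> (- t)) = mat 1" "mx (ex \<alpha> (- t)) ** mx (ex \<alpha> t) = mat 1"
    using ex_inverse[OF a, of t] by (metis times_sqmat.rep_eq one_sqmat.rep_eq)+
  then show ?thesis unfolding Units_def complex_matrix_mult complex_matrix_one
    by (auto simp: matrix_monoid_def)
qed

lemma ex_inv: "\<alpha> \<in> \<Phi> \<Longrightarrow> inv\<^bsub>general_linear_group complex_ring\<^esub> (mx (ex \<alpha> t)) = mx (ex \<alpha> (- t))"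
proof -
  assume a: "\<alpha> \<in> \<Phi>"
  have "mx (ex \<alpha> t) ** mx (ex \<alpha> (- t)) = mat 1" "mx (ex \<alpha> (- t)) ** mx (ex \<alpha> t) = mat 1"
    using ex_inverse[OF a, of t] by (metis times_sqmat.rep_eq one_sqmat.rep_eq)+
  then have "inv\<^bsub>matrix_monoid complex_ring\<^esub> (mx (ex \<alpha> t)) = mx (ex \<alpha> (- t))"
    by (intro cmat.inv_char) (auto simp: complex_matrix_mult complex_matrix_one, auto simp: matrix_monoid_def)
  then show ?thesis
    unfolding general_linear_group_def by (simp add: cmat.units_of_inv[OF ex_unit[OF a]])
qed

lemma EC_one: "1 \<in> EC"
  using generate.one[of "general_linear_group complex_ring"]
  by (simp add: EC_def elementary_subgroup_def general_linear_group_def units_of_one complex_matrix_one one_sqmat.rep_eq)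

lemma EC_ex: "\<alpha> \<in> \<Phi> \<Longrightarrow> ex \<alpha> t \<in> EC"
  unfolding EC_def elementary_subgroup_def
  by (simp, rule generate.incl) (use exp_elem_complex[of \<alpha> t, symmetric] in blast)

lemma EC_mult: "A \<in> EC \<Longrightarrow> B \<in> EC \<Longrightarrow> A * B \<in> EC"
  using generate.eng[of "mx A" "general_linear_group complex_ring" _ "mx B"]
  by (simp add: EC_def elementary_subgroup_def general_linear_group_def units_of_mult complex_matrix_mult times_sqmat.rep_eq)

text \<open>The inverse of a generator is again a root element, with parameter \<open>- t\<close>,
  so no case for inverses appears.\<close>

lemma EC_induct [consumes 1, case_names one ex mult]:
  assumes "A \<in> EC" "P 1" "\<And>\<alpha> t. \<alpha> \<in> \<Phi> \<Longrightarrow> P (ex \<alpha> t)" "\<And>A B. P A \<Longrightarrow> P B \<Longrightarrow> P (A * B)"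
  shows "P A"
proof -
  have "P (Mx M)" if "M \<in> elementary_subgroup complex_ring \<Phi> (\<lambda>\<alpha>. mx (X \<alpha>))" for M
    using that unfolding elementary_subgroup_def
  proof (induction rule: generate.induct)
    case one
    then show ?case using assms(2)
      by (simp add: general_linear_group_def units_of_one complex_matrix_one one_sqmat.abs_eq)
  next
    case (incl h)
    then show ?case using assms(3) by (auto simp: exp_elem_complex mx_inverse)
  next
    case (inv h)
    then show ?case using assms(3) by (auto simp: exp_elem_complex ex_inv mx_inverse)
  next
    case (eng M N)
    then show ?case using assms(4)[of "Mx M" "Mx N"]
      by (simp add: general_linear_group_def units_of_mult complex_matrix_mult times_sqmat.abs_eq)
  qed
  from this[of "mx A"] assms(1) show ?thesis by (simp add: EC_def mx_inverse)
qed

lemma EC_properties: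
  assumes "A \<in> EC"
  shows "det (mx A) = 1" "minv A \<in> EC" "A * minv A = 1" "minv A * A = 1"
    "a \<in> LL \<Longrightarrow> A * a * minv A \<in> LL" "a \<in> LL \<Longrightarrow> minv A * a * A \<in> LL"
proof -
  have "det (mx A) = 1 \<and> (\<exists>A'\<in>EC. A * A' = 1 \<and> A' * A = 1 \<and> (\<forall>a\<in>LL. A * a * A' \<in> LL \<and> A' * a * A \<in> LL))"
    using assms
  proof (induction rule: EC_induct)
    case one
    then show ?case using EC_one by (auto simp: one_sqmat.rep_eq intro!: bexI[of _ 1])
  next
    case (ex \<alpha> t)
    have "det (mx (ex \<alpha> t)) = 1" unfolding ex_def by (intro det_mexp nil_smul X_nil ex)
    moreover have "ex \<alpha> (- t) \<in> EC" by (rule EC_ex[OF ex])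
    moreover have "ex \<alpha> t * a * ex \<alpha> (- t) \<in> LL" "ex \<alpha> (- t) * a * ex \<alpha> t \<in> LL" if "a \<in> LL" for a
      using E_LL[OF ex that, of t] E_LL[OF ex that, of "- t"] by (auto simp: E_def)
    ultimately show ?case using ex by (intro conjI bexI[of _ "ex \<alpha> (- t)"]) auto
  next
    case (mult A B)
    obtain A' where A': "A' \<in> EC" "A * A' = 1" "A' * A = 1" "\<forall>a\<in>LL. A * a * A' \<in> LL \<and> A' * a * A \<in> LL"
      using mult(1) by blast
    obtain B' where B': "B' \<in> EC" "B * B' = 1" "B' * B = 1" "\<forall>a\<in>LL. B * a * B' \<in> LL \<and> B' * a * B \<in> LL"
      using mult(2) by blast
    have "det (mx (A * B)) = 1" using mult by (simp add: times_sqmat.rep_eq det_mul)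
    moreover have "B' * A' \<in> EC" by (rule EC_mult[OF B'(1) A'(1)])
    moreover have "A * B * (B' * A') = A * (B * B') * A'" "B' * A' * (A * B) = B' * (A' * A) * B"
      by (simp_all only: mult.assoc)
    moreover have "A * B * a * (B' * A') = A * (B * a * B') * A'" "B' * A' * a * (A * B) = B' * (A' * a * A) * B" for a
      by (simp_all only: mult.assoc)
    ultimately show ?case using A' B' by (intro conjI bexI[of _ "B' * A'"]) auto
  qed
  then obtain A' where d: "det (mx A) = 1" and A': "A' \<in> EC" "A * A' = 1" "A' * A = 1"
      "\<forall>a\<in>LL. A * a * A' \<in> LL \<and> A' * a * A \<in> LL" by blast
  have "minv A = A'" by (rule minv_eq[OF d A'(2)])
  then show "det (mx A) = 1" "minv A \<in> EC" "A * minv A = 1" "minv A * A = 1"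
    "a \<in> LL \<Longrightarrow> A * a * minv A \<in> LL" "a \<in> LL \<Longrightarrow> minv A * a * A \<in> LL" using d A' by auto
qed

end

section \<open>Points of the Chevalley group as specializations\<close>

context spec
begin

lemma V_eval_poly:
  assumes "mrel F B"
  shows "V (\<lambda>x. eval_poly complex_ring p (mx (F x))) (eval_poly R p B)"
proof -
  have "eval_poly complex_ring p (mx (F x)) = (\<Sum>m\<in>Poly_Mapping.keys p. of_int (Poly_Mapping.lookup p m) *
      (\<Prod>v\<in>Poly_Mapping.keys m. entry (F x) (fst v) (snd v) ^ Poly_Mapping.lookup m v))" for x
    by (simp add: eval_poly_def complex_finsum complex_finprod complex_add_pow complex_pow entry.rep_eq)
  then show ?thesis
    unfolding eval_poly_def using assms
    by (simp only:) (intro V_sum V_add_pow V_prod V_power, auto simp: mrel_def)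
qed

lemma MO_minv: fixes F :: "'x \<Rightarrow> 'n::finite sqmat" assumes "MO F" shows "MO (\<lambda>x. minv (F x))"
  unfolding MO_def
proof (intro allI)
  fix k j :: 'n
  have e: "entry (minv (F x)) k j = (\<Sum>p | p permutes UNIV. of_int (sign p) *
      (\<Prod>i\<in>UNIV. if p i = k then if i = j then 1 else 0 else entry (F x) i (p i)))" for x
    by (simp add: minv_def entry.abs_eq det_def)
  show "ofn (\<lambda>x. entry (minv (F x)) k j)"
    unfolding e
  proof (intro ofn_sum ofn_intros ofn_prod)
    fix p and i :: 'n
    show "ofn (\<lambda>x. if p i = k then if i = j then 1 else 0 else entry (F x) i (p i))"
      using assms by (cases "p i = k"; cases "i = j") (auto simp: MO_def intro: ofn_intros)
  qed auto
qed

end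

context chevalley
begin

text \<open>The value at g of functions that agree on the complex elementary group with an integer
  polynomial in the entries. It does not depend on the polynomial: one that vanishes on
  \<open>EC\<close> is a Chevalley equation and so vanishes at g.\<close>

definition at_point :: "('r, 'm) ring_scheme \<Rightarrow> 'r^'n^'n \<Rightarrow> ('n sqmat \<Rightarrow> complex) \<Rightarrow> 'r \<Rightarrow> bool" where
  "at_point R g f r \<longleftrightarrow> (\<exists>p. (\<forall>A\<in>EC. f A = eval_poly complex_ring p (mx A)) \<and> r = eval_poly R p g)"

context
  fixes R :: "('r, 'm) ring_scheme" and g
  assumes R: "cring R" and g: "g \<in> carrier (chevalley_group R \<Phi> (\<lambda>\<alpha>. mx (X \<alpha>)))"
begin

lemma point_carrier: "g $ i $ j \<in> carrier R"
  using g by (auto simp: chevalley_group_def general_linear_group_def units_of_def Units_def matrix_monoid_def)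

lemma point_spec: "spec R EC (at_point R g)"
proof -
  interpret cring R by (rule R)
  note simps = eval_poly_add eval_poly_mult eval_poly_uminus eval_poly_1 eval_poly_closed
  note c = point_carrier
  show ?thesis
  proof
    show "at_point R g f r \<Longrightarrow> r \<in> carrier R" for f r
      by (auto simp: at_point_def eval_poly_closed c)
    show "at_point R g (\<lambda>_. 1) \<one>\<^bsub>R\<^esub>"
      unfolding at_point_def by (rule exI[of _ 1]) (simp add: eval_poly_1 c complex.eval_poly_1)
    show "at_point R g (\<lambda>x. - f x) (\<ominus>\<^bsub>R\<^esub> r)" if f: "at_point R g f r" for f r
    proof -
      obtain p where "\<forall>A\<in>EC. f A = eval_poly complex_ring p (mx A)" "r = eval_poly R p g" using f by (auto simp: at_point_def)
      then show ?thesis unfolding at_point_def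
        by (intro exI[of _ "- p"]) (simp add: eval_poly_uminus c complex.eval_poly_uminus)
    qed
    show "at_point R g (\<lambda>x. f x + h x) (r \<oplus>\<^bsub>R\<^esub> s)" if fh: "at_point R g f r" "at_point R g h s" for f r h s
    proof -
      obtain p where p: "\<forall>A\<in>EC. f A = eval_poly complex_ring p (mx A)" "r = eval_poly R p g" using fh by (auto simp: at_point_def)
      obtain q where q: "\<forall>A\<in>EC. h A = eval_poly complex_ring q (mx A)" "s = eval_poly R q g" using fh by (auto simp: at_point_def)
      show ?thesis unfolding at_point_def
        by (intro exI[of _ "p + q"]) (simp add: eval_poly_add c complex.eval_poly_add p q)
    qed
    show "at_point R g (\<lambda>x. f x * h x) (r \<otimes>\<^bsub>R\<^esub> s)" if fh: "at_point R g f r" "at_point R g h s" for f r h s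
    proof -
      obtain p where p: "\<forall>A\<in>EC. f A = eval_poly complex_ring p (mx A)" "r = eval_poly R p g" using fh by (auto simp: at_point_def)
      obtain q where q: "\<forall>A\<in>EC. h A = eval_poly complex_ring q (mx A)" "s = eval_poly R q g" using fh by (auto simp: at_point_def)
      show ?thesis unfolding at_point_def
        by (intro exI[of _ "p * q"]) (simp add: eval_poly_mult c complex.eval_poly_mult p q)
    qed
    show "at_point R g h r" if "at_point R g f r" "\<And>x. x \<in> EC \<Longrightarrow> f x = h x" for f r h
      using that by (auto simp: at_point_def)
    show "r = \<zero>\<^bsub>R\<^esub>" if f: "at_point R g f r" "\<And>x. x \<in> EC \<Longrightarrow> f x = 0" for f r
    proof -
      obtain p where p: "\<forall>A\<in>EC. f A = eval_poly complex_ring p (mx A)" "r = eval_poly R p g" using f by (auto simp: at_point_def)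
      have "p \<in> chevalley_equations \<Phi> (\<lambda>\<alpha>. mx (X \<alpha>))"
        unfolding chevalley_equations_def
      proof (intro CollectI ballI)
        fix M assume M: "M \<in> elementary_subgroup complex_ring \<Phi> (\<lambda>\<alpha>. mx (X \<alpha>))"
        then have "Mx M \<in> EC" by (simp add: EC_def Mx_inverse)
        then show "eval_poly complex_ring p M = 0" using p f(2)[of "Mx M"] by (simp add: Mx_inverse)
      qed
      then show ?thesis using g p by (simp add: chevalley_group_def)
    qed
  qed
qed

lemma point_mrel: "spec.mrel (at_point R g) (\<lambda>A. A) g"
proof -
  interpret spec R EC "at_point R g" by (rule point_spec)
  show ?thesis unfolding mrel_def at_point_def
  proof (intro allI)
    fix i j
    show "\<exists>p. (\<forall>A\<in>EC. entry A i j = eval_poly complex_ring p (mx A)) \<and> g $ i $ j = eval_poly R p g"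
      by (rule exI[of _ "Poly_Mapping.single (Poly_Mapping.single (i, j) 1) 1"])
        (simp add: eval_poly_entry[OF point_carrier] complex.eval_poly_entry entry.rep_eq del: One_nat_def)
  qed
qed

text \<open>The inverse is the specialization of \<open>minv\<close>. It satisfies the Chevalley
  equations because \<open>minv\<close> maps \<open>EC\<close> to itself.\<close>

lemma point_inverse:
  "\<exists>B \<in> carrier (chevalley_group R \<Phi> (\<lambda>\<alpha>. mx (X \<alpha>))).
     g \<otimes>\<^bsub>matrix_monoid R\<^esub> B = \<one>\<^bsub>matrix_monoid R\<^esub> \<and> B \<otimes>\<^bsub>matrix_monoid R\<^esub> g = \<one>\<^bsub>matrix_monoid R\<^esub>"
proof -
  interpret spec R EC "at_point R g" by (rule point_spec)
  obtain B where B: "mrel minv B" using MO_mrel[OF MO_minv[OF mrel_MO[OF point_mrel]]] by blast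
  have 1: "g \<otimes>\<^bsub>matrix_monoid R\<^esub> B = \<one>\<^bsub>matrix_monoid R\<^esub>"
    by (rule mrel_unique[OF mrel_mult[OF point_mrel B] mrel_one]) (simp add: EC_properties)
  have 2: "B \<otimes>\<^bsub>matrix_monoid R\<^esub> g = \<one>\<^bsub>matrix_monoid R\<^esub>"
    by (rule mrel_unique[OF mrel_mult[OF B point_mrel] mrel_one]) (simp add: EC_properties)
  have "g \<in> carrier (matrix_monoid R)" by (rule mrel_carrier[OF point_mrel])
  then have "B \<in> Units (matrix_monoid R)" using mrel_carrier[OF B] 1 2 by (auto simp: Units_def)
  moreover have "eval_poly R p B = \<zero>\<^bsub>R\<^esub>" if p: "p \<in> chevalley_equations \<Phi> (\<lambda>\<alpha>. mx (X \<alpha>))" for p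
  proof (rule V_zero[OF V_eval_poly[OF B]])
    fix A assume "A \<in> EC"
    then have "minv A \<in> EC" by (rule EC_properties)
    then show "eval_poly complex_ring p (mx (minv A)) = 0"
      using p by (auto simp: EC_def chevalley_equations_def)
  qed
  ultimately have "B \<in> carrier (chevalley_group R \<Phi> (\<lambda>\<alpha>. mx (X \<alpha>)))"
    by (simp add: chevalley_group_def general_linear_group_def units_of_carrier)
  then show ?thesis using 1 2 B by blast
qed

end

end

section \<open>The centralizer of the parabolic unipotents\<close>

context spec
begin

text \<open>Equality after specialization. The two sides remain functions on the complex group, so
  that arguments in the complex Lie algebra can still be applied to them pointwise.\<close>

definition eqv :: "('x \<Rightarrow> 'n::finite sqmat) \<Rightarrow> ('x \<Rightarrow> 'n sqmat) \<Rightarrow> bool" (infix \<open>\<simeq>\<close> 50) where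
  "F \<simeq> G \<longleftrightarrow> MO F \<and> MO G \<and> MJ (\<lambda>x. F x - G x)"

lemma MO_cong: "MO F \<Longrightarrow> (\<And>x. x \<in> S \<Longrightarrow> F x = G x) \<Longrightarrow> MO G"
  unfolding MO_def by (metis (no_types, lifting) ofn_cong)

lemma eqv_pointwise: "MO F \<Longrightarrow> (\<And>x. x \<in> S \<Longrightarrow> F x = G x) \<Longrightarrow> F \<simeq> G"
  unfolding eqv_def using MO_cong[of F G] MJ_cong[OF MJ_intros(1), of "\<lambda>x. F x - G x"] by auto

lemma eqv_refl: "MO F \<Longrightarrow> F \<simeq> F"
  by (rule eqv_pointwise) auto

lemma eqv_sym: "F \<simeq> G \<Longrightarrow> G \<simeq> F"
  unfolding eqv_def using MJ_intros(8)[of "\<lambda>x. F x - G x"] by simp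

lemma eqv_trans: "F \<simeq> G \<Longrightarrow> G \<simeq> H \<Longrightarrow> F \<simeq> H"
  unfolding eqv_def using MJ_intros(2)[of "\<lambda>x. F x - G x" "\<lambda>x. G x - H x"] by simp

lemma eqv_trans_left: "(\<And>x. x \<in> S \<Longrightarrow> F x = G x) \<Longrightarrow> G \<simeq> H \<Longrightarrow> F \<simeq> H"
  by (rule eqv_trans[OF eqv_sym[OF eqv_pointwise]]) (auto simp: eqv_def)

lemma eqv_trans_right: "F \<simeq> G \<Longrightarrow> (\<And>x. x \<in> S \<Longrightarrow> G x = H x) \<Longrightarrow> F \<simeq> H"
  by (rule eqv_trans, assumption, rule eqv_pointwise) (auto simp: eqv_def)

lemma eqv_add: "F \<simeq> G \<Longrightarrow> F' \<simeq> G' \<Longrightarrow> (\<lambda>x. F x + F' x) \<simeq> (\<lambda>x. G x + G' x)"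
  unfolding eqv_def using MJ_intros(2)[of "\<lambda>x. F x - G x" "\<lambda>x. F' x - G' x"]
  by (auto intro: MO_intros simp: algebra_simps)

lemma eqv_diff: "F \<simeq> G \<Longrightarrow> F' \<simeq> G' \<Longrightarrow> (\<lambda>x. F x - F' x) \<simeq> (\<lambda>x. G x - G' x)"
  unfolding eqv_def using MJ_intros(3)[of "\<lambda>x. F x - G x" "\<lambda>x. F' x - G' x"]
  by (auto intro: MO_intros simp: algebra_simps)

lemma eqv_mult: "F \<simeq> G \<Longrightarrow> F' \<simeq> G' \<Longrightarrow> (\<lambda>x. F x * F' x) \<simeq> (\<lambda>x. G x * G' x)"
proof -
  assume a: "F \<simeq> G" "F' \<simeq> G'"
  have "MJ (\<lambda>x. (F x - G x) * F' x + G x * (F' x - G' x))"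
    using a by (intro MJ_intros(2) MJ_intros(4)[of G] MJ_intros(5)) (auto simp: eqv_def)
  then show ?thesis using a by (auto simp: eqv_def algebra_simps intro: MO_intros)
qed

lemma eqv_comm: "F \<simeq> G \<Longrightarrow> F' \<simeq> G' \<Longrightarrow> (\<lambda>x. comm (F x) (F' x)) \<simeq> (\<lambda>x. comm (G x) (G' x))"
  unfolding comm_def by (intro eqv_diff eqv_mult)

lemma eqv_smul: "ofn f \<Longrightarrow> F \<simeq> G \<Longrightarrow> (\<lambda>x. smul (f x) (F x)) \<simeq> (\<lambda>x. smul (f x) (G x))"
  unfolding eqv_def using MJ_intros(6)[of f "\<lambda>x. F x - G x"]
  by (auto intro: MO_intros simp: sqm.scale_right_diff_distrib)

lemma eqv_smul_left: "ofn f \<Longrightarrow> ofn g \<Longrightarrow> jfn (\<lambda>x. f x - g x) \<Longrightarrow> MO F \<Longrightarrow>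
    (\<lambda>x. smul (f x) (F x)) \<simeq> (\<lambda>x. smul (g x) (F x))"
  unfolding eqv_def using MJ_intros(7)[of "\<lambda>x. f x - g x" F]
  by (auto intro: MO_intros simp: sqm.scale_left_diff_distrib)

lemma eqv_intfun: assumes "intfun f" "F \<simeq> G" shows "jfn (\<lambda>x. f (F x) - f (G x))"
  using jfn_intfun[OF assms(1), of "\<lambda>x. F x - G x"] assms by (simp add: eqv_def intfun_D)

lemma eqv_const: "intmat a \<Longrightarrow> (\<lambda>_. a) \<simeq> (\<lambda>_. a)"
  by (intro eqv_refl MO_intros)

lemma eqv_MO: "F \<simeq> G \<Longrightarrow> MO F" "F \<simeq> G \<Longrightarrow> MO G"
  by (auto simp: eqv_def)

text \<open>The absolute values m and m - 1 differ by 1, so f is a difference of two members of the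
  ideal. This replaces division by structure constants, which R need not allow.\<close>

lemma jfn_int_factors:
  fixes k l :: int
  assumes "ofn f" "jfn (\<lambda>x. of_int k * f x)" "jfn (\<lambda>x. of_int l * f x)" "\<bar>k\<bar> = int m" "\<bar>l\<bar> = int m - 1"
  shows "jfn f"
proof -
  have *: "jfn (\<lambda>x. of_int \<bar>k\<bar> * f x)" if "jfn (\<lambda>x. of_int k * f x)" for k
    using that jfn_intros(4)[OF that] by (cases "k \<ge> 0") auto
  have "jfn (\<lambda>x. of_int \<bar>k\<bar> * f x - of_int \<bar>l\<bar> * f x)"
    by (rule jfn_intros(3)[OF *[OF assms(2)] *[OF assms(3)]])
  then show ?thesis using assms(4,5) by (simp add: algebra_simps)
qed

end

text \<open>The variable A is the generic element of the complex elementary group;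
  \<open>central\<close> expresses that its specialization commutes with the constants of degree
  \<ge> 0.\<close>

locale centralizer = chevalley_graded \<Phi> X T \<theta> + spec R EC V
  for \<Phi> :: "'e::euclidean_space set" and X :: "'e \<Rightarrow> 'n::finite sqmat" and T \<theta>
    and R :: "('r, 'm) ring_scheme" (structure) and V :: "('n sqmat \<Rightarrow> complex) \<Rightarrow> 'r \<Rightarrow> bool" +
  assumes MO_id: "MO (\<lambda>A. A)"
    and central: "\<delta> \<in> \<Phi> \<Longrightarrow> deg \<delta> \<ge> 0 \<Longrightarrow> (\<lambda>A. A * ex \<delta> 1) \<simeq> (\<lambda>A. ex \<delta> 1 * A)"
begin

lemma MO_inv: "MO minv"
  using MO_minv[OF MO_id] .

definition Ad :: "'n sqmat \<Rightarrow> 'n sqmat \<Rightarrow> 'n sqmat" where "Ad a A = A * a * minv A"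

definition Ad' :: "'n sqmat \<Rightarrow> 'n sqmat \<Rightarrow> 'n sqmat" where "Ad' a A = minv A * a * A"

lemma MO_Ad: "intmat a \<Longrightarrow> MO (Ad a)" "intmat a \<Longrightarrow> MO (Ad' a)"
  unfolding Ad_def[abs_def] Ad'_def[abs_def] by (intro MO_intros MO_id MO_inv; simp)+

lemma Ad_LL: "A \<in> EC \<Longrightarrow> a \<in> LL \<Longrightarrow> Ad a A \<in> LL" "A \<in> EC \<Longrightarrow> a \<in> LL \<Longrightarrow> Ad' a A \<in> LL"
  by (auto simp: Ad_def Ad'_def EC_properties)

lemma Ad_simps:
  "Ad (a + b) A = Ad a A + Ad b A" "Ad (a - b) A = Ad a A - Ad b A" "Ad (smul c a) A = smul c (Ad a A)"
  "Ad (- a) A = - Ad a A" "Ad 0 A = 0"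
  by (simp_all add: Ad_def algebra_simps)

lemma Ad_comm: "A \<in> EC \<Longrightarrow> Ad (comm a b) A = comm (Ad a A) (Ad b A)"
  unfolding Ad_def by (rule comm_conj[symmetric]) (auto simp: EC_properties)

lemma Ad_Ad': "A \<in> EC \<Longrightarrow> minv A * Ad a A * A = a"
  using EC_properties[of A] unfolding Ad_def by (intro conj_conj) auto

lemma central_inv:
  assumes "\<delta> \<in> \<Phi>" "deg \<delta> \<ge> 0"
  shows "(\<lambda>A. minv A * ex \<delta> 1) \<simeq> (\<lambda>A. ex \<delta> 1 * minv A)"
    "(\<lambda>A. A * ex \<delta> (-1)) \<simeq> (\<lambda>A. ex \<delta> (-1) * A)"
    "(\<lambda>A. minv A * ex \<delta> (-1)) \<simeq> (\<lambda>A. ex \<delta> (-1) * minv A)"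
proof -
  have i: "intmat (ex \<delta> 1)" "intmat (ex \<delta> (-1))" using assms by auto
  have ee: "ex \<delta> 1 * ex \<delta> (-1) = 1" "ex \<delta> (-1) * ex \<delta> 1 = 1" using ex_inverse[OF assms(1), of 1] by auto
  note [simp] = EC_properties
  have m: "MO minv" "MO (\<lambda>A. A)" by (rule MO_inv MO_id)+
  have 1: "(\<lambda>A. minv A * (A * ex \<delta> 1) * minv A) \<simeq> (\<lambda>A. minv A * (ex \<delta> 1 * A) * minv A)"
    by (intro eqv_mult eqv_refl central assms m)
  show c: "(\<lambda>A. minv A * ex \<delta> 1) \<simeq> (\<lambda>A. ex \<delta> 1 * minv A)"
  proof (rule eqv_sym[OF eqv_trans_left[OF _ eqv_trans_right[OF 1]]])
    fix A assume A: "A \<in> EC"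
    show "ex \<delta> 1 * minv A = minv A * (A * ex \<delta> 1) * minv A"
      using A by (simp add: mult.assoc[symmetric])
    have "minv A * (ex \<delta> 1 * A) * minv A = minv A * ex \<delta> 1 * (A * minv A)" by (simp only: mult.assoc)
    then show "minv A * (ex \<delta> 1 * A) * minv A = minv A * ex \<delta> 1" using A by simp
  qed
  have conj: "(\<lambda>A. F A * ex \<delta> (-1)) \<simeq> (\<lambda>A. ex \<delta> (-1) * F A)"
    if F: "(\<lambda>A. F A * ex \<delta> 1) \<simeq> (\<lambda>A. ex \<delta> 1 * F A)" for F
  proof -
    have 1: "(\<lambda>A. ex \<delta> (-1) * (F A * ex \<delta> 1) * ex \<delta> (-1)) \<simeq> (\<lambda>A. ex \<delta> (-1) * (ex \<delta> 1 * F A) * ex \<delta> (-1))"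
      by (intro eqv_mult eqv_const i F)
    show ?thesis
    proof (rule eqv_sym[OF eqv_trans_left[OF _ eqv_trans_right[OF 1]]])
      fix A
      have "ex \<delta> (-1) * (F A * ex \<delta> 1) * ex \<delta> (-1) = ex \<delta> (-1) * F A * (ex \<delta> 1 * ex \<delta> (-1))" by (simp only: mult.assoc)
      then show "ex \<delta> (-1) * F A = ex \<delta> (-1) * (F A * ex \<delta> 1) * ex \<delta> (-1)" by (simp add: ee)
      have "ex \<delta> (-1) * (ex \<delta> 1 * F A) * ex \<delta> (-1) = (ex \<delta> (-1) * ex \<delta> 1) * F A * ex \<delta> (-1)" by (simp only: mult.assoc)
      then show "ex \<delta> (-1) * (ex \<delta> 1 * F A) * ex \<delta> (-1) = F A * ex \<delta> (-1)" by (simp add: ee)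
    qed
  qed
  show "(\<lambda>A. A * ex \<delta> (-1)) \<simeq> (\<lambda>A. ex \<delta> (-1) * A)" by (rule conj[OF central[OF assms]])
  show "(\<lambda>A. minv A * ex \<delta> (-1)) \<simeq> (\<lambda>A. ex \<delta> (-1) * minv A)" by (rule conj[OF c])
qed

lemma Ad_E:
  assumes d: "\<delta> \<in> \<Phi>" "deg \<delta> \<ge> 0" and a: "intmat a"
  shows "Ad (E \<delta> 1 a) \<simeq> (\<lambda>A. E \<delta> 1 (Ad a A))" "Ad' (E \<delta> 1 a) \<simeq> (\<lambda>A. E \<delta> 1 (Ad' a A))"
proof -
  have i: "intmat (ex \<delta> 1)" "intmat (ex \<delta> (-1))" using d by auto
  have "(\<lambda>A. (A * ex \<delta> 1) * a * (ex \<delta> (-1) * minv A)) \<simeq> (\<lambda>A. (ex \<delta> 1 * A) * a * (minv A * ex \<delta> (-1)))"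
    by (intro eqv_mult eqv_const a eqv_sym[OF central_inv(3)] central d)
  then show "Ad (E \<delta> 1 a) \<simeq> (\<lambda>A. E \<delta> 1 (Ad a A))"
    by (simp add: Ad_def[abs_def] E_def mult.assoc)
  have "(\<lambda>A. (minv A * ex \<delta> 1) * a * (ex \<delta> (-1) * A)) \<simeq> (\<lambda>A. (ex \<delta> 1 * minv A) * a * (A * ex \<delta> (-1)))"
    by (intro eqv_mult eqv_const a eqv_sym[OF central_inv(2)] central_inv(1) d)
  then show "Ad' (E \<delta> 1 a) \<simeq> (\<lambda>A. E \<delta> 1 (Ad' a A))"
    by (simp add: Ad'_def[abs_def] E_def mult.assoc)
qed

lemma eqv_E: "\<delta> \<in> \<Phi> \<Longrightarrow> F \<simeq> G \<Longrightarrow> (\<lambda>A. E \<delta> 1 (F A)) \<simeq> (\<lambda>A. E \<delta> 1 (G A))"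
  unfolding E_def by (intro eqv_mult eqv_const) auto

lemma L1_ge: "\<beta> \<in> L1 \<Longrightarrow> deg \<beta> \<ge> 0" by (simp add: L1_deg)

definition YY :: "'n sqmat \<Rightarrow> 'n sqmat" where "YY = Ad (X (- \<theta>))"

definition yy :: "'n sqmat \<Rightarrow> complex" where "yy A = cf (- \<theta>) (YY A)"

definition rr :: "'e \<Rightarrow> 'n sqmat \<Rightarrow> complex" where "rr \<beta> A = cf (\<beta> - \<theta>) (YY A)"

definition ee :: "'e \<Rightarrow> 'n sqmat \<Rightarrow> complex" where "ee \<beta> A = - of_int (nu \<beta>) * rr (\<theta> - \<beta>) A"

lemma YY_LL: "A \<in> EC \<Longrightarrow> YY A \<in> LL" by (simp add: YY_def Ad_LL)

lemma MO_YY: "MO YY" unfolding YY_def by (rule MO_Ad) simp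

lemma cf_mtheta: "intfun (cf (- \<theta>))" "a \<in> LL \<Longrightarrow> cf (- \<theta>) a = coef (- \<theta>) a"
  using cf[of "- \<theta>"] by auto

lemma cf_theta: "intfun (cf \<theta>)" "a \<in> LL \<Longrightarrow> cf \<theta> a = coef \<theta> a"
  using cf[of \<theta>] by auto

lemma cf_Lm1: "\<beta> \<in> L1 \<Longrightarrow> intfun (cf (\<beta> - \<theta>))" "\<beta> \<in> L1 \<Longrightarrow> a \<in> LL \<Longrightarrow> cf (\<beta> - \<theta>) a = coef (\<beta> - \<theta>) a"
  using cf[of "\<beta> - \<theta>"] L1_deg[of \<beta>] by auto

lemma cf_L1: "\<beta> \<in> L1 \<Longrightarrow> intfun (cf \<beta>)" "\<beta> \<in> L1 \<Longrightarrow> a \<in> LL \<Longrightarrow> cf \<beta> a = coef \<beta> a"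
  using cf[of \<beta>] L1_deg[of \<beta>] by auto

lemma ofn_yy: "ofn yy" unfolding yy_def[abs_def] by (rule ofn_intfun[OF cf_mtheta(1) MO_YY])

lemma ofn_rr: "\<beta> \<in> L1 \<Longrightarrow> ofn (rr \<beta>)"
  unfolding rr_def[abs_def] by (rule ofn_intfun[OF cf_Lm1(1) MO_YY])

lemma ofn_ee: "\<beta> \<in> L1 \<Longrightarrow> ofn (ee \<beta>)"
  unfolding ee_def[abs_def] by (intro ofn_intros ofn_rr L1_compl) auto

text \<open>The element \<open>X\<^sub>\<beta>\<close> is obtained from \<open>X\<^bsub>-\<theta>\<^esub>\<close> by root automorphisms with which the centralizer
  commutes, so that its image is determined by that of \<open>X\<^bsub>-\<theta>\<^esub>\<close>.\<close>

lemma Ad_L1: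
  assumes b: "\<beta> \<in> L1"
  shows "Ad (X \<beta>) \<simeq> (\<lambda>A. smul (yy A) (X \<beta>) + smul (ee \<beta> A) (X \<theta>))"
proof -
  define F where "F a = E \<beta> 1 (E \<theta> 1 a - a) - (E \<theta> 1 a - a)" for a
  have ib: "intmat (E \<theta> 1 (X (- \<theta>)))"
    by (rule intop_int[OF intop_E]) auto
  have ic: "intmat (E \<theta> 1 (X (- \<theta>)) - X (- \<theta>))" using ib by simp
  have 1: "(\<lambda>A. Ad (E \<theta> 1 (X (- \<theta>)) - X (- \<theta>)) A) \<simeq> (\<lambda>A. E \<theta> 1 (YY A) - YY A)"
    unfolding Ad_simps YY_def by (intro eqv_diff Ad_E eqv_refl MO_Ad) auto
  have 2: "Ad (E \<beta> 1 (E \<theta> 1 (X (- \<theta>)) - X (- \<theta>))) \<simeq> (\<lambda>A. E \<beta> 1 (E \<theta> 1 (YY A) - YY A))"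
    using eqv_trans[OF Ad_E(1)[OF _ L1_ge[OF b] ic] eqv_E[OF _ 1]] b by simp
  have "(\<lambda>A. Ad (F (X (- \<theta>))) A) \<simeq> (\<lambda>A. F (YY A))"
    unfolding F_def Ad_simps(2)[of "E \<beta> 1 _"] by (rule eqv_diff[OF 2 1])
  moreover have "F (X (- \<theta>)) = - X \<beta>"
  proof -
    have nb: "- \<beta> \<in> \<Phi>" "- \<beta> \<noteq> - \<theta>" using b L1_deg[OF b] by auto
    show ?thesis using double_difference[OF b, of "X (- \<theta>)"] nb by (simp add: F_def)
  qed
  ultimately have "(\<lambda>A. - Ad (X \<beta>) A) \<simeq> (\<lambda>A. F (YY A))" by (simp add: Ad_simps)
  then have "(\<lambda>A. 0 - - Ad (X \<beta>) A) \<simeq> (\<lambda>A. 0 - F (YY A))" by (intro eqv_diff eqv_const) auto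
  then have "Ad (X \<beta>) \<simeq> (\<lambda>A. - F (YY A))" by simp
  then show ?thesis
  proof (rule eqv_trans_right)
    fix A assume A: "A \<in> EC"
    have "rr (\<theta> - \<beta>) A = coef (- \<beta>) (YY A)" using cf_Lm1(2)[OF L1_compl[OF b] YY_LL[OF A]] by (simp add: rr_def)
    then show "- F (YY A) = smul (yy A) (X \<beta>) + smul (ee \<beta> A) (X \<theta>)"
      using double_difference[OF b YY_LL[OF A]] cf_mtheta(2)[OF YY_LL[OF A]]
      by (simp add: F_def ee_def yy_def)
  qed
qed

lemma int_parts: assumes "\<beta> \<in> L1" shows "intmat (comm (X \<beta>) (X (- \<theta>)))" "intmat (comm (qq \<beta>) (X \<beta>))"
  using int_qq[OF assms] assms by auto

text \<open>As \<open>E \<theta> 1\<close> fixes \<open>qq \<beta>\<close>, it fixes its image up to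
  congruence. But it adds to the coordinate at \<beta> the one at \<open>\<beta> - \<theta>\<close>,
  up to sign, so the latter is congruent to 0.\<close>

lemma Ad_qq_coef:
  assumes b: "\<beta> \<in> L1" shows "jfn (\<lambda>A. cf (\<beta> - \<theta>) (Ad (qq \<beta>) A))"
proof -
  have "Ad (qq \<beta>) \<simeq> (\<lambda>A. E \<theta> 1 (Ad (qq \<beta>) A))"
    using Ad_E(1)[of \<theta> "qq \<beta>"] int_qq[OF b] E_theta_qq[OF b] by simp
  from eqv_intfun[OF cf_L1(1)[OF b] eqv_sym[OF this]]
  have "jfn (\<lambda>A. of_int (N \<theta> (\<beta> - \<theta>)) * (cf \<beta> (E \<theta> 1 (Ad (qq \<beta>) A)) - cf \<beta> (Ad (qq \<beta>) A)))"
    by (intro jfn_intros(5) ofn_intros) auto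
  then show ?thesis
  proof (rule jfn_cong)
    fix A assume A: "A \<in> EC"
    have L: "Ad (qq \<beta>) A \<in> LL" by (rule Ad_LL(1)[OF A qq_LL[OF b]])
    have "of_int (N \<theta> (\<beta> - \<theta>)) * of_int (N \<theta> (\<beta> - \<theta>)) = (1::complex)"
      using abs_1[OF N_theta[of "\<beta> - \<theta>"]] b L1_deg[OF b] by auto
    then show "of_int (N \<theta> (\<beta> - \<theta>)) * (cf \<beta> (E \<theta> 1 (Ad (qq \<beta>) A)) - cf \<beta> (Ad (qq \<beta>) A)) = cf (\<beta> - \<theta>) (Ad (qq \<beta>) A)"
      using cf_L1(2)[OF b] E_LL[OF _ L] L coef_E_theta[OF b L] cf_Lm1(2)[OF b L] by simp
  qed
qed

text \<open>Ad is applied to the defining equation of \<open>qq \<beta>\<close>. On one side it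
  commutes with \<open>E \<beta> 1\<close>; on the other the commutator with
  \<open>X \<beta>\<close> becomes the commutator with the image found in \<open>Ad_L1\<close>.
  Comparing coordinates yields equations between \<open>yy\<close> and \<open>ee\<close>.\<close>

lemma second_order:
  assumes b: "\<beta> \<in> L1"
  shows "(\<lambda>A. E \<beta> 1 (YY A) - YY A)
    \<simeq> (\<lambda>A. comm (smul (yy A) (X \<beta>) + smul (ee \<beta> A) (X \<theta>)) (YY A) + Ad (qq \<beta>) A)"
proof -
  have 1: "Ad (E \<beta> 1 (X (- \<theta>))) \<simeq> (\<lambda>A. E \<beta> 1 (YY A))"
    unfolding YY_def by (rule Ad_E) (use b L1_ge in auto)
  have 2: "(\<lambda>A. Ad (comm (X \<beta>) (X (- \<theta>))) A + Ad (qq \<beta>) A)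
     \<simeq> (\<lambda>A. comm (smul (yy A) (X \<beta>) + smul (ee \<beta> A) (X \<theta>)) (YY A) + Ad (qq \<beta>) A)"
  proof (rule eqv_add)
    show "Ad (comm (X \<beta>) (X (- \<theta>))) \<simeq> (\<lambda>A. comm (smul (yy A) (X \<beta>) + smul (ee \<beta> A) (X \<theta>)) (YY A))"
      by (rule eqv_trans_left[OF _ eqv_comm[OF Ad_L1[OF b] eqv_refl[OF MO_YY]]]) (simp add: Ad_comm YY_def)
    show "Ad (qq \<beta>) \<simeq> Ad (qq \<beta>)" by (intro eqv_refl MO_Ad int_qq b)
  qed
  have 3: "(\<lambda>A. Ad (E \<beta> 1 (X (- \<theta>))) A - YY A) \<simeq> (\<lambda>A. E \<beta> 1 (YY A) - YY A)"
    by (rule eqv_diff[OF 1 eqv_refl[OF MO_YY]])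
  have "(\<lambda>A. Ad (E \<beta> 1 (X (- \<theta>))) A - YY A) \<simeq> (\<lambda>A. comm (smul (yy A) (X \<beta>) + smul (ee \<beta> A) (X \<theta>)) (YY A) + Ad (qq \<beta>) A)"
    by (rule eqv_trans_left[OF _ 2]) (simp add: YY_def qq_def Ad_simps)
  with 3 show ?thesis by (rule eqv_trans[OF eqv_sym])
qed

text \<open>At \<open>\<beta> - \<theta>\<close> the left side of \<open>second_order\<close> has
  the coordinate \<open>yy\<close> up to sign, and the right side \<open>yy\<close> squared with the
  same sign: one factor comes from the image of \<open>X \<beta>\<close>, the other from Y. The
  terms with \<open>X \<theta>\<close> and \<open>qq \<beta>\<close> do not contribute.\<close>

lemma yy_idempotent: "jfn (\<lambda>A. (1 - yy A) * yy A)"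
proof -
  obtain \<beta> where b: "\<beta> \<in> L1" using L1_nonempty by blast
  define n :: complex where "n = of_int (N \<beta> (- \<theta>))"
  have n: "n * n = 1" using abs_1[OF N_L1_mtheta[OF b]] by (auto simp: n_def)
  have "jfn (\<lambda>A. cf (\<beta> - \<theta>) (E \<beta> 1 (YY A) - YY A)
      - cf (\<beta> - \<theta>) (comm (smul (yy A) (X \<beta>) + smul (ee \<beta> A) (X \<theta>)) (YY A) + Ad (qq \<beta>) A))"
    by (rule eqv_intfun[OF cf_Lm1(1)[OF b] second_order[OF b]])
  then have "jfn (\<lambda>A. n * ((cf (\<beta> - \<theta>) (E \<beta> 1 (YY A) - YY A)
      - cf (\<beta> - \<theta>) (comm (smul (yy A) (X \<beta>) + smul (ee \<beta> A) (X \<theta>)) (YY A) + Ad (qq \<beta>) A))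
      + cf (\<beta> - \<theta>) (Ad (qq \<beta>) A)))"
    by (intro jfn_intros(5) jfn_intros(2) Ad_qq_coef b ofn_intros) (auto simp: n_def)
  then show ?thesis
  proof (rule jfn_cong)
    fix A assume A: "A \<in> EC"
    note L = YY_LL[OF A]
    have c: "comm (X \<beta>) (YY A) \<in> LL" "comm (X \<theta>) (YY A) \<in> LL" "E \<beta> 1 (YY A) \<in> LL" "Ad (qq \<beta>) A \<in> LL"
      using comm_LL E_LL L b Ad_LL(1)[OF A qq_LL[OF b]] by auto
    have 1: "cf (\<beta> - \<theta>) (E \<beta> 1 (YY A) - YY A) = n * yy A"
      using c L coef_E_L1[OF b b L, of 1] b
      by (simp add: cf_Lm1 intfun_D[OF cf_Lm1(1)[OF b]] n_def yy_def cf_mtheta)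
    have 2: "cf (\<beta> - \<theta>) (comm (smul (yy A) (X \<beta>) + smul (ee \<beta> A) (X \<theta>)) (YY A) + Ad (qq \<beta>) A)
       = yy A * (n * yy A) + cf (\<beta> - \<theta>) (Ad (qq \<beta>) A)"
      using c L coef_comm_L1[OF b L] coef_comm_theta_m1[OF b L] b
      by (simp add: comm_simps cf_Lm1 intfun_D[OF cf_Lm1(1)[OF b]] n_def yy_def cf_mtheta)
    show "n * ((cf (\<beta> - \<theta>) (E \<beta> 1 (YY A) - YY A)
      - cf (\<beta> - \<theta>) (comm (smul (yy A) (X \<beta>) + smul (ee \<beta> A) (X \<theta>)) (YY A) + Ad (qq \<beta>) A))
      + cf (\<beta> - \<theta>) (Ad (qq \<beta>) A)) = (1 - yy A) * yy A"
    proof -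
      have "n * (n * yy A - (yy A * (n * yy A) + cf (\<beta> - \<theta>) (Ad (qq \<beta>) A)) + cf (\<beta> - \<theta>) (Ad (qq \<beta>) A))
        = (n * n) * ((1 - yy A) * yy A)" by (simp add: algebra_simps)
      then show ?thesis unfolding 1 2 n by simp
    qed
  qed
qed

text \<open>By the previous lemmas, \<open>(1 - yy) X\<^sub>\<beta>\<close> is congruent to a multiple of the preimage of \<open>X\<^sub>\<theta>\<close>.  The latter is
  fixed by the root automorphisms that fix \<open>X\<^sub>\<theta>\<close>, but \<open>X\<^sub>\<beta>\<close> is not.\<close>

lemma yy_one: "jfn (\<lambda>A. 1 - yy A)"
proof -
  obtain \<beta> where b: "\<beta> \<in> L1" using L1_nonempty by blast
  define u where "u A = 1 - yy A" for A
  have u: "ofn u" unfolding u_def[abs_def] by (intro ofn_intros ofn_yy)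
  have iX: "intmat (X \<beta>)" "intmat (X \<theta>)" using b by auto
  have "(\<lambda>A. minv A * Ad (X \<beta>) A * A) \<simeq> (\<lambda>A. minv A * (smul (yy A) (X \<beta>) + smul (ee \<beta> A) (X \<theta>)) * A)"
    by (intro eqv_mult eqv_refl MO_inv MO_id Ad_L1 b)
  then have "(\<lambda>_. X \<beta>) \<simeq> (\<lambda>A. minv A * (smul (yy A) (X \<beta>) + smul (ee \<beta> A) (X \<theta>)) * A)"
    by (rule eqv_trans_left[rotated]) (simp add: Ad_Ad')
  then have "(\<lambda>_. X \<beta>) \<simeq> (\<lambda>A. smul (yy A) (Ad' (X \<beta>) A) + smul (ee \<beta> A) (Ad' (X \<theta>) A))"
    by (simp add: Ad'_def algebra_simps)
  then have 1: "(\<lambda>A. smul (u A) (X \<beta>)) \<simeq> (\<lambda>A. smul (u A) (smul (yy A) (Ad' (X \<beta>) A) + smul (ee \<beta> A) (Ad' (X \<theta>) A)))"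
    by (rule eqv_smul[OF u])
  have 2: "(\<lambda>A. smul (u A * yy A) (Ad' (X \<beta>) A)) \<simeq> (\<lambda>A. smul 0 (Ad' (X \<beta>) A))"
    by (rule eqv_smul_left) (use yy_idempotent in \<open>auto simp: u_def intro!: ofn_intros ofn_yy MO_Ad iX u[unfolded u_def]\<close>)
  have "(\<lambda>A. smul (u A) (smul (yy A) (Ad' (X \<beta>) A) + smul (ee \<beta> A) (Ad' (X \<theta>) A)))
      \<simeq> (\<lambda>A. smul (u A * ee \<beta> A) (Ad' (X \<theta>) A))"
    using eqv_add[OF 2 eqv_refl[of "\<lambda>A. smul (u A * ee \<beta> A) (Ad' (X \<theta>) A)"]]
    by (simp add: sqm.scale_right_distrib MO_intros ofn_intros u ofn_ee b MO_Ad iX)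
  from eqv_trans[OF 1 this] have 3: "(\<lambda>A. smul (u A) (X \<beta>)) \<simeq> (\<lambda>A. smul (u A * ee \<beta> A) (Ad' (X \<theta>) A))" .
  \<comment> \<open>\<open>smul (u A) (X \<beta>)\<close> is congruent to a multiple of
    \<open>Ad' (X \<theta>) A\<close>, which \<open>E \<delta> 1\<close> fixes up to congruence
    because it fixes \<open>X \<theta>\<close>.\<close>
  have key: "jfn (\<lambda>A. f (E \<delta> 1 (X \<beta>) - X \<beta>) * u A)"
    if d: "\<delta> \<in> \<Phi>" "deg \<delta> \<ge> 0" "E \<delta> 1 (X \<theta>) = X \<theta>" and f: "intfun f" for \<delta> f
  proof -
    have "Ad' (X \<theta>) \<simeq> (\<lambda>A. E \<delta> 1 (Ad' (X \<theta>) A))" using Ad_E(2)[OF d(1,2) iX(2)] d(3) by simp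
    then have 4: "(\<lambda>A. smul (u A * ee \<beta> A) (Ad' (X \<theta>) A)) \<simeq> (\<lambda>A. smul (u A * ee \<beta> A) (E \<delta> 1 (Ad' (X \<theta>) A)))"
      by (intro eqv_smul ofn_intros u ofn_ee b)
    have 5: "(\<lambda>A. E \<delta> 1 (smul (u A) (X \<beta>))) \<simeq> (\<lambda>A. smul (u A * ee \<beta> A) (E \<delta> 1 (Ad' (X \<theta>) A)))"
      using eqv_E[OF d(1) 3] by (simp add: E_smul)
    have "(\<lambda>A. E \<delta> 1 (smul (u A) (X \<beta>))) \<simeq> (\<lambda>A. smul (u A) (X \<beta>))"
      using eqv_trans[OF 3 4] 5 by (blast intro: eqv_trans eqv_sym)
    from eqv_intfun[OF f this] show ?thesis
      by (simp add: E_smul intfun_D[OF f] algebra_simps)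
  qed
  have i: "\<theta> - \<beta> \<in> \<Phi>" "\<theta> - \<beta> \<in> L1" "deg (\<theta> - \<beta>) \<ge> 0" using b L1_compl[OF b] L1_ge[OF L1_compl[OF b]] by simp_all
  have "jfn (\<lambda>A. cf \<theta> (E (\<theta> - \<beta>) 1 (X \<beta>) - X \<beta>) * u A)"
    by (rule key[OF i(1,3) E_L1_theta[OF i(2)] cf_theta(1)])
  moreover have "cf \<theta> (E (\<theta> - \<beta>) 1 (X \<beta>) - X \<beta>) = of_int (N (\<theta> - \<beta>) \<beta>)"
    using E_L1_L1[OF i(2) b, of 1] by (simp add: cf_theta)
  ultimately have m1: "jfn (\<lambda>A. of_int (N (\<theta> - \<beta>) \<beta>) * u A)" by simp
  have a1: "\<bar>N (\<theta> - \<beta>) \<beta>\<bar> = int (mlt \<beta>)"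
    using N_compl[OF i(2)] mult_compl[OF b] by simp
  have "jfn u"
  proof (cases "mlt \<beta> = 1")
    case True
    show ?thesis by (rule jfn_int_factors[OF u m1, of 0]) (use a1 True jfn_intros(1) in auto)
  next
    case False
    \<comment> \<open>The relation from \<open>\<theta> - \<beta>\<close> only kills
      \<open>mlt \<beta>\<close> times u. The root of degree 0 supplies the coprime factor
      \<open>mlt \<beta> - 1\<close>.\<close>
    then have m: "mlt \<beta> \<ge> 2" using mult_cartan(2)[OF b] by auto
    have d: "\<theta> - 2 *\<^sub>R \<beta> \<in> \<Phi>" by (rule theta_minus_2[OF b m])
    have "jfn (\<lambda>A. cf (\<theta> - \<beta>) (E (\<theta> - 2 *\<^sub>R \<beta>) 1 (X \<beta>) - X \<beta>) * u A)"
      by (rule key[OF d _ _ cf_L1(1)[OF i(2)]]) (use delta_deg[OF b] E_delta_theta(1)[OF d] in auto)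
    moreover have "cf (\<theta> - \<beta>) (E (\<theta> - 2 *\<^sub>R \<beta>) 1 (X \<beta>) - X \<beta>) = of_int (N (\<theta> - 2 *\<^sub>R \<beta>) \<beta>)"
    proof -
      have "\<theta> - \<beta> \<noteq> \<beta>" using theta_multiple[OF L1_root[OF b], of 2 1] by (auto simp: scaleR_2 diff_eq_eq)
      then show ?thesis
        using coef_E_delta_L1[OF b m] cf_L1(2)[OF i(2)] E_LL[OF d] b i by simp
    qed
    ultimately have m2: "jfn (\<lambda>A. of_int (N (\<theta> - 2 *\<^sub>R \<beta>) \<beta>) * u A)" by simp
    show ?thesis by (rule jfn_int_factors[OF u m1 m2 a1 N_delta_L1[OF b m]])
  qed
  then show ?thesis by (simp add: u_def[abs_def])
qed

text \<open>The functional h takes the coordinate at \<beta> of the commutator with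
  \<open>X \<beta>\<close>. Applied to \<open>second_order\<close> with \<open>yy\<close> replaced
  by 1, it annihilates the terms of order two on the left by \<open>coef_comm_second_order\<close>;
  on the right \<open>ee \<beta>\<close> times [X \<theta>, Y] yields \<open>ee \<beta>\<close>
  times \<open>yy\<close>, and the image of \<open>qq \<beta>\<close> yields 0 up to
  congruence.\<close>

lemma ee_zero:
  assumes b: "\<beta> \<in> L1" shows "jfn (ee \<beta>)"
proof -
  define h where "h a = cf \<beta> (comm a (X \<beta>))" for a
  have br: "\<beta> \<in> \<Phi>" "intmat (X \<beta>)" using b by auto
  have "intop (\<lambda>a. comm a (X \<beta>))" using br by (auto simp: intop_def comm_simps)
  then have h: "intfun h" unfolding h_def[abs_def] by (rule intfun_intop[OF cf_L1(1)[OF b]])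
  have y1: "(\<lambda>A. smul (yy A) (F A)) \<simeq> F" if "MO F" for F
  proof -
    have "(\<lambda>A. smul (yy A) (F A)) \<simeq> (\<lambda>A. smul 1 (F A))"
      using jfn_intros(4)[OF yy_one] that by (intro eqv_smul_left ofn_intros ofn_yy) auto
    then show ?thesis by simp
  qed
  have MOc: "MO (\<lambda>A. comm (X \<beta>) (YY A))" "MO (\<lambda>A. comm (X \<theta>) (YY A))" "MO (Ad (qq \<beta>))"
    using br MO_YY int_qq[OF b] by (auto simp: comm_def intro!: MO_intros MO_Ad)
  have "(\<lambda>A. E \<beta> 1 (YY A) - YY A) \<simeq> (\<lambda>A. smul (yy A) (comm (X \<beta>) (YY A)) + smul (ee \<beta> A) (comm (X \<theta>) (YY A)) + Ad (qq \<beta>) A)"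
    using second_order[OF b] by (simp add: comm_simps)
  moreover have "(\<lambda>A. smul (yy A) (comm (X \<beta>) (YY A)) + smul (ee \<beta> A) (comm (X \<theta>) (YY A)) + Ad (qq \<beta>) A)
     \<simeq> (\<lambda>A. comm (X \<beta>) (YY A) + smul (ee \<beta> A) (comm (X \<theta>) (YY A)) + Ad (qq \<beta>) A)"
    by (intro eqv_add y1 eqv_refl MO_intros MOc ofn_ee b)
  ultimately have "(\<lambda>A. E \<beta> 1 (YY A) - YY A) \<simeq> (\<lambda>A. comm (X \<beta>) (YY A) + smul (ee \<beta> A) (comm (X \<theta>) (YY A)) + Ad (qq \<beta>) A)"
    by (rule eqv_trans)
  from eqv_intfun[OF h this] have j1: "jfn (\<lambda>A. h (E \<beta> 1 (YY A) - YY A)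
      - h (comm (X \<beta>) (YY A) + smul (ee \<beta> A) (comm (X \<theta>) (YY A)) + Ad (qq \<beta>) A))" .
  \<comment> \<open>Up to congruence \<open>X \<beta>\<close> is
    \<open>Ad (X \<beta>) A - smul (ee \<beta> A) (X \<theta>)\<close>. The first term turns the
    commutator into the image of [qq \<beta>, X \<beta>], a multiple of
    \<open>X (3 *\<^sub>R \<beta> - \<theta>)\<close>, whose image has no coordinate at \<beta> by
    \<open>Ad_L1\<close>. The second term leads to the coordinate handled in
    \<open>Ad_qq_coef\<close>.\<close>
  have j2: "jfn (\<lambda>A. h (Ad (qq \<beta>) A))"
  proof -
    have "(\<lambda>A. smul (yy A) (X \<beta>) + smul (ee \<beta> A) (X \<theta>)) \<simeq> (\<lambda>A. X \<beta> + smul (ee \<beta> A) (X \<theta>))"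
      using br by (intro eqv_add y1 eqv_refl MO_intros ofn_ee b) auto
    from eqv_trans[OF Ad_L1[OF b] this]
    have "(\<lambda>A. Ad (X \<beta>) A - smul (ee \<beta> A) (X \<theta>)) \<simeq> (\<lambda>A. X \<beta> + smul (ee \<beta> A) (X \<theta>) - smul (ee \<beta> A) (X \<theta>))"
      by (intro eqv_diff eqv_refl MO_intros ofn_ee b) auto
    then have "(\<lambda>A. Ad (X \<beta>) A - smul (ee \<beta> A) (X \<theta>)) \<simeq> (\<lambda>A. X \<beta>)" by simp
    from eqv_comm[OF eqv_refl[OF MOc(3)] this]
    have c1: "(\<lambda>A. comm (Ad (qq \<beta>) A) (Ad (X \<beta>) A - smul (ee \<beta> A) (X \<theta>))) \<simeq> (\<lambda>A. comm (Ad (qq \<beta>) A) (X \<beta>))" .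
    have "jfn (\<lambda>A. cf \<beta> (comm (Ad (qq \<beta>) A) (Ad (X \<beta>) A - smul (ee \<beta> A) (X \<theta>))))"
    proof -
      have ja: "jfn (\<lambda>A. ee \<beta> A * (- of_int (N \<theta> (\<beta> - \<theta>)) * cf (\<beta> - \<theta>) (Ad (qq \<beta>) A)))"
        by (intro jfn_intros(5) Ad_qq_coef b ofn_ee ofn_intros) auto
      have jb: "jfn (\<lambda>A. cf \<beta> (Ad (comm (qq \<beta>) (X \<beta>)) A))"
      proof (cases "3 *\<^sub>R \<beta> - \<theta> \<in> \<Phi>")
        case False
        have "3 *\<^sub>R \<beta> - \<theta> \<noteq> 0"
        proof
          assume "3 *\<^sub>R \<beta> - \<theta> = 0"
          then have "deg (3 *\<^sub>R \<beta> - \<theta>) = 0" by (metis deg_simps(5))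
          then show False using L1_deg[OF b] by simp
        qed
        then have "comm (qq \<beta>) (X \<beta>) = 0" using W_trivial[OF comm_qq_W[OF b] False] by blast
        then show ?thesis using jfn_intros(1) by (simp add: Ad_simps intfun_D[OF cf_L1(1)[OF b]])
      next
        case True
        then have g: "3 *\<^sub>R \<beta> - \<theta> \<in> L1" using L1_deg[OF b] unfolding L1_def by simp
        have ne: "\<beta> \<noteq> 3 *\<^sub>R \<beta> - \<theta>" "\<beta> \<noteq> \<theta>"
        proof -
          show "\<beta> \<noteq> \<theta>" using L1_deg[OF b] by auto
          show "\<beta> \<noteq> 3 *\<^sub>R \<beta> - \<theta>"
          proof
            assume "\<beta> = 3 *\<^sub>R \<beta> - \<theta>"
            then have "2 *\<^sub>R \<beta> = 1 *\<^sub>R \<theta>" unfolding scaleR_3 by simp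
            then show False using theta_multiple[OF br(1), of 2 1] by auto
          qed
        qed
        define c where "c = coef (3 *\<^sub>R \<beta> - \<theta>) (comm (qq \<beta>) (X \<beta>))"
        have ceq: "comm (qq \<beta>) (X \<beta>) = smul c (X (3 *\<^sub>R \<beta> - \<theta>))"
          unfolding c_def by (rule W_coef[OF comm_qq_W[OF b] True])
        have "c = cf (3 *\<^sub>R \<beta> - \<theta>) (comm (qq \<beta>) (X \<beta>))"
          unfolding c_def by (rule cf_L1(2)[OF g W_LL[OF comm_qq_W[OF b]], symmetric])
        then have c: "c \<in> \<int>" using intfun_D(3)[OF cf_L1(1)[OF g] int_parts(2)[OF b]] by simp
        have "jfn (\<lambda>A. c * (cf \<beta> (Ad (X (3 *\<^sub>R \<beta> - \<theta>)) A) - cf \<beta> (smul (yy A) (X (3 *\<^sub>R \<beta> - \<theta>)) + smul (ee (3 *\<^sub>R \<beta> - \<theta>) A) (X \<theta>))))"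
          by (intro jfn_intros(5) eqv_intfun[OF cf_L1(1)[OF b] Ad_L1[OF g]] ofn_intros c)
        then show ?thesis
          using g b ne br by (simp add: ceq Ad_simps intfun_D[OF cf_L1(1)[OF b]] cf_L1(2)[OF b])
      qed
      from jfn_intros(3)[OF jb ja] show ?thesis
      proof (rule jfn_cong)
        fix A assume A: "A \<in> EC"
        have L: "Ad (qq \<beta>) A \<in> LL" by (rule Ad_LL(1)[OF A qq_LL[OF b]])
        have bt: "\<beta> \<noteq> \<theta>" using L1_deg[OF b] by auto
        have "cf \<beta> (comm (Ad (qq \<beta>) A) (X \<theta>)) = - cf \<beta> (comm (X \<theta>) (Ad (qq \<beta>) A))"
          by (subst comm_swap) (simp add: intfun_D[OF cf_L1(1)[OF b]])
        also have "\<dots> = - of_int (N \<theta> (\<beta> - \<theta>)) * cf (\<beta> - \<theta>) (Ad (qq \<beta>) A)"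
          using coef_comm[of \<theta> \<beta>, OF _ br(1) bt L] cf_L1(2)[OF b comm_LL[OF _ L]] cf_Lm1(2)[OF b L] b by simp
        finally show "cf \<beta> (Ad (comm (qq \<beta>) (X \<beta>)) A) - ee \<beta> A * (- of_int (N \<theta> (\<beta> - \<theta>)) * cf (\<beta> - \<theta>) (Ad (qq \<beta>) A))
          = cf \<beta> (comm (Ad (qq \<beta>) A) (Ad (X \<beta>) A - smul (ee \<beta> A) (X \<theta>)))"
          using A by (simp add: Ad_comm comm_simps intfun_D[OF cf_L1(1)[OF b]])
      qed
    qed
    from jfn_intros(3)[OF this eqv_intfun[OF cf_L1(1)[OF b] c1]] show ?thesis by (simp add: h_def)
  qed
  have j3: "jfn (\<lambda>A. ee \<beta> A * (1 - yy A))" by (intro jfn_intros(5) yy_one ofn_ee b)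
  from jfn_intros(3)[OF j3 jfn_intros(2)[OF j1 j2]] show ?thesis
  proof (rule jfn_cong)
    fix A assume A: "A \<in> EC"
    note L = YY_LL[OF A]
    have EL: "E \<beta> 1 (YY A) \<in> LL" by (rule E_LL[OF br(1) L])
    have "E \<beta> 1 (YY A) - YY A - comm (X \<beta>) (YY A) \<in> LL" using EL L comm_LL[OF br(1) L] by simp
    then have 0: "h (E \<beta> 1 (YY A) - YY A - comm (X \<beta>) (YY A)) = 0"
      using coef_comm_second_order[OF b L] cf_L1(2)[OF b comm_LL'[OF _ LL_X[OF br(1)]]] by (simp add: h_def)
    have 1: "h (comm (X \<theta>) (YY A)) = yy A"
      using coef_comm_comm_theta[OF b L] cf_L1(2)[OF b comm_LL'[OF comm_LL[OF _ L] LL_X[OF br(1)]]] cf_mtheta(2)[OF L]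
      by (simp add: h_def yy_def)
    show "ee \<beta> A * (1 - yy A) - (h (E \<beta> 1 (YY A) - YY A) - h (comm (X \<beta>) (YY A) + smul (ee \<beta> A) (comm (X \<theta>) (YY A)) + Ad (qq \<beta>) A)
        + h (Ad (qq \<beta>) A)) = ee \<beta> A"
      using 0 by (simp add: intfun_D[OF h] 1 algebra_simps)
  qed
qed

text \<open>\<open>ee_zero\<close> controls only \<open>mlt \<beta>\<close> times
  \<open>rr \<beta>\<close>. For short \<beta> the automorphism of \<delta> =
  \<open>\<theta> - 2 *\<^sub>R \<beta>\<close> fixes \<open>X (- \<theta>)\<close> and hence Y up
  to congruence; the coordinate at \<open>- \<beta>\<close> then controls
  \<open>mlt \<beta> - 1\<close> times \<open>rr \<beta>\<close>, apart from a G2 term that belongs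
  to a long root.\<close>

lemma rr_zero:
  assumes b: "\<beta> \<in> L1" shows "jfn (rr \<beta>)"
proof -
  have m1: "jfn (\<lambda>A. of_int (nu (\<theta> - \<gamma>)) * rr \<gamma> A)" "\<bar>nu (\<theta> - \<gamma>)\<bar> = int (mlt \<gamma>)" if g: "\<gamma> \<in> L1" for \<gamma>
    using jfn_intros(4)[OF ee_zero[OF L1_compl[OF g]]] abs_nu[OF L1_compl[OF g]] mult_compl[OF g]
    by (simp_all add: ee_def[abs_def])
  have long: "jfn (rr \<gamma>)" if g: "\<gamma> \<in> L1" "mlt \<gamma> = 1" for \<gamma>
    by (rule jfn_int_factors[OF ofn_rr[OF g(1)] m1(1)[OF g(1)], of 0]) (use m1(2)[OF g(1)] g(2) jfn_intros(1) in auto)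
  show ?thesis
  proof (cases "mlt \<beta> = 1")
    case True then show ?thesis by (rule long[OF b])
  next
    case False
    then have m: "mlt \<beta> \<ge> 2" "mlt \<beta> = 2 \<or> mlt \<beta> = 3" using mult_cartan(2)[OF b] by auto
    define \<delta> where "\<delta> = \<theta> - 2 *\<^sub>R \<beta>"
    have d: "\<delta> \<in> \<Phi>" unfolding \<delta>_def by (rule theta_minus_2[OF b m(1)])
    have dd: "deg \<delta> = 0" unfolding \<delta>_def by (rule delta_deg[OF b])
    have nb: "- \<beta> \<in> \<Phi>" "intfun (cf (- \<beta>))" "\<And>a. a \<in> LL \<Longrightarrow> cf (- \<beta>) a = coef (- \<beta>) a"
      using b cf_Lm1[OF L1_compl[OF b]] by auto
    define c where "c = coef (- \<beta>) (adp (X \<delta>) 2 (X (3 *\<^sub>R \<beta> - 2 *\<^sub>R \<theta>)))"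
    have "YY \<simeq> (\<lambda>A. E \<delta> 1 (YY A))"
      using Ad_E(1)[OF d, of "X (- \<theta>)"] E_delta_theta(2)[OF d dd] dd by (simp add: YY_def)
    from eqv_intfun[OF nb(2) eqv_sym[OF this]]
    have j: "jfn (\<lambda>A. cf (- \<beta>) (E \<delta> 1 (YY A)) - cf (- \<beta>) (YY A))" .
    have j2: "jfn (\<lambda>A. if 3 *\<^sub>R \<beta> - 2 *\<^sub>R \<theta> \<in> \<Phi> then c * rr (3 *\<^sub>R \<beta> - \<theta>) A else 0)"
    proof (cases "3 *\<^sub>R \<beta> - 2 *\<^sub>R \<theta> \<in> \<Phi>")
      case True
      have m3: "mlt \<beta> = 3"
      proof (rule ccontr)
        assume "mlt \<beta> \<noteq> 3"
        with m have m2: "mlt \<beta> = 2" by auto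
        have "(-2) *\<^sub>R \<theta> + 3 *\<^sub>R \<beta> \<in> \<Phi>" using True by simp
        from deg_bounds[OF reflect_lin[OF b this]] L1_deg[OF b] m2 show False by simp
      qed
      have g: "3 *\<^sub>R \<beta> - \<theta> \<in> L1" "mlt (3 *\<^sub>R \<beta> - \<theta>) = 1" using mult_3[OF b m3] by auto
      have "c = cf (- \<beta>) (adp (X \<delta>) 2 (X (3 *\<^sub>R \<beta> - 2 *\<^sub>R \<theta>)))"
        unfolding c_def using nb(3) adp_LL[OF d LL_X[OF True]] by simp
      moreover have "intmat (adp (X \<delta>) 2 (X (3 *\<^sub>R \<beta> - 2 *\<^sub>R \<theta>)))"
        by (rule intop_int[OF intop_adp[OF d] int_X[OF True]])
      ultimately have "c \<in> \<int>" using intfun_D(3)[OF nb(2)] by simp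
      then show ?thesis using True by (simp) (intro jfn_intros(5) long g ofn_intros)
    qed (simp add: jfn_intros(1))
    from jfn_intros(3)[OF j j2] have "jfn (\<lambda>A. of_int (N \<delta> (\<beta> - \<theta>)) * rr \<beta> A)"
    proof (rule jfn_cong)
      fix A assume A: "A \<in> EC"
      note L = YY_LL[OF A]
      have e: "3 *\<^sub>R \<beta> - \<theta> - \<theta> = 3 *\<^sub>R \<beta> - 2 *\<^sub>R \<theta>" by (simp add: scaleR_2)
      have r3: "rr (3 *\<^sub>R \<beta> - \<theta>) A = coef (3 *\<^sub>R \<beta> - 2 *\<^sub>R \<theta>) (YY A)" if "3 *\<^sub>R \<beta> - 2 *\<^sub>R \<theta> \<in> \<Phi>"
        unfolding rr_def e using cf(2)[OF that _ L] L1_deg[OF b] by simp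
      show "cf (- \<beta>) (E \<delta> 1 (YY A)) - cf (- \<beta>) (YY A)
          - (if 3 *\<^sub>R \<beta> - 2 *\<^sub>R \<theta> \<in> \<Phi> then c * rr (3 *\<^sub>R \<beta> - \<theta>) A else 0) = of_int (N \<delta> (\<beta> - \<theta>)) * rr \<beta> A"
        using coef_E_delta[OF b m(1) L] r3 nb(3) E_LL[OF d L] L cf_Lm1(2)[OF b L]
        by (simp add: \<delta>_def[symmetric] c_def rr_def)
    qed
    then show ?thesis
      using jfn_int_factors[OF ofn_rr[OF b] m1(1)[OF b] _ m1(2)[OF b]] N_delta_Lm1[OF b m(1)] by (simp add: \<delta>_def)
  qed
qed

end

section \<open>Conjugation by the centralizer\<close>

context spec
begin

lemma mrel_eqv: "mrel F B \<Longrightarrow> mrel G B \<Longrightarrow> F \<simeq> G"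
proof -
  assume F: "mrel F B" and G: "mrel G B"
  have "V (\<lambda>x. entry (F x) i j - entry (G x) i j) \<zero>" for i j
  proof -
    have f: "V (\<lambda>x. entry (F x) i j) (B $ i $ j)" and g: "V (\<lambda>x. entry (G x) i j) (B $ i $ j)"
      using F G by (auto simp: mrel_def)
    have "B $ i $ j \<ominus> B $ i $ j = \<zero>" using V_carrier[OF f] by (simp add: a_minus_def r_neg)
    then show ?thesis using V_diff[OF f g] by simp
  qed
  then show ?thesis using F G by (auto simp: eqv_def MJ_def jfn_def mrel_MO)
qed

lemma jfn_one: "jfn (\<lambda>x. 1 - f x) \<Longrightarrow> V f \<one>"
  using V_diff[OF V_one, of "\<lambda>x. 1 - f x" \<zero>] by (simp add: jfn_def a_minus_def)

lemma exp_elem_zero: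
  fixes X :: "'n::finite sqmat"
  assumes "\<And>k. intmat (dpow X k)" shows "exp_elem R (mx X) \<zero> = \<one>\<^bsub>matrix_monoid R\<^esub>"
  by (rule mrel_unique[OF mrel_exp[OF assms V_0] mrel_one]) simp

lemma mrel_adj:
  assumes "a \<in> carrier R" "mrel F B" shows "spec.mrel (adj a) (\<lambda>p. F (fst p)) B"
  using assms adj_base[OF assms(1)] unfolding mrel_def spec.mrel_def[OF spec_adj[OF assms(1)]] by blast

lemma mrel_loc:
  assumes "V d \<one>" "mrel F B" shows "spec.mrel (loc d) F B"
  using assms loc_base unfolding mrel_def spec.mrel_def[OF spec_loc[OF assms(1)]] by blast

end

context chevalley
begin

lemma mrel_ex:
  assumes "spec R S V" "\<alpha> \<in> \<Phi>" "V f r"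
  shows "spec.mrel V (\<lambda>x. ex \<alpha> (f x)) (exp_elem R (mx (X \<alpha>)) r)"
  using spec.mrel_exp[OF assms(1) int_dpow[OF assms(2)] assms(3)] by (simp add: ex_def)

end

context chevalley_graded
begin

lemma mrel_uprod:
  fixes R :: "('r, 'm) ring_scheme" (structure)
  assumes "spec R S V" "\<And>\<beta>. \<beta> \<in> set bs \<Longrightarrow> \<beta> \<in> \<Phi> \<and> V (c \<beta>) \<zero>\<^bsub>R\<^esub>"
  shows "spec.mrel V (\<lambda>x. uprod (\<lambda>\<beta>. c \<beta> x) bs) \<one>\<^bsub>matrix_monoid R\<^esub>"
    "spec.mrel V (\<lambda>x. uprod_inv (\<lambda>\<beta>. c \<beta> x) bs) \<one>\<^bsub>matrix_monoid R\<^esub>"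
proof -
  interpret spec R S V by (rule assms(1))
  interpret m: monoid "matrix_monoid R :: ('r^'n^'n) monoid" by (rule monoid_matrix)
  have one: "mrel (\<lambda>x. ex \<beta> (c \<beta> x)) \<one>\<^bsub>matrix_monoid R\<^esub>" "mrel (\<lambda>x. ex \<beta> (- c \<beta> x)) \<one>\<^bsub>matrix_monoid R\<^esub>" if "\<beta> \<in> set bs" for \<beta>
    using mrel_ex[OF assms(1), of \<beta> "c \<beta>" \<zero>] mrel_ex[OF assms(1), of \<beta> "\<lambda>x. - c \<beta> x" \<zero>]
      V_uminus[of "c \<beta>" \<zero>] assms(2)[OF that] exp_elem_zero[OF int_dpow, of \<beta>] by auto
  show "mrel (\<lambda>x. uprod (\<lambda>\<beta>. c \<beta> x) bs) \<one>\<^bsub>matrix_monoid R\<^esub>"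
    using one
  proof (induction bs)
    case Nil then show ?case by (simp add: uprod_def mrel_one)
  next
    case (Cons \<beta> bs)
    then have "mrel (\<lambda>x. ex \<beta> (c \<beta> x) * uprod (\<lambda>\<beta>. c \<beta> x) bs) (\<one>\<^bsub>matrix_monoid R\<^esub> \<otimes>\<^bsub>matrix_monoid R\<^esub> \<one>\<^bsub>matrix_monoid R\<^esub>)"
      by (intro mrel_mult) auto
    then show ?case by (simp add: uprod_def)
  qed
  show "mrel (\<lambda>x. uprod_inv (\<lambda>\<beta>. c \<beta> x) bs) \<one>\<^bsub>matrix_monoid R\<^esub>"
    using one
  proof (induction bs)
    case Nil then show ?case by (simp add: uprod_inv_def mrel_one)
  next
    case (Cons \<beta> bs)
    then have "mrel (\<lambda>x. uprod_inv (\<lambda>\<beta>. c \<beta> x) bs * ex \<beta> (- c \<beta> x)) (\<one>\<^bsub>matrix_monoid R\<^esub> \<otimes>\<^bsub>matrix_monoid R\<^esub> \<one>\<^bsub>matrix_monoid R\<^esub>)"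
      by (intro mrel_mult) auto
    then show ?case by (simp add: uprod_inv_def)
  qed
qed

text \<open>The identity of \<open>big_cell\<close> is specialized in an extension of
  \<open>at_point R g\<close>: first \<open>yy\<close> is inverted, then a variable for s is
  adjoined. There \<open>yy\<close> goes to 1 and each \<open>c \<beta>\<close> to 0, so
  \<open>uprod\<close> becomes the identity matrix and only the \<theta>-root elements remain around
  that of \<open>- \<theta>\<close>.\<close>

theorem centralizer_conjugation:
  fixes R :: "('r, 'm) ring_scheme" (structure) and g :: "'r^'n^'n"
  defines "xr \<equiv> \<lambda>\<alpha>. exp_elem R (mx (X \<alpha>))"
  assumes R: "cring R" and g: "g \<in> carrier (chevalley_group R \<Phi> (\<lambda>\<alpha>. mx (X \<alpha>)))"
    and comm: "\<And>\<delta>. \<delta> \<in> \<Phi> \<Longrightarrow> deg \<delta> \<ge> 0 \<Longrightarrow>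
      g \<otimes>\<^bsub>matrix_monoid R\<^esub> xr \<delta> \<one> = xr \<delta> \<one> \<otimes>\<^bsub>matrix_monoid R\<^esub> g"
  shows "\<exists>c\<in>carrier R. \<forall>s\<in>carrier R. g \<otimes>\<^bsub>matrix_monoid R\<^esub> xr (- \<theta>) s
    = xr \<theta> c \<otimes>\<^bsub>matrix_monoid R\<^esub> xr (- \<theta>) s \<otimes>\<^bsub>matrix_monoid R\<^esub> xr \<theta> (\<ominus> c) \<otimes>\<^bsub>matrix_monoid R\<^esub> g"
proof -
  let ?M = "matrix_monoid R :: ('r^'n^'n) monoid"
  interpret v0: spec R EC "at_point R g" by (rule point_spec[OF R g])
  interpret m: monoid ?M by (rule v0.monoid_matrix)
  have id: "v0.mrel (\<lambda>A. A) g" by (rule point_mrel[OF R g])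
  have e1: "v0.mrel (\<lambda>_. ex \<delta> 1) (xr \<delta> \<one>)" if "\<delta> \<in> \<Phi>" for \<delta>
    using mrel_ex[OF v0.spec_axioms that v0.V_one] by (simp add: xr_def)
  interpret ce: centralizer \<Phi> X T \<theta> R "at_point R g"
  proof
    show "v0.MO (\<lambda>A. A)" by (rule v0.mrel_MO[OF id])
    show "v0.eqv (\<lambda>A. A * ex \<delta> 1) (\<lambda>A. ex \<delta> 1 * A)" if d: "\<delta> \<in> \<Phi>" "0 \<le> deg \<delta>" for \<delta>
      using v0.mrel_eqv[OF v0.mrel_mult[OF id e1[OF d(1)]]] v0.mrel_mult[OF e1[OF d(1)] id] comm[OF d] by simp
  qed
  have y1: "at_point R g ce.yy \<one>" by (rule v0.jfn_one[OF ce.yy_one])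
  define V1 where "V1 = v0.loc ce.yy"
  define S1 where "S1 = {A \<in> EC. ce.yy A \<noteq> 0}"
  interpret v1: spec R S1 V1 unfolding V1_def S1_def by (rule v0.spec_loc[OF y1])
  obtain bs where bs: "set bs = L1" "distinct bs" using finite_distinct_list[OF finite_L1] by blast
  obtain \<beta>\<^sub>0 where b0: "\<beta>\<^sub>0 \<in> L1" using L1_nonempty by blast
  define c where "c \<beta> A = (- of_int (N \<beta> (- \<theta>)) * ce.rr \<beta> A) * (1 / ce.yy A)" for \<beta> A
  have cV: "V1 (c \<beta>) \<zero>" if "\<beta> \<in> L1" for \<beta>
  proof -
    have r: "V1 (ce.rr \<beta>) \<zero>" using ce.rr_zero[OF that] v0.loc_base by (auto simp: V1_def v0.jfn_def)
    have "v1.jfn (\<lambda>A. - of_int (N \<beta> (- \<theta>)) * ce.rr \<beta> A)"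
      by (intro v1.jfn_intros(5) v1.ofn_intros) (use r in \<open>auto simp: v1.jfn_def\<close>)
    moreover have "v1.ofn (\<lambda>A. 1 / ce.yy A)" unfolding v1.ofn_def using v0.loc_inverse[of ce.yy] by (auto simp: V1_def)
    ultimately have "v1.jfn (\<lambda>A. - of_int (N \<beta> (- \<theta>)) * ce.rr \<beta> A * (1 / ce.yy A))" by (rule v1.jfn_intros(6))
    then show ?thesis unfolding c_def[abs_def] v1.jfn_def .
  qed
  have U: "v1.mrel (\<lambda>A. uprod (\<lambda>\<beta>. c \<beta> A) bs) \<one>\<^bsub>?M\<^esub>" "v1.mrel (\<lambda>A. uprod_inv (\<lambda>\<beta>. c \<beta> A) bs) \<one>\<^bsub>?M\<^esub>"
    by (rule mrel_uprod[OF v1.spec_axioms]; use cV bs in auto)+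
  define d where "d A = cf \<beta>\<^sub>0 (comm (uprod (\<lambda>\<beta>. c \<beta> A) bs * ce.YY A * uprod_inv (\<lambda>\<beta>. c \<beta> A) bs) (X \<beta>\<^sub>0)) * (1 / ce.yy A)" for A
  have "v1.ofn d"
  proof -
    have "V1 f r" if "at_point R g f r" for f r using v0.loc_base[OF that] by (simp add: V1_def)
    then have "v1.MO ce.YY"
      using ce.MO_YY unfolding v1.MO_def v0.MO_def v1.ofn_def v0.ofn_def by blast
    then have "v1.MO (\<lambda>A. comm (uprod (\<lambda>\<beta>. c \<beta> A) bs * ce.YY A * uprod_inv (\<lambda>\<beta>. c \<beta> A) bs) (X \<beta>\<^sub>0))"
      unfolding comm_def using U[THEN v1.mrel_MO] b0 by (intro v1.MO_intros) auto
    moreover have "v1.ofn (\<lambda>A. 1 / ce.yy A)" unfolding v1.ofn_def using v0.loc_inverse[of ce.yy] by (auto simp: V1_def)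
    ultimately show ?thesis unfolding d_def[abs_def] by (intro v1.ofn_intros v1.ofn_intfun[OF ce.cf_L1(1)[OF b0]])
  qed
  then obtain c0 where c0: "V1 d c0" by (auto simp: v1.ofn_def)
  have c0R: "c0 \<in> carrier R" by (rule v1.V_carrier[OF c0])
  have id1: "v1.mrel (\<lambda>A. A) g" using v0.mrel_loc[OF y1 id] by (simp add: V1_def)
  have y1': "V1 ce.yy \<one>" using v0.loc_base[OF y1] by (simp add: V1_def)
  show ?thesis
  proof (intro bexI[OF _ c0R] ballI)
    fix s assume s: "s \<in> carrier R"
    define V2 where "V2 = v1.adj s"
    interpret v2: spec R "S1 \<times> UNIV" V2 unfolding V2_def by (rule v1.spec_adj[OF s])
    have base: "v2.mrel (\<lambda>p. F (fst p)) B" if "v1.mrel F B" for F and B :: "'r^'n^'n"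
      using v1.mrel_adj[OF s that] by (simp add: V2_def)
    have vb: "V2 (\<lambda>p. f (fst p)) r" if "V1 f r" for f r using v1.adj_base[OF s that] by (simp add: V2_def)
    have var: "V2 snd s" using v1.adj_var[OF s] by (simp add: V2_def)
    have lhs: "v2.mrel (\<lambda>p. fst p * ex (- \<theta>) (snd p)) (g \<otimes>\<^bsub>?M\<^esub> xr (- \<theta>) s)"
      unfolding xr_def by (intro v2.mrel_mult base id1 mrel_ex[OF v2.spec_axioms _ var]) simp
    have x1: "v2.mrel (\<lambda>p. ex \<theta> (d (fst p))) (xr \<theta> c0)" "v2.mrel (\<lambda>p. ex \<theta> (- d (fst p))) (xr \<theta> (\<ominus> c0))"
      unfolding xr_def using mrel_ex[OF v2.spec_axioms theta_roots(1) vb[OF c0]]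
        mrel_ex[OF v2.spec_axioms theta_roots(1) v2.V_uminus[OF vb[OF c0]]] by simp_all
    have "V2 (\<lambda>p. ce.yy (fst p) * snd p) (\<one> \<otimes> s)" by (rule v2.V_mult[OF vb[OF y1'] var])
    then have "V2 (\<lambda>p. ce.yy (fst p) * snd p) s" using s by simp
    then have x2: "v2.mrel (\<lambda>p. ex (- \<theta>) (ce.yy (fst p) * snd p)) (xr (- \<theta>) s)"
      unfolding xr_def using mrel_ex[OF v2.spec_axioms theta_roots(2), of _ s] by simp
    have rhs: "v2.mrel (\<lambda>p. (uprod_inv (\<lambda>\<beta>. c \<beta> (fst p)) bs * ex \<theta> (d (fst p))) * ex (- \<theta>) (ce.yy (fst p) * snd p)
        * (ex \<theta> (- d (fst p)) * uprod (\<lambda>\<beta>. c \<beta> (fst p)) bs) * fst p)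
      ((\<one>\<^bsub>?M\<^esub> \<otimes>\<^bsub>?M\<^esub> xr \<theta> c0) \<otimes>\<^bsub>?M\<^esub> xr (- \<theta>) s \<otimes>\<^bsub>?M\<^esub> (xr \<theta> (\<ominus> c0) \<otimes>\<^bsub>?M\<^esub> \<one>\<^bsub>?M\<^esub>) \<otimes>\<^bsub>?M\<^esub> g)"
      by (intro v2.mrel_mult x1 x2 base[OF U(1)] base[OF U(2)] base[OF id1])
    have "g \<otimes>\<^bsub>?M\<^esub> xr (- \<theta>) s
      = (\<one>\<^bsub>?M\<^esub> \<otimes>\<^bsub>?M\<^esub> xr \<theta> c0) \<otimes>\<^bsub>?M\<^esub> xr (- \<theta>) s \<otimes>\<^bsub>?M\<^esub> (xr \<theta> (\<ominus> c0) \<otimes>\<^bsub>?M\<^esub> \<one>\<^bsub>?M\<^esub>) \<otimes>\<^bsub>?M\<^esub> g"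
    proof (rule v2.mrel_unique[OF lhs rhs])
      fix p assume "p \<in> S1 \<times> (UNIV :: complex set)"
      then obtain A t where p: "p = (A, t)" and A: "A \<in> EC" "ce.yy A \<noteq> 0" by (auto simp: S1_def)
      have YL: "ce.YY A \<in> LL" by (rule ce.YY_LL[OF A(1)])
      have L: "uprod (\<lambda>\<beta>. c \<beta> A) bs * ce.YY A * uprod_inv (\<lambda>\<beta>. c \<beta> A) bs \<in> LL"
        by (rule uprod_conj_LL) (use bs YL in auto)
      have "A * ex (- \<theta>) t * minv A = (uprod_inv (\<lambda>\<beta>. c \<beta> A) bs * ex \<theta> (d A)) * ex (- \<theta>) (ce.yy A * t)
        * (ex \<theta> (- d A) * uprod (\<lambda>\<beta>. c \<beta> A) bs)"
      proof (rule big_cell[where Y = "ce.YY A" and \<beta>\<^sub>0 = \<beta>\<^sub>0, OF EC_properties(3,4)[OF A(1)] EC_properties(5,6)[OF A(1)] _ _ A(2) bs b0])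
        show "ce.YY A = A * X (- \<theta>) * minv A" by (simp add: ce.YY_def ce.Ad_def)
        show "ce.yy A = coef (- \<theta>) (ce.YY A)" by (simp add: ce.yy_def ce.cf_mtheta(2)[OF YL])
        show "c \<beta> A = - of_int (N \<beta> (- \<theta>)) * coef (\<beta> - \<theta>) (ce.YY A) / ce.yy A" if "\<beta> \<in> L1" for \<beta>
          by (simp add: c_def ce.rr_def ce.cf_Lm1(2)[OF that YL])
        show "d A = coef \<beta>\<^sub>0 (comm (uprod (\<lambda>\<beta>. c \<beta> A) bs * ce.YY A * uprod_inv (\<lambda>\<beta>. c \<beta> A) bs) (X \<beta>\<^sub>0)) / ce.yy A"
          using ce.cf_L1(2)[OF b0 comm_LL'[OF L]] b0 by (simp add: d_def)
      qed
      then have "A * ex (- \<theta>) t * (minv A * A) = (uprod_inv (\<lambda>\<beta>. c \<beta> A) bs * ex \<theta> (d A)) * ex (- \<theta>) (ce.yy A * t)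
        * (ex \<theta> (- d A) * uprod (\<lambda>\<beta>. c \<beta> A) bs) * A" by (metis mult.assoc)
      then show "fst p * ex (- \<theta>) (snd p) = (uprod_inv (\<lambda>\<beta>. c \<beta> (fst p)) bs * ex \<theta> (d (fst p))) * ex (- \<theta>) (ce.yy (fst p) * snd p)
        * (ex \<theta> (- d (fst p)) * uprod (\<lambda>\<beta>. c \<beta> (fst p)) bs) * fst p"
        using EC_properties(4)[OF A(1)] by (simp add: p)
    qed
    then show "g \<otimes>\<^bsub>?M\<^esub> xr (- \<theta>) s = xr \<theta> c0 \<otimes>\<^bsub>?M\<^esub> xr (- \<theta>) s \<otimes>\<^bsub>?M\<^esub> xr \<theta> (\<ominus> c0) \<otimes>\<^bsub>?M\<^esub> g"
      using v2.mrel_carrier[OF x1(1)] v2.mrel_carrier[OF x1(2)] by simp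
  qed
qed

end

section \<open>Weyl elements and commutators\<close>

context chevalley
begin

lemma comm_Hc_W: assumes "\<gamma> \<in> \<Phi>" "a \<in> W \<mu>" shows "comm (Hc \<gamma>) a = smul (of_real (\<mu> \<bullet> coroot \<gamma>)) a"
proof (cases "\<mu> \<in> \<Phi>")
  case True
  obtain c where "a = smul c (X \<mu>)" using W_coef[OF assms(2) True] by blast
  then show ?thesis using Hc_X[OF assms(1) True] by (simp add: comm_simps mult.commute)
next
  case False
  show ?thesis
  proof (cases "\<mu> = 0")
    case True
    then have "a \<in> T" using assms(2) \<open>\<mu> \<notin> \<Phi>\<close> by (simp add: W_def)
    then show ?thesis using T_comm[of "Hc \<gamma>" a] assms(1) True by simp
  next
    case False
    then have "a = 0" using W_trivial[OF assms(2)] \<open>\<mu> \<notin> \<Phi>\<close> by blast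
    then show ?thesis by (simp add: comm_simps)
  qed
qed

definition weyl :: "'e \<Rightarrow> 'n sqmat \<Rightarrow> 'n sqmat" where "weyl \<gamma> a = E \<gamma> 1 (E (- \<gamma>) (- 1) (E \<gamma> 1 a))"

text \<open>With v1 = [X (- \<gamma>), X \<mu>] the Jacobi identity gives [X \<gamma>, v1] = X
  \<mu>, because the Cartan integer is 1 and the string ends at \<mu>. This forces the structure
  constant to be 1 or -1, and the three exponentials act on the span of the two vectors as in
  SL2.\<close>

lemma weyl_two_string:
  assumes g: "\<gamma> \<in> \<Phi>" and m: "\<mu> \<in> \<Phi>" "\<mu> \<bullet> coroot \<gamma> = 1" "\<mu> - \<gamma> \<in> \<Phi>"
    and up: "\<And>k. k \<ge> 1 \<Longrightarrow> \<mu> + real k *\<^sub>R \<gamma> \<notin> \<Phi> \<and> \<mu> + real k *\<^sub>R \<gamma> \<noteq> 0"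
    and down: "\<And>k. k \<ge> 2 \<Longrightarrow> \<mu> - real k *\<^sub>R \<gamma> \<notin> \<Phi> \<and> \<mu> - real k *\<^sub>R \<gamma> \<noteq> 0"
  shows "\<exists>c::int. \<bar>c\<bar> = 1 \<and> weyl \<gamma> (X \<mu>) = smul (of_int c) (X (\<mu> - \<gamma>))"
proof -
  have g': "- \<gamma> \<in> \<Phi>" using g by simp
  define v1 where "v1 = comm (X (- \<gamma>)) (X \<mu>)"
  have s: "\<gamma> + (\<mu> - \<gamma>) = \<mu>" "- \<gamma> + \<mu> = \<mu> - \<gamma>" by auto
  have v1: "v1 = smul (of_int (N (- \<gamma>) \<mu>)) (X (\<mu> - \<gamma>))"
    using N(2)[OF g' m(1)] m(3) unfolding s by (simp add: v1_def)
  have ev: "comm (X \<gamma>) (X \<mu>) = 0"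
    using W_trivial[OF comm_W[OF g X_W[OF m(1)]]] up[of 1] by simp
  have e1: "comm (X \<gamma>) v1 = X \<mu>"
    using comm_jacobi[of "X \<gamma>" "X (- \<gamma>)" "X \<mu>"] Hc_X[OF g m(1)] m(2) ev
    by (simp add: v1_def Hc_def comm_simps)
  have "smul (of_int (N (- \<gamma>) \<mu> * N \<gamma> (\<mu> - \<gamma>))) (X \<mu>) = X \<mu>"
    using e1 N(2)[OF g m(3)] m(1) unfolding s by (simp add: v1 comm_simps)
  then have "coef \<mu> (smul (of_int (N (- \<gamma>) \<mu> * N \<gamma> (\<mu> - \<gamma>))) (X \<mu>)) = coef \<mu> (X \<mu>)" by simp
  then have "of_int (N (- \<gamma>) \<mu> * N \<gamma> (\<mu> - \<gamma>)) = (of_int 1 :: complex)" using m(1) by simp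
  then have n1: "\<bar>N (- \<gamma>) \<mu>\<bar> = 1" by (simp only: of_int_eq_iff) (metis zmult_eq_1_iff abs_minus abs_one)
  have E1: "E \<gamma> 1 (X \<mu>) = X \<mu>" by (rule E_fix[OF g X_W[OF m(1)] up])
  have E2: "E (- \<gamma>) (- 1) (X \<mu>) = X \<mu> - v1"
    using E_linear[OF g' X_W[OF m(1)], of "- 1"] down by (simp add: v1_def)
  have W1: "v1 \<in> W (\<mu> - \<gamma>)" using comm_W[OF g' X_W[OF m(1)]] by (simp add: v1_def)
  have "(\<mu> - \<gamma>) + real k *\<^sub>R \<gamma> \<notin> \<Phi> \<and> (\<mu> - \<gamma>) + real k *\<^sub>R \<gamma> \<noteq> 0" if "k \<ge> 2" for k
  proof -
    have eq: "(\<mu> - \<gamma>) + real k *\<^sub>R \<gamma> = \<mu> + real (k - 1) *\<^sub>R \<gamma>" using that by (simp add: of_nat_diff algebra_simps)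
    show ?thesis unfolding eq using up[of "k - 1"] that by simp
  qed
  then have E3: "E \<gamma> 1 v1 = v1 + X \<mu>" using E_linear[OF g W1, of 1] e1 by simp
  have "weyl \<gamma> (X \<mu>) = - v1" by (simp add: weyl_def E1 E2 E_diff E3)
  then show ?thesis using n1 v1 by (intro exI[of _ "- N (- \<gamma>) \<mu>"]) simp
qed

text \<open>X \<mu>, v1 and v2 span a three-dimensional representation of sl2; in the product of the
  three exponentials everything but v2 cancels.\<close>

lemma weyl_three_string:
  assumes g: "\<gamma> \<in> \<Phi>" and m: "\<mu> \<in> \<Phi>" "\<mu> \<bullet> coroot \<gamma> = 2"
    and up: "\<And>k. k \<ge> 1 \<Longrightarrow> \<mu> + real k *\<^sub>R \<gamma> \<notin> \<Phi> \<and> \<mu> + real k *\<^sub>R \<gamma> \<noteq> 0"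
    and down: "\<And>k. k \<ge> 3 \<Longrightarrow> \<mu> - real k *\<^sub>R \<gamma> \<notin> \<Phi> \<and> \<mu> - real k *\<^sub>R \<gamma> \<noteq> 0"
  shows "weyl \<gamma> (X \<mu>) = adp (X (- \<gamma>)) 2 (X \<mu>)"
proof -
  have g': "- \<gamma> \<in> \<Phi>" using g by simp
  define v1 where "v1 = comm (X (- \<gamma>)) (X \<mu>)"
  define v2 where "v2 = adp (X (- \<gamma>)) 2 (X \<mu>)"
  have W1: "v1 \<in> W (\<mu> - \<gamma>)" using comm_W[OF g' X_W[OF m(1)]] by (simp add: v1_def)
  have W2: "v2 \<in> W (\<mu> - 2 *\<^sub>R \<gamma>)" using adp_W[OF g' X_W[OF m(1)], of 2] by (simp add: v2_def)
  have v2: "v2 = smul (1/2) (comm (X (- \<gamma>)) v1)" by (simp add: v2_def v1_def adp_2)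
  have ev: "comm (X \<gamma>) (X \<mu>) = 0"
    using W_trivial[OF comm_W[OF g X_W[OF m(1)]]] up[of 1] by simp
  have e1: "comm (X \<gamma>) v1 = smul 2 (X \<mu>)"
    using comm_jacobi[of "X \<gamma>" "X (- \<gamma>)" "X \<mu>"] Hc_X[OF g m(1)] m(2) ev
    by (simp add: v1_def Hc_def comm_simps)
  have "comm (Hc \<gamma>) v1 = 0"
    using comm_Hc_W[OF g W1] m(2) coroot_self[OF g] by (simp add: inner_diff_left)
  then have e2: "comm (X \<gamma>) v2 = v1"
    using comm_jacobi[of "X \<gamma>" "X (- \<gamma>)" v1] e1 by (simp add: v2 Hc_def comm_simps v1_def)
  have e22: "adp (X \<gamma>) 2 v2 = X \<mu>" by (simp add: adp_2 e2 e1)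
  have E1: "E \<gamma> 1 (X \<mu>) = X \<mu>" by (rule E_fix[OF g X_W[OF m(1)] up])
  have E2: "E (- \<gamma>) (- 1) (X \<mu>) = X \<mu> - v1 + v2"
    using E_quadratic[OF g' X_W[OF m(1)], of "- 1"] down by (simp add: v1_def v2_def)
  have up1: "(\<mu> - \<gamma>) + real k *\<^sub>R \<gamma> \<notin> \<Phi> \<and> (\<mu> - \<gamma>) + real k *\<^sub>R \<gamma> \<noteq> 0" if "k \<ge> 2" for k
  proof -
    have eq: "(\<mu> - \<gamma>) + real k *\<^sub>R \<gamma> = \<mu> + real (k - 1) *\<^sub>R \<gamma>" using that by (simp add: of_nat_diff algebra_simps)
    show ?thesis unfolding eq using up[of "k - 1"] that by simp
  qed
  have up2: "(\<mu> - 2 *\<^sub>R \<gamma>) + real k *\<^sub>R \<gamma> \<notin> \<Phi> \<and> (\<mu> - 2 *\<^sub>R \<gamma>) + real k *\<^sub>R \<gamma> \<noteq> 0" if "k \<ge> 3" for k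
  proof -
    have eq: "(\<mu> - 2 *\<^sub>R \<gamma>) + real k *\<^sub>R \<gamma> = \<mu> + real (k - 2) *\<^sub>R \<gamma>" using that by (simp add: of_nat_diff algebra_simps)
    show ?thesis unfolding eq using up[of "k - 2"] that by simp
  qed
  have E3: "E \<gamma> 1 v1 = v1 + smul 2 (X \<mu>)" using E_linear[OF g W1 up1, of 1] e1 by simp
  have E4: "E \<gamma> 1 v2 = v2 + v1 + X \<mu>" using E_quadratic[OF g W2 up2, of 1] e2 e22 by simp
  have "smul 2 (X \<mu>) = X \<mu> + X \<mu>" using sqm.scale_left_distrib[of 1 1 "X \<mu>"] by simp
  then show ?thesis unfolding v2_def[symmetric] by (simp add: weyl_def E1 E2 E_diff E_add E3 E4)
qed

lemma E_mexp: "\<gamma> \<in> \<Phi> \<Longrightarrow> E \<gamma> t (mexp A) = mexp (E \<gamma> t A)"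
  unfolding E_def by (rule mexp_conj[symmetric]) auto

lemma E_ex: "\<gamma> \<in> \<Phi> \<Longrightarrow> E \<gamma> t a * ex \<gamma> t = ex \<gamma> t * a"
  by (simp add: E_def mult.assoc)

text \<open>The standard Weyl element w(1) of \<gamma>. Its parameters are 1 and -1, so over R it is
  a word in the constants.\<close>

definition wel :: "'e \<Rightarrow> 'n sqmat" where "wel \<gamma> = ex \<gamma> 1 * ex (- \<gamma>) (- 1) * ex \<gamma> 1"

lemma weyl_ex:
  assumes "\<gamma> \<in> \<Phi>" "weyl \<gamma> (X \<mu>) = smul (of_int c) (X \<mu>')"
  shows "wel \<gamma> * ex \<mu> t = ex \<mu>' (of_int c * t) * wel \<gamma>"
proof -
  have g': "- \<gamma> \<in> \<Phi>" using assms by simp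
  have "weyl \<gamma> (ex \<mu> t) = mexp (weyl \<gamma> (smul t (X \<mu>)))"
    by (simp add: weyl_def ex_def E_mexp[OF assms(1)] E_mexp[OF g'])
  also have "weyl \<gamma> (smul t (X \<mu>)) = smul t (weyl \<gamma> (X \<mu>))" by (simp add: weyl_def E_smul)
  finally have w: "weyl \<gamma> (ex \<mu> t) = ex \<mu>' (of_int c * t)" by (simp add: assms ex_def mult.commute)
  have "weyl \<gamma> a * wel \<gamma> = wel \<gamma> * a" for a
  proof -
    have "weyl \<gamma> a * wel \<gamma> = (E \<gamma> 1 (E (- \<gamma>) (- 1) (E \<gamma> 1 a)) * ex \<gamma> 1) * ex (- \<gamma>) (- 1) * ex \<gamma> 1"
      by (simp add: weyl_def wel_def mult.assoc)
    also have "\<dots> = ex \<gamma> 1 * (E (- \<gamma>) (- 1) (E \<gamma> 1 a) * ex (- \<gamma>) (- 1)) * ex \<gamma> 1"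
      unfolding E_ex[OF assms(1)] by (simp add: mult.assoc)
    also have "\<dots> = ex \<gamma> 1 * ex (- \<gamma>) (- 1) * (E \<gamma> 1 a * ex \<gamma> 1)"
      unfolding E_ex[OF g'] by (simp add: mult.assoc)
    also have "\<dots> = wel \<gamma> * a" unfolding E_ex[OF assms(1)] by (simp add: wel_def mult.assoc)
    finally show ?thesis .
  qed
  then show ?thesis using w by metis
qed

lemma ex_commute:
  assumes "\<alpha> \<in> \<Phi>" "\<beta> \<in> \<Phi>" "\<alpha> + \<beta> \<notin> \<Phi>" "\<alpha> + \<beta> \<noteq> 0"
  shows "ex \<alpha> t * ex \<beta> s = ex \<beta> s * ex \<alpha> t"
proof -
  have "comm (X \<alpha>) (X \<beta>) = 0" by (rule X_zero) (use assms in auto)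
  then have "smul t (X \<alpha>) * smul s (X \<beta>) = smul s (X \<beta>) * smul t (X \<alpha>)"
    by (simp add: comm_def mult.commute[of t])
  then show ?thesis unfolding ex_def using X_nil assms nil_smul
    by (metis add.commute mexp_add(2))
qed

lemma smul_commute: "smul s (X \<alpha>) * smul t (X \<beta>) = smul t (X \<beta>) * smul s (X \<alpha>)" if "comm (X \<alpha>) (X \<beta>) = 0"
  using that by (simp add: comm_def mult.commute[of t])

text \<open>Conjugation by \<open>ex \<alpha> t\<close> turns the exponential of
  \<open>smul s (X \<beta>)\<close> into that of its image under \<open>E \<alpha> t\<close>. The
  terms of this image commute and are exponentiated separately; the quadratic version works in the
  same way.\<close>

lemma ex_commutator_linear:
  assumes "\<alpha> \<in> \<Phi>" "\<beta> \<in> \<Phi>" "\<alpha> + \<beta> \<in> \<Phi>" "\<alpha> + \<beta> + \<beta> \<notin> \<Phi>" "\<alpha> + \<beta> + \<beta> \<noteq> 0"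
    "E \<alpha> t (X \<beta>) = X \<beta> + smul (t * of_int c) (X (\<alpha> + \<beta>))"
  shows "ex \<alpha> t * ex \<beta> s = ex (\<alpha> + \<beta>) (of_int c * (t * s)) * ex \<beta> s * ex \<alpha> t"
proof -
  have "E \<alpha> t (ex \<beta> s) = mexp (E \<alpha> t (smul s (X \<beta>)))" by (simp add: ex_def E_mexp[OF assms(1)])
  also have "E \<alpha> t (smul s (X \<beta>)) = smul (of_int c * (t * s)) (X (\<alpha> + \<beta>)) + smul s (X \<beta>)"
    by (simp add: E_smul assms(6) sqm.scale_right_distrib mult.commute mult.left_commute)
  also have "mexp \<dots> = ex (\<alpha> + \<beta>) (of_int c * (t * s)) * ex \<beta> s"
    unfolding ex_def by (rule mexp_add(2)[OF smul_commute]) (use assms X_nil nil_smul in \<open>auto intro!: X_zero\<close>)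
  finally show ?thesis using E_ex[OF assms(1), of t "ex \<beta> s"] by simp
qed

lemma ex_commutator_quadratic:
  assumes "\<alpha> \<in> \<Phi>" "\<beta> \<in> \<Phi>" "\<alpha> + \<beta> \<in> \<Phi>" "\<alpha> + \<alpha> + \<beta> \<in> \<Phi>"
    and sums: "\<And>\<mu>. \<mu> \<in> {\<alpha> + \<beta> + \<beta>, \<alpha> + \<alpha> + \<beta> + \<beta>, \<alpha> + \<alpha> + \<alpha> + \<beta> + \<beta>} \<Longrightarrow> \<mu> \<notin> \<Phi> \<and> \<mu> \<noteq> 0"
    and E: "E \<alpha> t (X \<beta>) = X \<beta> + smul (t * of_int c) (X (\<alpha> + \<beta>)) + smul (t ^ 2 * of_int d) (X (\<alpha> + \<alpha> + \<beta>))"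
  shows "ex \<alpha> t * ex \<beta> s = ex \<beta> s * ex (\<alpha> + \<beta>) (of_int c * (t * s)) * ex (\<alpha> + \<alpha> + \<beta>) (of_int d * (t * (t * s))) * ex \<alpha> t"
proof -
  define A where "A = smul s (X \<beta>)"
  define B where "B = smul (of_int c * (t * s)) (X (\<alpha> + \<beta>))"
  define C where "C = smul (of_int d * (t * (t * s))) (X (\<alpha> + \<alpha> + \<beta>))"
  have n: "nil A" "nil B" "nil C" using assms(1-4) X_nil nil_smul by (auto simp: A_def B_def C_def)
  have z: "comm (X \<beta>) (X (\<alpha> + \<beta>)) = 0" "comm (X \<beta>) (X (\<alpha> + \<alpha> + \<beta>)) = 0" "comm (X (\<alpha> + \<beta>)) (X (\<alpha> + \<alpha> + \<beta>)) = 0"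
    by (rule X_zero; use assms(1-4) sums[of "\<alpha> + \<beta> + \<beta>"] sums[of "\<alpha> + \<alpha> + \<beta> + \<beta>"] sums[of "\<alpha> + \<alpha> + \<alpha> + \<beta> + \<beta>"]
      in \<open>simp add: ac_simps\<close>)+
  have c: "A * B = B * A" "A * C = C * A" "B * C = C * B" unfolding A_def B_def C_def by (intro smul_commute z)+
  have "E \<alpha> t (ex \<beta> s) = mexp (E \<alpha> t (smul s (X \<beta>)))" by (simp add: ex_def E_mexp[OF assms(1)])
  also have "E \<alpha> t (smul s (X \<beta>)) = A + B + C"
    by (simp add: A_def B_def C_def E_smul E sqm.scale_right_distrib power2_eq_square mult.commute mult.left_commute)
  also have "mexp \<dots> = mexp A * mexp B * mexp C"
    using mexp_add[OF c(1) n(1,2)] mexp_add(2)[of "A + B" C] n c by (simp add: algebra_simps)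
  finally show ?thesis using E_ex[OF assms(1), of t "ex \<beta> s"] by (simp add: A_def B_def C_def ex_def mult.assoc)
qed

end

section \<open>Root elements over a commutative ring\<close>

text \<open>The initial specialization, from the integers to R, realized by functions on one point.
  With two variables adjoined it becomes evaluation of integer polynomials at a and b, so that
  relations between complex root elements hold over R.\<close>

lemma (in cring) spec_int:
  "spec R (UNIV :: unit set) (\<lambda>f r. \<exists>z::int. f () = of_int z \<and> r = [z] \<cdot> \<one>)"
proof
  show "\<exists>z::int. f () * g () = of_int z \<and> r \<otimes> s = [z] \<cdot> \<one>"
    if h: "\<exists>z::int. f () = of_int z \<and> r = [z] \<cdot> \<one>" "\<exists>z::int. g () = of_int z \<and> s = [z] \<cdot> \<one>"
    for f g :: "unit \<Rightarrow> complex" and r s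
  proof -
    obtain z w :: int where "f () = of_int z" "r = [z] \<cdot> \<one>" "g () = of_int w" "s = [w] \<cdot> \<one>" using h by blast
    then show ?thesis
      by (intro exI[of _ "z * w"]) (simp add: add_pow_ldistr_int add_pow_rdistr_int add.int_pow_pow mult.commute)
  qed
  show "\<exists>z::int. f () + g () = of_int z \<and> r \<oplus> s = [z] \<cdot> \<one>"
    if h: "\<exists>z::int. f () = of_int z \<and> r = [z] \<cdot> \<one>" "\<exists>z::int. g () = of_int z \<and> s = [z] \<cdot> \<one>"
    for f g :: "unit \<Rightarrow> complex" and r s
  proof -
    obtain z w :: int where "f () = of_int z" "r = [z] \<cdot> \<one>" "g () = of_int w" "s = [w] \<cdot> \<one>" using h by blast
    then show ?thesis by (intro exI[of _ "z + w"]) (simp add: add.int_pow_mult)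
  qed
  show "\<exists>z::int. - f () = of_int z \<and> \<ominus> r = [z] \<cdot> \<one>"
    if h: "\<exists>z::int. f () = of_int z \<and> r = [z] \<cdot> \<one>" for f :: "unit \<Rightarrow> complex" and r
  proof -
    obtain z :: int where "f () = of_int z" "r = [z] \<cdot> \<one>" using h by blast
    then show ?thesis by (intro exI[of _ "- z"]) (simp add: add.int_pow_neg)
  qed
  show "\<exists>z::int. 1 = complex_of_int z \<and> \<one> = [z] \<cdot> \<one>" by (intro exI[of _ 1]) (simp add: add.int_pow_1)
qed (auto simp: add_pow_int_ge)

lemma (in cring) spec_variables:
  assumes "a \<in> carrier R" "b \<in> carrier R"
  obtains V :: "((unit \<times> complex) \<times> complex \<Rightarrow> complex) \<Rightarrow> 'a \<Rightarrow> bool"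
  where "spec R UNIV V" "V (\<lambda>p. snd (fst p)) a" "V snd b"
proof -
  interpret v0: spec R "UNIV :: unit set" "\<lambda>f r. \<exists>z::int. f () = of_int z \<and> r = [z] \<cdot> \<one>" by (rule spec_int)
  interpret v1: spec R "UNIV \<times> UNIV" "v0.adj a" by (rule v0.spec_adj[OF assms(1)])
  have "spec R ((UNIV \<times> UNIV) \<times> UNIV) (v1.adj b)" by (rule v1.spec_adj[OF assms(2)])
  then have "spec R UNIV (v1.adj b)" by simp
  then show ?thesis using that v1.adj_base[OF assms(2) v0.adj_var[OF assms(1)]] v1.adj_var[OF assms(2)] by blast
qed

context chevalley
begin

definition xr :: "('r, 'm) ring_scheme \<Rightarrow> 'e \<Rightarrow> 'r \<Rightarrow> 'r^'n^'n" where
  "xr R \<alpha> t = exp_elem R (mx (X \<alpha>)) t"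

end

locale chevalley_ring = chevalley \<Phi> X T + R: cring R
  for \<Phi> :: "'e::euclidean_space set" and X :: "'e \<Rightarrow> 'n::finite sqmat" and T
    and R :: "('r, 'm) ring_scheme" (structure)
begin

abbreviation mat_mult :: "'r^'n^'n \<Rightarrow> 'r^'n^'n \<Rightarrow> 'r^'n^'n" (infixl \<open>\<odot>\<close> 70) where
  "A \<odot> B \<equiv> A \<otimes>\<^bsub>matrix_monoid R\<^esub> B"

lemma mrel_xr: "spec R S V \<Longrightarrow> \<alpha> \<in> \<Phi> \<Longrightarrow> V f r \<Longrightarrow> spec.mrel V (\<lambda>x. ex \<alpha> (f x)) (xr R \<alpha> r)"
  unfolding xr_def by (rule mrel_ex)

lemma xr_add:
  assumes "\<alpha> \<in> \<Phi>" "a \<in> carrier R" "b \<in> carrier R"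
  shows "xr R \<alpha> (a \<oplus> b) = xr R \<alpha> a \<odot> xr R \<alpha> b"
proof -
  obtain V :: "((unit \<times> complex) \<times> complex \<Rightarrow> complex) \<Rightarrow> 'r \<Rightarrow> bool" where V: "spec R UNIV V" "V (\<lambda>p. snd (fst p)) a" "V snd b" by (rule R.spec_variables[OF assms(2,3)]) blast
  interpret v: spec R UNIV V by (rule V(1))
  note mx = mrel_xr[OF V(1)]
  note m = mx[OF assms(1) v.V_add[OF V(2,3)]] mx[OF assms(1) V(2)] mx[OF assms(1) V(3)]
  show ?thesis by (rule v.mrel_unique[OF m(1) v.mrel_mult[OF m(2,3)]]) (rule ex_add[OF assms(1)])
qed

lemma xr_zero: "\<alpha> \<in> \<Phi> \<Longrightarrow> xr R \<alpha> \<zero> = \<one>\<^bsub>matrix_monoid R\<^esub>"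
proof -
  assume a: "\<alpha> \<in> \<Phi>"
  interpret v: spec R "UNIV :: unit set" "\<lambda>f r. \<exists>z::int. f () = of_int z \<and> r = [z] \<cdot> \<one>" by (rule R.spec_int)
  show ?thesis unfolding xr_def by (rule v.exp_elem_zero) (use a in simp)
qed

lemma xr_commute:
  assumes "\<alpha> \<in> \<Phi>" "\<beta> \<in> \<Phi>" "\<alpha> + \<beta> \<notin> \<Phi>" "\<alpha> + \<beta> \<noteq> 0" "a \<in> carrier R" "b \<in> carrier R"
  shows "xr R \<alpha> a \<odot> xr R \<beta> b = xr R \<beta> b \<odot> xr R \<alpha> a"
proof -
  obtain V :: "((unit \<times> complex) \<times> complex \<Rightarrow> complex) \<Rightarrow> 'r \<Rightarrow> bool" where V: "spec R UNIV V" "V (\<lambda>p. snd (fst p)) a" "V snd b" by (rule R.spec_variables[OF assms(5,6)]) blast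
  interpret v: spec R UNIV V by (rule V(1))
  note mx = mrel_xr[OF V(1)]
  note m = mx[OF assms(1) V(2)] mx[OF assms(2) V(3)]
  show ?thesis
    by (rule v.mrel_unique[OF v.mrel_mult[OF m] v.mrel_mult[OF m(2) m(1)]]) (rule ex_commute[OF assms(1-4)])
qed

definition wr :: "'e \<Rightarrow> 'r^'n^'n" where "wr \<gamma> = xr R \<gamma> \<one> \<odot> xr R (- \<gamma>) (\<ominus> \<one>) \<odot> xr R \<gamma> \<one>"

lemma wr_xr:
  assumes "\<gamma> \<in> \<Phi>" "\<mu> \<in> \<Phi>" "\<mu>' \<in> \<Phi>" "weyl \<gamma> (X \<mu>) = smul (of_int c) (X \<mu>')" "a \<in> carrier R"
  shows "wr \<gamma> \<odot> xr R \<mu> a = xr R \<mu>' ([c] \<cdot> a) \<odot> wr \<gamma>"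
proof -
  have g': "- \<gamma> \<in> \<Phi>" using assms(1) by simp
  obtain V :: "((unit \<times> complex) \<times> complex \<Rightarrow> complex) \<Rightarrow> 'r \<Rightarrow> bool" where V: "spec R UNIV V" "V (\<lambda>p. snd (fst p)) a" "V snd a" by (rule R.spec_variables[OF assms(5,5)]) blast
  interpret v: spec R UNIV V by (rule V(1))
  note mx = mrel_xr[OF V(1)]
  have w: "v.mrel (\<lambda>_. wel \<gamma>) (wr \<gamma>)"
    unfolding wel_def wr_def
    by (intro v.mrel_mult mx assms(1) g' v.V_one v.V_uminus)
  note m = w mx[OF assms(2) V(3)] mx[OF assms(3) v.V_add_pow[OF V(3)]]
  show ?thesis
    by (rule v.mrel_unique[OF v.mrel_mult[OF m(1,2)] v.mrel_mult[OF m(3,1)]]) (rule weyl_ex[OF assms(1,4)])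
qed

lemma xr_commutator_linear:
  assumes "\<alpha> \<in> \<Phi>" "\<beta> \<in> \<Phi>" "\<alpha> + \<beta> \<in> \<Phi>" "\<alpha> + \<beta> + \<beta> \<notin> \<Phi>" "\<alpha> + \<beta> + \<beta> \<noteq> 0"
    "\<And>t. E \<alpha> t (X \<beta>) = X \<beta> + smul (t * of_int c) (X (\<alpha> + \<beta>))" "a \<in> carrier R" "b \<in> carrier R"
  shows "xr R \<alpha> a \<odot> xr R \<beta> b = xr R (\<alpha> + \<beta>) ([c] \<cdot> (a \<otimes> b)) \<odot> xr R \<beta> b \<odot> xr R \<alpha> a"
proof -
  obtain V :: "((unit \<times> complex) \<times> complex \<Rightarrow> complex) \<Rightarrow> 'r \<Rightarrow> bool" where V: "spec R UNIV V" "V (\<lambda>p. snd (fst p)) a" "V snd b" by (rule R.spec_variables[OF assms(7,8)]) blast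
  interpret v: spec R UNIV V by (rule V(1))
  note mx = mrel_xr[OF V(1)]
  note m = mx[OF assms(1) V(2)] mx[OF assms(2) V(3)]
    mx[OF assms(3) v.V_add_pow[OF v.V_mult[OF V(2,3)]]]
  show ?thesis
    by (rule v.mrel_unique[OF v.mrel_mult[OF m(1,2)] v.mrel_mult[OF v.mrel_mult[OF m(3,2)] m(1)]])
      (rule ex_commutator_linear[OF assms(1-6)])
qed

lemma xr_commutator_quadratic:
  assumes "\<alpha> \<in> \<Phi>" "\<beta> \<in> \<Phi>" "\<alpha> + \<beta> \<in> \<Phi>" "\<alpha> + \<alpha> + \<beta> \<in> \<Phi>"
    and sums: "\<And>\<mu>. \<mu> \<in> {\<alpha> + \<beta> + \<beta>, \<alpha> + \<alpha> + \<beta> + \<beta>, \<alpha> + \<alpha> + \<alpha> + \<beta> + \<beta>} \<Longrightarrow> \<mu> \<notin> \<Phi> \<and> \<mu> \<noteq> 0"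
    and E: "\<And>t. E \<alpha> t (X \<beta>) = X \<beta> + smul (t * of_int c) (X (\<alpha> + \<beta>)) + smul (t ^ 2 * of_int d) (X (\<alpha> + \<alpha> + \<beta>))"
    and R: "a \<in> carrier R" "b \<in> carrier R"
  shows "xr R \<alpha> a \<odot> xr R \<beta> b
    = xr R \<beta> b \<odot> xr R (\<alpha> + \<beta>) ([c] \<cdot> (a \<otimes> b)) \<odot> xr R (\<alpha> + \<alpha> + \<beta>) ([d] \<cdot> (a \<otimes> (a \<otimes> b))) \<odot> xr R \<alpha> a"
proof -
  obtain V :: "((unit \<times> complex) \<times> complex \<Rightarrow> complex) \<Rightarrow> 'r \<Rightarrow> bool" where V: "spec R UNIV V" "V (\<lambda>p. snd (fst p)) a" "V snd b" by (rule R.spec_variables[OF R]) blast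
  interpret v: spec R UNIV V by (rule V(1))
  note mx = mrel_xr[OF V(1)]
  note m = mx[OF assms(1) V(2)] mx[OF assms(2) V(3)]
    mx[OF assms(3) v.V_add_pow[OF v.V_mult[OF V(2,3)]]]
    mx[OF assms(4) v.V_add_pow[OF v.V_mult[OF V(2) v.V_mult[OF V(2,3)]]]]
  show ?thesis
    by (rule v.mrel_unique[OF v.mrel_mult[OF m(1,2)] v.mrel_mult[OF v.mrel_mult[OF v.mrel_mult[OF m(2,3)] m(4)] m(1)]])
      (rule ex_commutator_quadratic[OF assms(1-4) sums E])
qed

lemma sign_zero: assumes "a \<in> carrier R" "\<bar>c\<bar> = (1::int)" "[c] \<cdot> a = \<zero>" shows "a = \<zero>"
proof -
  have "c = 1 \<or> c = -1" using assms(2) by auto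
  then show ?thesis using assms(1,3) by (auto simp: R.add.int_pow_neg R.add.int_pow_1)
qed

text \<open>If the root elements commute over R, conjugating v by their two products gives congruent
  results. A functional that separates these by the parameter, up to sign, forces the parameter to
  be 0. Thus a single constant detects whether a root element is trivial.\<close>

lemma commuting_test:
  assumes a: "a \<in> carrier R" and g: "\<gamma> \<in> \<Phi>" "\<gamma>' \<in> \<Phi>"
    and comm: "xr R \<gamma> a \<odot> xr R \<gamma>' \<one> = xr R \<gamma>' \<one> \<odot> xr R \<gamma> a"
    and v: "intmat v" and f: "intfun f"
    and test: "\<And>t. f (E \<gamma> t (E \<gamma>' 1 v)) - f (E \<gamma>' 1 (E \<gamma> t v)) = of_int c * t" "\<bar>c\<bar> = 1"
  shows "a = \<zero>"
proof -
  obtain V :: "((unit \<times> complex) \<times> complex \<Rightarrow> complex) \<Rightarrow> 'r \<Rightarrow> bool" where V: "spec R UNIV V" "V (\<lambda>p. snd (fst p)) a" "V snd a" by (rule R.spec_variables[OF a a]) blast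
  interpret v: spec R UNIV V by (rule V(1))
  note mx = mrel_xr[OF V(1)]
  note m = mx[OF g(1) V(3)] mx[OF g(2) v.V_one]
    mx[OF g(1) v.V_uminus[OF V(3)]] mx[OF g(2) v.V_uminus[OF v.V_one]]
  define F where "F = (\<lambda>p :: (unit \<times> complex) \<times> complex. ex \<gamma> (snd p) * ex \<gamma>' 1)"
  define G where "G = (\<lambda>p :: (unit \<times> complex) \<times> complex. ex \<gamma>' 1 * ex \<gamma> (snd p))"
  define F' where "F' = (\<lambda>p :: (unit \<times> complex) \<times> complex. ex \<gamma>' (- 1) * ex \<gamma> (- snd p))"
  define G' where "G' = (\<lambda>p :: (unit \<times> complex) \<times> complex. ex \<gamma> (- snd p) * ex \<gamma>' (- 1))"
  have FG: "v.eqv F G" unfolding F_def G_def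
    using v.mrel_eqv[OF v.mrel_mult[OF m(1,2)]] v.mrel_mult[OF m(2,1)] comm by simp
  have MO: "v.MO F'" "v.MO G'" "v.MO F" "v.MO G" unfolding F'_def G'_def F_def G_def
    by (rule v.mrel_MO, rule v.mrel_mult, rule m, rule m)+
  have inv: "F' p * F p = 1" "G p * G' p = 1" for p
  proof -
    have "F' p * F p = ex \<gamma>' (- 1) * (ex \<gamma> (- snd p) * ex \<gamma> (snd p)) * ex \<gamma>' 1"
      by (simp only: F_def F'_def mult.assoc)
    then show "F' p * F p = 1" using g by simp
    have "G p * G' p = ex \<gamma>' 1 * (ex \<gamma> (snd p) * ex \<gamma> (- snd p)) * ex \<gamma>' (- 1)"
      by (simp only: G_def G'_def mult.assoc)
    then show "G p * G' p = 1" using g by simp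
  qed
  note r = v.eqv_refl[OF MO(1)] v.eqv_refl[OF MO(2)] v.eqv_refl[OF MO(3)] v.eqv_const[OF v]
  \<comment> \<open>Only F and G are known to be congruent. The same for their inverses F' and G' is
    obtained by inserting G G' = 1 and replacing G by F.\<close>
  have 1: "v.eqv (\<lambda>p. F p * v * F' p * G p * G' p) (\<lambda>p. F p * v * F' p * F p * G' p)"
    by (intro v.eqv_mult r v.eqv_sym[OF FG])
  have 2: "v.eqv (\<lambda>p. F p * v * F' p) (\<lambda>p. F p * v * G' p)"
  proof (rule v.eqv_trans_left[OF _ v.eqv_trans_right[OF 1]])
    show "F p * v * F' p = F p * v * F' p * G p * G' p" for p using inv by (simp add: mult.assoc)
    show "F p * v * F' p * F p * G' p = F p * v * G' p" for p
    proof -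
      have "F p * v * F' p * F p * G' p = F p * v * (F' p * F p) * G' p" by (simp only: mult.assoc)
      then show ?thesis using inv by simp
    qed
  qed
  have "v.eqv (\<lambda>p. F p * v * G' p) (\<lambda>p. G p * v * G' p)" by (intro v.eqv_mult r FG)
  from v.eqv_intfun[OF f v.eqv_trans[OF 2 this]]
  have "v.jfn (\<lambda>p. f (F p * v * F' p) - f (G p * v * G' p))" .
  moreover have "f (F p * v * F' p) - f (G p * v * G' p) = of_int c * snd p" for p
    using test(1)[of "snd p"] by (simp add: F_def F'_def G_def G'_def E_def mult.assoc)
  ultimately have "V (\<lambda>p. of_int c * snd p) \<zero>" by (simp add: v.jfn_def)
  then have "[c] \<cdot> a = \<zero>" using v.V_unique[OF v.V_add_pow[OF V(3)]] by blast
  then show ?thesis by (rule sign_zero[OF a test(2)])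
qed

end

section \<open>Equations in groups and interpretations\<close>

lemma group_structure_simps [simp]:
  "univ (group_structure M) = carrier M" "fun_syms (group_structure M) = UNIV"
  "fun_arity (group_structure M) f = (case f of Group_Mult \<Rightarrow> 2 | Group_Inv \<Rightarrow> 1 | Group_One \<Rightarrow> 0)"
  "fun_interp (group_structure M) Group_Mult xs = xs ! 0 \<otimes>\<^bsub>M\<^esub> xs ! 1"
  "fun_interp (group_structure M) Group_Inv xs = inv\<^bsub>M\<^esub> (xs ! 0)"
  "fun_interp (group_structure M) Group_One xs = \<one>\<^bsub>M\<^esub>"
  by (simp_all add: group_structure_def)

context group
begin

lemma commute_mult: "g \<in> carrier G \<Longrightarrow> g' \<in> carrier G \<Longrightarrow> h \<in> carrier G \<Longrightarrow> g \<otimes> h = h \<otimes> g \<Longrightarrow>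
    g' \<otimes> h = h \<otimes> g' \<Longrightarrow> (g \<otimes> g') \<otimes> h = h \<otimes> (g \<otimes> g')"
  by (metis m_assoc)

lemma commute_inv: "g \<in> carrier G \<Longrightarrow> h \<in> carrier G \<Longrightarrow> g \<otimes> h = h \<otimes> g \<Longrightarrow> inv g \<otimes> h = h \<otimes> inv g"
  by (metis inv_closed inv_solve_left inv_solve_right m_assoc m_closed)

end

definition tprod :: "(group_op, 'a) trm \<Rightarrow> (group_op, 'a) trm \<Rightarrow> (group_op, 'a) trm" where
  "tprod s t = App Group_Mult [s, t]"

definition tinv :: "(group_op, 'a) trm \<Rightarrow> (group_op, 'a) trm" where "tinv t = App Group_Inv [t]"

lemma tprod_simps [simp]:
  "eval_trm (group_structure M) xs (tprod s t) = eval_trm (group_structure M) xs s \<otimes>\<^bsub>M\<^esub> eval_trm (group_structure M) xs t"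
  "wf_trm (group_structure M) C m (tprod s t) \<longleftrightarrow> wf_trm (group_structure M) C m s \<and> wf_trm (group_structure M) C m t"
  by (auto simp: tprod_def)

lemma tinv_simps [simp]:
  "eval_trm (group_structure M) xs (tinv t) = inv\<^bsub>M\<^esub> (eval_trm (group_structure M) xs t)"
  "wf_trm (group_structure M) C m (tinv t) \<longleftrightarrow> wf_trm (group_structure M) C m t"
  by (auto simp: tinv_def)

lemma generate_term:
  assumes "C \<subseteq> carrier M" "g \<in> generate M C"
  shows "\<exists>t. \<forall>m xs. wf_trm (group_structure M) C m t \<and> eval_trm (group_structure M) xs t = g"
  using assms(2)
proof induction
  case one
  show ?case by (intro exI[of _ "App Group_One []"]) simp
next
  case (incl h)
  then show ?case using assms(1) by (intro exI[of _ "Const h"]) auto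
next
  case (inv h)
  then show ?case using assms(1) by (intro exI[of _ "tinv (Const h)"]) auto
next
  case (eng g h)
  then obtain s t where "\<forall>m xs. wf_trm (group_structure M) C m s \<and> eval_trm (group_structure M) xs s = g"
    "\<forall>m xs. wf_trm (group_structure M) C m t \<and> eval_trm (group_structure M) xs t = h" by blast
  then show ?case by (intro exI[of _ "tprod s t"]) simp
qed

text \<open>S cuts out the domain and y detects whether a parameter is 0. \<open>central\<close>
  makes the ambiguity of representatives invisible to the constants and to every
  \<open>xt a\<close>; \<open>mult\<close> expresses multiplication as commutation of a word with a
  constant.\<close>

locale group_interp = M: group M + R: cring R
  for M :: "('a, 'k) monoid_scheme" (structure) and R :: "('r, 'm) ring_scheme" +
  fixes C S :: "'a set" and y :: 'a and xt :: "'r \<Rightarrow> 'a"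
  assumes constants: "C \<subseteq> carrier M" "S \<subseteq> C" "finite S" "y \<in> C"
    and xt_closed: "a \<in> carrier R \<Longrightarrow> xt a \<in> carrier M"
    and xt_add: "a \<in> carrier R \<Longrightarrow> b \<in> carrier R \<Longrightarrow> xt (a \<oplus>\<^bsub>R\<^esub> b) = xt a \<otimes> xt b"
    and xt_one: "xt \<one>\<^bsub>R\<^esub> \<in> C"
    and xt_S: "a \<in> carrier R \<Longrightarrow> s \<in> S \<Longrightarrow> xt a \<otimes> s = s \<otimes> xt a"
    and xt_y: "a \<in> carrier R \<Longrightarrow> xt a \<otimes> y = y \<otimes> xt a \<Longrightarrow> a = \<zero>\<^bsub>R\<^esub>"
    and parameter: "g \<in> carrier M \<Longrightarrow> (\<And>s. s \<in> S \<Longrightarrow> g \<otimes> s = s \<otimes> g) \<Longrightarrow>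
      \<exists>a\<in>carrier R. (xt (\<ominus>\<^bsub>R\<^esub> a) \<otimes> g) \<otimes> y = y \<otimes> (xt (\<ominus>\<^bsub>R\<^esub> a) \<otimes> g)"
    and central: "z \<in> carrier M \<Longrightarrow> (\<And>s. s \<in> S \<Longrightarrow> z \<otimes> s = s \<otimes> z) \<Longrightarrow> z \<otimes> y = y \<otimes> z \<Longrightarrow>
      (\<forall>c\<in>C. z \<otimes> c = c \<otimes> z) \<and> (\<forall>a\<in>carrier R. z \<otimes> xt a = xt a \<otimes> z)"
    and mult: "\<exists>W. wf_trm (group_structure M) C 3 W \<and> (\<exists>q\<in>C.
      \<forall>a\<in>carrier R. \<forall>b\<in>carrier R. \<forall>c\<in>carrier R.
        (eval_trm (group_structure M) [xt a, xt b, xt c] W \<otimes> q = q \<otimes> eval_trm (group_structure M) [xt a, xt b, xt c] W)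
          \<longleftrightarrow> a \<otimes>\<^bsub>R\<^esub> b = c)"
begin

abbreviation "wft \<equiv> wf_trm (group_structure M) C"

abbreviation "ev \<equiv> eval_trm (group_structure M)"

abbreviation commutes :: "'a \<Rightarrow> 'a \<Rightarrow> bool" where "commutes g h \<equiv> g \<otimes> h = h \<otimes> g"

definition Dom :: "'a set" where "Dom = {g \<in> carrier M. \<forall>s\<in>S. commutes g s}"

definition Ker :: "'a set" where "Ker = {z \<in> Dom. commutes z y}"

definition par :: "'a \<Rightarrow> 'r" where "par g = (THE a. a \<in> carrier R \<and> xt (\<ominus>\<^bsub>R\<^esub> a) \<otimes> g \<in> Ker)"

lemma S_carrier: "s \<in> S \<Longrightarrow> s \<in> carrier M" and C_carrier: "c \<in> C \<Longrightarrow> c \<in> carrier M"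
  and y_carrier: "y \<in> carrier M"
  using constants by auto

lemma Dom_mult: "g \<in> Dom \<Longrightarrow> h \<in> Dom \<Longrightarrow> g \<otimes> h \<in> Dom"
  and Dom_inv: "g \<in> Dom \<Longrightarrow> inv g \<in> Dom"
  unfolding Dom_def using M.commute_mult M.commute_inv S_carrier by auto

lemma Ker_mult: "g \<in> Ker \<Longrightarrow> h \<in> Ker \<Longrightarrow> g \<otimes> h \<in> Ker"
  and Ker_inv: "g \<in> Ker \<Longrightarrow> inv g \<in> Ker"
  unfolding Ker_def using Dom_mult Dom_inv M.commute_mult M.commute_inv y_carrier by (auto simp: Dom_def)

lemma Ker_carrier: "z \<in> Ker \<Longrightarrow> z \<in> carrier M" by (simp add: Ker_def Dom_def)

lemma Ker_one: "\<one> \<in> Ker"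
  using S_carrier y_carrier by (auto simp: Ker_def Dom_def)

lemma Ker_commutes: "z \<in> Ker \<Longrightarrow> c \<in> C \<Longrightarrow> commutes z c" "z \<in> Ker \<Longrightarrow> a \<in> carrier R \<Longrightarrow> commutes z (xt a)"
  using central[of z] by (auto simp: Ker_def Dom_def)

lemma xt_Dom: "a \<in> carrier R \<Longrightarrow> xt a \<in> Dom"
  using xt_S xt_closed by (auto simp: Dom_def)

lemma xt_zero: "xt \<zero>\<^bsub>R\<^esub> = \<one>"
  using xt_add[of "\<zero>\<^bsub>R\<^esub>" "\<zero>\<^bsub>R\<^esub>"] xt_closed[of "\<zero>\<^bsub>R\<^esub>"] by (simp add: M.l_cancel_one')

lemma xt_inv: "a \<in> carrier R \<Longrightarrow> xt (\<ominus>\<^bsub>R\<^esub> a) = inv (xt a)"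
  using xt_add[of "\<ominus>\<^bsub>R\<^esub> a" a] xt_closed xt_zero by (simp add: R.l_neg M.inv_equality)

text \<open>Two candidates differ by an r with \<open>xt r\<close> in the kernel, and then
  \<open>xt_y\<close> gives r = 0.\<close>

lemma par_eqI: assumes "a \<in> carrier R" "z \<in> Ker" shows "par (xt a \<otimes> z) = a"
  unfolding par_def
proof (rule the_equality)
  have zc: "z \<in> carrier M" by (rule Ker_carrier[OF assms(2)])
  show "a \<in> carrier R \<and> xt (\<ominus>\<^bsub>R\<^esub> a) \<otimes> (xt a \<otimes> z) \<in> Ker"
    using assms zc xt_closed by (simp add: xt_inv flip: M.m_assoc)
  fix b assume b: "b \<in> carrier R \<and> xt (\<ominus>\<^bsub>R\<^esub> b) \<otimes> (xt a \<otimes> z) \<in> Ker"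
  have "(xt (\<ominus>\<^bsub>R\<^esub> b) \<otimes> (xt a \<otimes> z)) \<otimes> inv z = xt (\<ominus>\<^bsub>R\<^esub> b \<oplus>\<^bsub>R\<^esub> a)"
    using assms b zc xt_closed by (simp add: xt_add M.m_assoc)
  then have "xt (\<ominus>\<^bsub>R\<^esub> b \<oplus>\<^bsub>R\<^esub> a) \<in> Ker" using b Ker_mult Ker_inv[OF assms(2)] by metis
  then have "\<ominus>\<^bsub>R\<^esub> b \<oplus>\<^bsub>R\<^esub> a = \<zero>\<^bsub>R\<^esub>" using xt_y b assms by (auto simp: Ker_def)
  then show "b = a" using b assms by (metis R.a_comm R.a_inv_closed R.minus_equality R.minus_minus)
qed

lemma par: assumes "g \<in> Dom" shows "par g \<in> carrier R" "\<exists>z\<in>Ker. g = xt (par g) \<otimes> z"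
proof -
  have gc: "g \<in> carrier M" using assms by (simp add: Dom_def)
  obtain a where a: "a \<in> carrier R" "commutes (xt (\<ominus>\<^bsub>R\<^esub> a) \<otimes> g) y"
    using parameter[OF gc] assms by (auto simp: Dom_def)
  define z where "z = xt (\<ominus>\<^bsub>R\<^esub> a) \<otimes> g"
  have z: "z \<in> Ker" using a Dom_mult[OF xt_Dom assms] by (simp add: z_def Ker_def)
  have g: "g = xt a \<otimes> z" using a gc xt_closed by (simp add: z_def xt_inv flip: M.m_assoc)
  then have "par g = a" using par_eqI[OF a(1) z] by simp
  then show "par g \<in> carrier R" "\<exists>z\<in>Ker. g = xt (par g) \<otimes> z" using a z g by auto
qed

lemma par_xt: "a \<in> carrier R \<Longrightarrow> par (xt a) = a"
  using par_eqI[OF _ Ker_one] xt_closed by simp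

text \<open>Elements of the kernel commute with the constants and the \<open>xt a\<close>, so they can be moved out of words.\<close>

definition over :: "'a \<Rightarrow> 'a \<Rightarrow> bool" where
  "over g h \<longleftrightarrow> h \<in> carrier M \<and> (\<forall>z\<in>Ker. commutes z h) \<and> (\<exists>z\<in>Ker. g = h \<otimes> z)"

lemma over_mult: assumes "over g h" "over g' h'" shows "over (g \<otimes> g') (h \<otimes> h')"
proof -
  obtain z z' where z: "z \<in> Ker" "z' \<in> Ker" "g = h \<otimes> z" "g' = h' \<otimes> z'" using assms by (auto simp: over_def)
  have c: "h \<in> carrier M" "h' \<in> carrier M" "z \<in> carrier M" "z' \<in> carrier M" using assms z Ker_carrier by (auto simp: over_def)
  have "z \<otimes> h' = h' \<otimes> z" using assms z by (simp add: over_def)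
  then have "g \<otimes> g' = (h \<otimes> h') \<otimes> (z \<otimes> z')" using z(3,4) c by (metis M.m_assoc M.m_closed)
  moreover have "commutes w (h \<otimes> h')" if "w \<in> Ker" for w
    using M.commute_mult[of h h' w] c that assms Ker_carrier by (auto simp: over_def)
  ultimately show ?thesis using c Ker_mult[OF z(1,2)] by (auto simp: over_def)
qed

lemma over_inv: assumes "over g h" shows "over (inv g) (inv h)"
proof -
  obtain z where z: "z \<in> Ker" "g = h \<otimes> z" using assms by (auto simp: over_def)
  have c: "h \<in> carrier M" "z \<in> carrier M" using assms z Ker_carrier by (auto simp: over_def)
  have "commutes w (inv h)" if "w \<in> Ker" for w
    using M.commute_inv[of h w] c that assms Ker_carrier by (auto simp: over_def)
  moreover have "inv g = inv h \<otimes> inv z"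
    using z(2) c M.commute_inv[of h "inv z"] M.commute_inv[of z h] assms z(1) by (simp add: over_def M.inv_mult_group)
  ultimately show ?thesis using c Ker_inv[OF z(1)] by (auto simp: over_def)
qed

lemma over_const: "h \<in> carrier M \<Longrightarrow> (\<And>z. z \<in> Ker \<Longrightarrow> commutes z h) \<Longrightarrow> over h h"
  unfolding over_def using Ker_one by force

lemma over_eval:
  "wft m W \<Longrightarrow> length gs = m \<Longrightarrow> length hs = m \<Longrightarrow> (\<And>i. i < m \<Longrightarrow> over (gs ! i) (hs ! i)) \<Longrightarrow> over (ev gs W) (ev hs W)"
proof (induction W)
  case (Var i) then show ?case by simp
next
  case (Const c) then show ?case by (auto intro: over_const Ker_commutes(1))
next
  case (App f ts)
  then have IH: "over (ev gs t) (ev hs t)" if "t \<in> set ts" for t using that by auto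
  show ?case
  proof (cases f)
    case Group_Mult
    then have "length ts = 2" using App.prems(1) by simp
    then obtain t t' where "ts = [t, t']" by (metis One_nat_def Suc_1 length_0_conv length_Suc_conv)
    then show ?thesis using IH over_mult by (simp add: Group_Mult)
  next
    case Group_Inv
    then have "length ts = 1" using App.prems(1) by simp
    then obtain t where "ts = [t]" by (metis One_nat_def length_0_conv length_Suc_conv)
    then show ?thesis using IH over_inv by (simp add: Group_Inv)
  next
    case Group_One
    then show ?thesis using over_const[of \<one>] Ker_carrier by simp
  qed
qed

lemma over_commutes: assumes "over g h" "q \<in> C" shows "commutes g q \<longleftrightarrow> commutes h q"
proof -
  obtain z where z: "z \<in> Ker" "g = h \<otimes> z" and h: "h \<in> carrier M" using assms by (auto simp: over_def)
  have c: "z \<in> carrier M" "q \<in> carrier M" using z Ker_carrier C_carrier assms by auto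
  have zq: "z \<otimes> q = q \<otimes> z" using Ker_commutes(1)[OF z(1) assms(2)] .
  have "g \<otimes> q = (h \<otimes> q) \<otimes> z" "q \<otimes> g = (q \<otimes> h) \<otimes> z" using z(2) zq h c by (metis M.m_assoc)+
  then show ?thesis using h c by simp
qed

lemma tuples_0: "tuples A 0 = {[]}" by (auto simp: tuples_def)

section \<open>Definable relations between parameters\<close>

lemma e_definable_equations:
  assumes "finite Eqs" "\<And>s t. (s, t) \<in> Eqs \<Longrightarrow> wft m s \<and> wft m t"
    "\<And>a. a \<in> tuples (carrier M) m \<Longrightarrow> a \<in> B \<longleftrightarrow> (\<forall>(s, t)\<in>Eqs. ev a s = ev a t)" "B \<subseteq> tuples (carrier M) m"
  shows "e_definable (group_structure M) C m B"
  unfolding e_definable_def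
  by (intro conjI exI[of _ 0] exI[of _ Eqs]) (use assms in \<open>auto simp: tuples_0\<close>)

text \<open>The test is made on the standard representatives \<open>xt a\<close> only;
  \<open>e_definable_Dom\<close> transfers it to all representatives.\<close>

definition rel_def :: "nat \<Rightarrow> ('r list \<Rightarrow> bool) \<Rightarrow> bool" where
  "rel_def m P \<longleftrightarrow> (\<exists>W. \<exists>q\<in>C. wft m W \<and> (\<forall>rs\<in>tuples (carrier R) m.
     commutes (ev (map xt rs) W) q \<longleftrightarrow> P rs))"

text \<open>By \<open>over_eval\<close> the value of the word at gs and at the standard
  representatives differ by a kernel factor, which commutes with q. So the main equation depends on
  the parameters only, and the remaining equations place each \<open>gs ! i\<close> in
  \<open>Dom\<close>.\<close>

lemma e_definable_Dom:
  assumes "rel_def m P"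
  shows "e_definable (group_structure M) C m {gs \<in> tuples Dom m. P (map par gs)}"
proof -
  obtain W q where W: "wft m W" and q: "q \<in> C"
    and P: "\<And>rs. rs \<in> tuples (carrier R) m \<Longrightarrow> commutes (ev (map xt rs) W) q \<longleftrightarrow> P rs"
    using assms unfolding rel_def_def by blast
  define Eqs where "Eqs = insert (tprod W (Const q), tprod (Const q) W)
    ((\<lambda>(i, s). (tprod (Var i) (Const s), tprod (Const s) (Var i))) ` ({..<m} \<times> S))"
  show ?thesis
  proof (rule e_definable_equations[of Eqs])
    show "finite Eqs" using constants by (simp add: Eqs_def)
    show "wft m s \<and> wft m t" if "(s, t) \<in> Eqs" for s t
      using that W q C_carrier constants by (auto simp: Eqs_def)
    show "{gs \<in> tuples Dom m. P (map par gs)} \<subseteq> tuples (carrier M) m" by (auto simp: tuples_def Dom_def)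
    fix gs assume gs: "gs \<in> tuples (carrier M) m"
    have l: "length gs = m" using gs by (simp add: tuples_def)
    have "(\<forall>(s, t)\<in>Eqs. ev gs s = ev gs t) \<longleftrightarrow>
      commutes (ev gs W) q \<and> (\<forall>i<m. \<forall>s\<in>S. commutes (gs ! i) s)"
      by (auto simp: Eqs_def)
    also have "(\<forall>i<m. \<forall>s\<in>S. commutes (gs ! i) s) \<longleftrightarrow> gs \<in> tuples Dom m"
      using gs l by (auto simp: tuples_def Dom_def set_conv_nth subset_iff) 
    also have "commutes (ev gs W) q \<and> gs \<in> tuples Dom m \<longleftrightarrow> gs \<in> tuples Dom m \<and> P (map par gs)"
    proof -
      have "commutes (ev gs W) q \<longleftrightarrow> P (map par gs)" if D: "gs \<in> tuples Dom m"
      proof -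
        have Di: "gs ! i \<in> Dom" if "i < m" for i using D that l by (auto simp: tuples_def)
        have "over (gs ! i) (map xt (map par gs) ! i)" if "i < m" for i
          using par[OF Di[OF that]] that l xt_closed Ker_commutes(2) by (auto simp: over_def)
        then have "over (ev gs W) (ev (map xt (map par gs)) W)" by (intro over_eval[OF W l]) (use l in auto)
        then have "commutes (ev gs W) q \<longleftrightarrow> commutes (ev (map xt (map par gs)) W) q" using over_commutes q by blast
        also have "\<dots> \<longleftrightarrow> P (map par gs)" by (rule P) (use D par(1) in \<open>auto simp: tuples_def\<close>)
        finally show ?thesis .
      qed
      then show ?thesis by blast
    qed
    finally show "gs \<in> {gs \<in> tuples Dom m. P (map par gs)} \<longleftrightarrow> (\<forall>(s, t)\<in>Eqs. ev gs s = ev gs t)" by simp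
  qed
qed

lemma commutes_xt_y: "a \<in> carrier R \<Longrightarrow> commutes (xt a) y \<longleftrightarrow> a = \<zero>\<^bsub>R\<^esub>"
  using xt_y xt_zero y_carrier by auto

lemma tuples_Suc: "rs \<in> tuples A (Suc m) \<longleftrightarrow> (\<exists>a rs'. a \<in> A \<and> rs' \<in> tuples A m \<and> rs = a # rs')"
  by (auto simp: tuples_def length_Suc_conv)

lemma tuples_cases:
  "rs \<in> tuples A (Suc 0) \<longleftrightarrow> (\<exists>a\<in>A. rs = [a])"
  "rs \<in> tuples A 2 \<longleftrightarrow> (\<exists>a\<in>A. \<exists>b\<in>A. rs = [a, b])"
  "rs \<in> tuples A 3 \<longleftrightarrow> (\<exists>a\<in>A. \<exists>b\<in>A. \<exists>c\<in>A. rs = [a, b, c])"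
  by (auto simp: tuples_Suc tuples_0 numeral_2_eq_2 numeral_3_eq_3)

text \<open>Apart from multiplication, which is supplied by \<open>mult\<close>, each relation says
  that a sum or difference of parameters is 0, and by \<open>commutes_xt_y\<close> this is
  commutation of the corresponding word with y.\<close>

lemma rel_def_ops:
  "rel_def 1 (\<lambda>rs. \<zero>\<^bsub>R\<^esub> = rs ! 0)" "rel_def 1 (\<lambda>rs. \<one>\<^bsub>R\<^esub> = rs ! 0)"
  "rel_def 2 (\<lambda>rs. rs ! 0 = rs ! 1)" "rel_def 2 (\<lambda>rs. \<ominus>\<^bsub>R\<^esub> (rs ! 0) = rs ! 1)"
  "rel_def 3 (\<lambda>rs. rs ! 0 \<oplus>\<^bsub>R\<^esub> rs ! 1 = rs ! 2)" "rel_def 3 (\<lambda>rs. rs ! 0 \<otimes>\<^bsub>R\<^esub> rs ! 1 = rs ! 2)"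
  "rel_def 1 (\<lambda>_. True)"
proof -
  have y: "y \<in> C" by (rule constants)
  have d: "a \<oplus>\<^bsub>R\<^esub> \<ominus>\<^bsub>R\<^esub> b = \<zero>\<^bsub>R\<^esub> \<longleftrightarrow> a = b" if "a \<in> carrier R" "b \<in> carrier R" for a b
    using that by (metis R.a_inv_closed R.minus_equality R.minus_minus R.r_neg)
  note [simp] = commutes_xt_y d xt_closed C_carrier[OF xt_one] xt_one
  note [simp] = xt_inv[symmetric] xt_add[symmetric]
  show "rel_def 1 (\<lambda>rs. \<zero>\<^bsub>R\<^esub> = rs ! 0)"
    unfolding rel_def_def
    by (intro exI[of _ "Var 0"] bexI[OF _ y]) (auto simp: tuples_cases)
  show "rel_def 1 (\<lambda>rs. \<one>\<^bsub>R\<^esub> = rs ! 0)"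
    unfolding rel_def_def
    by (intro exI[of _ "tprod (Const (xt \<one>\<^bsub>R\<^esub>)) (tinv (Var 0))"] bexI[OF _ y]) (auto simp: tuples_cases)
  show "rel_def 2 (\<lambda>rs. rs ! 0 = rs ! 1)"
    unfolding rel_def_def
    by (intro exI[of _ "tprod (Var 0) (tinv (Var 1))"] bexI[OF _ y]) (auto simp: tuples_cases)
  show "rel_def 2 (\<lambda>rs. \<ominus>\<^bsub>R\<^esub> (rs ! 0) = rs ! 1)"
    unfolding rel_def_def
    by (intro exI[of _ "tprod (tinv (Var 0)) (tinv (Var 1))"] bexI[OF _ y]) (auto simp: tuples_cases)
  show "rel_def 3 (\<lambda>rs. rs ! 0 \<oplus>\<^bsub>R\<^esub> rs ! 1 = rs ! 2)"
    unfolding rel_def_def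
    by (intro exI[of _ "tprod (tprod (Var 0) (Var 1)) (tinv (Var 2))"] bexI[OF _ y]) (auto simp: tuples_cases)
  obtain W q where W: "wft 3 W" "q \<in> C" "\<And>a b c. a \<in> carrier R \<Longrightarrow> b \<in> carrier R \<Longrightarrow> c \<in> carrier R \<Longrightarrow>
     commutes (ev [xt a, xt b, xt c] W) q \<longleftrightarrow> a \<otimes>\<^bsub>R\<^esub> b = c"
    using mult by blast
  show "rel_def 3 (\<lambda>rs. rs ! 0 \<otimes>\<^bsub>R\<^esub> rs ! 1 = rs ! 2)"
    unfolding rel_def_def by (intro exI[of _ W] bexI[OF _ W(2)]) (use W in \<open>auto simp: tuples_cases\<close>)
  show "rel_def 1 (\<lambda>_. True)"
    unfolding rel_def_def
    by (intro exI[of _ "App Group_One []"] bexI[OF _ y]) (auto simp: y_carrier)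
qed

text \<open>A ring element is represented by one group element, coded as a list of length 1; this
  rule and \<open>graph_definable\<close> remove the wrapping.\<close>

lemma tuples_singletons: "tuples ((\<lambda>g. [g]) ` A) m = map (\<lambda>g. [g]) ` tuples A m"
proof
  show "map (\<lambda>g. [g]) ` tuples A m \<subseteq> tuples ((\<lambda>g. [g]) ` A) m" by (auto simp: tuples_def subset_iff)
  show "tuples ((\<lambda>g. [g]) ` A) m \<subseteq> map (\<lambda>g. [g]) ` tuples A m"
  proof
    fix us assume us: "us \<in> tuples ((\<lambda>g. [g]) ` A) m"
    have "us = map (\<lambda>g. [g]) (map hd us)" using us by (auto simp: tuples_def intro!: map_idI[symmetric])
    moreover have "map hd us \<in> tuples A m" using us by (auto simp: tuples_def)
    ultimately show "us \<in> map (\<lambda>g. [g]) ` tuples A m" by blast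
  qed
qed

lemma graph_definable:
  assumes "rel_def (m + 1) (\<lambda>rs. F (take m rs) = rs ! m)"
  shows "e_definable (group_structure M) C (m + 1)
    {concat us @ v | us v. us \<in> tuples ((\<lambda>g. [g]) ` Dom) m \<and> v \<in> (\<lambda>g. [g]) ` Dom \<and>
      F (map (par \<circ> hd) us) = (par \<circ> hd) v}"
proof -
  have "{concat us @ v | us v. us \<in> tuples ((\<lambda>g. [g]) ` Dom) m \<and> v \<in> (\<lambda>g. [g]) ` Dom \<and>
      F (map (par \<circ> hd) us) = (par \<circ> hd) v} =
    {gs @ [g] | gs g. gs \<in> tuples Dom m \<and> g \<in> Dom \<and> F (map par gs) = par g}" (is "_ = ?A")
    unfolding tuples_singletons by (force simp: comp_def)
  also have "?A = {gs \<in> tuples Dom (m + 1). F (take m (map par gs)) = map par gs ! m}"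
  proof (rule Set.set_eqI)
    fix gs
    have "gs \<in> tuples Dom (m + 1) \<longleftrightarrow> (\<exists>hs g. gs = hs @ [g] \<and> hs \<in> tuples Dom m \<and> g \<in> Dom)"
      by (auto simp: tuples_def length_Suc_conv_rev)
    then show "gs \<in> ?A \<longleftrightarrow> gs \<in> {gs \<in> tuples Dom (m + 1). F (take m (map par gs)) = map par gs ! m}"
      by (auto simp: tuples_def nth_append)
  qed
  finally show ?thesis using e_definable_Dom[OF assms] by simp
qed

theorem e_interpretable: "e_interpretable (ring_structure R) (group_structure M) C"
  unfolding e_interpretable_def
proof (intro exI[of _ 1] exI[of _ "(\<lambda>g. [g]) ` Dom"] exI[of _ "par \<circ> hd"] conjI ballI)
  show "e_definable (group_structure M) C 1 ((\<lambda>g. [g]) ` Dom)"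
  proof -
    have "(\<lambda>g. [g]) ` Dom = {gs \<in> tuples Dom 1. True}" by (auto simp: tuples_Suc tuples_0)
    then show ?thesis using e_definable_Dom[OF rel_def_ops(7)] by simp
  qed
  show "(par \<circ> hd) ` (\<lambda>g. [g]) ` Dom = univ (ring_structure R)"
    using par(1) par_xt xt_Dom by (force simp: ring_structure_def image_iff)
  show "e_definable (group_structure M) C (1 * (fun_arity (ring_structure R) f + 1))
      {concat us @ v | us v. us \<in> tuples ((\<lambda>g. [g]) ` Dom) (fun_arity (ring_structure R) f) \<and> v \<in> (\<lambda>g. [g]) ` Dom \<and>
        fun_interp (ring_structure R) f (map (par \<circ> hd) us) = (par \<circ> hd) v}"
    if "f \<in> fun_syms (ring_structure R)" for f
  proof -
    have "rel_def (fun_arity (ring_structure R) f + 1)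
      (\<lambda>rs. fun_interp (ring_structure R) f (take (fun_arity (ring_structure R) f) rs) = rs ! fun_arity (ring_structure R) f)"
      by (cases f) (use rel_def_ops in \<open>simp_all add: ring_structure_def numeral_2_eq_2 numeral_3_eq_3\<close>)
    then show ?thesis unfolding nat_mult_1 by (rule graph_definable)
  qed
  show "e_definable (group_structure M) C (1 * rel_arity (ring_structure R) r)
      {concat us | us. us \<in> tuples ((\<lambda>g. [g]) ` Dom) (rel_arity (ring_structure R) r) \<and>
        rel_interp (ring_structure R) r (map (par \<circ> hd) us)}" if "r \<in> rel_syms (ring_structure R)" for r
    using that by (simp add: ring_structure_def)
  have "{u @ v | u v. u \<in> (\<lambda>g. [g]) ` Dom \<and> v \<in> (\<lambda>g. [g]) ` Dom \<and> (par \<circ> hd) u = (par \<circ> hd) v}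
    = {gs \<in> tuples Dom 2. map par gs ! 0 = map par gs ! 1}"
    by (auto simp: tuples_cases) (metis append_Cons append_Nil imageI list.sel(1))
  then show "e_definable (group_structure M) C (1 * 2)
      {u @ v | u v. u \<in> (\<lambda>g. [g]) ` Dom \<and> v \<in> (\<lambda>g. [g]) ` Dom \<and> (par \<circ> hd) u = (par \<circ> hd) v}"
    using e_definable_Dom[OF rel_def_ops(3)] by simp
qed

end

section \<open>The ring inside the group\<close>

context chevalley_graded
begin

lemma high_deg_sum: "\<beta> \<in> \<Phi> \<Longrightarrow> deg \<beta> \<ge> 0 \<Longrightarrow> \<theta> + \<beta> \<notin> \<Phi> \<and> \<theta> + \<beta> \<noteq> 0"
  using deg2[of "\<theta> + \<beta>"] high_deg[of "\<theta> + \<beta>"] root_nonzero[of \<beta>] by (cases "deg \<beta> = 0") auto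

text \<open>Cartan integers with a long root lie between -2 and 2, so the \<gamma>-string through
  \<mu> consists of \<mu> and \<open>\<mu> - \<gamma>\<close> only.\<close>

lemma weyl_long:
  assumes "long \<gamma>" "\<mu> \<in> \<Phi>" "\<mu> \<bullet> coroot \<gamma> = 1" "\<mu> - \<gamma> = \<mu>'"
  shows "\<exists>c::int. \<bar>c\<bar> = 1 \<and> weyl \<gamma> (X \<mu>) = smul (of_int c) (X \<mu>')"
proof -
  have g: "\<gamma> \<in> \<Phi>" by (rule long_root[OF assms(1)])
  have c: "(\<mu> + c *\<^sub>R \<gamma>) \<bullet> coroot \<gamma> = 1 + 2 * c" for c
    using assms(3) coroot_self[OF g] by (simp add: inner_add_left)
  have no: "\<mu> + c *\<^sub>R \<gamma> \<notin> \<Phi> \<and> \<mu> + c *\<^sub>R \<gamma> \<noteq> 0" if "1 + 2 * c > 2 \<or> 1 + 2 * c < - 2" for c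
  proof -
    have "\<mu> + c *\<^sub>R \<gamma> \<noteq> \<gamma>" "\<mu> + c *\<^sub>R \<gamma> \<noteq> - \<gamma>" "\<mu> + c *\<^sub>R \<gamma> \<noteq> 0" using c[of c] coroot_self[OF g] that by auto
    then show ?thesis using long_cartan[OF assms(1), of "\<mu> + c *\<^sub>R \<gamma>"] that unfolding c by auto
  qed
  show ?thesis unfolding assms(4)[symmetric]
  proof (rule weyl_two_string[OF g assms(2,3)])
    show "\<mu> - \<gamma> \<in> \<Phi>" using reflection[OF g assms(2)] assms(3) by simp
    show "\<mu> + real k *\<^sub>R \<gamma> \<notin> \<Phi> \<and> \<mu> + real k *\<^sub>R \<gamma> \<noteq> 0" if "k \<ge> 1" for k
      by (rule no) (use that in simp)
    show "\<mu> - real k *\<^sub>R \<gamma> \<notin> \<Phi> \<and> \<mu> - real k *\<^sub>R \<gamma> \<noteq> 0" if "k \<ge> 2" for k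
      using no[of "- real k"] that by simp
  qed
qed

lemma weyl_theta: "weyl \<theta> (X \<theta>) = smul (of_int (- 1)) (X (- \<theta>))"
proof -
  have "weyl \<theta> (X \<theta>) = adp (X (- \<theta>)) 2 (X \<theta>)"
    by (rule weyl_three_string; (rule high_deg low_deg)?; simp add: coroot_self)
  then show ?thesis by (simp add: adp_2_neg')
qed

text \<open>Input for \<open>commuting_test\<close>: \<open>E \<theta> t\<close> fixes
  \<open>X \<beta>\<close> but moves the component at \<open>\<beta> - \<theta>\<close> created by
  \<open>E (- \<theta>) 1\<close> back to \<beta>, so the order of the two matters.\<close>

lemma theta_commuting_test: assumes "\<beta> \<in> L1"
  shows "cf \<beta> (E \<theta> t (E (- \<theta>) 1 (X \<beta>))) - cf \<beta> (E (- \<theta>) 1 (E \<theta> t (X \<beta>))) = of_int (N (- \<theta>) \<beta> * N \<theta> (\<beta> - \<theta>)) * t"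
    "\<bar>N (- \<theta>) \<beta> * N \<theta> (\<beta> - \<theta>)\<bar> = 1"
proof -
  have b: "\<beta> \<in> \<Phi>" "\<beta> - \<theta> \<in> \<Phi>" "deg \<beta> = 1" using assms L1_deg by auto
  have s: "- \<theta> + \<beta> = \<beta> - \<theta>" by simp
  have h: "\<beta> + real k *\<^sub>R - \<theta> \<notin> \<Phi> \<and> \<beta> + real k *\<^sub>R - \<theta> \<noteq> 0" if "k \<ge> 2" for k
    by (rule low_deg) (use that b in simp)
  have 1: "E (- \<theta>) 1 (X \<beta>) = X \<beta> + smul (of_int (N (- \<theta>) \<beta>)) (X (\<beta> - \<theta>))"
    using E_linear[OF theta_roots(2) X_W[OF b(1)] h, of 1] N(2)[OF theta_roots(2) b(1)] b(2)
    by (simp add: s)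
  have 2: "E \<theta> t (X \<beta>) = X \<beta>"
    by (rule E_theta_fix[OF X_W[OF b(1)]]) (use b root_nonzero in auto)
  have 3: "E \<theta> t (X (\<beta> - \<theta>)) = X (\<beta> - \<theta>) + smul (t * of_int (N \<theta> (\<beta> - \<theta>))) (X \<beta>)"
    using E_theta_m1[OF b(2), of t] b(3) by simp
  have ne: "\<beta> \<noteq> \<beta> - \<theta>" using root_nonzero[OF theta_roots(1)] by simp
  show "cf \<beta> (E \<theta> t (E (- \<theta>) 1 (X \<beta>))) - cf \<beta> (E (- \<theta>) 1 (E \<theta> t (X \<beta>))) = of_int (N (- \<theta>) \<beta> * N \<theta> (\<beta> - \<theta>)) * t"
    using ne b by (simp add: 1 2 3 E_add E_smul cf(2))
  show "\<bar>N (- \<theta>) \<beta> * N \<theta> (\<beta> - \<theta>)\<bar> = 1"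
    using N_mtheta[OF assms] N_theta[OF b(2)] b(3) by (simp add: abs_mult)
qed

end

text \<open>A root \<open>\<beta>\<close> with \<open>mlt \<beta> = 2\<close> spans with \<open>\<theta>\<close> a system of type B2, in which
  \<open>\<theta> - \<beta>, \<beta>\<close> is an orthogonal basis of short roots and \<open>\<theta> - 2 *\<^sub>R \<beta>\<close> is long.\<close>

locale type_B2 = chevalley_graded \<Phi> X T \<theta>
  for \<Phi> :: "'e::euclidean_space set" and X :: "'e \<Rightarrow> 'n::finite sqmat" and T \<theta> +
  fixes \<beta> :: 'e
  assumes b: "\<beta> \<in> L1" and mlt_2: "mlt \<beta> = 2"
begin

abbreviation "\<gamma> \<equiv> \<theta> - \<beta>"

abbreviation "\<delta> \<equiv> \<theta> - 2 *\<^sub>R \<beta>"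

text \<open>\<beta> and \<open>\<theta> - \<beta>\<close> are orthogonal and equally long, and the
  coordinates with respect to them are u + v and u. Roots have u^2 + (u + v)^2 at most 2, which
  \<open>not_root_B2\<close> uses as a test.\<close>

lemma norm_B2: "(u *\<^sub>R \<theta> + v *\<^sub>R \<beta>) \<bullet> (u *\<^sub>R \<theta> + v *\<^sub>R \<beta>) = (u\<^sup>2 + (u + v)\<^sup>2) * (\<beta> \<bullet> \<beta>)"
proof -
  have "\<theta> \<bullet> \<theta> = 2 * (\<beta> \<bullet> \<beta>)" "\<theta> \<bullet> \<beta> = \<beta> \<bullet> \<beta>" "\<beta> \<bullet> \<theta> = \<beta> \<bullet> \<beta>"
    using mult_norm[OF b] inner_theta[OF b] mlt_2 by (auto simp: inner_commute)
  then show ?thesis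
    by (simp add: inner_add_left inner_add_right power2_eq_square algebra_simps)
qed

lemma beta_pos: "\<beta> \<bullet> \<beta> > 0" using root_nonzero[OF L1_root[OF b]] by simp

lemma not_root_B2: assumes "u\<^sup>2 + (u + v)\<^sup>2 > 2" shows "u *\<^sub>R \<theta> + v *\<^sub>R \<beta> \<notin> \<Phi> \<and> u *\<^sub>R \<theta> + v *\<^sub>R \<beta> \<noteq> 0"
proof -
  have t: "\<theta> \<bullet> \<theta> = 2 * (\<beta> \<bullet> \<beta>)" using norm_B2[of 1 0] by simp
  have "(u *\<^sub>R \<theta> + v *\<^sub>R \<beta>) \<bullet> (u *\<^sub>R \<theta> + v *\<^sub>R \<beta>) > \<theta> \<bullet> \<theta>"
    unfolding norm_B2 t using assms beta_pos by simp
  then show ?thesis using long_theta unfolding long_def by (metis inner_ge_zero inner_zero_left not_less)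
qed

lemma delta_root: "\<delta> \<in> \<Phi>" "deg \<delta> = 0" "- \<delta> \<in> \<Phi>"
  using theta_minus_2[OF b] neg_root[OF theta_minus_2[OF b]] mlt_2 L1_deg[OF b] by auto

lemma delta_long: "long \<delta>"
  using long_norm_eq[OF long_theta delta_root(1)] norm_B2[of 1 "-2"] norm_B2[of 1 0] by simp

lemma N_B2: "\<bar>N \<beta> \<delta>\<bar> = 1" "\<bar>N \<beta> \<gamma>\<bar> = 2" "\<bar>N \<gamma> (- \<delta>)\<bar> = 1" "\<bar>N (- \<beta>) \<theta>\<bar> = 1" "\<bar>N (- \<beta>) \<gamma>\<bar> = 2"
proof -
  have bR: "\<beta> \<in> \<Phi>" "\<gamma> \<in> \<Phi>" "- \<beta> \<in> \<Phi>" using b by auto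
  note d = delta_root
  have dg: "deg \<beta> = 1" by (rule L1_deg[OF b])
  have s: "\<beta> + \<delta> = \<gamma>" "\<gamma> + - \<delta> = \<beta>" "- \<beta> + \<theta> = \<gamma>" "- \<beta> + \<gamma> = \<delta>" by (simp_all add: scaleR_2)
  have sq: "(2::real)\<^sup>2 \<le> (1 + real p)\<^sup>2" if "p \<noteq> 0" for p using that by (intro power_mono) auto
  show "\<bar>N \<beta> \<gamma>\<bar> = 2" using N_compl[OF b] mlt_2 by simp
  have "string_len \<beta> \<delta> = 0"
  proof (rule string_lenI)
    fix p assume p: "\<delta> - real p *\<^sub>R \<beta> \<in> \<Phi>"
    have eq: "1 *\<^sub>R \<theta> + (- 2 - real p) *\<^sub>R \<beta> = \<delta> - real p *\<^sub>R \<beta>" by (simp add: algebra_simps)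
    have "\<not> 1 < (1 + (- 2 - real p))\<^sup>2" using not_root_B2[of 1 "- 2 - real p"] p unfolding eq by auto
    moreover have "(1 + (- 2 - real p))\<^sup>2 = (1 + real p)\<^sup>2" by (simp add: power2_eq_square algebra_simps)
    ultimately show "p \<le> 0" using sq[of p] by (cases "p = 0") auto
  qed (use d in simp)
  then show "\<bar>N \<beta> \<delta>\<bar> = 1" using N(1)[OF bR(1) d(1)] bR unfolding s by simp
  have "string_len \<gamma> (- \<delta>) = 0"
  proof (rule string_lenI)
    fix p assume p: "- \<delta> - real p *\<^sub>R \<gamma> \<in> \<Phi>"
    have eq: "(- 1 - real p) *\<^sub>R \<theta> + (2 + real p) *\<^sub>R \<beta> = - \<delta> - real p *\<^sub>R \<gamma>" by (simp add: algebra_simps)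
    have "\<not> 1 < (- 1 - real p)\<^sup>2" using not_root_B2[of "- 1 - real p" "2 + real p"] p unfolding eq by auto
    moreover have "(- 1 - real p)\<^sup>2 = (1 + real p)\<^sup>2" by (simp add: power2_eq_square algebra_simps)
    ultimately show "p \<le> 0" using sq[of p] by (cases "p = 0") auto
  qed (use d in simp)
  then show "\<bar>N \<gamma> (- \<delta>)\<bar> = 1" using N(1)[OF bR(2) d(3)] bR unfolding s by simp
  have "string_len (- \<beta>) \<theta> = 0"
  proof (rule string_lenI)
    fix p assume "\<theta> - real p *\<^sub>R - \<beta> \<in> \<Phi>"
    then show "p \<le> 0" using deg_bounds dg by fastforce
  qed simp
  then show "\<bar>N (- \<beta>) \<theta>\<bar> = 1" using N(1)[OF bR(3) theta_root] bR unfolding s by simp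
  have "string_len (- \<beta>) \<gamma> = 1"
  proof (rule string_lenI)
    fix p assume "\<gamma> - real p *\<^sub>R - \<beta> \<in> \<Phi>"
    then show "p \<le> 1" using deg_bounds dg by fastforce
  qed simp
  then show "\<bar>N (- \<beta>) \<gamma>\<bar> = 2" using N(1)[OF bR(3,2)] d unfolding s by simp
qed

text \<open>The 1/2 of a second divided power cancels the structure constant 2 of the two short
  roots.\<close>

lemma half_sign: assumes "\<bar>u\<bar> = (1::int)" "\<bar>v\<bar> = 2" shows "\<exists>c::int. \<bar>c\<bar> = 1 \<and> of_int u * of_int v / 2 = (of_int c :: complex)"
proof -
  have "(u = 1 \<or> u = -1) \<and> (v = 2 \<or> v = -2)" using assms by auto
  then show ?thesis using assms(1) by (intro exI[of _ "u * (v div 2)"]) (auto simp: abs_mult)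
qed

lemma weyl_beta: "\<exists>c::int. \<bar>c\<bar> = 1 \<and> weyl \<beta> (X \<theta>) = smul (of_int c) (X \<delta>)"
proof -
  have bR: "\<beta> \<in> \<Phi>" "\<gamma> \<in> \<Phi>" "- \<beta> \<in> \<Phi>" using b by auto
  have dg: "deg \<beta> = 1" by (rule L1_deg[OF b])
  have s: "- \<beta> + \<theta> = \<gamma>" "- \<beta> + \<gamma> = \<delta>" by (simp_all add: scaleR_2)
  have "weyl \<beta> (X \<theta>) = adp (X (- \<beta>)) 2 (X \<theta>)"
  proof (rule weyl_three_string[OF bR(1) theta_root])
    show "\<theta> \<bullet> coroot \<beta> = 2" using mult_cartan(1)[OF b] mlt_2 by simp
    show "\<theta> + real k *\<^sub>R \<beta> \<notin> \<Phi> \<and> \<theta> + real k *\<^sub>R \<beta> \<noteq> 0" if "k \<ge> 1" for k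
      by (rule high_deg) (use that dg in simp)
    show "\<theta> - real k *\<^sub>R \<beta> \<notin> \<Phi> \<and> \<theta> - real k *\<^sub>R \<beta> \<noteq> 0" if "k \<ge> 3" for k
    proof -
      have "(2::real)\<^sup>2 \<le> (real k - 1)\<^sup>2" using that by (intro power_mono) auto
      then have "1\<^sup>2 + (1 + (- real k))\<^sup>2 > (2::real)" by (simp add: power2_eq_square algebra_simps)
      from not_root_B2[OF this] show ?thesis by simp
    qed
  qed
  also have "\<dots> = smul (of_int (N (- \<beta>) \<theta>) * of_int (N (- \<beta>) \<gamma>) / 2) (X \<delta>)"
    using N(2)[OF bR(3) theta_root] N(2)[OF bR(3,2)] bR delta_root(1) unfolding s
    by (simp add: adp_2 comm_simps)
  finally show ?thesis using half_sign[OF N_B2(4,5)] by metis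
qed

lemma weyl_delta: "\<exists>c::int. \<bar>c\<bar> = 1 \<and> weyl \<delta> (X \<gamma>) = smul (of_int c) (X \<beta>)"
proof (rule weyl_long[OF delta_long])
  have t: "\<theta> \<bullet> \<theta> = 2 * (\<beta> \<bullet> \<beta>)" "\<theta> \<bullet> \<beta> = \<beta> \<bullet> \<beta>" "\<beta> \<bullet> \<theta> = \<beta> \<bullet> \<beta>"
    using mult_norm[OF b] inner_theta[OF b] mlt_2 by (auto simp: inner_commute)
  show "\<gamma> \<bullet> coroot \<delta> = 1"
    using beta_pos by (simp add: coroot_def inner_diff_left inner_diff_right t)
qed (use b in \<open>simp_all add: scaleR_2\<close>)

lemma E_beta_delta:
  "\<exists>d::int. \<bar>d\<bar> = 1 \<and> (\<forall>t. E \<beta> t (X \<delta>) = X \<delta> + smul (t * of_int (N \<beta> \<delta>)) (X \<gamma>) + smul (t ^ 2 * of_int d) (X \<theta>))"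
proof -
  have bR: "\<beta> \<in> \<Phi>" "\<gamma> \<in> \<Phi>" using b by auto
  have s: "\<beta> + \<delta> = \<gamma>" "\<beta> + \<gamma> = \<theta>" by (simp_all add: scaleR_2)
  have cmm: "comm (X \<beta>) (X \<delta>) = smul (of_int (N \<beta> \<delta>)) (X \<gamma>)" "comm (X \<beta>) (X \<gamma>) = smul (of_int (N \<beta> \<gamma>)) (X \<theta>)"
    using N(2)[OF bR(1) delta_root(1)] N(2)[OF bR] bR unfolding s by auto
  have "adp (X \<beta>) 2 (X \<delta>) = smul (of_int (N \<beta> \<delta>) * of_int (N \<beta> \<gamma>) / 2) (X \<theta>)"
    by (simp add: adp_2 comm_simps cmm)
  moreover obtain d :: int where d: "\<bar>d\<bar> = 1" "of_int (N \<beta> \<delta>) * of_int (N \<beta> \<gamma>) / 2 = (of_int d :: complex)"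
    using half_sign[OF N_B2(1,2)] by blast
  ultimately have a: "adp (X \<beta>) 2 (X \<delta>) = smul (of_int d) (X \<theta>)" by simp
  have h: "\<delta> + real k *\<^sub>R \<beta> \<notin> \<Phi> \<and> \<delta> + real k *\<^sub>R \<beta> \<noteq> 0" if "k \<ge> 3" for k
    by (rule high_deg) (use that L1_deg[OF b] in simp)
  show ?thesis
    using E_quadratic[OF bR(1) X_W[OF delta_root(1)] h] d by (intro exI[of _ d]) (simp add: cmm a)
qed

text \<open>Input for \<open>commuting_test\<close>: \<open>E (- \<delta>) 1\<close> creates the
  component \<open>- X (- \<delta>)\<close>, and only this one is moved by
  \<open>E \<gamma> t\<close> to the coordinate at \<beta>. As \<delta> has degree 0, the detecting
  constant commutes with all \<theta>-root elements.\<close>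

lemma gamma_commuting_test:
  "cf \<beta> (E \<gamma> t (E (- \<delta>) 1 (X \<delta>))) - cf \<beta> (E (- \<delta>) 1 (E \<gamma> t (X \<delta>))) = of_int (- N \<gamma> (- \<delta>)) * t"
proof -
  have bR: "\<beta> \<in> \<Phi>" "\<gamma> \<in> \<Phi>" using b by auto
  have dg: "deg \<beta> = 1" by (rule L1_deg[OF b])
  note d = delta_root
  define H where "H = comm (X (- \<delta>)) (X \<delta>)"
  have HT: "H \<in> T" using coroot_T[OF d(3)] by (simp add: H_def)
  have s: "\<gamma> + - \<delta> = \<beta>" by (simp add: scaleR_2)
  have k3: "\<delta> + real k *\<^sub>R (- \<delta>) \<notin> \<Phi> \<and> \<delta> + real k *\<^sub>R (- \<delta>) \<noteq> 0" if "k \<ge> 3" for k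
  proof -
    have eq: "\<delta> + real k *\<^sub>R (- \<delta>) = (1 - real k) *\<^sub>R \<delta>" by (simp add: algebra_simps)
    then show ?thesis unfolding eq using multiple_root[OF d(1), of "1 - real k"] root_nonzero[OF d(1)] that by auto
  qed
  have 1: "E (- \<delta>) 1 (X \<delta>) = X \<delta> + H - X (- \<delta>)"
    using E_quadratic[OF d(3) X_W[OF d(1)] k3, of 1] unfolding adp_2_neg'[OF d(1)] H_def[symmetric] by simp
  have k1: "\<delta> + real k *\<^sub>R \<gamma> \<notin> \<Phi> \<and> \<delta> + real k *\<^sub>R \<gamma> \<noteq> 0" if "k \<ge> 1" for k
  proof -
    have "(2::real)\<^sup>2 \<le> (1 + real k)\<^sup>2" using that by (intro power_mono) auto
    then have "(1 + real k)\<^sup>2 + ((1 + real k) + (- 2 - real k))\<^sup>2 > (2::real)" by simp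
    from not_root_B2[OF this] show ?thesis by (simp add: algebra_simps)
  qed
  have 2: "E \<gamma> t (X \<delta>) = X \<delta>" by (rule E_fix[OF bR(2) X_W[OF d(1)] k1])
  have "deg \<beta> \<noteq> deg \<delta>" "deg \<beta> \<noteq> deg (- \<delta>)" using dg by simp_all
  then have ne: "\<beta> \<noteq> \<delta>" "\<beta> \<noteq> - \<delta>" by metis+
  have 3: "coef \<beta> (E \<gamma> t H) = 0"
  proof (rule coef_E_0[OF bR(2) T_W[OF HT] bR(1)])
    fix k :: nat
    show "\<beta> \<noteq> 0 + real k *\<^sub>R \<gamma>"
    proof
      assume eq: "\<beta> = 0 + real k *\<^sub>R \<gamma>"
      then have "deg \<beta> = deg (0 + real k *\<^sub>R \<gamma>)" by simp
      then have "real k = 1" using dg by simp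
      then have "4 *\<^sub>R \<beta> = 2 *\<^sub>R \<theta>" using eq by (simp add: algebra_simps) (metis add_diff_cancel_left' diff_add_cancel scaleR_2 scaleR_scaleR mult_2 numeral_Bit0)
      then show False using not_2_4[OF b] by simp
    qed
  qed
  have 4: "coef \<beta> (E \<gamma> t (X (- \<delta>))) = t * of_int (N \<gamma> (- \<delta>))"
  proof -
    have eq: "- \<delta> + real 1 *\<^sub>R \<gamma> = \<beta>" by (simp add: scaleR_2)
    have "coef \<beta> (E \<gamma> t (X (- \<delta>))) = t ^ 1 * coef \<beta> (adp (X \<gamma>) 1 (X (- \<delta>)))"
      using coef_E[OF bR(2) X_W[OF d(3)], of 1 t] bR(1) unfolding eq by simp
    then show ?thesis using N(2)[OF bR(2) d(3)] bR(1) unfolding s by simp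
  qed
  have L: "E \<gamma> t H \<in> LL" "E \<gamma> t (X (- \<delta>)) \<in> LL" using E_LL bR d HT by simp_all
  have "cf \<beta> (E \<gamma> t (E (- \<delta>) 1 (X \<delta>))) = - (t * of_int (N \<gamma> (- \<delta>)))"
    using L bR d dg ne by (simp add: 1 E_add E_diff 2 cf(2) 3 4 del: minus_diff_eq)
  moreover have "cf \<beta> (E (- \<delta>) 1 (E \<gamma> t (X \<delta>))) = 0"
    using bR d dg ne HT by (simp add: 1 2 cf(2) del: minus_diff_eq)
  ultimately show ?thesis by simp
qed

end

text \<open>All that is kept of the large subgroup: it consists of points of the scheme, contains
  the root elements and multiplies as matrices do.\<close>

locale chevalley_points = chevalley_graded \<Phi> X T \<theta> + chevalley_ring \<Phi> X T R + M: group M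
  for \<Phi> :: "'e::euclidean_space set" and X :: "'e \<Rightarrow> 'n::finite sqmat" and T \<theta>
    and R :: "('r, 'm) ring_scheme" (structure) and M :: "('r^'n^'n, 'k) monoid_scheme" +
  assumes mult_M: "A \<otimes>\<^bsub>matrix_monoid R\<^esub> B = A \<otimes>\<^bsub>M\<^esub> B"
    and one_M: "\<one>\<^bsub>matrix_monoid R\<^esub> = \<one>\<^bsub>M\<^esub>"
    and points: "carrier M \<subseteq> carrier (chevalley_group R \<Phi> (\<lambda>\<alpha>. mx (X \<alpha>)))"
    and xr_M [simp]: "\<alpha> \<in> \<Phi> \<Longrightarrow> a \<in> carrier R \<Longrightarrow> xr R \<alpha> a \<in> carrier M"
begin

abbreviation mprod :: "'r^'n^'n \<Rightarrow> 'r^'n^'n \<Rightarrow> 'r^'n^'n" (infixl \<open>\<cdot>\<^sub>M\<close> 70) where "A \<cdot>\<^sub>M B \<equiv> A \<otimes>\<^bsub>M\<^esub> B"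

abbreviation minverse :: "'r^'n^'n \<Rightarrow> 'r^'n^'n" where "minverse A \<equiv> inv\<^bsub>M\<^esub> A"

abbreviation x :: "'e \<Rightarrow> 'r \<Rightarrow> 'r^'n^'n" where "x \<equiv> xr R"

lemma x_add: "\<alpha> \<in> \<Phi> \<Longrightarrow> a \<in> carrier R \<Longrightarrow> b \<in> carrier R \<Longrightarrow> x \<alpha> (a \<oplus> b) = x \<alpha> a \<cdot>\<^sub>M x \<alpha> b"
  using xr_add by (simp add: mult_M)

lemma x_zero: "\<alpha> \<in> \<Phi> \<Longrightarrow> x \<alpha> \<zero> = \<one>\<^bsub>M\<^esub>"
  using xr_zero by (simp add: one_M)

lemma x_inv: "\<alpha> \<in> \<Phi> \<Longrightarrow> a \<in> carrier R \<Longrightarrow> x \<alpha> (\<ominus> a) = minverse (x \<alpha> a)"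
  using x_add[of \<alpha> "\<ominus> a" a] x_zero[of \<alpha>] by (simp add: R.l_neg M.inv_equality)

definition C :: "('r^'n^'n) set" where "C = {x \<alpha> \<one> | \<alpha>. \<alpha> \<in> \<Phi>}"

lemma C_I: "\<alpha> \<in> \<Phi> \<Longrightarrow> x \<alpha> \<one> \<in> C" by (auto simp: C_def)

lemma C_carrier: "C \<subseteq> carrier M" by (auto simp: C_def)

lemma finite_C: "finite C" using finite_roots by (simp add: C_def)

lemma wr_M: "\<gamma> \<in> \<Phi> \<Longrightarrow> wr \<gamma> = x \<gamma> \<one> \<cdot>\<^sub>M minverse (x (- \<gamma>) \<one>) \<cdot>\<^sub>M x \<gamma> \<one>"
  by (simp add: wr_def mult_M x_inv)

lemma wr_generate: "\<gamma> \<in> \<Phi> \<Longrightarrow> wr \<gamma> \<in> generate M C"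
  unfolding wr_M by (intro generate.eng generate.incl generate.inv C_I) auto

lemma wr_carrier: "\<gamma> \<in> \<Phi> \<Longrightarrow> wr \<gamma> \<in> carrier M"
  by (simp add: wr_M)

lemma wr_conj:
  assumes "\<gamma> \<in> \<Phi>" "\<mu> \<in> \<Phi>" "\<mu>' \<in> \<Phi>" "weyl \<gamma> (X \<mu>) = smul (of_int c) (X \<mu>')" "a \<in> carrier R"
  shows "wr \<gamma> \<cdot>\<^sub>M x \<mu> a \<cdot>\<^sub>M minverse (wr \<gamma>) = x \<mu>' ([c] \<cdot> a)"
  using wr_xr[OF assms] assms wr_carrier by (simp add: mult_M M.m_assoc)

text \<open>A sign in the parameter of a root element is realized by inversion, which is available
  in words.\<close>

definition ssign :: "int \<Rightarrow> 'r^'n^'n \<Rightarrow> 'r^'n^'n" where "ssign c g = (if c = 1 then g else minverse g)"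

lemma x_sign: "\<alpha> \<in> \<Phi> \<Longrightarrow> a \<in> carrier R \<Longrightarrow> \<bar>c\<bar> = 1 \<Longrightarrow> x \<alpha> ([c] \<cdot> a) = ssign c (x \<alpha> a)"
  using abs_1[of c] by (auto simp: ssign_def R.add.int_pow_neg R.add.int_pow_1 x_inv)

lemma theta_faithful: assumes "a \<in> carrier R" "x \<theta> a \<cdot>\<^sub>M x (- \<theta>) \<one> = x (- \<theta>) \<one> \<cdot>\<^sub>M x \<theta> a" shows "a = \<zero>"
proof -
  obtain \<beta> where b: "\<beta> \<in> L1" using L1_nonempty by blast
  show ?thesis
    by (rule commuting_test[OF assms(1) theta_roots _ _ _ theta_commuting_test[OF b]])
      (use assms(2) b L1_deg[OF b] cf(1)[of \<beta>] in \<open>simp_all add: mult_M\<close>)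
qed

lemma theta_commutes:
  assumes "\<beta> \<in> \<Phi>" "deg \<beta> \<ge> 0" "a \<in> carrier R" "b \<in> carrier R"
  shows "x \<theta> a \<cdot>\<^sub>M x \<beta> b = x \<beta> b \<cdot>\<^sub>M x \<theta> a"
  using xr_commute[OF theta_root assms(1) _ _ assms(3,4)] high_deg_sum[OF assms(1,2)] by (simp add: mult_M)

lemma conjugation:
  assumes "g \<in> carrier M" "\<And>\<delta>. \<delta> \<in> \<Phi> \<Longrightarrow> deg \<delta> \<ge> 0 \<Longrightarrow> g \<cdot>\<^sub>M x \<delta> \<one> = x \<delta> \<one> \<cdot>\<^sub>M g"
  shows "\<exists>c\<in>carrier R. \<forall>s\<in>carrier R. (x \<theta> (\<ominus> c) \<cdot>\<^sub>M g) \<cdot>\<^sub>M x (- \<theta>) s = x (- \<theta>) s \<cdot>\<^sub>M (x \<theta> (\<ominus> c) \<cdot>\<^sub>M g)"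
proof -
  have "\<exists>c\<in>carrier R. \<forall>s\<in>carrier R. g \<cdot>\<^sub>M x (- \<theta>) s = x \<theta> c \<cdot>\<^sub>M x (- \<theta>) s \<cdot>\<^sub>M x \<theta> (\<ominus> c) \<cdot>\<^sub>M g"
    using centralizer_conjugation[OF R.is_cring, of g] assms points unfolding xr_def[symmetric] mult_M by blast
  then obtain c where c: "c \<in> carrier R" "\<And>s. s \<in> carrier R \<Longrightarrow> g \<cdot>\<^sub>M x (- \<theta>) s = x \<theta> c \<cdot>\<^sub>M x (- \<theta>) s \<cdot>\<^sub>M x \<theta> (\<ominus> c) \<cdot>\<^sub>M g"
    by blast
  show ?thesis
  proof (intro bexI[OF _ c(1)] ballI)
    fix s assume s: "s \<in> carrier R"
    have "(x \<theta> (\<ominus> c) \<cdot>\<^sub>M g) \<cdot>\<^sub>M x (- \<theta>) s = x \<theta> (\<ominus> c) \<cdot>\<^sub>M (x \<theta> c \<cdot>\<^sub>M x (- \<theta>) s \<cdot>\<^sub>M x \<theta> (\<ominus> c) \<cdot>\<^sub>M g)"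
      using c(2)[OF s] assms(1) c(1) s by (simp add: M.m_assoc)
    also have "\<dots> = (x \<theta> (\<ominus> c) \<cdot>\<^sub>M x \<theta> c) \<cdot>\<^sub>M (x (- \<theta>) s \<cdot>\<^sub>M (x \<theta> (\<ominus> c) \<cdot>\<^sub>M g))"
      using assms(1) c(1) s by (simp add: M.m_assoc)
    also have "x \<theta> (\<ominus> c) \<cdot>\<^sub>M x \<theta> c = \<one>\<^bsub>M\<^esub>" using c(1) by (simp add: x_inv)
    finally show "(x \<theta> (\<ominus> c) \<cdot>\<^sub>M g) \<cdot>\<^sub>M x (- \<theta>) s = x (- \<theta>) s \<cdot>\<^sub>M (x \<theta> (\<ominus> c) \<cdot>\<^sub>M g)"
      using assms(1) c(1) s by simp
  qed
qed

text \<open>By \<open>conjugation\<close> some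
  \<open>x \<theta> (\<ominus> c) \<cdot>\<^sub>M z\<close> commutes with all root elements of
  \<open>- \<theta>\<close>. Parameter 1 shows that \<open>x \<theta> (\<ominus> c)\<close> commutes
  with \<open>x (- \<theta>) \<one>\<close>, so c = 0 and z itself commutes with them. The Weyl
  element of \<theta> is a word in constants commuting with z; it relates these elements to those of
  \<theta>, and the constants of degree 1 to those of degree -1.\<close>

lemma kernel_central:
  assumes z: "z \<in> carrier M" "\<And>\<delta>. \<delta> \<in> \<Phi> \<Longrightarrow> deg \<delta> \<ge> 0 \<Longrightarrow> z \<cdot>\<^sub>M x \<delta> \<one> = x \<delta> \<one> \<cdot>\<^sub>M z"
    and y: "z \<cdot>\<^sub>M x (- \<theta>) \<one> = x (- \<theta>) \<one> \<cdot>\<^sub>M z"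
  shows "\<alpha> \<in> \<Phi> \<Longrightarrow> z \<cdot>\<^sub>M x \<alpha> \<one> = x \<alpha> \<one> \<cdot>\<^sub>M z" "a \<in> carrier R \<Longrightarrow> z \<cdot>\<^sub>M x \<theta> a = x \<theta> a \<cdot>\<^sub>M z"
proof -
  have mul: "z \<cdot>\<^sub>M (g \<cdot>\<^sub>M h) = (g \<cdot>\<^sub>M h) \<cdot>\<^sub>M z"
    if "g \<in> carrier M" "h \<in> carrier M" "z \<cdot>\<^sub>M g = g \<cdot>\<^sub>M z" "z \<cdot>\<^sub>M h = h \<cdot>\<^sub>M z" for g h
    using M.commute_mult[of g h z] that z(1) by simp
  have inv: "z \<cdot>\<^sub>M minverse g = minverse g \<cdot>\<^sub>M z" if "g \<in> carrier M" "z \<cdot>\<^sub>M g = g \<cdot>\<^sub>M z" for g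
    using M.commute_inv[of g z] that z(1) by simp
  obtain c where c: "c \<in> carrier R" "\<And>s. s \<in> carrier R \<Longrightarrow>
      (x \<theta> (\<ominus> c) \<cdot>\<^sub>M z) \<cdot>\<^sub>M x (- \<theta>) s = x (- \<theta>) s \<cdot>\<^sub>M (x \<theta> (\<ominus> c) \<cdot>\<^sub>M z)"
    using conjugation[OF z] by blast
  have "x \<theta> (\<ominus> c) \<cdot>\<^sub>M z \<cdot>\<^sub>M minverse z = x \<theta> (\<ominus> c)" using c(1) z(1) by (simp add: M.m_assoc)
  moreover have "(x \<theta> (\<ominus> c) \<cdot>\<^sub>M z \<cdot>\<^sub>M minverse z) \<cdot>\<^sub>M x (- \<theta>) \<one> = x (- \<theta>) \<one> \<cdot>\<^sub>M (x \<theta> (\<ominus> c) \<cdot>\<^sub>M z \<cdot>\<^sub>M minverse z)"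
    by (rule M.commute_mult) (use c(1) c(2)[of \<one>] z(1) y M.commute_inv[of z "x (- \<theta>) \<one>"] in simp_all)
  ultimately have "\<ominus> c = \<zero>" using theta_faithful[of "\<ominus> c"] c(1) by simp
  then have ms: "z \<cdot>\<^sub>M x (- \<theta>) s = x (- \<theta>) s \<cdot>\<^sub>M z" if "s \<in> carrier R" for s
    using c(2)[OF that] z(1) by (simp add: x_zero)
  have w: "z \<cdot>\<^sub>M wr \<theta> = wr \<theta> \<cdot>\<^sub>M z"
    unfolding wr_M[OF theta_root] by (intro mul inv z(2) y) auto
  have conj: "z \<cdot>\<^sub>M (wr \<theta> \<cdot>\<^sub>M g \<cdot>\<^sub>M minverse (wr \<theta>)) = (wr \<theta> \<cdot>\<^sub>M g \<cdot>\<^sub>M minverse (wr \<theta>)) \<cdot>\<^sub>M z"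
    if "g \<in> carrier M" "z \<cdot>\<^sub>M g = g \<cdot>\<^sub>M z" for g
    using that w wr_carrier[OF theta_root] by (intro mul inv) auto
  show "z \<cdot>\<^sub>M x \<theta> a = x \<theta> a \<cdot>\<^sub>M z" if a: "a \<in> carrier R"
  proof -
    have "x (- \<theta>) (\<ominus> a) = wr \<theta> \<cdot>\<^sub>M x \<theta> a \<cdot>\<^sub>M minverse (wr \<theta>)"
      using wr_conj[OF theta_root theta_root theta_roots(2) weyl_theta a] a by (simp add: R.add.int_pow_neg R.add.int_pow_1)
    then have "x \<theta> a = minverse (wr \<theta>) \<cdot>\<^sub>M x (- \<theta>) (\<ominus> a) \<cdot>\<^sub>M wr \<theta>"
      using wr_carrier[OF theta_root] a by (simp add: M.m_assoc M.inv_solve_left)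
    then show ?thesis using ms[of "\<ominus> a"] wr_carrier[OF theta_root] a by (metis M.inv_closed M.m_closed R.a_inv_closed inv mul theta_roots(2) w xr_M)
  qed
  show "z \<cdot>\<^sub>M x \<alpha> \<one> = x \<alpha> \<one> \<cdot>\<^sub>M z" if a: "\<alpha> \<in> \<Phi>"
  proof -
    consider "deg \<alpha> \<ge> 0" | "\<alpha> = - \<theta>" | "deg \<alpha> = - 1" using deg_cases[OF a] by fastforce
    then show ?thesis
    proof cases
      case 1 then show ?thesis using z(2) a by blast
    next
      case 2 then show ?thesis using y by simp
    next
      case 3
      have e: "\<alpha> + \<theta> \<in> \<Phi>" "deg (\<alpha> + \<theta>) = 1" using deg_m1_plus_theta[OF a 3] 3 by auto
      obtain c :: int where c: "\<bar>c\<bar> = 1" "weyl \<theta> (X (\<alpha> + \<theta>)) = smul (of_int c) (X \<alpha>)"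
        using weyl_long[OF long_theta e(1), of \<alpha>] e(2) by (auto simp: deg_def)
      have "z \<cdot>\<^sub>M x \<alpha> ([c] \<cdot> \<one>) = x \<alpha> ([c] \<cdot> \<one>) \<cdot>\<^sub>M z"
        unfolding wr_conj[OF theta_root e(1) a c(2) R.one_closed, symmetric]
        by (rule conj) (use e z(2) in auto)
      then have sg: "z \<cdot>\<^sub>M ssign c (x \<alpha> \<one>) = ssign c (x \<alpha> \<one>) \<cdot>\<^sub>M z" using x_sign[OF a R.one_closed c(1)] by simp
      show ?thesis
      proof (cases "c = 1")
        case True then show ?thesis using sg by (simp add: ssign_def)
      next
        case False
        then show ?thesis using sg inv[of "minverse (x \<alpha> \<one>)"] a by (simp add: ssign_def)
      qed
    qed
  qed
qed

subsection \<open>Multiplication\<close>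

abbreviation "wfM \<equiv> wf_trm (group_structure M) C"

abbreviation "evM \<equiv> eval_trm (group_structure M)"

definition cmt :: "'r^'n^'n \<Rightarrow> 'r^'n^'n \<Rightarrow> 'r^'n^'n" where "cmt g h = g \<cdot>\<^sub>M h \<cdot>\<^sub>M minverse g \<cdot>\<^sub>M minverse h"

definition word :: "nat \<Rightarrow> (('r^'n^'n) list \<Rightarrow> 'r^'n^'n) \<Rightarrow> bool" where
  "word m f \<longleftrightarrow> (\<exists>W. wfM m W \<and> (\<forall>gs. evM gs W = f gs))"

lemma word_intros:
  "i < m \<Longrightarrow> word m (\<lambda>gs. gs ! i)"
  "g \<in> generate M C \<Longrightarrow> word m (\<lambda>_. g)"
  "word m f \<Longrightarrow> word m f' \<Longrightarrow> word m (\<lambda>gs. f gs \<cdot>\<^sub>M f' gs)"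
  "word m f \<Longrightarrow> word m (\<lambda>gs. minverse (f gs))"
proof -
  show "i < m \<Longrightarrow> word m (\<lambda>gs. gs ! i)" unfolding word_def by (intro exI[of _ "Var i"]) simp
  show "g \<in> generate M C \<Longrightarrow> word m (\<lambda>_. g)" unfolding word_def using generate_term[OF C_carrier] by blast
  show "word m f \<Longrightarrow> word m f' \<Longrightarrow> word m (\<lambda>gs. f gs \<cdot>\<^sub>M f' gs)"
    unfolding word_def by (metis tprod_simps)
  show "word m f \<Longrightarrow> word m (\<lambda>gs. minverse (f gs))"
    unfolding word_def by (metis tinv_simps)
qed

lemma word_sign: "word m f \<Longrightarrow> word m (\<lambda>gs. ssign c (f gs))"
  using word_intros(4) by (cases "c = 1") (auto simp: ssign_def)

lemma word_cmt: "word m f \<Longrightarrow> word m f' \<Longrightarrow> word m (\<lambda>gs. cmt (f gs) (f' gs))"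
  unfolding cmt_def by (intro word_intros)

lemma word_conj: "\<gamma> \<in> \<Phi> \<Longrightarrow> word m f \<Longrightarrow> word m (\<lambda>gs. wr \<gamma> \<cdot>\<^sub>M f gs \<cdot>\<^sub>M minverse (wr \<gamma>))"
  by (intro word_intros wr_generate)

lemma scale_mult: "a \<in> carrier R \<Longrightarrow> b \<in> carrier R \<Longrightarrow> [(k::int)] \<cdot> (([(l::int)] \<cdot> a) \<otimes> ([(m::int)] \<cdot> b)) = [(k * l * m)] \<cdot> (a \<otimes> b)"
  by (simp add: R.add_pow_ldistr_int R.add_pow_rdistr_int R.add.int_pow_pow ac_simps)

lemma scale_scale: "a \<in> carrier R \<Longrightarrow> [(k::int)] \<cdot> ([(l::int)] \<cdot> a) = [(k * l)] \<cdot> a"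
  by (simp add: R.add.int_pow_pow ac_simps)

lemma sign_eq:
  assumes "a \<in> carrier R" "b \<in> carrier R" "\<bar>e\<bar> = (1::int)" shows "[e] \<cdot> a \<oplus> [(- e)] \<cdot> b = \<zero> \<longleftrightarrow> a = b"
proof -
  have "[e] \<cdot> a \<oplus> [(- e)] \<cdot> b = [e] \<cdot> (a \<oplus> \<ominus> b)"
    using assms by (simp add: R.add.int_pow_distrib R.add.int_pow_neg R.add.int_pow_inv)
  moreover have "[e] \<cdot> (a \<oplus> \<ominus> b) = \<zero> \<longleftrightarrow> a \<oplus> \<ominus> b = \<zero>"
    using sign_zero[of "a \<oplus> \<ominus> b" e] assms by auto
  moreover have "a \<oplus> \<ominus> b = \<zero> \<longleftrightarrow> a = b"
    using assms by (metis R.a_inv_closed R.minus_equality R.minus_minus R.r_neg)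
  ultimately show ?thesis by simp
qed

text \<open>The Weyl elements of the long roots \<open>\<theta> - \<beta>\<close> and \<beta> move
  the arguments from \<theta> to \<beta> and to \<open>\<theta> - \<beta>\<close>. The commutator
  has parameter a b up to a sign e, because the structure constant has absolute value
  \<open>mlt \<beta> = 1\<close>. After multiplication by the \<theta>-root element with parameter -
  e c, it commutes with \<open>x (- \<theta>) \<one>\<close> exactly if a b = c.\<close>

lemma multiplication_long:
  assumes b: "\<beta> \<in> L1" "mlt \<beta> = 1"
  shows "\<exists>f. word 3 f \<and> (\<exists>q\<in>C. \<forall>a\<in>carrier R. \<forall>b\<in>carrier R. \<forall>c\<in>carrier R.
    f [x \<theta> a, x \<theta> b, x \<theta> c] \<cdot>\<^sub>M q = q \<cdot>\<^sub>M f [x \<theta> a, x \<theta> b, x \<theta> c] \<longleftrightarrow> a \<otimes> b = c)"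
proof -
  have bR: "\<beta> \<in> \<Phi>" "\<theta> - \<beta> \<in> \<Phi>" using b by auto
  have b': "\<theta> - \<beta> \<in> L1" "mlt (\<theta> - \<beta>) = 1" using L1_compl[OF b(1)] mult_compl[OF b(1)] b(2) by auto
  obtain c\<^sub>1 :: int where c1: "\<bar>c\<^sub>1\<bar> = 1" "weyl (\<theta> - \<beta>) (X \<theta>) = smul (of_int c\<^sub>1) (X \<beta>)"
    using weyl_long[OF mult_1_long[OF b'] theta_root, of \<beta>] mult_cartan(1)[OF b'(1)] b'(2) by auto
  obtain c\<^sub>2 :: int where c2: "\<bar>c\<^sub>2\<bar> = 1" "weyl \<beta> (X \<theta>) = smul (of_int c\<^sub>2) (X (\<theta> - \<beta>))"
    using weyl_long[OF mult_1_long[OF b] theta_root, of "\<theta> - \<beta>"] mult_cartan(1)[OF b(1)] b(2) by auto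
  define e where "e = N \<beta> (\<theta> - \<beta>) * c\<^sub>1 * c\<^sub>2"
  have e: "\<bar>e\<bar> = 1" using N_compl[OF b(1)] b(2) c1(1) c2(1) by (simp add: e_def abs_mult)
  have s: "\<beta> + (\<theta> - \<beta>) = \<theta>" by simp
  have cm: "cmt (x \<beta> u) (x (\<theta> - \<beta>) v) = x \<theta> ([(N \<beta> (\<theta> - \<beta>))] \<cdot> (u \<otimes> v))" if uv: "u \<in> carrier R" "v \<in> carrier R" for u v
  proof -
    have "x \<beta> u \<cdot>\<^sub>M x (\<theta> - \<beta>) v = x \<theta> ([(N \<beta> (\<theta> - \<beta>))] \<cdot> (u \<otimes> v)) \<cdot>\<^sub>M x (\<theta> - \<beta>) v \<cdot>\<^sub>M x \<beta> u"
    proof -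
      have "E \<beta> t (X (\<theta> - \<beta>)) = X (\<theta> - \<beta>) + smul (t * of_int (N \<beta> (\<theta> - \<beta>))) (X \<theta>)" for t
        using E_L1_L1[OF b(1) b'(1), of t] by simp
      moreover have "\<theta> + (\<theta> - \<beta>) \<notin> \<Phi> \<and> \<theta> + (\<theta> - \<beta>) \<noteq> 0"
        by (rule high_deg_sum) (use bR L1_deg[OF b(1)] in auto)
      ultimately show ?thesis
        using xr_commutator_linear[OF bR, of "N \<beta> (\<theta> - \<beta>)" u v] uv theta_root unfolding s mult_M by blast
    qed
    then show ?thesis using uv bR by (simp add: cmt_def M.m_assoc)
  qed
  define f where "f gs = cmt (wr (\<theta> - \<beta>) \<cdot>\<^sub>M gs ! 0 \<cdot>\<^sub>M minverse (wr (\<theta> - \<beta>))) (wr \<beta> \<cdot>\<^sub>M gs ! 1 \<cdot>\<^sub>M minverse (wr \<beta>))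
    \<cdot>\<^sub>M ssign (- e) (gs ! 2)" for gs
  have "word 3 f" unfolding f_def by (intro word_intros(3) word_cmt word_conj word_sign word_intros(1) bR) auto
  moreover have "f [x \<theta> a, x \<theta> b, x \<theta> c] \<cdot>\<^sub>M x (- \<theta>) \<one> = x (- \<theta>) \<one> \<cdot>\<^sub>M f [x \<theta> a, x \<theta> b, x \<theta> c] \<longleftrightarrow> a \<otimes> b = c"
    if abc: "a \<in> carrier R" "b \<in> carrier R" "c \<in> carrier R" for a b c
  proof -
    have "f [x \<theta> a, x \<theta> b, x \<theta> c] = cmt (x \<beta> ([c\<^sub>1] \<cdot> a)) (x (\<theta> - \<beta>) ([c\<^sub>2] \<cdot> b)) \<cdot>\<^sub>M x \<theta> ([(- e)] \<cdot> c)"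
      using abc bR e by (simp add: f_def wr_conj[OF bR(2) theta_root bR(1) c1(2)] wr_conj[OF bR(1) theta_root bR(2) c2(2)] x_sign)
    also have "\<dots> = x \<theta> ([e] \<cdot> (a \<otimes> b) \<oplus> [(- e)] \<cdot> c)"
      using abc by (simp add: cm scale_mult x_add e_def)
    finally have f: "f [x \<theta> a, x \<theta> b, x \<theta> c] = x \<theta> ([e] \<cdot> (a \<otimes> b) \<oplus> [(- e)] \<cdot> c)" .
    have "x \<theta> r \<cdot>\<^sub>M x (- \<theta>) \<one> = x (- \<theta>) \<one> \<cdot>\<^sub>M x \<theta> r \<longleftrightarrow> r = \<zero>" if "r \<in> carrier R" for r
      using theta_faithful[OF that] by (auto simp: x_zero)
    then show ?thesis unfolding f using abc sign_eq[OF _ _ e, of "a \<otimes> b" c] by simp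
  qed
  ultimately show ?thesis using C_I[OF theta_roots(2)] by blast
qed

end

context chevalley_points
begin

text \<open>The two short roots \<beta> and \<gamma> would only give 2 a b at \<theta>. The pair
  \<beta>, \<delta> has structure constant 1 or -1 at \<gamma>, at the price of an unwanted
  \<theta>-part quadratic in the parameter at \<beta>. The test is therefore made with
  \<open>x (- \<delta>) \<one>\<close>, which commutes with the \<theta>-part and still detects the
  parameter at \<gamma>.\<close>

lemma multiplication_B2:
  assumes b: "\<beta> \<in> L1" "mlt \<beta> = 2"
  shows "\<exists>f. word 3 f \<and> (\<exists>q\<in>C. \<forall>a\<in>carrier R. \<forall>b\<in>carrier R. \<forall>c\<in>carrier R.
    f [x \<theta> a, x \<theta> b, x \<theta> c] \<cdot>\<^sub>M q = q \<cdot>\<^sub>M f [x \<theta> a, x \<theta> b, x \<theta> c] \<longleftrightarrow> a \<otimes> b = c)"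
proof -
  interpret B: type_B2 \<Phi> X T \<theta> \<beta> by unfold_locales (fact b)+
  define \<gamma> \<delta> where "\<gamma> = \<theta> - \<beta>" and "\<delta> = \<theta> - 2 *\<^sub>R \<beta>"
  note d = B.delta_root[folded \<delta>_def]
  have g: "\<gamma> \<in> \<Phi>" "\<beta> \<in> \<Phi>" "deg \<gamma> = 1" "deg \<beta> = 1" using b L1_deg[OF b(1)] by (auto simp: \<gamma>_def)
  have s: "\<beta> + \<delta> = \<gamma>" "\<beta> + \<beta> + \<delta> = \<theta>" "\<beta> + \<gamma> = \<theta>" by (simp_all add: \<gamma>_def \<delta>_def scaleR_2)
  obtain c\<^sub>1 :: int where c1: "\<bar>c\<^sub>1\<bar> = 1" "weyl \<beta> (X \<theta>) = smul (of_int c\<^sub>1) (X \<delta>)"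
    using B.weyl_beta unfolding \<delta>_def by blast
  obtain c\<^sub>2 :: int where c2: "\<bar>c\<^sub>2\<bar> = 1" "weyl \<delta> (X \<gamma>) = smul (of_int c\<^sub>2) (X \<beta>)"
    using B.weyl_delta unfolding \<delta>_def \<gamma>_def by blast
  obtain k :: int where k: "\<bar>k\<bar> = 1"
      "\<And>t. E \<beta> t (X \<delta>) = X \<delta> + smul (t * of_int (N \<beta> \<delta>)) (X \<gamma>) + smul (t ^ 2 * of_int k) (X \<theta>)"
    using B.E_beta_delta unfolding \<delta>_def \<gamma>_def by blast
  define n where "n = N \<beta> \<delta>"
  have n: "\<bar>n\<bar> = 1" using B.N_B2(1) by (simp add: n_def \<delta>_def)
  have sums: "\<mu> \<notin> \<Phi> \<and> \<mu> \<noteq> 0" if "\<mu> \<in> {\<beta> + \<delta> + \<delta>, \<beta> + \<beta> + \<delta> + \<delta>, \<beta> + \<beta> + \<beta> + \<delta> + \<delta>}" for \<mu>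
  proof -
    have "2 *\<^sub>R \<theta> + (- 3) *\<^sub>R \<beta> = \<beta> + \<delta> + \<delta>" "2 *\<^sub>R \<theta> + (- 2) *\<^sub>R \<beta> = \<beta> + \<beta> + \<delta> + \<delta>"
      "2 *\<^sub>R \<theta> + (- 1) *\<^sub>R \<beta> = \<beta> + \<beta> + \<beta> + \<delta> + \<delta>"
      by (simp_all add: \<delta>_def scaleR_2 flip: scaleR_scaleR[of 2 "- 1"]) (simp_all add: scaleR_2 scaleR_3)
    then show ?thesis using that B.not_root_B2[of 2 "- 3"] B.not_root_B2[of 2 "- 2"] B.not_root_B2[of 2 "- 1"] by auto
  qed
  have ct: "x \<delta> v \<cdot>\<^sub>M x \<gamma> w = x \<gamma> w \<cdot>\<^sub>M x \<delta> v" "x \<delta> v \<cdot>\<^sub>M x \<theta> w = x \<theta> w \<cdot>\<^sub>M x \<delta> v"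
    "x \<gamma> v \<cdot>\<^sub>M x \<theta> w = x \<theta> w \<cdot>\<^sub>M x \<gamma> v"
    if "v \<in> carrier R" "w \<in> carrier R" for v w
  proof -
    have "\<delta> + \<gamma> = \<beta> + \<delta> + \<delta>" using s(1) by (simp add: ac_simps)
    then show "x \<delta> v \<cdot>\<^sub>M x \<gamma> w = x \<gamma> w \<cdot>\<^sub>M x \<delta> v"
      using xr_commute[OF d(1) g(1) _ _ that] sums[of "\<delta> + \<gamma>"] by (simp add: mult_M)
    show "x \<delta> v \<cdot>\<^sub>M x \<theta> w = x \<theta> w \<cdot>\<^sub>M x \<delta> v" using theta_commutes[OF d(1) _ that(2,1)] d(2) by simp
    show "x \<gamma> v \<cdot>\<^sub>M x \<theta> w = x \<theta> w \<cdot>\<^sub>M x \<gamma> v" using theta_commutes[OF g(1) _ that(2,1)] g(3) by simp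
  qed
  have cm: "cmt (x \<beta> u) (x \<delta> v) = x \<gamma> ([n] \<cdot> (u \<otimes> v)) \<cdot>\<^sub>M x \<theta> ([k] \<cdot> (u \<otimes> (u \<otimes> v)))"
    if uv: "u \<in> carrier R" "v \<in> carrier R" for u v
  proof -
    have bd: "\<beta> + \<delta> \<in> \<Phi>" "\<beta> + \<beta> + \<delta> \<in> \<Phi>" using g unfolding s by auto
    define p q where "p = x \<gamma> ([n] \<cdot> (u \<otimes> v))" and "q = x \<theta> ([k] \<cdot> (u \<otimes> (u \<otimes> v)))"
    have pq: "p \<in> carrier M" "q \<in> carrier M" using uv g by (auto simp: p_def q_def)
    have "x \<beta> u \<cdot>\<^sub>M x \<delta> v = x \<delta> v \<cdot>\<^sub>M p \<cdot>\<^sub>M q \<cdot>\<^sub>M x \<beta> u"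
      using xr_commutator_quadratic[OF g(2) d(1) bd sums, of n k u v] k(2) uv unfolding s n_def mult_M p_def q_def by blast
    then have "cmt (x \<beta> u) (x \<delta> v) = (x \<delta> v \<cdot>\<^sub>M (p \<cdot>\<^sub>M q)) \<cdot>\<^sub>M minverse (x \<delta> v)"
      using uv g d pq by (simp add: cmt_def M.m_assoc)
    also have "x \<delta> v \<cdot>\<^sub>M (p \<cdot>\<^sub>M q) = (p \<cdot>\<^sub>M q) \<cdot>\<^sub>M x \<delta> v"
      by (rule M.commute_mult[symmetric]) (use ct uv d g pq in \<open>auto simp: p_def q_def\<close>)
    finally show ?thesis using uv d pq by (simp add: M.m_assoc p_def q_def)
  qed
  have gf: "u = \<zero>" if "u \<in> carrier R" "x \<gamma> u \<cdot>\<^sub>M x (- \<delta>) \<one> = x (- \<delta>) \<one> \<cdot>\<^sub>M x \<gamma> u" for u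
    by (rule commuting_test[OF that(1) g(1) d(3) _ _ _ B.gamma_commuting_test[folded \<gamma>_def \<delta>_def]])
      (use that(2) d B.N_B2(3) cf(1)[of \<beta>] g in \<open>simp_all add: mult_M \<gamma>_def \<delta>_def\<close>)
  \<comment> \<open>D, F and G move the parameter of a \<theta>-root element to \<delta>, \<gamma>
    and \<beta>, up to sign. In F the parameter at \<beta> is 1, so the \<theta>-part of the
    commutator is linear in the parameter of g and is cancelled by g or its inverse.\<close>
  define D where "D g = wr \<beta> \<cdot>\<^sub>M g \<cdot>\<^sub>M minverse (wr \<beta>)" for g
  define F where "F g = cmt (x \<beta> \<one>) (D g) \<cdot>\<^sub>M ssign (- (k * c\<^sub>1)) g" for g
  define G where "G g = wr \<delta> \<cdot>\<^sub>M F g \<cdot>\<^sub>M minverse (wr \<delta>)" for g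
  define c\<^sub>3 where "c\<^sub>3 = c\<^sub>2 * (n * c\<^sub>1)"
  define e where "e = n * c\<^sub>3 * c\<^sub>1"
  define f where "f gs = cmt (G (gs ! 1)) (D (gs ! 0)) \<cdot>\<^sub>M ssign (- c\<^sub>3) (F (gs ! 2))" for gs
  have sgn: "\<bar>- (k * c\<^sub>1)\<bar> = 1" "\<bar>- c\<^sub>3\<bar> = 1" "\<bar>e\<bar> = 1"
    using c1(1) c2(1) k(1) n by (simp_all add: c\<^sub>3_def e_def abs_mult)
  have D: "D (x \<theta> a) = x \<delta> ([c\<^sub>1] \<cdot> a)" if "a \<in> carrier R" for a
    unfolding D_def by (rule wr_conj[OF g(2) theta_root d(1) c1(2) that])
  have F: "F (x \<theta> a) = x \<gamma> ([(n * c\<^sub>1)] \<cdot> a)" if a: "a \<in> carrier R" for a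
  proof -
    have "F (x \<theta> a) = x \<gamma> ([(n * c\<^sub>1)] \<cdot> a) \<cdot>\<^sub>M (x \<theta> ([(k * c\<^sub>1)] \<cdot> a) \<cdot>\<^sub>M x \<theta> ([(- (k * c\<^sub>1))] \<cdot> a))"
      using a g by (simp add: F_def D cm x_sign[OF theta_root a sgn(1), symmetric] scale_scale M.m_assoc)
    also have "x \<theta> ([(k * c\<^sub>1)] \<cdot> a) \<cdot>\<^sub>M x \<theta> ([(- (k * c\<^sub>1))] \<cdot> a) = \<one>\<^bsub>M\<^esub>"
      using a by (simp add: x_add[symmetric] R.add.int_pow_neg R.r_neg x_zero)
    finally show ?thesis using a g by simp
  qed
  have G: "G (x \<theta> a) = x \<beta> ([c\<^sub>3] \<cdot> a)" if a: "a \<in> carrier R" for a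
    using wr_conj[OF d(1) g(1,2) c2(2), of "[(n * c\<^sub>1)] \<cdot> a"] a by (simp add: G_def F scale_scale c\<^sub>3_def)
  have "word 3 f" unfolding f_def G_def F_def D_def
    by (intro word_intros(3) word_cmt word_conj word_sign word_intros(1) word_intros(2) generate.incl C_I g d) auto
  moreover have "f [x \<theta> a, x \<theta> b, x \<theta> c] \<cdot>\<^sub>M x (- \<delta>) \<one> = x (- \<delta>) \<one> \<cdot>\<^sub>M f [x \<theta> a, x \<theta> b, x \<theta> c] \<longleftrightarrow> a \<otimes> b = c"
    if abc: "a \<in> carrier R" "b \<in> carrier R" "c \<in> carrier R" for a b c
  proof -
    define r where "r = [k] \<cdot> (([c\<^sub>3] \<cdot> b) \<otimes> (([c\<^sub>3] \<cdot> b) \<otimes> ([c\<^sub>1] \<cdot> a)))"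
    define u where "u = [e] \<cdot> (a \<otimes> b) \<oplus> [(- e)] \<cdot> c"
    have ru: "r \<in> carrier R" "u \<in> carrier R" using abc by (auto simp: r_def u_def)
    have "ssign (- c\<^sub>3) (F (x \<theta> c)) = x \<gamma> ([(- c\<^sub>3)] \<cdot> ([(n * c\<^sub>1)] \<cdot> c))"
      using abc x_sign[OF g(1) _ sgn(2), of "[(n * c\<^sub>1)] \<cdot> c"] by (simp add: F)
    also have "[(- c\<^sub>3)] \<cdot> ([(n * c\<^sub>1)] \<cdot> c) = [(- e)] \<cdot> c"
      using abc by (simp add: scale_scale e_def ac_simps)
    finally have 1: "ssign (- c\<^sub>3) (F (x \<theta> c)) = x \<gamma> ([(- e)] \<cdot> c)" .
    have "[n] \<cdot> (([c\<^sub>3] \<cdot> b) \<otimes> ([c\<^sub>1] \<cdot> a)) = [e] \<cdot> (a \<otimes> b)"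
      using abc by (simp add: scale_mult e_def R.m_comm ac_simps)
    then have 2: "cmt (G (x \<theta> b)) (D (x \<theta> a)) = x \<gamma> ([e] \<cdot> (a \<otimes> b)) \<cdot>\<^sub>M x \<theta> r"
      using abc by (simp add: G D cm r_def)
    have "f [x \<theta> a, x \<theta> b, x \<theta> c] = x \<gamma> ([e] \<cdot> (a \<otimes> b)) \<cdot>\<^sub>M (x \<theta> r \<cdot>\<^sub>M x \<gamma> ([(- e)] \<cdot> c))"
      using abc ru g by (simp add: f_def 1 2 M.m_assoc)
    also have "x \<theta> r \<cdot>\<^sub>M x \<gamma> ([(- e)] \<cdot> c) = x \<gamma> ([(- e)] \<cdot> c) \<cdot>\<^sub>M x \<theta> r"
      using ct(3)[of "[(- e)] \<cdot> c" r] ru abc by simp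
    finally have f: "f [x \<theta> a, x \<theta> b, x \<theta> c] = x \<gamma> u \<cdot>\<^sub>M x \<theta> r"
      using abc ru g by (simp add: u_def x_add M.m_assoc)
    have tq: "x \<theta> r \<cdot>\<^sub>M x (- \<delta>) \<one> = x (- \<delta>) \<one> \<cdot>\<^sub>M x \<theta> r"
      using theta_commutes[OF d(3) _ ru(1), of \<one>] d(2) by simp
    have "(x \<gamma> u \<cdot>\<^sub>M x \<theta> r) \<cdot>\<^sub>M x (- \<delta>) \<one> = (x \<gamma> u \<cdot>\<^sub>M x (- \<delta>) \<one>) \<cdot>\<^sub>M x \<theta> r"
      using ru g d tq by (simp add: M.m_assoc)
    moreover have "x (- \<delta>) \<one> \<cdot>\<^sub>M (x \<gamma> u \<cdot>\<^sub>M x \<theta> r) = (x (- \<delta>) \<one> \<cdot>\<^sub>M x \<gamma> u) \<cdot>\<^sub>M x \<theta> r"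
      using ru g d by (simp add: M.m_assoc)
    ultimately have "(x \<gamma> u \<cdot>\<^sub>M x \<theta> r) \<cdot>\<^sub>M x (- \<delta>) \<one> = x (- \<delta>) \<one> \<cdot>\<^sub>M (x \<gamma> u \<cdot>\<^sub>M x \<theta> r)
      \<longleftrightarrow> x \<gamma> u \<cdot>\<^sub>M x (- \<delta>) \<one> = x (- \<delta>) \<one> \<cdot>\<^sub>M x \<gamma> u"
      using ru g d by simp
    also have "\<dots> \<longleftrightarrow> u = \<zero>" using gf[OF ru(2)] d g by (auto simp: x_zero)
    also have "\<dots> \<longleftrightarrow> a \<otimes> b = c" unfolding u_def by (rule sign_eq[OF _ _ sgn(3)]) (use abc in auto)
    finally show ?thesis unfolding f .
  qed
  ultimately show ?thesis using C_I[OF d(3)] by blast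
qed

text \<open>For \<open>mlt \<beta> = 3\<close> the long root
  \<open>3 *\<^sub>R \<beta> - \<theta>\<close> of degree 1 takes the place of \<beta>.\<close>

lemma multiplication:
  "\<exists>f. word 3 f \<and> (\<exists>q\<in>C. \<forall>a\<in>carrier R. \<forall>b\<in>carrier R. \<forall>c\<in>carrier R.
    f [x \<theta> a, x \<theta> b, x \<theta> c] \<cdot>\<^sub>M q = q \<cdot>\<^sub>M f [x \<theta> a, x \<theta> b, x \<theta> c] \<longleftrightarrow> a \<otimes> b = c)"
proof -
  obtain \<beta> where b: "\<beta> \<in> L1" using L1_nonempty by blast
  then consider "mlt \<beta> = 1" | "mlt \<beta> = 2" | "mlt \<beta> = 3" using mult_cartan(2) by blast
  then show ?thesis
    using multiplication_long[OF b] multiplication_B2[OF b] multiplication_long[OF mult_3(1,2)[OF b]] by cases blast+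
qed

theorem interpretable: "e_interpretable (ring_structure R) (group_structure M) C"
proof -
  interpret group_interp M R C "{x \<alpha> \<one> | \<alpha>. \<alpha> \<in> \<Phi> \<and> deg \<alpha> \<ge> 0}" "x (- \<theta>) \<one>" "x \<theta>"
  proof
    show "\<exists>W. wfM 3 W \<and> (\<exists>q\<in>C. \<forall>a\<in>carrier R. \<forall>b\<in>carrier R. \<forall>c\<in>carrier R.
        (evM [x \<theta> a, x \<theta> b, x \<theta> c] W \<cdot>\<^sub>M q = q \<cdot>\<^sub>M evM [x \<theta> a, x \<theta> b, x \<theta> c] W) \<longleftrightarrow> a \<otimes> b = c)"
      using multiplication unfolding word_def by metis
    show "C \<subseteq> carrier M" by (rule C_carrier)
    show S: "{x \<alpha> \<one> | \<alpha>. \<alpha> \<in> \<Phi> \<and> deg \<alpha> \<ge> 0} \<subseteq> C" by (auto simp: C_def)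
    show "finite {x \<alpha> \<one> | \<alpha>. \<alpha> \<in> \<Phi> \<and> deg \<alpha> \<ge> 0}" by (rule finite_subset[OF S finite_C])
    show "x (- \<theta>) \<one> \<in> C" "x \<theta> \<one> \<in> C" by (simp_all add: C_I)
    show "x \<theta> a \<in> carrier M" if "a \<in> carrier R" for a using that by simp
    show "x \<theta> (a \<oplus> b) = x \<theta> a \<cdot>\<^sub>M x \<theta> b" if "a \<in> carrier R" "b \<in> carrier R" for a b using x_add that by simp
    show "x \<theta> a \<cdot>\<^sub>M s = s \<cdot>\<^sub>M x \<theta> a" if "a \<in> carrier R" "s \<in> {x \<alpha> \<one> | \<alpha>. \<alpha> \<in> \<Phi> \<and> deg \<alpha> \<ge> 0}" for a s
      using that theta_commutes by auto
    show "a = \<zero>" if "a \<in> carrier R" "x \<theta> a \<cdot>\<^sub>M x (- \<theta>) \<one> = x (- \<theta>) \<one> \<cdot>\<^sub>M x \<theta> a" for a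
      using theta_faithful that by blast
    show "\<exists>a\<in>carrier R. x \<theta> (\<ominus> a) \<cdot>\<^sub>M g \<cdot>\<^sub>M x (- \<theta>) \<one> = x (- \<theta>) \<one> \<cdot>\<^sub>M (x \<theta> (\<ominus> a) \<cdot>\<^sub>M g)"
      if gM: "g \<in> carrier M" and gS: "\<And>s. s \<in> {x \<alpha> \<one> | \<alpha>. \<alpha> \<in> \<Phi> \<and> deg \<alpha> \<ge> 0} \<Longrightarrow> g \<cdot>\<^sub>M s = s \<cdot>\<^sub>M g" for g
    proof -
      have "g \<cdot>\<^sub>M x \<delta> \<one> = x \<delta> \<one> \<cdot>\<^sub>M g" if "\<delta> \<in> \<Phi>" "deg \<delta> \<ge> 0" for \<delta>
        using gS that by blast
      then show ?thesis using conjugation[OF gM] by blast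
    qed
    show "(\<forall>c\<in>C. z \<cdot>\<^sub>M c = c \<cdot>\<^sub>M z) \<and> (\<forall>a\<in>carrier R. z \<cdot>\<^sub>M x \<theta> a = x \<theta> a \<cdot>\<^sub>M z)"
      if z: "z \<in> carrier M" and zS: "\<And>s. s \<in> {x \<alpha> \<one> | \<alpha>. \<alpha> \<in> \<Phi> \<and> deg \<alpha> \<ge> 0} \<Longrightarrow> z \<cdot>\<^sub>M s = s \<cdot>\<^sub>M z"
        and zy: "z \<cdot>\<^sub>M x (- \<theta>) \<one> = x (- \<theta>) \<one> \<cdot>\<^sub>M z" for z
    proof -
      have "z \<cdot>\<^sub>M x \<delta> \<one> = x \<delta> \<one> \<cdot>\<^sub>M z" if "\<delta> \<in> \<Phi>" "deg \<delta> \<ge> 0" for \<delta> using zS that by blast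
      from kernel_central[OF z this zy] show ?thesis by (auto simp: C_def)
    qed
  qed
  show ?thesis by (rule e_interpretable)
qed

end

section \<open>Chevalley groups\<close>

context complex_lie_algebra
begin

lemma brk_linear:
  "brk (a + b) c = brk a c + brk b c" "brk (scale r a) c = scale r (brk a c)"
  "brk a (b + c) = brk a b + brk a c" "brk a (scale r c) = scale r (brk a c)"
proof -
  have l: "module_hom scale scale (\<lambda>x. brk x c)" and r: "module_hom scale scale (\<lambda>y. brk a y)"
    using brk_linear_left[of c] brk_linear_right[of a] by (simp_all add: linear_iff_module_hom)
  show "brk (a + b) c = brk a c + brk b c" "brk (scale r a) c = scale r (brk a c)"
    by (rule module_hom.add[OF l] module_hom.scale[OF l])+
  show "brk a (b + c) = brk a b + brk a c" "brk a (scale r c) = scale r (brk a c)"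
    by (rule module_hom.add[OF r] module_hom.scale[OF r])+
qed

lemma brk_zero: "brk 0 c = 0" "brk a 0 = 0"
  using brk_linear(2)[of 0 0 c] brk_linear(4)[of a 0 0] by simp_all

text \<open>Injectivity of the representation preserves the independence of the Chevalley basis; the
  commutator conditions are images of identities in the Lie algebra, and integrality is
  admissibility.\<close>

lemma chevalley_representation:
  fixes \<Phi> :: "'e::euclidean_space set" and \<rho> :: "'l \<Rightarrow> complex^'n^'n"
  assumes "root_system \<Phi>" "reduced \<Phi>" "chevalley_basis \<Phi> \<Delta> h x" "faithful_representation \<rho>"
    "admissible \<Phi> (\<lambda>\<alpha>. \<rho> (x \<alpha>))"
  shows "chevalley \<Phi> (\<lambda>\<alpha>. Mx (\<rho> (x \<alpha>))) ((\<lambda>a. Mx (\<rho> a)) ` span (h ` \<Delta>))"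
proof -
  define f where "f a = Mx (\<rho> a)" for a
  have mx_f: "mx (f a) = \<rho> a" for a by (simp add: f_def Mx_inverse)
  have lin: "module_hom scale (\<lambda>c (A :: complex^'n^'n). \<chi> i j. c * A $ i $ j) \<rho>"
    using assms(4) by (simp add: faithful_representation_def linear_iff_module_hom)
  have f_add: "f (a + b) = f a + f b" for a b
    by (rule mx_inject[THEN iffD1]) (simp add: mx_f plus_sqmat.rep_eq module_hom.add[OF lin])
  have f_scale: "f (scale r a) = smul r (f a)" for r a
    by (rule mx_inject[THEN iffD1]) (simp add: mx_f smul.rep_eq module_hom.scale[OF lin])
  have f_brk: "f (brk a b) = comm (f a) (f b)" for a b
    using assms(4) by (intro mx_inject[THEN iffD1])
      (simp add: mx_f comm_def faithful_representation_def times_sqmat.rep_eq minus_sqmat.rep_eq)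
  have f_0: "f 0 = 0" using f_scale[of 0 0] by simp
  have f_inj: "f a = f b \<Longrightarrow> a = b" for a b
    using assms(4) mx_f by (metis faithful_representation_def injD)
  have f_sum: "f (sum g S) = (\<Sum>s\<in>S. f (g s))" for g and S :: "'e set"
    by (induction S rule: infinite_finite_induct) (auto simp: f_0 f_add)
  note cb = assms(3)[unfolded chevalley_basis_def]
  have hh: "brk (h \<delta>) (h \<epsilon>) = 0" if "\<delta> \<in> \<Delta>" "\<epsilon> \<in> \<Delta>" for \<delta> \<epsilon> using cb that by blast
  have hx: "brk (h \<delta>) (x \<alpha>) = scale (of_real (\<alpha> \<bullet> coroot \<delta>)) (x \<alpha>)" if "\<delta> \<in> \<Delta>" "\<alpha> \<in> \<Phi>" for \<delta> \<alpha>
    using cb that by blast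
  have co: "\<exists>c::'e \<Rightarrow> int. coroot \<alpha> = (\<Sum>\<delta>\<in>\<Delta>. of_int (c \<delta>) *\<^sub>R coroot \<delta>) \<and>
      brk (x \<alpha>) (x (- \<alpha>)) = (\<Sum>\<delta>\<in>\<Delta>. scale (of_int (c \<delta>)) (h \<delta>))" if "\<alpha> \<in> \<Phi>" for \<alpha>
    using cb that by blast
  have hsp: "h \<delta> \<in> span (h ` \<Delta>)" if "\<delta> \<in> \<Delta>" for \<delta> using that by (intro span_base) simp
  interpret root_sys \<Phi> by unfold_locales (fact assms(1,2))+
  have "chevalley \<Phi> (\<lambda>\<alpha>. f (x \<alpha>)) (f ` span (h ` \<Delta>))"
  proof
    show "sqm.subspace (f ` span (h ` \<Delta>))"
      unfolding sqm.subspace_def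
      using span_zero[of "h ` \<Delta>"] span_add[of _ "h ` \<Delta>"] span_scale[of _ "h ` \<Delta>"]
      by (auto simp: f_0[symmetric] f_add[symmetric] f_scale[symmetric])
  next
    fix H c \<delta> assume H: "H \<in> f ` span (h ` \<Delta>)" and eq: "(\<Sum>\<delta>\<in>\<Phi>. smul (c \<delta>) (f (x \<delta>))) + H = 0" and d: "\<delta> \<in> \<Phi>"
    obtain t where t: "t \<in> span (h ` \<Delta>)" "H = f t" using H by blast
    have "f ((\<Sum>\<delta>\<in>\<Phi>. scale (c \<delta>) (x \<delta>)) + t) = f 0" using eq by (simp add: f_add f_sum f_scale t(2) f_0)
    then have "(\<Sum>\<delta>\<in>\<Phi>. scale (c \<delta>) (x \<delta>)) + t = 0" by (rule f_inj)
    then have s: "scale (c \<delta>) (x \<delta>) = - ((\<Sum>\<epsilon>\<in>\<Phi> - {\<delta>}. scale (c \<epsilon>) (x \<epsilon>)) + t)"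
      using sum.remove[OF finite_roots d, of "\<lambda>\<delta>. scale (c \<delta>) (x \<delta>)"] by (intro eq_neg_iff_add_eq_0[THEN iffD2]) (simp add: add.assoc)
    show "c \<delta> = 0"
    proof (rule ccontr)
      assume "c \<delta> \<noteq> 0"
      let ?B = "h ` \<Delta> \<union> x ` \<Phi> - {x \<delta>}"
      have "x \<delta> \<notin> h ` \<Delta>" using cb d by blast
      then have "t \<in> span ?B" using t(1) span_mono[of "h ` \<Delta>" ?B] by blast
      moreover have "x \<epsilon> \<in> ?B" if "\<epsilon> \<in> \<Phi> - {\<delta>}" for \<epsilon> using that d cb by (auto dest: inj_onD)
      ultimately have "scale (c \<delta>) (x \<delta>) \<in> span ?B"
        unfolding s by (intro span_neg span_add[OF span_sum] span_scale[OF span_base])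
      then have "scale (1 / c \<delta>) (scale (c \<delta>) (x \<delta>)) \<in> span ?B" by (rule span_scale)
      then have "x \<delta> \<in> span ?B" using \<open>c \<delta> \<noteq> 0\<close> by simp
      then have "dependent (h ` \<Delta> \<union> x ` \<Phi>)" unfolding dependent_def using d by blast
      then show False using cb by blast
    qed
  next
    fix H H' assume "H \<in> f ` span (h ` \<Delta>)" "H' \<in> f ` span (h ` \<Delta>)"
    then obtain t t' where t: "t \<in> span (h ` \<Delta>)" "H = f t" "t' \<in> span (h ` \<Delta>)" "H' = f t'" by blast
    have z: "brk a t' = 0" if "a \<in> h ` \<Delta>" for a using t(3)
      by (induction rule: span_induct_alt) (use that hh in \<open>auto simp: brk_linear brk_zero\<close>)
    have "brk t t' = 0" using t(1)
      by (induction rule: span_induct_alt) (auto simp: brk_linear brk_zero z)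
    then show "comm H H' = 0" using f_brk[of t t'] t by (simp add: f_0)
  next
    fix H \<delta> assume "H \<in> f ` span (h ` \<Delta>)" "\<delta> \<in> \<Phi>"
    then obtain t where t: "t \<in> span (h ` \<Delta>)" "H = f t" by blast
    have "\<exists>c. brk t (x \<delta>) = scale c (x \<delta>)" using t(1)
    proof (induction rule: span_induct_alt)
      case base show ?case by (intro exI[of _ 0]) (simp add: brk_zero)
    next
      case (step r a b)
      then obtain \<epsilon> c where "a = h \<epsilon>" "\<epsilon> \<in> \<Delta>" "brk b (x \<delta>) = scale c (x \<delta>)" by blast
      then show ?case using hx[of \<epsilon> \<delta>] \<open>\<delta> \<in> \<Phi>\<close>
        by (intro exI[of _ "r * of_real (\<delta> \<bullet> coroot \<epsilon>) + c"]) (simp add: brk_linear scale_left_distrib)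
    qed
    then show "\<exists>c. comm H (f (x \<delta>)) = smul c (f (x \<delta>))" unfolding t(2) f_brk[symmetric] f_scale[symmetric] by metis
  next
    fix \<alpha> assume a: "\<alpha> \<in> \<Phi>"
    then obtain c :: "'e \<Rightarrow> int" where c: "coroot \<alpha> = (\<Sum>\<delta>\<in>\<Delta>. of_int (c \<delta>) *\<^sub>R coroot \<delta>)"
      "brk (x \<alpha>) (x (- \<alpha>)) = (\<Sum>\<delta>\<in>\<Delta>. scale (of_int (c \<delta>)) (h \<delta>))" using co by blast
    show "comm (f (x \<alpha>)) (f (x (- \<alpha>))) \<in> f ` span (h ` \<Delta>)"
      unfolding f_brk[symmetric] c by (intro imageI span_sum span_scale hsp)
    fix \<beta> assume b: "\<beta> \<in> \<Phi>"
    have sb: "brk (sum g S) a = (\<Sum>s\<in>S. brk (g s) a)" for g and S :: "'e set" and a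
      by (induction S rule: infinite_finite_induct) (auto simp: brk_zero brk_linear)
    have "brk (\<Sum>\<delta>\<in>\<Delta>. scale (of_int (c \<delta>)) (h \<delta>)) (x \<beta>)
      = (\<Sum>\<delta>\<in>\<Delta>. scale (of_int (c \<delta>) * of_real (\<beta> \<bullet> coroot \<delta>)) (x \<beta>))"
      unfolding sb by (rule sum.cong) (simp_all add: brk_linear hx b)
    also have "\<dots> = scale (of_real (\<beta> \<bullet> coroot \<alpha>)) (x \<beta>)"
      unfolding c(1) by (simp add: inner_sum_right flip: scale_sum_left)
    finally show "comm (comm (f (x \<alpha>)) (f (x (- \<alpha>)))) (f (x \<beta>)) = smul (of_real (\<beta> \<bullet> coroot \<alpha>)) (f (x \<beta>))"
      unfolding f_brk[symmetric] f_scale[symmetric] c(2) by simp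
    show "comm (f (x \<alpha>)) (f (x \<beta>)) = 0" if "\<alpha> + \<beta> \<notin> \<Phi>" "\<alpha> + \<beta> \<noteq> 0"
    proof -
      have "brk (x \<alpha>) (x \<beta>) = 0" using cb a b that by blast
      then show ?thesis using f_brk f_0 by metis
    qed
    show "\<exists>c::int. \<bar>c\<bar> = int (string_len \<alpha> \<beta>) + 1 \<and> comm (f (x \<alpha>)) (f (x \<beta>)) = smul (of_int c) (f (x (\<alpha> + \<beta>)))"
      if ab: "\<alpha> + \<beta> \<in> \<Phi>"
    proof -
      define p where "p = string_len \<alpha> \<beta>"
      have "brk (x \<alpha>) (x \<beta>) = scale (of_nat (p + 1)) (x (\<alpha> + \<beta>)) \<or>
          brk (x \<alpha>) (x \<beta>) = scale (- of_nat (p + 1)) (x (\<alpha> + \<beta>))"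
        using cb a b ab unfolding p_def string_len_def Let_def by blast
      then show ?thesis
      proof
        assume "brk (x \<alpha>) (x \<beta>) = scale (of_nat (p + 1)) (x (\<alpha> + \<beta>))"
        then show ?thesis unfolding f_brk[symmetric] f_scale[symmetric] p_def[symmetric]
          by (intro exI[of _ "int p + 1"]) (simp add: add.commute)
      next
        assume "brk (x \<alpha>) (x \<beta>) = scale (- of_nat (p + 1)) (x (\<alpha> + \<beta>))"
        then show ?thesis unfolding f_brk[symmetric] f_scale[symmetric] p_def[symmetric]
          by (intro exI[of _ "- 1 - int p"]) simp
      qed
    qed
    show "entry (dpow (f (x \<alpha>)) k) i j \<in> \<int>" for k i j
      using assms(5) a unfolding admissible_def div_power_eq[symmetric] mx_f by blast
  qed
  then show ?thesis by (simp add: f_def[abs_def])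
qed

end

lemma chevalley_group_simps:
  "A \<otimes>\<^bsub>chevalley_group R \<Phi> X\<^esub> B = A \<otimes>\<^bsub>matrix_monoid R\<^esub> B"
  "\<one>\<^bsub>chevalley_group R \<Phi> X\<^esub> = \<one>\<^bsub>matrix_monoid R\<^esub>"
  by (simp_all add: chevalley_group_def general_linear_group_def units_of_def)

text \<open>The inverse in \<open>chevalley_group\<close> is sought among the points of the scheme
  only. By \<open>point_inverse\<close> the inverse matrix of a point is such a point, so it is the
  one found, and G contains it.\<close>

lemma (in chevalley) subgroup_is_group:
  assumes R: "cring R" and G: "subgroup G (chevalley_group R \<Phi> (\<lambda>\<alpha>. mx (X \<alpha>)))"
  shows "group ((chevalley_group R \<Phi> (\<lambda>\<alpha>. mx (X \<alpha>)))\<lparr>carrier := G\<rparr>)"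
proof -
  let ?M = "matrix_monoid R :: ('a^'n^'n) monoid" and ?C = "chevalley_group R \<Phi> (\<lambda>\<alpha>. mx (X \<alpha>))"
  interpret cring R by (rule R)
  interpret m: monoid ?M by (rule monoid_matrix)
  have sub: "g \<in> carrier ?C" if "g \<in> G" for g using subgroup.subset[OF G] that by blast
  have car: "g \<in> carrier ?M" if "g \<in> carrier ?C" for g
    using that by (auto simp: chevalley_group_def general_linear_group_def units_of_def Units_def)
  show ?thesis
  proof (rule groupI; simp add: chevalley_group_simps)
    show "g \<otimes>\<^bsub>?M\<^esub> g' \<in> G" if "g \<in> G" "g' \<in> G" for g g'
      using subgroup.m_closed[OF G that] by (simp add: chevalley_group_simps)
    show "\<one>\<^bsub>?M\<^esub> \<in> G" using subgroup.one_closed[OF G] by (simp add: chevalley_group_simps)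
    show "g \<otimes>\<^bsub>?M\<^esub> g' \<otimes>\<^bsub>?M\<^esub> g'' = g \<otimes>\<^bsub>?M\<^esub> (g' \<otimes>\<^bsub>?M\<^esub> g'')" if "g \<in> G" "g' \<in> G" "g'' \<in> G" for g g' g''
      using that by (simp add: m.m_assoc sub car)
    show "\<one>\<^bsub>?M\<^esub> \<otimes>\<^bsub>?M\<^esub> g = g" if "g \<in> G" for g using that by (simp add: sub car)
    show "\<exists>y\<in>G. y \<otimes>\<^bsub>?M\<^esub> g = \<one>\<^bsub>?M\<^esub>" if g: "g \<in> G" for g
    proof -
      obtain B where B: "B \<in> carrier ?C" "g \<otimes>\<^bsub>?M\<^esub> B = \<one>\<^bsub>?M\<^esub>" "B \<otimes>\<^bsub>?M\<^esub> g = \<one>\<^bsub>?M\<^esub>"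
        using point_inverse[OF R sub[OF g]] by blast
      have "inv\<^bsub>?C\<^esub> g = B"
        unfolding m_inv_def chevalley_group_simps
      proof (rule the_equality)
        fix B' assume "B' \<in> carrier ?C \<and> g \<otimes>\<^bsub>?M\<^esub> B' = \<one>\<^bsub>?M\<^esub> \<and> B' \<otimes>\<^bsub>?M\<^esub> g = \<one>\<^bsub>?M\<^esub>"
        then show "B' = B" using m.inv_unique[of B' g B] B sub[OF g] car by blast
      qed (use B in blast)
      then show ?thesis using subgroup.m_inv_closed[OF G g] B by metis
    qed
  qed
qed

theorem mainTheorem2:
  fixes \<Phi> \<Delta> :: "'e::euclidean_space set"
    and scale :: "complex \<Rightarrow> 'l::ab_group_add \<Rightarrow> 'l"
    and brk :: "'l \<Rightarrow> 'l \<Rightarrow> 'l"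
    and h x :: "'e \<Rightarrow> 'l"
    and \<rho> :: "'l \<Rightarrow> complex^'n^'n"
    and R :: "('r, 'm) ring_scheme"
    and G :: "('r^'n^'n) set"
  assumes "root_system \<Phi>" and "reduced \<Phi>" and "indecomposable \<Phi>" and "root_rank \<Phi> > 1"
    and "complex_lie_algebra scale brk"
    and "complex_lie_algebra.semisimple scale brk"
    and "complex_lie_algebra.chevalley_basis scale brk \<Phi> \<Delta> h x"
    and "complex_lie_algebra.faithful_representation scale brk \<rho>"
    and "admissible \<Phi> (\<lambda>\<alpha>. \<rho> (x \<alpha>))"
    and "cring R"
    and "large_subgroup R \<Phi> (\<lambda>\<alpha>. \<rho> (x \<alpha>)) G"
  shows "e_interpretable (ring_structure R)
           (group_structure ((chevalley_group R \<Phi> (\<lambda>\<alpha>. \<rho> (x \<alpha>)))\<lparr>carrier := G\<rparr>))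
           {exp_elem R (\<rho> (x \<alpha>)) \<one>\<^bsub>R\<^esub> | \<alpha>. \<alpha> \<in> \<Phi>}"
proof -
  interpret L: complex_lie_algebra scale brk by (rule assms(5))
  define X where "X \<alpha> = Mx (\<rho> (x \<alpha>))" for \<alpha>
  define T where "T = (\<lambda>a. Mx (\<rho> a)) ` L.span (h ` \<Delta>)"
  have mX: "mx (X \<alpha>) = \<rho> (x \<alpha>)" for \<alpha> by (simp add: X_def Mx_inverse)
  interpret c: chevalley \<Phi> X T
    using L.chevalley_representation[OF assms(1,2,7,8,9)] by (simp add: X_def[abs_def] T_def)
  obtain \<theta> where \<theta>: "c.long \<theta>" using c.long_exists assms(3) by (auto simp: indecomposable_def)
  let ?M = "(chevalley_group R \<Phi> (\<lambda>\<alpha>. \<rho> (x \<alpha>)))\<lparr>carrier := G\<rparr>"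
  have sg: "subgroup G (chevalley_group R \<Phi> (\<lambda>\<alpha>. \<rho> (x \<alpha>)))" and el: "elementary_subgroup R \<Phi> (\<lambda>\<alpha>. \<rho> (x \<alpha>)) \<subseteq> G"
    using assms(11) by (auto simp: large_subgroup_def)
  have grp: "group ?M" using c.subgroup_is_group[OF assms(10), of G] sg by (simp add: mX)
  interpret chevalley_points \<Phi> X T \<theta> R ?M
  proof (intro chevalley_points.intro chevalley_graded.intro chevalley_ring.intro graded_root_sys.intro
      c.chevalley_axioms assms(10) grp c.root_sys_axioms graded_root_sys_axioms.intro \<theta> chevalley_graded_axioms.intro
      assms(3,4) chevalley_points_axioms.intro)
    show "carrier ?M \<subseteq> carrier (chevalley_group R \<Phi> (\<lambda>\<alpha>. mx (X \<alpha>)))" using subgroup.subset[OF sg] by (simp add: mX)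
    show "c.xr R \<alpha> a \<in> carrier ?M" if "\<alpha> \<in> \<Phi>" "a \<in> carrier R" for \<alpha> a
    proof -
      have "c.xr R \<alpha> a \<in> elementary_subgroup R \<Phi> (\<lambda>\<alpha>. \<rho> (x \<alpha>))"
        unfolding elementary_subgroup_def c.xr_def mX by (rule generate.incl) (use that in blast)
      then show ?thesis using el by auto
    qed
  qed (simp_all add: chevalley_group_simps)
  show ?thesis using interpretable by (simp add: C_def c.xr_def mX)
qed

end
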